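(* Let $p\ge 2$, $\alpha=p-1$, $0<R<\infty$, $\theta\ge\alpha$ and $0\le\nu<\lambda_{\alpha,\theta}$. Then the supremum $$S(p,\nu,\theta,R)=\sup_{u\in X^{1,p}_R(\alpha,\theta),\ H_\nu(u)\le 1}\int_0^R e^{\mu_{\alpha,\theta}|u|^{\frac{p}{p-1}}}\,\mathrm d\lambda_\theta$$ is attained by some function $u_0\in X^{1,p}_R(\alpha,\theta)\cap C^1[0,R]$ with $H_\nu(u_0)=1$.
   Context: For $s\ge 0$ let $\omega_s=\frac{2\pi^{s/2}}{\Gamma(s/2)}$ and let $\mathrm d\lambda_s=\omega_s r^s\,\mathrm dr$ on $(0,R)$; $L^q_s=L^q((0,R),\mathrm d\lambda_s)$. The space $X^{1,p}_R(\alpha,\theta)$ is the completion of the set of all $u\in AC_{loc}(0,R)$ with $\lim_{r\to R}u(r)=0$, $u\in L^p_\theta$, $u'\in L^p_\alpha$, with respect to the norm $\|u\|=(\|u\|^p_{L^p_\theta}+\|u'\|^p_{L^p_\alpha})^{1/p}$. Set $\mu_{\alpha,\theta}=(\theta+1)\omega_\alpha^{1/\alpha}$, $\lambda_{\alpha,\theta}=\inf_{u\in X^{1,p}_R(\alpha,\theta)\setminus\{0\}}\|u'\|^p_{L^p_\alpha}/\|u\|^p_{L^p_\theta}$, and $H_\nu(u)=(\|u'\|^p_{L^p_\alpha}-\nu\|u\|^p_{L^p_\theta})^{1/p}$. *)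

theory Defs
  imports "HOL-Analysis.Analysis"
begin

definition omega :: "real \<Rightarrow> real" where
  "omega s = 2 * pi powr (s / 2) / Gamma (s / 2)"

definition lpn :: "real \<Rightarrow> real \<Rightarrow> real \<Rightarrow> (real \<Rightarrow> real) \<Rightarrow> ennreal" where
  "lpn R s p f = (\<integral>\<^sup>+ x. indicator {0<..<R} x * ennreal (omega s * x powr s * \<bar>f x\<bar> powr p) \<partial>lborel)"

definition lpp :: "real \<Rightarrow> real \<Rightarrow> real \<Rightarrow> (real \<Rightarrow> real) \<Rightarrow> real" where
  "lpp R s p f = enn2real (lpn R s p f)"

definition AC_loc_pair :: "real \<Rightarrow> (real \<Rightarrow> real) \<Rightarrow> (real \<Rightarrow> real) \<Rightarrow> bool" where
  "AC_loc_pair R u w \<longleftrightarrow> (\<forall>x y. 0 < x \<and> x \<le> y \<and> y < R \<longrightarrow>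
      set_integrable lborel {x..y} w \<and> u y - u x = (LINT t:{x..y}|lborel. w t))"

definition nice :: "real \<Rightarrow> real \<Rightarrow> real \<Rightarrow> real \<Rightarrow> (real \<Rightarrow> real) \<Rightarrow> (real \<Rightarrow> real) \<Rightarrow> bool" where
  "nice R p a th u w \<longleftrightarrow> AC_loc_pair R u w \<and> (u \<longlongrightarrow> 0) (at_left R)
     \<and> set_borel_measurable lborel {0<..<R} u \<and> set_borel_measurable lborel {0<..<R} w
     \<and> lpn R th p u < \<infinity> \<and> lpn R a p w < \<infinity>"

text \<open>Elements of the completion X^{1,p}_R(alpha,theta), represented by the locally
  absolutely continuous representative u together with its derivative w.\<close>
definition Xsp :: "real \<Rightarrow> real \<Rightarrow> real \<Rightarrow> real \<Rightarrow> (real \<Rightarrow> real) \<Rightarrow> (real \<Rightarrow> real) \<Rightarrow> bool" where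
  "Xsp R p a th u w \<longleftrightarrow> AC_loc_pair R u w
     \<and> set_borel_measurable lborel {0<..<R} u \<and> set_borel_measurable lborel {0<..<R} w
     \<and> lpn R th p u < \<infinity> \<and> lpn R a p w < \<infinity>
     \<and> (\<exists>U W. (\<forall>n. nice R p a th (U n) (W n))
          \<and> (\<lambda>n. lpn R th p (\<lambda>x. U n x - u x)) \<longlonglongrightarrow> 0
          \<and> (\<lambda>n. lpn R a p (\<lambda>x. W n x - w x)) \<longlonglongrightarrow> 0)"

definition mu :: "real \<Rightarrow> real \<Rightarrow> real" where
  "mu a th = (th + 1) * omega a powr (1 / a)"

definition lam :: "real \<Rightarrow> real \<Rightarrow> real \<Rightarrow> real \<Rightarrow> real" where
  "lam R p a th = (INF uw \<in> {(u, w). Xsp R p a th u w \<and> (lpp R th p u + lpp R a p w) powr (1 / p) \<noteq> 0}.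
      lpp R a p (snd uw) / lpp R th p (fst uw))"

definition H :: "real \<Rightarrow> real \<Rightarrow> real \<Rightarrow> real \<Rightarrow> real \<Rightarrow> (real \<Rightarrow> real) \<Rightarrow> (real \<Rightarrow> real) \<Rightarrow> real" where
  "H R p a th nu u w = (lpp R a p w - nu * lpp R th p u) powr (1 / p)"

definition MT :: "real \<Rightarrow> real \<Rightarrow> real \<Rightarrow> real \<Rightarrow> (real \<Rightarrow> real) \<Rightarrow> ennreal" where
  "MT R p a th u = (\<integral>\<^sup>+ x. indicator {0<..<R} x *
      ennreal (omega th * x powr th * exp (mu a th * \<bar>u x\<bar> powr (p / (p - 1)))) \<partial>lborel)"

end

theory Submission
  imports Defs "HOL-Complex_Analysis.Great_Picard" "HOL-Real_Asymp.Real_Asymp"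
begin

text \<open>The substitution \<open>s = (\<theta> + 1) ln (R / r)\<close> turns the problem into maximising
  \<open>\<integral>exp (\<bar>b\<bar> powr q - s)\<close> over \<open>b(s) = \<integral>\<^sub>0\<^sup>s w\<close> with
  \<open>\<integral>\<bar>w\<bar> powr p - \<nu> \<integral>\<bar>b\<bar> powr p exp (- s) \<le> 1\<close> on the half line, where \<open>q = p / (p - 1)\<close>.
  A maximising sequence converges weakly (Clarkson's inequality replaces reflexivity), and it is
  compact unless all its energy escapes to infinity. In the latter case an argument in the style
  of Carleson and Chang bounds the level by \<open>1 + exp (A + c)\<close>: the optimal cost of the linearised
  inner problem is governed by the cost-to-go \<open>I(t) = \<integral>\<^sub>t\<^sup>\<infinity> exp (z - s)\<close>, which
  obeys a Bellman inequality and yields \<open>c\<close>, while the outer part with its potential acts like a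
  potential-free piece of length \<open>tau T = T + A + o(1)\<close>. Gluing near-extremals of both
  parts gives an admissible function strictly above that level, so a maximiser exists. By
  convexity it solves the Euler-Lagrange equation, whence the regularity at the origin.\<close>

section \<open>Inequalities for powers\<close>

text \<open>After the substitution Hoelder's inequality reads
  \<open>\<bar>b s\<bar> powr q \<le> s\<close> for unit energy, so the exponent is exactly
  critical: for one fixed function it tends to minus infinity, but not uniformly on the constraint
  set. The strict inequality against the concentration level is a comparison of orders. A
  near-optimal outer profile cannot vanish on the times [2,3] and gains there an amount of order
  \<open>T powr (1 - q)\<close>, whereas every error of the gluing (the rate of \<open>tau\<close>,
  the remainder of \<open>c\<close>, the failure to be exactly optimal) can be made exponentially
  small in \<open>T\<close>. The constant \<open>c\<close> is \<open>cst p\<close>, the harmonic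
  number 1 + 1/2 + ... + 1/(p - 1) continued to real \<open>p\<close>; for \<open>p = 2\<close>
  without potential the level is 1 + e, the value of Carleson and Chang. The hypothesis
  \<open>p \<ge> 2\<close> enters through Clarkson's inequality and through
  \<open>q \<le> 2\<close>, which controls the second-order term when the exponent is linearised and
  keeps the gain at least of order 1/T.\<close>

lemma powr_tangent_strict:
  fixes p x m :: real
  assumes "p > 1" "x \<ge> 0" "m \<ge> 0" "x \<noteq> m"
  shows "m powr p + p * m powr (p - 1) * (x - m) < x powr p"
proof (cases "m = 0 \<or> x = 0")
  case True
  then show ?thesis
  proof
    assume "m = 0" then show ?thesis using assms by simp
  next
    assume x: "x = 0"
    then have m: "m > 0" using assms by simp
    have "m powr (p - 1) * m = m powr p"
      using m by (simp add: powr_mult_base mult.commute)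
    then have "m powr p + p * m powr (p - 1) * (x - m) = (1 - p) * m powr p"
      using x by (simp add: algebra_simps)
    also have "\<dots> < 0" using m assms by (simp add: mult_neg_pos)
    finally show ?thesis using x by simp
  qed
next
  case False
  then have pos: "m > 0" "x > 0" using assms by auto
  have D: "((\<lambda>x. x powr p) has_real_derivative p * z powr (p - 1)) (at z)" if "z > 0" for z
    using that by (auto intro!: derivative_eq_intros)
  consider "m < x" | "x < m" using assms by linarith
  then show ?thesis
  proof cases
    case 1
    then obtain z where z: "m < z" "z < x" "x powr p - m powr p = (x - m) * (p * z powr (p - 1))"
      using MVT2[OF 1, of "\<lambda>x. x powr p" "\<lambda>z. p * z powr (p - 1)"] D pos by auto
    have "m powr (p - 1) < z powr (p - 1)"
      using z pos assms by (intro powr_less_mono2) auto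
    then have "(x - m) * (p * m powr (p - 1)) < (x - m) * (p * z powr (p - 1))"
      using 1 assms by simp
    then show ?thesis using z by (simp add: algebra_simps)
  next
    case 2
    then obtain z where z: "x < z" "z < m" "m powr p - x powr p = (m - x) * (p * z powr (p - 1))"
      using MVT2[OF 2, of "\<lambda>x. x powr p" "\<lambda>z. p * z powr (p - 1)"] D pos by auto
    have "z powr (p - 1) < m powr (p - 1)"
      using z pos assms by (intro powr_less_mono2) auto
    then have "(m - x) * (p * z powr (p - 1)) < (m - x) * (p * m powr (p - 1))"
      using 2 assms by simp
    then show ?thesis using z by (simp add: algebra_simps)
  qed
qed

lemma powr_tangent:
  fixes p x m :: real
  assumes "p > 1" "x \<ge> 0" "m \<ge> 0"
  shows "m powr p + p * m powr (p - 1) * (x - m) \<le> x powr p"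
  using powr_tangent_strict[OF assms] by (cases "x = m") auto

text \<open>On [0,1] a power with exponent at most 1 lies above the identity; this is applied to the
  shares \<open>y / s\<close> and \<open>z / s\<close> of the sum.\<close>

lemma powr_subadd:
  fixes a y z :: real
  assumes "0 \<le> a" "a \<le> 1" "y \<ge> 0" "z \<ge> 0"
  shows "(y + z) powr a \<le> y powr a + z powr a"
proof (cases "y + z = 0")
  case False
  define s where "s = y + z"
  have s: "s > 0" using False assms by (simp add: s_def)
  have *: "t / s \<le> (t / s) powr a" if "0 \<le> t" "t \<le> s" for t
  proof -
    have "(t / s) powr 1 \<le> (t / s) powr a"
    proof (cases "t = 0")
      case False
      then show ?thesis using that s assms by (intro powr_mono') auto
    qed auto
    then show ?thesis using that s by simp
  qed
  have "s powr a = s powr a * (y / s + z / s)"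
    using s by (simp add: s_def add_divide_distrib [symmetric])
  also have "\<dots> \<le> s powr a * ((y / s) powr a + (z / s) powr a)"
    using *[of y] *[of z] assms s by (intro mult_left_mono add_mono) (auto simp: s_def)
  also have "\<dots> = y powr a + z powr a"
    using s assms by (simp add: powr_divide distrib_left)
  finally show ?thesis by (simp add: s_def)
qed (use assms in auto)

lemma powr_superadd:
  fixes r x y :: real
  assumes "r \<ge> 1" "x \<ge> 0" "y \<ge> 0"
  shows "x powr r + y powr r \<le> (x + y) powr r"
proof (cases "x = 0 \<or> y = 0")
  case False
  then have pos: "x > 0" "y > 0" using assms by auto
  have *: "t powr r \<le> t * (x + y) powr (r - 1)" if "t > 0" "t \<le> x + y" for t
  proof -
    have "t powr r = t * t powr (r - 1)" using that by (simp add: powr_mult_base)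
    also have "\<dots> \<le> t * (x + y) powr (r - 1)"
      using that assms by (intro mult_left_mono powr_mono2) auto
    finally show ?thesis .
  qed
  have "x powr r + y powr r \<le> x * (x + y) powr (r - 1) + y * (x + y) powr (r - 1)"
    using *[of x] *[of y] pos by (intro add_mono) auto
  also have "\<dots> = (x + y) * (x + y) powr (r - 1)" by (simp add: algebra_simps)
  also have "\<dots> = (x + y) powr r" using pos by (simp add: powr_mult_base)
  finally show ?thesis .
qed (use assms in auto)

lemma powr_midpoint:
  fixes r x y :: real
  assumes "r \<ge> 1" "x \<ge> 0" "y \<ge> 0"
  shows "((x + y) / 2) powr r \<le> (x powr r + y powr r) / 2"
proof (cases "r = 1")
  case False
  then have r: "r > 1" using assms by simp
  define m where "m = (x + y) / 2"
  have "m powr r + r * m powr (r - 1) * (x - m) \<le> x powr r"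
    "m powr r + r * m powr (r - 1) * (y - m) \<le> y powr r"
    using r assms by (intro powr_tangent; simp add: m_def)+
  moreover have "r * m powr (r - 1) * (x - m) + r * m powr (r - 1) * (y - m) = r * m powr (r - 1) * (x + y - 2 * m)"
    by (simp add: algebra_simps)
  then have "r * m powr (r - 1) * (x - m) + r * m powr (r - 1) * (y - m) = 0" by (simp add: m_def)
  moreover have "a + b \<le> c \<Longrightarrow> a + b' \<le> c' \<Longrightarrow> b + b' = 0 \<Longrightarrow> a \<le> (c + c') / 2" for a b b' c c' :: real
    by (simp add: field_simps)
  ultimately show ?thesis unfolding m_def[symmetric] by blast
qed (use assms in auto)

text \<open>Squares obey the parallelogram identity. Superadditivity of the power
  \<open>p / 2\<close> handles the left side and convexity of the same power the right side; both
  need \<open>p / 2 \<ge> 1\<close>.\<close>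

lemma clarkson:
  fixes p x y :: real
  assumes "p \<ge> 2"
  shows "\<bar>(x + y) / 2\<bar> powr p + \<bar>(x - y) / 2\<bar> powr p \<le> (\<bar>x\<bar> powr p + \<bar>y\<bar> powr p) / 2"
proof -
  have sq: "\<bar>t\<bar> powr p = (t\<^sup>2) powr (p / 2)" for t :: real
  proof -
    have "(t\<^sup>2) powr (p / 2) = (\<bar>t\<bar> powr 2) powr (p / 2)" by simp
    also have "\<dots> = \<bar>t\<bar> powr p" by (simp add: powr_powr del: powr_numeral)
    finally show ?thesis by simp
  qed
  have "(((x + y) / 2)\<^sup>2) powr (p / 2) + (((x - y) / 2)\<^sup>2) powr (p / 2)
    \<le> (((x + y) / 2)\<^sup>2 + ((x - y) / 2)\<^sup>2) powr (p / 2)"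
    using assms by (intro powr_superadd) auto
  also have "((x + y) / 2)\<^sup>2 + ((x - y) / 2)\<^sup>2 = (x\<^sup>2 + y\<^sup>2) / 2"
    by (simp add: power2_eq_square field_simps)
  also have "((x\<^sup>2 + y\<^sup>2) / 2) powr (p / 2) \<le> ((x\<^sup>2) powr (p / 2) + (y\<^sup>2) powr (p / 2)) / 2"
    using assms by (intro powr_midpoint) auto
  finally show ?thesis unfolding sq .
qed

text \<open>As a function of \<open>z\<close>, the difference of the two sides has as derivative
  \<open>q\<close> times the subadditivity defect of the power \<open>q - 1\<close>, whose exponent
  is at most 1 because \<open>q \<le> 2\<close>. It expands the exponent at the crossing height with
  no smallness condition on \<open>z\<close>.\<close>

lemma powr_add_le:
  fixes q y z :: real
  assumes "1 < q" "q \<le> 2" "y \<ge> 0" "z \<ge> 0"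
  shows "(y + z) powr q \<le> y powr q + q * y powr (q - 1) * z + z powr q"
proof -
  let ?f = "\<lambda>z. y powr q + q * y powr (q - 1) * z + z powr q - (y + z) powr q"
  have "?f 0 \<le> ?f z"
  proof (rule DERIV_nonneg_imp_increasing_open[OF assms(4)])
    fix t assume t: "0 < t" "t < z"
    have "(?f has_real_derivative (q * y powr (q - 1) + q * t powr (q - 1) - q * (y + t) powr (q - 1))) (at t)"
      using t assms by (auto intro!: derivative_eq_intros)
    moreover have "(y + t) powr (q - 1) \<le> y powr (q - 1) + t powr (q - 1)"
      using assms t by (intro powr_subadd) auto
    then have "q * (y + t) powr (q - 1) \<le> q * (y powr (q - 1) + t powr (q - 1))"
      using assms by (intro mult_left_mono) auto
    then have "0 \<le> q * y powr (q - 1) + q * t powr (q - 1) - q * (y + t) powr (q - 1)"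
      by (simp add: algebra_simps)
    ultimately show "\<exists>D. (?f has_real_derivative D) (at t) \<and> 0 \<le> D" by blast
  next
    show "continuous_on {0..z} ?f"
      using assms by (intro continuous_intros continuous_on_powr') auto
  qed
  then show ?thesis using assms by simp
qed

section \<open>Functionals on the half line\<close>

definition Lp :: "real \<Rightarrow> (real \<Rightarrow> real) \<Rightarrow> bool" where
  "Lp p w \<longleftrightarrow> w \<in> borel_measurable borel \<and> set_integrable lborel {0..} (\<lambda>s. \<bar>w s\<bar> powr p)"

definition prim :: "(real \<Rightarrow> real) \<Rightarrow> real \<Rightarrow> real" where
  "prim w s = (LINT t:{0..s}|lborel. w t)"

text \<open>Over \<open>{0..}\<close> this is the image of the gradient norm to the power
  \<open>p\<close>; \<open>mass\<close> and \<open>expint\<close> correspond, up to constants, to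
  the norm of the function and to the exponential integral. The set argument allows splitting at a
  time.\<close>

definition enrg :: "real \<Rightarrow> (real \<Rightarrow> real) \<Rightarrow> real set \<Rightarrow> real" where
  "enrg p w A = (LINT s:A|lborel. \<bar>w s\<bar> powr p)"

definition mass :: "real \<Rightarrow> (real \<Rightarrow> real) \<Rightarrow> real set \<Rightarrow> real" where
  "mass p w A = (LINT s:A|lborel. \<bar>prim w s\<bar> powr p * exp (- s))"

definition expint :: "real \<Rightarrow> (real \<Rightarrow> real) \<Rightarrow> real set \<Rightarrow> real" where
  "expint q w A = (LINT s:A|lborel. exp (\<bar>prim w s\<bar> powr q - s))"

lemma Lp_measurable [measurable_dest]: "Lp p w \<Longrightarrow> w \<in> borel_measurable borel"
  by (simp add: Lp_def)

lemma Lp_set_integrable: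
  assumes "Lp p w" "A \<in> sets borel" "A \<subseteq> {0..}"
  shows "set_integrable lborel A (\<lambda>s. \<bar>w s\<bar> powr p)"
  using assms by (auto simp: Lp_def intro: set_integrable_subset)

lemma set_integrable_bdd_interval [simp]:
  "set_integrable lborel {a..b::real} (\<lambda>_. c::real)"
  by (intro borel_integrable_atLeastAtMost') (auto intro: continuous_intros)

lemma set_integrable_bound_fin:
  fixes f g :: "real \<Rightarrow> real"
  assumes "set_integrable lborel A g" "f \<in> borel_measurable borel" "A \<in> sets borel"
    "\<And>x. x \<in> A \<Longrightarrow> \<bar>f x\<bar> \<le> g x"
  shows "set_integrable lborel A f"
proof (rule set_integrable_bound[OF assms(1)])
  show "set_borel_measurable lborel A f"
    using assms by (auto simp: set_borel_measurable_def)
qed (use assms(4) in \<open>auto intro!: AE_I2 order.trans[OF assms(4)]\<close>)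

lemma Lp_int_integrable:
  assumes "Lp p w" "p \<ge> 1" "0 \<le> s"
  shows "set_integrable lborel {s..t} w"
proof (rule set_integrable_bound_fin)
  show "set_integrable lborel {s..t} (\<lambda>x. 1 + \<bar>w x\<bar> powr p)"
    using assms by (intro set_integral_add Lp_set_integrable) auto
  show "\<bar>w x\<bar> \<le> 1 + \<bar>w x\<bar> powr p" for x
  proof (cases "\<bar>w x\<bar> \<le> 1")
    case False
    then have "\<bar>w x\<bar> powr 1 \<le> \<bar>w x\<bar> powr p" using assms by (intro powr_mono) auto
    then show ?thesis by simp
  next
    case True
    then show ?thesis using powr_ge_zero[of "\<bar>w x\<bar>" p] by linarith
  qed
qed (use assms in \<open>auto simp: Lp_def\<close>)

lemma set_integral_split:
  fixes f :: "real \<Rightarrow> real"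
  assumes "set_integrable lborel {a..c} f" "a \<le> b" "b \<le> c"
  shows "(LINT t:{a..c}|lborel. f t) = (LINT t:{a..b}|lborel. f t) + (LINT t:{b..c}|lborel. f t)"
proof -
  have "{a..c} = {a..b} \<union> {b..c}" using assms by auto
  moreover have "AE x in lborel. \<not> (x \<in> {a..b} \<and> x \<in> {b..c})"
    using AE_lborel_singleton[of b] by eventually_elim auto
  moreover have "set_integrable lborel {a..b} f" "set_integrable lborel {b..c} f"
    using assms by (auto intro!: set_integrable_subset[OF assms(1)])
  ultimately show ?thesis by (simp add: set_integral_Un_AE)
qed

lemma set_integral_split_inf:
  fixes f :: "real \<Rightarrow> real"
  assumes "set_integrable lborel {a..} f" "a \<le> b"
  shows "(LINT t:{a..}|lborel. f t) = (LINT t:{a..b}|lborel. f t) + (LINT t:{b..}|lborel. f t)"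
proof -
  have "{a..} = {a..b} \<union> {b..}" using assms by auto
  moreover have "AE x in lborel. \<not> (x \<in> {a..b} \<and> x \<in> {b..})"
    using AE_lborel_singleton[of b] by eventually_elim auto
  moreover have "set_integrable lborel {a..b} f" "set_integrable lborel {b..} f"
    using assms by (auto intro!: set_integrable_subset[OF assms(1)])
  ultimately show ?thesis by (simp add: set_integral_Un_AE)
qed

lemma set_integral_point [simp]: "(LINT t:{a}|lborel. w t) = (0::real)" for w :: "real \<Rightarrow> real"
proof -
  have "AE x in lborel. indicat_real {a} x *\<^sub>R w x = 0"
    using AE_lborel_singleton[of a] by eventually_elim auto
  then show ?thesis unfolding set_lebesgue_integral_def by (rule integral_eq_zero_AE)
qed

lemma prim_diff:
  assumes "Lp p w" "p \<ge> 1" "0 \<le> s" "s \<le> t"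
  shows "prim w t - prim w s = (LINT x:{s..t}|lborel. w x)"
  unfolding prim_def using set_integral_split[of 0 t w s] Lp_int_integrable[OF assms(1,2), of 0 t] assms
  by simp

lemma enrg_nonneg [simp]: "0 \<le> enrg p w A"
  unfolding enrg_def set_lebesgue_integral_def by (intro integral_nonneg_AE) auto

lemma mass_nonneg [simp]: "0 \<le> mass p w A"
  unfolding mass_def set_lebesgue_integral_def by (intro integral_nonneg_AE) auto

lemma expint_nonneg [simp]: "0 \<le> expint q w A"
  unfolding expint_def set_lebesgue_integral_def by (intro integral_nonneg_AE) auto

lemma set_integral_constI: "a \<le> b \<Longrightarrow> (LINT x:{a..b::real}|lborel. (c::real)) = c * (b - a)"
  by (simp add: set_lebesgue_integral_def)

text \<open>Jensen's inequality: the tangent of \<open>powr p\<close> is taken at the mean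
  \<open>m\<close> of the modulus, so that its linear term integrates to zero.\<close>

lemma holder_interval:
  assumes "Lp p w" "p > 1" "0 \<le> s" "s \<le> t"
  shows "\<bar>LINT x:{s..t}|lborel. w x\<bar> powr p \<le> (t - s) powr (p - 1) * enrg p w {s..t}"
proof (cases "s = t")
  case True
  then show ?thesis by simp
next
  case False
  then have h: "t - s > 0" using assms by simp
  have iw: "set_integrable lborel {s..t} w" "set_integrable lborel {s..t} (\<lambda>x. \<bar>w x\<bar>)"
    using Lp_int_integrable[of p w s t] assms by (auto intro: set_integrable_abs)
  define m where "m = (LINT x:{s..t}|lborel. \<bar>w x\<bar>) / (t - s)"
  have I: "(LINT x:{s..t}|lborel. \<bar>w x\<bar>) = m * (t - s)" using h by (simp add: m_def)
  have I0: "0 \<le> (LINT x:{s..t}|lborel. \<bar>w x\<bar>)"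
    unfolding set_lebesgue_integral_def by (intro integral_nonneg_AE) auto
  then have m0: "m \<ge> 0" using h by (simp add: m_def)
  have "(LINT x:{s..t}|lborel. m powr p + p * m powr (p - 1) * (\<bar>w x\<bar> - m)) \<le> enrg p w {s..t}"
    unfolding enrg_def using assms iw m0
    by (intro set_integral_mono Lp_set_integrable powr_tangent set_integral_add set_integral_diff set_integrable_mult_right) auto
  also have "(LINT x:{s..t}|lborel. m powr p + p * m powr (p - 1) * (\<bar>w x\<bar> - m)) =
     m powr p * (t - s) + p * m powr (p - 1) * (m * (t - s) - m * (t - s))"
    using iw h by (simp add: set_integral_add set_integral_diff set_integral_constI I)
  finally have *: "m powr p * (t - s) \<le> enrg p w {s..t}" by simp
  have "\<bar>LINT x:{s..t}|lborel. w x\<bar> \<le> m * (t - s)"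
    unfolding I[symmetric] set_lebesgue_integral_def
    using integral_abs_bound[of lborel "\<lambda>x. indicat_real {s..t} x *\<^sub>R w x"]
    by (simp add: abs_mult)
  then have "\<bar>LINT x:{s..t}|lborel. w x\<bar> powr p \<le> (m * (t - s)) powr p"
    using assms by (intro powr_mono2) auto
  also have "\<dots> = (t - s) powr (p - 1) * (m powr p * (t - s))"
    using h m0 by (simp add: powr_mult powr_diff)
  also have "\<dots> \<le> (t - s) powr (p - 1) * enrg p w {s..t}"
    using * by (intro mult_left_mono) auto
  finally show ?thesis .
qed

lemma enrg_mono:
  assumes "Lp p w" "A \<in> sets borel" "B \<in> sets borel" "A \<subseteq> B" "B \<subseteq> {0..}"
  shows "enrg p w A \<le> enrg p w B"
proof -
  have "set_integrable lborel A (\<lambda>s. \<bar>w s\<bar> powr p)" "set_integrable lborel B (\<lambda>s. \<bar>w s\<bar> powr p)"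
    using assms by (auto intro!: Lp_set_integrable)
  then show ?thesis unfolding enrg_def set_lebesgue_integral_def set_integrable_def
    using assms by (intro integral_mono) (auto simp: indicator_def)
qed

lemma prim_holder:
  assumes "Lp p w" "p > 1" "0 \<le> s" "s \<le> t"
  shows "\<bar>prim w t - prim w s\<bar> powr p \<le> (t - s) powr (p - 1) * enrg p w {s..t}"
  using holder_interval[OF assms] prim_diff[of p w s t] assms by simp

lemma prim_0 [simp]: "prim w 0 = 0"
  by (simp add: prim_def)

lemma prim_bound:
  assumes "Lp p w" "p > 1" "0 \<le> s"
  shows "\<bar>prim w s\<bar> powr p \<le> s powr (p - 1) * enrg p w {0..s}"
  using prim_holder[OF assms(1,2), of 0 s] assms by simp

lemma prim_bound':
  assumes "Lp p w" "p > 1" "0 \<le> s"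
  shows "\<bar>prim w s\<bar> powr p \<le> s powr (p - 1) * enrg p w {0..}"
proof -
  have "enrg p w {0..s} \<le> enrg p w {0..}" using assms by (intro enrg_mono) auto
  then show ?thesis by (intro order.trans[OF prim_bound[OF assms]] mult_left_mono) auto
qed

lemma prim_holder':
  assumes "Lp p w" "p > 1" "0 \<le> s" "s \<le> t"
  shows "\<bar>prim w t - prim w s\<bar> \<le> (t - s) powr ((p - 1) / p) * enrg p w {0..} powr (1 / p)"
proof -
  have "enrg p w {s..t} \<le> enrg p w {0..}" using assms by (intro enrg_mono) auto
  then have "\<bar>prim w t - prim w s\<bar> powr p \<le> (t - s) powr (p - 1) * enrg p w {0..}"
    by (intro order.trans[OF prim_holder[OF assms]] mult_left_mono) auto
  then have "(\<bar>prim w t - prim w s\<bar> powr p) powr (1/p) \<le> ((t - s) powr (p - 1) * enrg p w {0..}) powr (1/p)"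
    using assms by (intro powr_mono2) auto
  then show ?thesis using assms by (simp add: powr_powr powr_mult)
qed

section \<open>Decay estimates at infinity\<close>

lemma set_integrable_lborel_iff:
  fixes f :: "real \<Rightarrow> real"
  assumes "f \<in> borel_measurable borel" "A \<in> sets borel"
  shows "set_integrable lborel A f \<longleftrightarrow> f absolutely_integrable_on A"
  unfolding set_integrable_def using assms
  by (intro integrable_completion[symmetric]) auto

lemma set_integrable_exp_decay:
  assumes "a > 0"
  shows "set_integrable lborel {c..} (\<lambda>x::real. exp (- a * x))"
proof -
  have "(\<lambda>x::real. exp (- a * x)) integrable_on {c..}"
    using has_integral_exp_minus_to_infinity[OF assms] by (auto simp: has_integral_integrable)
  then have "(\<lambda>x::real. exp (- a * x)) absolutely_integrable_on {c..}"
    by (intro nonnegative_absolutely_integrable_1) auto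
  then show ?thesis by (subst set_integrable_lborel_iff) auto
qed

lemma integral_exp_decay:
  assumes "a > 0"
  shows "(LINT x:{c..}|lborel. exp (- a * x)) = exp (- a * c) / (a::real)"
  using set_borel_integral_eq_integral(2)[OF set_integrable_exp_decay[OF assms, of c]]
    has_integral_exp_minus_to_infinity[OF assms, of c] by (simp add: integral_unique)

lemma powr_le_exp:
  fixes k e s :: real
  assumes "k > 0" "e > 0" "s \<ge> 0"
  shows "s powr k \<le> (k / e) powr k * exp (e * s)"
proof -
  have "e * s / k \<le> exp (e * s / k)" using exp_ge_add_one_self[of "e * s / k"] by linarith
  then have "(e * s / k) powr k \<le> exp (e * s / k) powr k"
    using assms by (intro powr_mono2) auto
  also have "\<dots> = exp (e * s)" using assms by (simp add: exp_powr_real)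
  finally have "(k / e) powr k * (e * s / k) powr k \<le> (k / e) powr k * exp (e * s)"
    by (intro mult_left_mono) auto
  moreover have "(k / e) powr k * (e * s / k) powr k = s powr k"
    using assms by (simp add: powr_mult[symmetric])
  ultimately show ?thesis by simp
qed

lemma set_integrable_powr_exp:
  assumes "k > 0"
  shows "set_integrable lborel {0..} (\<lambda>s::real. s powr k * exp (- s))"
proof (rule set_integrable_bound_fin)
  show "set_integrable lborel {0..} (\<lambda>s. (k / (1/2)) powr k * exp (- (1/2) * s))"
    by (intro set_integrable_mult_right set_integrable_exp_decay) auto
  fix s :: real assume s: "s \<in> {0..}"
  have "s powr k * exp (- s) \<le> ((k / (1/2)) powr k * exp ((1/2) * s)) * exp (- s)"
    using powr_le_exp[OF assms, of "1/2" s] s by (intro mult_right_mono) auto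
  also have "\<dots> = (k / (1/2)) powr k * exp (- (1/2) * s)"
    by (simp add: mult_exp_exp)
  finally show "\<bar>s powr k * exp (- s)\<bar> \<le> (k / (1/2)) powr k * exp (- (1/2) * s)" by simp
qed auto

section \<open>Algebra of densities, energies and primitives\<close>

lemma powr_add_bound:
  fixes x y p :: real
  assumes "p \<ge> 1"
  shows "\<bar>x + y\<bar> powr p \<le> 2 powr (p - 1) * (\<bar>x\<bar> powr p + \<bar>y\<bar> powr p)"
proof -
  have "\<bar>x + y\<bar> powr p \<le> (\<bar>x\<bar> + \<bar>y\<bar>) powr p" using assms by (intro powr_mono2) auto
  also have "\<dots> = 2 powr p * ((\<bar>x\<bar> + \<bar>y\<bar>) / 2) powr p"
    by (simp add: powr_divide)
  also have "\<dots> \<le> 2 powr p * ((\<bar>x\<bar> powr p + \<bar>y\<bar> powr p) / 2)"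
    using assms by (intro mult_left_mono powr_midpoint) auto
  also have "\<dots> = 2 powr (p - 1) * (\<bar>x\<bar> powr p + \<bar>y\<bar> powr p)"
    by (simp add: powr_diff)
  finally show ?thesis .
qed

lemma Lp_scale:
  assumes "Lp p w" "p > 0"
  shows "Lp p (\<lambda>s. c * w s)"
  using assms by (auto simp: Lp_def abs_mult powr_mult)

lemma enrg_scale:
  shows "enrg p (\<lambda>s. c * w s) A = \<bar>c\<bar> powr p * enrg p w A"
  by (simp add: enrg_def abs_mult powr_mult)

lemma Lp_add:
  assumes "Lp p v" "Lp p w" "p \<ge> 1"
  shows "Lp p (\<lambda>s. v s + w s)"
  unfolding Lp_def
proof
  show "set_integrable lborel {0..} (\<lambda>s. \<bar>v s + w s\<bar> powr p)"
  proof (rule set_integrable_bound_fin)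
    show "set_integrable lborel {0..} (\<lambda>s. 2 powr (p - 1) * (\<bar>v s\<bar> powr p + \<bar>w s\<bar> powr p))"
      using assms by (intro set_integrable_mult_right set_integral_add) (auto simp: Lp_def)
  qed (use assms powr_add_bound in \<open>auto simp: Lp_def\<close>)
qed (use assms in \<open>auto simp: Lp_def\<close>)

lemma Lp_diff:
  assumes "Lp p v" "Lp p w" "p \<ge> 1"
  shows "Lp p (\<lambda>s. v s - w s)"
  using Lp_add[OF assms(1) Lp_scale[OF assms(2), of "-1"]] assms by simp

lemma Lp_abs: "Lp p w \<Longrightarrow> Lp p (\<lambda>s. \<bar>w s\<bar>)"
  by (auto simp: Lp_def)

lemma enrg_abs [simp]: "enrg p (\<lambda>s. \<bar>w s\<bar>) A = enrg p w A"
  by (simp add: enrg_def)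

lemma prim_scale: "prim (\<lambda>s. c * w s) t = c * prim w t"
  by (simp add: prim_def)

lemma prim_add:
  assumes "Lp p v" "Lp p w" "p \<ge> 1"
  shows "prim (\<lambda>s. v s + w s) t = prim v t + prim w t"
  unfolding prim_def using assms by (intro set_integral_add(2) Lp_int_integrable) auto

lemma prim_diff_fun:
  assumes "Lp p v" "Lp p w" "p \<ge> 1"
  shows "prim (\<lambda>s. v s - w s) t = prim v t - prim w t"
  unfolding prim_def using assms by (intro set_integral_diff(2) Lp_int_integrable) auto

lemma prim_abs_le:
  shows "\<bar>prim w s\<bar> \<le> prim (\<lambda>s. \<bar>w s\<bar>) s"
  unfolding prim_def set_lebesgue_integral_def
  using integral_abs_bound[of lborel "\<lambda>x. indicat_real {0..s} x *\<^sub>R w x"]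
  by (simp add: abs_mult)

lemma prim_nonneg: "(\<And>s. 0 \<le> w s) \<Longrightarrow> 0 \<le> prim w s"
  unfolding prim_def set_lebesgue_integral_def by (intro integral_nonneg_AE) auto

lemma prim_mono:
  assumes "Lp p w" "p \<ge> 1" "\<And>s. 0 \<le> w s" "0 \<le> s" "s \<le> t"
  shows "prim w s \<le> prim w t"
proof -
  have "0 \<le> (LINT x:{s..t}|lborel. w x)"
    unfolding set_lebesgue_integral_def using assms by (intro integral_nonneg_AE) auto
  then show ?thesis using prim_diff[OF assms(1,2,4,5)] by simp
qed

lemma prim_continuous:
  assumes "Lp p w" "p > 1"
  shows "continuous_on {0..} (prim w)"
proof -
  have "continuous_on {0..t} (prim w)" for t
  proof -
    have i: "w integrable_on {0..t}" "\<And>s. s \<le> t \<Longrightarrow> w integrable_on {0..s}"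
      using set_borel_integral_eq_integral(1)[OF Lp_int_integrable[OF assms(1), of 0]] assms by auto
    have "continuous_on {0..t} (\<lambda>s. integral {0..s} w)"
      using i by (intro indefinite_integral_continuous_1)
    moreover have "integral {0..s} w = prim w s" for s
      unfolding prim_def using assms
      by (intro set_borel_integral_eq_integral(2)[symmetric] Lp_int_integrable) auto
    ultimately show ?thesis by simp
  qed
  then have "isCont (\<lambda>s. prim w (max 0 s)) t" for t
  proof -
    have "continuous_on {t-1<..<t+1} (\<lambda>s. prim w (max 0 s))"
      by (intro continuous_on_compose2[OF \<open>continuous_on {0..\<bar>t\<bar>+1} (prim w)\<close>] continuous_intros) auto
    then show ?thesis by (simp add: continuous_on_eq_continuous_at)
  qed
  then have "continuous_on {0..} (\<lambda>s. prim w (max 0 s))"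
    by (simp add: continuous_at_imp_continuous_on)
  then show ?thesis by (rule continuous_on_eq) auto
qed

text \<open>\<open>prim\<close> is controlled only on the half line; composing with
  \<open>max 0\<close> makes it globally continuous without changing it there.\<close>

lemma prim_meas:
  assumes "Lp p w" "p > 1"
  shows "(\<lambda>s. prim w (max 0 s)) \<in> borel_measurable borel"
  by (intro borel_measurable_continuous_onI continuous_on_compose2[OF prim_continuous[OF assms]] continuous_intros) auto

lemma set_integrable_boundI:
  fixes f g :: "real \<Rightarrow> real"
  assumes "set_integrable lborel A g" "A \<in> sets borel" "A \<subseteq> {0..}"
    "(\<lambda>s. f (max 0 s)) \<in> borel_measurable borel" "\<And>x. x \<in> A \<Longrightarrow> \<bar>f x\<bar> \<le> g x"
  shows "set_integrable lborel A f"
proof -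
  have "set_integrable lborel A (\<lambda>s. f (max 0 s))"
    using assms by (intro set_integrable_bound_fin[OF assms(1)]) (auto simp: subset_iff max_def)
  moreover have "set_integrable lborel A (\<lambda>s. f (max 0 s)) = set_integrable lborel A f"
    using assms(3) by (intro set_integrable_cong) (auto simp: subset_iff max_def)
  ultimately show ?thesis by simp
qed

lemma mass_integrable:
  assumes "Lp p w" "p > 1" "A \<in> sets borel" "A \<subseteq> {0..}"
  shows "set_integrable lborel A (\<lambda>s. \<bar>prim w s\<bar> powr p * exp (- s))"
proof (rule set_integrable_boundI)
  have "set_integrable lborel {0..} (\<lambda>s. enrg p w {0..} * (s powr (p - 1) * exp (- s)))"
    using assms by (intro set_integrable_mult_right set_integrable_powr_exp) auto
  then show "set_integrable lborel A (\<lambda>s. enrg p w {0..} * (s powr (p - 1) * exp (- s)))"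
    by (rule set_integrable_subset) (use assms in auto)
  show "(\<lambda>s. \<bar>prim w (max 0 s)\<bar> powr p * exp (- max 0 s)) \<in> borel_measurable borel"
    using prim_meas[OF assms(1,2)] by measurable
  fix s assume "s \<in> A"
  then have "s \<ge> 0" using assms by auto
  then show "\<bar>\<bar>prim w s\<bar> powr p * exp (- s)\<bar> \<le> enrg p w {0..} * (s powr (p - 1) * exp (- s))"
    using prim_bound'[OF assms(1,2), of s] by (simp add: mult.commute)
qed (use assms in auto)

text \<open>A slope slightly above \<open>d\<close> absorbs \<open>K\<close> once \<open>s\<close>
  is large; for the other \<open>s\<close> one has \<open>s powr (1 / q) \<le> K / (d' - d)\<close>,
  and the left side is bounded.\<close>

lemma powr_growth:
  fixes q d d' K :: real
  assumes "q > 1" "0 \<le> d" "d < d'" "K \<ge> 0"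
  shows "\<exists>C\<ge>0. \<forall>s\<ge>0. (K + d * s powr (1 / q)) powr q \<le> C + d' powr q * s"
proof (intro exI conjI allI impI)
  fix s :: real assume s: "s \<ge> 0"
  show "(K + d * s powr (1 / q)) powr q \<le> (K + d * (K / (d' - d))) powr q + d' powr q * s"
  proof (cases "K + d * s powr (1 / q) \<le> d' * s powr (1 / q)")
    case True
    then have "(K + d * s powr (1 / q)) powr q \<le> (d' * s powr (1 / q)) powr q"
      using assms by (intro powr_mono2) auto
    also have "\<dots> = d' powr q * s" using assms s by (simp add: powr_mult powr_powr)
    finally show ?thesis using powr_ge_zero[of "K + d * (K / (d' - d))" q] by linarith
  next
    case False
    then have "(d' - d) * s powr (1 / q) \<le> K" by (simp add: algebra_simps)
    then have "s powr (1 / q) \<le> K / (d' - d)" using assms by (simp add: field_simps)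
    then have "(K + d * s powr (1 / q)) powr q \<le> (K + d * (K / (d' - d))) powr q"
      using assms by (intro powr_mono2 add_left_mono mult_left_mono) auto
    moreover have "0 \<le> d' powr q * s" using s by simp
    ultimately show ?thesis by linarith
  qed
qed auto

lemma enrg_tail:
  assumes "Lp p w" "e > 0"
  shows "\<exists>T\<ge>0. enrg p w {T..} < e"
proof -
  have "((\<lambda>T. enrg p w {0..T}) \<longlongrightarrow> enrg p w {0..}) at_top"
    unfolding enrg_def using assms
    by (intro tendsto_set_lebesgue_integral_at_top) (auto simp: Lp_def)
  then have "eventually (\<lambda>T. dist (enrg p w {0..T}) (enrg p w {0..}) < e) at_top"
    using assms by (simp add: tendsto_iff)
  then obtain T where T: "T \<ge> 0" "dist (enrg p w {0..T}) (enrg p w {0..}) < e"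
    using eventually_happens'[OF _ eventually_conj[OF _ eventually_ge_at_top[of 0]]] by force
  have "enrg p w {0..} = enrg p w {0..T} + enrg p w {T..}"
    unfolding enrg_def using assms T by (intro set_integral_split_inf) (auto simp: Lp_def)
  then show ?thesis using T by (auto simp: dist_real_def)
qed

text \<open>Only the energy beyond \<open>T\<close> determines the growth rate. This later separates
  sequences whose tail energy stays below 1 from those whose whole energy escapes.\<close>

lemma prim_tail_bound:
  assumes "Lp p w" "p > 1" "0 \<le> T" "T \<le> s"
  shows "\<bar>prim w s\<bar> \<le> \<bar>prim w T\<bar> + enrg p w {T..} powr (1/p) * s powr ((p - 1) / p)"
proof -
  have "enrg p w {T..s} \<le> enrg p w {T..}" using assms by (intro enrg_mono) auto
  then have "\<bar>prim w s - prim w T\<bar> powr p \<le> (s - T) powr (p - 1) * enrg p w {T..}"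
    using assms by (intro order.trans[OF prim_holder[OF assms(1)]] mult_left_mono) auto
  also have "\<dots> \<le> s powr (p - 1) * enrg p w {T..}"
    using assms by (intro mult_right_mono powr_mono2) auto
  finally have "(\<bar>prim w s - prim w T\<bar> powr p) powr (1/p) \<le> (s powr (p - 1) * enrg p w {T..}) powr (1/p)"
    using assms by (intro powr_mono2) auto
  then have "\<bar>prim w s - prim w T\<bar> \<le> enrg p w {T..} powr (1/p) * s powr ((p - 1) / p)"
    using assms by (simp add: powr_powr powr_mult mult.commute)
  then show ?thesis by linarith
qed

lemma Lp_restrict:
  assumes "Lp p w" "A \<in> sets borel" "p > 0"
  shows "Lp p (\<lambda>s. indicator A s * w s)"
  unfolding Lp_def
proof
  have [measurable]: "w \<in> borel_measurable borel" using assms by (simp add: Lp_def)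
  show m: "(\<lambda>s. indicator A s * w s) \<in> borel_measurable borel" using assms by measurable
  show "set_integrable lborel {0..} (\<lambda>s. \<bar>indicator A s * w s\<bar> powr p)"
  proof (rule set_integrable_bound_fin)
    show "set_integrable lborel {0..} (\<lambda>s. \<bar>w s\<bar> powr p)" using assms by (simp add: Lp_def)
    show "(\<lambda>s. \<bar>indicator A s * w s\<bar> powr p) \<in> borel_measurable borel" using m by measurable
  qed (use assms in \<open>auto simp: indicator_def\<close>)
qed

lemma enrg_restrict:
  assumes "p > 0"
  shows "enrg p (\<lambda>s. indicator A s * w s) B = enrg p w (A \<inter> B)"
  unfolding enrg_def set_lebesgue_integral_def
  using assms by (intro Bochner_Integration.integral_cong) (auto simp: indicator_def)

lemma prim_restrict:
  assumes "0 \<le> s" "0 \<le> T"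
  shows "prim (\<lambda>s. indicator {0..T} s * w s) s = prim w (min s T)"
  unfolding prim_def set_lebesgue_integral_def
  using assms by (intro Bochner_Integration.integral_cong) (auto simp: indicator_def)

lemma enrg_nn:
  assumes "Lp p w"
  shows "(\<integral>\<^sup>+x. ennreal (indicator {0..} x * \<bar>w x\<bar> powr p) \<partial>lborel) = ennreal (enrg p w {0..})"
  unfolding enrg_def set_lebesgue_integral_def
  using assms by (subst nn_integral_eq_integral) (auto simp: Lp_def set_integrable_def)

lemma enrg_of_nn:
  assumes "w \<in> borel_measurable borel" "c \<ge> 0"
    "(\<integral>\<^sup>+x. ennreal (indicator {0..} x * \<bar>w x\<bar> powr p) \<partial>lborel) \<le> ennreal c"
  shows "Lp p w" "enrg p w {0..} \<le> c"
proof -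
  have "integrable lborel (\<lambda>x. indicator {0..} x * \<bar>w x\<bar> powr p)"
    using assms by (intro integrableI_nonneg) (auto simp: top_unique intro: le_less_trans)
  then show *: "Lp p w" using assms by (simp add: Lp_def set_integrable_def)
  show "enrg p w {0..} \<le> c" using enrg_nn[OF *] assms by (simp add: ennreal_le_iff)
qed

section \<open>Weak compactness\<close>

text \<open>Riesz-Fischer. The last conclusion, lower semicontinuity of the energy, comes from the
  same Fatou argument as the convergence.\<close>

lemma Lp_complete:
  fixes f :: "nat \<Rightarrow> real \<Rightarrow> real"
  assumes "p \<ge> 1" and f: "\<And>n. Lp p (f n)"
    and cauchy: "\<And>e. e > 0 \<Longrightarrow> \<exists>K. \<forall>m\<ge>K. \<forall>n\<ge>K. enrg p (\<lambda>s. f m s - f n s) {0..} < e"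
  obtains w where "Lp p w" "(\<lambda>n. enrg p (\<lambda>s. f n s - w s) {0..}) \<longlonglongrightarrow> 0"
    "\<And>C. \<forall>\<^sub>F n in sequentially. enrg p (f n) {0..} \<le> C \<Longrightarrow> enrg p w {0..} \<le> C"
proof -
  have fm [measurable]: "f n \<in> borel_measurable borel" for n using f by (simp add: Lp_def)
  have fd: "Lp p (\<lambda>s. f m s - f n s)" for m n using f assms by (intro Lp_diff) auto
  have "\<exists>K. \<forall>m\<ge>K. \<forall>n\<ge>K. enrg p (\<lambda>s. f m s - f n s) {0..} < (1/4) ^ k" for k :: nat
    by (rule cauchy) simp
  then obtain K where K: "\<And>k m n. m \<ge> K k \<Longrightarrow> n \<ge> K k \<Longrightarrow> enrg p (\<lambda>s. f m s - f n s) {0..} < (1/4) ^ k"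
    by metis
  \<comment> \<open>The subsequence need not increase strictly; it only has to dominate all earlier
    thresholds and tend to infinity.\<close>
  define r where "r k = Max (K ` {..k}) + k" for k
  have rK: "K k \<le> r j" if "k \<le> j" for k j
  proof -
    have "K k \<le> Max (K ` {..j})" using that by (intro Max_ge) auto
    then show ?thesis by (simp add: r_def)
  qed
  have rk: "k \<le> r k" for k by (simp add: r_def)
  have rlim: "filterlim r at_top sequentially"
    using rk by (intro filterlim_at_top_mono[OF filterlim_ident]) auto
  \<comment> \<open>The increments have energy below \<open>(1/4) ^ k\<close>. The weight
    \<open>2 ^ k\<close> keeps the sum of the integrals finite, while finiteness of the pointwise
    sum forces geometric decay of the increments at that point.\<close>
  define g where "g k x = indicator {0..} x * (2 ^ k * \<bar>f (r (Suc k)) x - f (r k) x\<bar> powr p)" for k x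
  have gm [measurable]: "g k \<in> borel_measurable borel" for k unfolding g_def by measurable
  have g0: "g k x \<ge> 0" for k x by (simp add: g_def)
  have "(\<integral>\<^sup>+x. ennreal (g k x) \<partial>lborel) \<le> ennreal ((1/2) ^ k)" for k
  proof -
    have "(\<integral>\<^sup>+x. ennreal (g k x) \<partial>lborel) =
      (\<integral>\<^sup>+x. ennreal (2 ^ k) * ennreal (indicator {0..} x * \<bar>f (r (Suc k)) x - f (r k) x\<bar> powr p) \<partial>lborel)"
      by (intro nn_integral_cong) (auto simp: g_def ennreal_mult'[symmetric] mult_ac)
    also have "\<dots> = ennreal (2 ^ k) * ennreal (enrg p (\<lambda>s. f (r (Suc k)) s - f (r k) s) {0..})"
      by (subst nn_integral_cmult) (auto simp: enrg_nn[OF fd])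
    also have "\<dots> = ennreal (2 ^ k * enrg p (\<lambda>s. f (r (Suc k)) s - f (r k) s) {0..})"
      by (simp add: ennreal_mult')
    also have "\<dots> \<le> ennreal (2 ^ k * (1/4) ^ k)"
      using K[of k "r (Suc k)" "r k"] rK[of k k] rK[of k "Suc k"]
      by (intro ennreal_leI mult_left_mono) auto
    also have "(2::real) ^ k * (1/4) ^ k = (1/2) ^ k" by (simp add: power_mult_distrib[symmetric])
    finally show ?thesis .
  qed
  then have "(\<Sum>k. \<integral>\<^sup>+x. ennreal (g k x) \<partial>lborel) \<le> (\<Sum>k. ennreal ((1/2) ^ k))"
    by (intro suminf_le) auto
  also have "\<dots> = ennreal (\<Sum>k. (1/2) ^ k)"
    by (intro suminf_ennreal2) auto
  finally have "(\<integral>\<^sup>+x. (\<Sum>k. ennreal (g k x)) \<partial>lborel) \<noteq> \<infinity>"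
    by (subst nn_integral_suminf) (auto simp: top_unique)
  then have fin: "AE x in lborel. (\<Sum>k. ennreal (g k x)) \<noteq> \<infinity>"
    by (intro nn_integral_PInf_AE) auto
  have conv: "AE x in lborel. x \<ge> 0 \<longrightarrow> convergent (\<lambda>k. f (r k) x)"
    using fin
  proof eventually_elim
    fix x assume fx: "(\<Sum>k. ennreal (g k x)) \<noteq> \<infinity>"
    show "x \<ge> 0 \<longrightarrow> convergent (\<lambda>k. f (r k) x)"
    proof
      assume x: "x \<ge> 0"
      have sg: "summable (\<lambda>k. g k x)" using fx g0 by (intro summable_suminf_not_top) auto
      define C where "C = suminf (\<lambda>k. g k x)"
      have gC: "g k x \<le> C" for k
        using sum_le_suminf[OF sg, of "{k}"] g0 by (simp add: C_def)
      have le: "norm (f (r (Suc k)) x - f (r k) x) \<le> C powr (1/p) * ((1/2) powr (1/p)) ^ k" for k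
      proof -
        have "\<bar>f (r (Suc k)) x - f (r k) x\<bar> powr p \<le> C * (1/2) ^ k"
          using gC[of k] x by (simp add: g_def field_simps power_divide)
        then have "(\<bar>f (r (Suc k)) x - f (r k) x\<bar> powr p) powr (1/p) \<le> (C * (1/2) ^ k) powr (1/p)"
          using assms by (intro powr_mono2) auto
        moreover have "((1/2) ^ k) powr (1/p) = ((1/2::real) powr (1/p)) ^ k"
          by (simp add: powr_realpow[symmetric] powr_powr powr_power mult.commute)
        ultimately show ?thesis using assms by (simp add: powr_powr powr_mult)
      qed
      have sm: "summable (\<lambda>k. C powr (1/p) * ((1/2::real) powr (1/p)) ^ k)"
      proof -
        have "(1/2::real) powr (1/p) < 1 powr (1/p)" using assms by (intro powr_less_mono2) auto
        then show ?thesis by (intro summable_mult summable_geometric) simp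
      qed
      have "summable (\<lambda>k. f (r (Suc k)) x - f (r k) x)"
        by (rule summable_comparison_test'[OF sm, of 0]) (rule le)
      then have "convergent (\<lambda>n. \<Sum>k<n. f (r (Suc k)) x - f (r k) x)"
        by (simp add: summable_iff_convergent)
      moreover have "(\<Sum>k<n. f (r (Suc k)) x - f (r k) x) = f (r n) x - f (r 0) x" for n
        by (induction n) auto
      ultimately have "convergent (\<lambda>n. f (r n) x - f (r 0) x)" by simp
      then have "convergent (\<lambda>n. (f (r n) x - f (r 0) x) + f (r 0) x)"
        by (intro convergent_add convergent_const)
      then show "convergent (\<lambda>k. f (r k) x)" by simp
    qed
  qed
  define w where "w x = lim (\<lambda>k. f (r k) x)" for x
  have wm [measurable]: "w \<in> borel_measurable borel" unfolding w_def by measurable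
  have lim: "AE x in lborel. x \<ge> 0 \<longrightarrow> (\<lambda>k. f (r k) x) \<longlonglongrightarrow> w x"
    using conv by eventually_elim (auto simp: w_def convergent_LIMSEQ_iff)
  \<comment> \<open>Stated for \<open>h - c * f n\<close> to serve twice: \<open>h = f n\<close>,
    \<open>c = 1\<close> gives convergence, \<open>h = 0\<close>, \<open>c = -1\<close> the energy
    bound of the limit.\<close>
  have fatou: "(\<integral>\<^sup>+x. ennreal (indicator {0..} x * \<bar>h x - c * w x\<bar> powr p) \<partial>lborel) \<le> ennreal e"
    if [measurable]: "h \<in> borel_measurable borel" and h: "\<And>n. Lp p (\<lambda>x. h x - c * f n x)"
      and e: "\<forall>\<^sub>F n in sequentially. enrg p (\<lambda>x. h x - c * f n x) {0..} \<le> e" for h c e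
  proof -
    have "(\<integral>\<^sup>+x. ennreal (indicator {0..} x * \<bar>h x - c * w x\<bar> powr p) \<partial>lborel) =
       (\<integral>\<^sup>+x. liminf (\<lambda>k. ennreal (indicator {0..} x * \<bar>h x - c * f (r k) x\<bar> powr p)) \<partial>lborel)"
    proof (intro nn_integral_cong_AE)
      show "AE x in lborel. ennreal (indicator {0..} x * \<bar>h x - c * w x\<bar> powr p) =
         liminf (\<lambda>k. ennreal (indicator {0..} x * \<bar>h x - c * f (r k) x\<bar> powr p))"
        using lim
      proof eventually_elim
        fix x assume "x \<ge> 0 \<longrightarrow> (\<lambda>k. f (r k) x) \<longlonglongrightarrow> w x"
        then have "(\<lambda>k. ennreal (indicator {0..} x * \<bar>h x - c * f (r k) x\<bar> powr p))
            \<longlonglongrightarrow> ennreal (indicator {0..} x * \<bar>h x - c * w x\<bar> powr p)"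
          using assms by (cases "x \<ge> 0")
            (auto intro!: tendsto_ennrealI tendsto_mult tendsto_const tendsto_rabs tendsto_diff tendsto_powr' simp: indicator_def)
        then show "ennreal (indicator {0..} x * \<bar>h x - c * w x\<bar> powr p) =
          liminf (\<lambda>k. ennreal (indicator {0..} x * \<bar>h x - c * f (r k) x\<bar> powr p))"
          by (intro lim_imp_Liminf[symmetric]) auto
      qed
    qed
    also have "\<dots> \<le> liminf (\<lambda>k. \<integral>\<^sup>+x. ennreal (indicator {0..} x * \<bar>h x - c * f (r k) x\<bar> powr p) \<partial>lborel)"
      by (intro nn_integral_liminf) measurable
    also have "\<dots> = liminf (\<lambda>k. ennreal (enrg p (\<lambda>x. h x - c * f (r k) x) {0..}))"
      using h by (simp add: enrg_nn)
    also have "\<dots> \<le> ennreal e"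
    proof -
      have "\<forall>\<^sub>F k in sequentially. ennreal (enrg p (\<lambda>x. h x - c * f (r k) x) {0..}) \<le> ennreal e"
        using eventually_compose_filterlim[OF e rlim]
        by (auto elim!: eventually_mono intro: ennreal_leI)
      then have "limsup (\<lambda>k. ennreal (enrg p (\<lambda>x. h x - c * f (r k) x) {0..})) \<le> ennreal e"
        by (rule Limsup_bounded)
      then show ?thesis using Liminf_le_Limsup order.trans by (metis sequentially_bot)
    qed
    finally show ?thesis .
  qed
  have small: "\<exists>N. \<forall>n\<ge>N. Lp p (\<lambda>s. f n s - w s) \<and> enrg p (\<lambda>s. f n s - w s) {0..} \<le> e" if e0: "e > 0" for e
  proof -
    obtain N where N: "\<And>m n. m \<ge> N \<Longrightarrow> n \<ge> N \<Longrightarrow> enrg p (\<lambda>s. f m s - f n s) {0..} < e"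
      using cauchy[OF e0] by blast
    show ?thesis
    proof (intro exI allI impI)
      fix n assume n: "n \<ge> N"
      have "\<forall>\<^sub>F m in sequentially. enrg p (\<lambda>s. f n s - 1 * f m s) {0..} \<le> e"
        using N n by (intro eventually_sequentiallyI[of N]) (auto intro: less_imp_le)
      from fatou[OF fm _ this] have "(\<integral>\<^sup>+x. ennreal (indicator {0..} x * \<bar>f n x - w x\<bar> powr p) \<partial>lborel) \<le> ennreal e"
        using fd by simp
      from enrg_of_nn[OF _ _ this] show "Lp p (\<lambda>s. f n s - w s) \<and> enrg p (\<lambda>s. f n s - w s) {0..} \<le> e"
        using e0 by simp
    qed
  qed
  obtain n where n: "Lp p (\<lambda>s. f n s - w s)" using small[of 1] by auto
  have w: "Lp p w" using Lp_diff[OF f[of n] n] assms by simp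
  show ?thesis
  proof
    show "Lp p w" by fact
    show "(\<lambda>n. enrg p (\<lambda>s. f n s - w s) {0..}) \<longlonglongrightarrow> 0"
    proof (rule LIMSEQ_I)
      fix e :: real assume "e > 0"
      then obtain N where "\<forall>n\<ge>N. enrg p (\<lambda>s. f n s - w s) {0..} \<le> e/2" using small[of "e/2"] by auto
      then show "\<exists>N. \<forall>n\<ge>N. norm (enrg p (\<lambda>s. f n s - w s) {0..} - 0) < e"
        using \<open>e > 0\<close> by (intro exI[of _ N]) force
    qed
    fix C assume C: "\<forall>\<^sub>F n in sequentially. enrg p (f n) {0..} \<le> C"
    then obtain n where "enrg p (f n) {0..} \<le> C" by (auto simp: eventually_sequentially)
    then have C0: "C \<ge> 0" using enrg_nonneg order.trans by blast
    have e: "enrg p (\<lambda>x. 0 - (-1) * f n x) {0..} = enrg p (f n) {0..}" for n by simp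
    have "(\<integral>\<^sup>+x. ennreal (indicator {0..} x * \<bar>0 - (-1) * w x\<bar> powr p) \<partial>lborel) \<le> ennreal C"
      by (rule fatou) (use f C in auto)
    then show "enrg p w {0..} \<le> C" by (intro enrg_of_nn(2)[OF wm C0]) simp
  qed
qed

text \<open>A substitute for weak compactness. Densities whose primitives match \<open>b\<close> up
  to \<open>1 / Suc n\<close> at the first rational times form shrinking convex sets;
  near-minimisers of the energy in them are Cauchy by Clarkson's inequality, and the limit matches
  \<open>b\<close> at all rational times, hence everywhere by continuity. The bounds
  \<open>c n\<close> may vary, since the constraint bounds energies only through converging
  masses.\<close>

lemma Lp_weak_limit:
  fixes w :: "nat \<Rightarrow> real \<Rightarrow> real"
  assumes p: "p \<ge> 2" and w: "\<And>n. Lp p (w n)" and wc: "\<And>n. enrg p (w n) {0..} \<le> c n" and c: "c \<longlonglongrightarrow> C"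
    and lim: "\<And>s. s \<ge> 0 \<Longrightarrow> (\<lambda>n. prim (w n) s) \<longlonglongrightarrow> b s" and b: "continuous_on {0..} b"
  obtains v where "Lp p v" "\<And>s. s \<ge> 0 \<Longrightarrow> prim v s = b s" "enrg p v {0..} \<le> C"
proof -
  have "(0::real) \<in> \<rat> \<inter> {0..}" by simp
  then have ne: "\<rat> \<inter> {0::real..} \<noteq> {}" by blast
  have co: "countable (\<rat> \<inter> {0::real..})" using countable_rat by (rule countable_Int1)
  define r where "r = from_nat_into (\<rat> \<inter> {0::real..})"
  have r: "range r = \<rat> \<inter> {0..}" unfolding r_def by (rule range_from_nat_into[OF ne co])
  have r0: "r i \<ge> 0" for i using r by blast
  define K where "K n = {v. Lp p v \<and> (\<forall>i\<le>n. \<bar>prim v (r i) - b (r i)\<bar> \<le> 1 / Suc n)}" for n :: nat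
  have ev: "\<forall>\<^sub>F m in sequentially. w m \<in> K n" for n
  proof -
    have "\<forall>\<^sub>F m in sequentially. \<forall>i\<in>{..n}. \<bar>prim (w m) (r i) - b (r i)\<bar> \<le> 1 / Suc n"
    proof (intro eventually_ball_finite ballI)
      fix i
      have "\<forall>\<^sub>F m in sequentially. dist (prim (w m) (r i)) (b (r i)) < 1 / Suc n"
        using lim[OF r0[of i]] by (intro tendstoD) auto
      then show "\<forall>\<^sub>F m in sequentially. \<bar>prim (w m) (r i) - b (r i)\<bar> \<le> 1 / Suc n"
        by eventually_elim (simp add: dist_real_def)
    qed auto
    then show ?thesis by eventually_elim (use w in \<open>auto simp: K_def\<close>)
  qed
  have Kmono: "K n \<subseteq> K m" if "m \<le> n" for m n
  proof -
    have "1 / real (Suc n) \<le> 1 / real (Suc m)" using that by (intro divide_left_mono) auto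
    then show ?thesis using that unfolding K_def by (auto intro: order.trans le_trans)
  qed
  \<comment> \<open>These minimal energies increase as the sets shrink, and stay below
    \<open>C\<close> because almost all \<open>w m\<close> lie in \<open>K n\<close>; hence they
    converge.\<close>
  define d where "d n = Inf ((\<lambda>v. enrg p v {0..}) ` K n)" for n
  have bdd: "bdd_below ((\<lambda>v. enrg p v {0..}) ` K n)" for n by (rule bdd_belowI[of _ 0]) auto
  have Kne: "K n \<noteq> {}" for n using ev[of n] by (auto simp: eventually_sequentially)
  have dle: "d n \<le> enrg p v {0..}" if "v \<in> K n" for n v
    unfolding d_def using that by (intro cINF_lower bdd) auto
  have dC: "d n \<le> C" for n
  proof (rule tendsto_lowerbound[OF c])
    show "\<forall>\<^sub>F m in sequentially. d n \<le> c m"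
      using ev[of n] by eventually_elim (use dle wc order.trans in blast)
  qed simp
  have dmono: "incseq d"
    unfolding incseq_def d_def using Kmono bdd Kne by (intro allI impI cINF_superset_mono) auto
  then obtain D where D: "d \<longlonglongrightarrow> D" "\<And>n. d n \<le> D"
    using incseq_convergent[OF dmono, of C] dC by metis
  have DC: "D \<le> C" using D(1) dC by (intro LIMSEQ_le_const2) auto
  have "\<exists>v\<in>K n. enrg p v {0..} < d n + 1 / Suc n" for n
    using cInf_lessD[of "(\<lambda>v. enrg p v {0..}) ` K n" "d n + 1 / Suc n"] Kne[of n] by (auto simp: d_def)
  then obtain v where v: "\<And>n. v n \<in> K n" "\<And>n. enrg p (v n) {0..} < d n + 1 / Suc n" by metis
  have vLp: "Lp p (v n)" for n using v(1)[of n] by (simp add: K_def)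
  have claw: "2 * enrg p (\<lambda>s. (x s + y s) / 2) {0..} + 2 * enrg p (\<lambda>s. (x s - y s) / 2) {0..} \<le> enrg p x {0..} + enrg p y {0..}"
    if "Lp p x" "Lp p y" for x y
  proof -
    have L: "Lp p (\<lambda>s. (x s + y s) / 2)" "Lp p (\<lambda>s. (x s - y s) / 2)"
      using Lp_scale[OF Lp_add[OF that], of "1/2"] Lp_scale[OF Lp_diff[OF that], of "1/2"] p by auto
    have "enrg p (\<lambda>s. (x s + y s) / 2) {0..} + enrg p (\<lambda>s. (x s - y s) / 2) {0..} =
      (LINT s:{0..}|lborel. \<bar>(x s + y s) / 2\<bar> powr p + \<bar>(x s - y s) / 2\<bar> powr p)"
      unfolding enrg_def using L by (intro set_integral_add(2)[symmetric]) (auto simp: Lp_def)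
    also have "\<dots> \<le> (LINT s:{0..}|lborel. (\<bar>x s\<bar> powr p + \<bar>y s\<bar> powr p) / 2)"
      using L that clarkson[OF p] by (intro set_integral_mono set_integral_add set_integrable_divide) (auto simp: Lp_def)
    also have "\<dots> = (enrg p x {0..} + enrg p y {0..}) / 2"
      unfolding enrg_def using that by (simp add: set_integral_add Lp_def)
    finally show ?thesis by (simp add: field_simps)
  qed
  have mid: "(\<lambda>s. (x s + y s) / 2) \<in> K n" if "x \<in> K n" "y \<in> K n" for x y n
  proof -
    have xy: "Lp p x" "Lp p y" using that by (auto simp: K_def)
    have L: "Lp p (\<lambda>s. (x s + y s) / 2)"
      using Lp_scale[OF Lp_add[OF xy], of "1/2"] p by auto
    have P: "prim (\<lambda>s. (x s + y s) / 2) t = (prim x t + prim y t) / 2" for t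
      using prim_scale[of "1/2" "\<lambda>s. x s + y s" t] prim_add[OF xy, of t] p by simp
    have "\<bar>prim (\<lambda>s. (x s + y s) / 2) (r i) - b (r i)\<bar> \<le> 1 / Suc n" if "i \<le> n" for i
    proof -
      have "\<bar>prim x (r i) - b (r i)\<bar> \<le> 1 / Suc n" "\<bar>prim y (r i) - b (r i)\<bar> \<le> 1 / Suc n"
        using \<open>x \<in> K n\<close> \<open>y \<in> K n\<close> that by (auto simp: K_def)
      moreover have "\<bar>(x' + y') / 2 - z\<bar> \<le> e" if "\<bar>x' - z\<bar> \<le> e" "\<bar>y' - z\<bar> \<le> e" for x' y' z e :: real
        using that by (simp add: abs_le_iff field_simps)
      ultimately show ?thesis unfolding P by blast
    qed
    then show ?thesis using L by (simp add: K_def)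
  qed
  \<comment> \<open>The midpoint of two near-minimisers stays in the convex set \<open>K k\<close>,
    so its energy is at least \<open>d k\<close>; Clarkson's inequality leaves little for the half
    difference.\<close>
  have cau: "enrg p (\<lambda>s. v m s - v n s) {0..} \<le> 2 powr p * (D - d k + 1 / Suc k)" if "k \<le> m" "k \<le> n" for k m n
  proof -
    have "d k \<le> enrg p (\<lambda>s. (v m s + v n s) / 2) {0..}"
      using v(1) Kmono that by (intro dle mid) auto
    moreover have "1 / Suc m \<le> 1 / Suc k" "1 / Suc n \<le> 1 / Suc k"
      using that by (auto intro!: divide_left_mono)
    ultimately have "enrg p (\<lambda>s. (v m s - v n s) / 2) {0..} \<le> D - d k + 1 / Suc k"
      using claw[OF vLp[of m] vLp[of n]] v(2)[of m] v(2)[of n] D(2)[of m] D(2)[of n] by linarith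
    moreover have "enrg p (\<lambda>s. v m s - v n s) {0..} = 2 powr p * enrg p (\<lambda>s. (v m s - v n s) / 2) {0..}"
      using enrg_scale[of p 2 "\<lambda>s. (v m s - v n s) / 2" "{0..}"]
      by (simp only: times_divide_eq_right nonzero_mult_div_cancel_left[OF zero_neq_numeral[symmetric]] abs_numeral)
    ultimately show ?thesis by (simp add: mult_left_mono)
  qed
  have lim0: "(\<lambda>k. 2 powr p * (D - d k + 1 / Suc k)) \<longlonglongrightarrow> 2 powr p * (D - D + 0)"
    by (intro tendsto_intros D LIMSEQ_Suc[OF lim_1_over_n])
  have cau': "\<exists>K. \<forall>m\<ge>K. \<forall>n\<ge>K. enrg p (\<lambda>s. v m s - v n s) {0..} < e" if "e > 0" for e
  proof -
    have "\<forall>\<^sub>F k in sequentially. 2 powr p * (D - d k + 1 / Suc k) < e"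
      using order_tendstoD(2)[OF lim0, of e] that by simp
    then obtain k where "2 powr p * (D - d k + 1 / Suc k) < e" by (auto simp: eventually_sequentially)
    then show ?thesis using cau by (intro exI[of _ k]) (meson le_less_trans)
  qed
  have p1: "p \<ge> 1" using p by simp
  obtain u where u: "Lp p u" "(\<lambda>n. enrg p (\<lambda>s. v n s - u s) {0..}) \<longlonglongrightarrow> 0"
    "\<And>C. \<forall>\<^sub>F n in sequentially. enrg p (v n) {0..} \<le> C \<Longrightarrow> enrg p u {0..} \<le> C"
    by (rule Lp_complete[OF p1 vLp cau'], assumption, rule that)
  have "enrg p u {0..} \<le> C + e" if "e > 0" for e
  proof (rule u(3))
    have "\<forall>\<^sub>F n in sequentially. 1 / Suc n < e"
      using order_tendstoD(2)[OF LIMSEQ_Suc[OF lim_1_over_n], of e] that by simp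
    then show "\<forall>\<^sub>F n in sequentially. enrg p (v n) {0..} \<le> C + e"
      by eventually_elim (use v(2) dC in \<open>smt (verit)\<close>)
  qed
  then have uC: "enrg p u {0..} \<le> C" by (rule field_le_epsilon)
  have pr: "prim u (r i) = b (r i)" for i
  proof -
    have "(\<lambda>n. prim (v n) (r i)) \<longlonglongrightarrow> b (r i)"
    proof (rule LIM_zero_cancel, rule Lim_null_comparison)
      show "\<forall>\<^sub>F n in sequentially. norm (prim (v n) (r i) - b (r i)) \<le> 1 / Suc n"
        using v(1) by (intro eventually_sequentiallyI[of i]) (auto simp: K_def)
      show "(\<lambda>n. 1 / real (Suc n)) \<longlonglongrightarrow> 0" by (rule LIMSEQ_Suc[OF lim_1_over_n])
    qed
    moreover have "(\<lambda>n. prim (v n) (r i)) \<longlonglongrightarrow> prim u (r i)"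
    proof (rule LIM_zero_cancel, rule Lim_null_comparison)
      show "\<forall>\<^sub>F n in sequentially. norm (prim (v n) (r i) - prim u (r i)) \<le>
         r i powr ((p - 1) / p) * enrg p (\<lambda>s. v n s - u s) {0..} powr (1 / p)"
        using prim_holder'[OF Lp_diff[OF vLp u(1)], of 0 "r i"] prim_diff_fun[OF vLp u(1)] r0[of i] p by simp
      show "(\<lambda>n. r i powr ((p - 1) / p) * enrg p (\<lambda>s. v n s - u s) {0..} powr (1 / p)) \<longlonglongrightarrow> 0"
        using u(2) p by (auto intro!: tendsto_eq_intros tendsto_powr2 simp: )
    qed
    ultimately show ?thesis using LIMSEQ_unique by blast
  qed
  have "prim u s = b s" if s: "s \<ge> 0" for s
  proof (rule ccontr)
    define h where "h s = prim u s - b s" for s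
    assume "prim u s \<noteq> b s"
    then have hs: "\<bar>h s\<bar> > 0" by (simp add: h_def)
    have "continuous_on {0..} h" unfolding h_def
      using prim_continuous[OF u(1)] p b by (intro continuous_intros) auto
    then obtain e where e: "e > 0" "\<And>x. x \<ge> 0 \<Longrightarrow> dist x s < e \<Longrightarrow> dist (h x) (h s) < \<bar>h s\<bar>"
      using s hs unfolding continuous_on_iff by (metis atLeast_iff)
    obtain x where x: "x \<in> \<rat>" "s < x" "x < s + e" using Rats_dense_in_real[of s "s + e"] e(1) by auto
    then obtain i where "x = r i" using r s by (metis IntI atLeast_iff image_iff le_less_trans less_imp_le rangeE)
    then have "h x = 0" using pr by (simp add: h_def)
    then show False using e(2)[of x] x s by (auto simp: dist_real_def)
  qed
  then show ?thesis using that u(1) uC by blast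
qed

section \<open>The linearised inner problem\<close>

lemma set_integrable_bounded_limit:
  fixes f :: "real \<Rightarrow> real"
  assumes "\<And>T. 0 \<le> T \<Longrightarrow> set_integrable lborel {0..T} f" "\<And>x. 0 \<le> x \<Longrightarrow> 0 \<le> f x"
    "\<And>T. 0 \<le> T \<Longrightarrow> (LINT x:{0..T}|lborel. f x) \<le> B"
  shows "set_integrable lborel {0..} f" "(LINT x:{0..}|lborel. f x) \<le> B"
proof -
  have mono: "incseq (\<lambda>n. LINT x:{0..real n}|lborel. f x)"
  proof (rule incseq_SucI)
    fix n
    have "(LINT x:{0..real (Suc n)}|lborel. f x) = (LINT x:{0..real n}|lborel. f x) + (LINT x:{real n..real (Suc n)}|lborel. f x)"
      using assms(1)[of "real (Suc n)"] by (intro set_integral_split) auto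
    moreover have "0 \<le> (LINT x:{real n..real (Suc n)}|lborel. f x)"
      unfolding set_lebesgue_integral_def using assms(2) by (intro integral_nonneg_AE) (auto simp: indicator_def)
    ultimately show "(LINT x:{0..real n}|lborel. f x) \<le> (LINT x:{0..real (Suc n)}|lborel. f x)" by linarith
  qed
  then obtain l where l: "(\<lambda>n. LINT x:{0..real n}|lborel. f x) \<longlonglongrightarrow> l"
    using incseq_convergent[OF mono, of B] assms(3) by (metis of_nat_0_le_iff)
  have U: "(\<Union>n. {0..real n}) = {0..}" using real_arch_simple by auto
  have "set_integrable lborel (\<Union>n. {0..real n}) f"
    using assms(1,2) l by (intro pos_integrable_to_top) (auto simp: mono_def)
  then show i: "set_integrable lborel {0..} f" by (simp add: U)
  have "((\<lambda>T. LINT x:{0..T}|lborel. f x) \<longlongrightarrow> (LINT x:{0..}|lborel. f x)) at_top"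
    using i by (intro tendsto_set_lebesgue_integral_at_top) auto
  then show "(LINT x:{0..}|lborel. f x) \<le> B"
    by (rule tendsto_upperbound) (use assms(3) in \<open>auto intro: eventually_mono[OF eventually_ge_at_top[of 0]]\<close>)
qed

lemma FTC_atLeast_nonneg:
  fixes f F :: "real \<Rightarrow> real"
  assumes "f \<in> borel_measurable borel" "\<And>x. a \<le> x \<Longrightarrow> DERIV F x :> f x" "\<And>x. a \<le> x \<Longrightarrow> 0 \<le> f x" "(F \<longlongrightarrow> T) at_top"
  shows "set_integrable lborel {a..} f" "(LINT x:{a..}|lborel. f x) = T - F a"
proof -
  have le: "F a \<le> T"
  proof (rule tendsto_lowerbound[OF assms(4)])
    show "\<forall>\<^sub>F x in at_top. F a \<le> F x"
      using eventually_ge_at_top[of a]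
    proof eventually_elim
      fix x assume "a \<le> x"
      then show "F a \<le> F x"
        by (rule DERIV_nonneg_imp_nondecreasing) (use assms(2,3) in blast)
    qed
  qed simp
  have *: "(\<integral>\<^sup>+x. ennreal (indicator {a..} x * f x) \<partial>lborel) = ennreal (T - F a)"
    using nn_integral_FTC_atLeast[OF assms]
    by (auto simp: nn_integral_set_ennreal mult.commute)
  have nn: "AE x in lborel. 0 \<le> indicator {a..} x * f x" using assms(3) by (auto simp: indicator_def)
  have i: "integrable lborel (\<lambda>x. indicator {a..} x * f x)"
    using assms(1) * nn by (intro integrableI_nonneg) auto
  then show "set_integrable lborel {a..} f" by (simp add: set_integrable_def)
  have "(\<integral>x. indicator {a..} x * f x \<partial>lborel) = T - F a"
    using nn_integral_eq_integral[OF i nn] * le integral_nonneg_AE[OF nn] by simp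
  then show "(LINT x:{a..}|lborel. f x) = T - F a" by (simp add: set_lebesgue_integral_def)
qed

section \<open>The cost function of the inner problem and its constant\<close>

definition Lden :: "real \<Rightarrow> real \<Rightarrow> real" where
  "Lden p x = max 0 (x - 1) powr (p - 1) * x powr (- p)"

text \<open>The density vanishes to the left of 1, so this is the integral from 1. The base point
  1/2 makes it differentiable at 1 as well, a value that the cost-to-go attains.\<close>

definition Lfun :: "real \<Rightarrow> real \<Rightarrow> real" where
  "Lfun p v = integral {1/2..v} (Lden p)"

text \<open>The substitution t = 1 - 1/x turns this into the integral over [0,1] of
  \<open>(1 - t powr (p - 1)) / (1 - t)\<close>, the harmonic number of \<open>p - 1\<close>. The
  supremum is a limit, because the difference increases with \<open>v\<close>.\<close>

definition cst :: "real \<Rightarrow> real" where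
  "cst p = (SUP v\<in>{1..}. ln v - Lfun p v)"

lemma Lden_cont: "p > 1 \<Longrightarrow> continuous_on {1/2..v} (Lden p)"
  unfolding Lden_def by (intro continuous_intros continuous_on_powr') auto

lemma Lfun_deriv:
  assumes "p > 1" "v > 1/2"
  shows "(Lfun p has_real_derivative Lden p v) (at v)"
proof -
  have "(Lfun p has_real_derivative Lden p v) (at v within {1/2..v+1})"
    unfolding Lfun_def using assms by (intro integral_has_real_derivative Lden_cont) auto
  then show ?thesis using assms by (simp add: at_within_Icc_at)
qed

lemma Lfun_cont: "p > 1 \<Longrightarrow> continuous_on {1..} (Lfun p)"
  by (rule DERIV_continuous_on, rule has_field_derivative_at_within, rule Lfun_deriv) auto

lemma Lfun_1 [simp]: "Lfun p 1 = 0"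
proof -
  have "integral {1/2..1} (Lden p) = integral {1/2..1::real} (\<lambda>x. 0::real)"
    by (intro integral_cong) (auto simp: Lden_def)
  then show ?thesis by (simp add: Lfun_def)
qed

lemma Lden_nonneg [simp]: "0 \<le> Lden p x" by (simp add: Lden_def)

text \<open>With \<open>Lden p x = (1 - 1/x) powr (p - 1) / x\<close> these are monotonicity and
  Bernoulli's inequality for the exponent \<open>p - 1 \<ge> 1\<close>; the tangent lemma needs an
  exponent above 1, so \<open>p = 2\<close> is separate.\<close>

lemma Lden_le:
  assumes "p \<ge> 2" "x \<ge> 1"
  shows "Lden p x \<le> 1 / x" "1 / x - (p - 1) / x\<^sup>2 \<le> Lden p x"
proof -
  have e: "Lden p x = (1 - 1/x) powr (p - 1) / x"
  proof -
    have "(1 - 1/x) powr (p - 1) = (x - 1) powr (p - 1) / x powr (p - 1)"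
      using assms by (simp add: powr_divide[symmetric] diff_divide_distrib)
    moreover have "x powr p = x * x powr (p - 1)" using powr_mult_base[of x "p - 1"] assms by simp
    ultimately show ?thesis using assms by (simp add: Lden_def powr_minus divide_inverse)
  qed
  have "(1 - 1/x) powr (p - 1) \<le> 1 powr (p - 1)" using assms by (intro powr_mono2) auto
  then show "Lden p x \<le> 1 / x" unfolding e using assms by (intro divide_right_mono) auto
  have "1 - (p - 1) / x \<le> (1 - 1/x) powr (p - 1)"
  proof (cases "p = 2")
    case False
    have "1 powr (p - 1) + (p - 1) * 1 powr (p - 1 - 1) * ((1 - 1/x) - 1) \<le> (1 - 1/x) powr (p - 1)"
      using assms False by (intro powr_tangent) auto
    then show ?thesis by (simp add: field_simps)
  qed (use assms in auto)
  then have "(1 - (p - 1) / x) / x \<le> Lden p x" unfolding e using assms by (intro divide_right_mono) auto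
  then show "1 / x - (p - 1) / x\<^sup>2 \<le> Lden p x" using assms by (simp add: diff_divide_distrib power2_eq_square)
qed

text \<open>\<open>ln v - Lfun p v\<close> increases and becomes decreasing after adding
  \<open>(p - 1) / v\<close>, which encloses its limit. The remainder is exponentially small in the
  cost, as \<open>v\<close> grows like the exponential of \<open>Lfun p v\<close>.\<close>

lemma cst_bounds:
  assumes p: "p \<ge> 2" and v: "v \<ge> 1"
  shows "ln v - Lfun p v \<le> cst p" "cst p \<le> ln v - Lfun p v + (p - 1) / v"
proof -
  have inc: "ln x - Lfun p x \<le> ln y - Lfun p y" if "1 \<le> x" "x \<le> y" for x y
  proof (rule DERIV_nonneg_imp_nondecreasing[OF that(2)])
    fix t assume t: "x \<le> t" "t \<le> y"
    have "((\<lambda>x. ln x - Lfun p x) has_real_derivative (1/t - Lden p t)) (at t)"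
      using t that p by (auto intro!: derivative_eq_intros Lfun_deriv)
    moreover have "0 \<le> 1/t - Lden p t" using Lden_le(1)[of p t] p t that by simp
    ultimately show "\<exists>y. ((\<lambda>x. ln x - Lfun p x) has_real_derivative y) (at t) \<and> 0 \<le> y" by blast
  qed
  have dec: "ln y - Lfun p y + (p - 1) / y \<le> ln x - Lfun p x + (p - 1) / x" if "1 \<le> x" "x \<le> y" for x y
  proof (rule DERIV_nonpos_imp_nonincreasing[OF that(2)])
    fix t assume t: "x \<le> t" "t \<le> y"
    have "((\<lambda>x. ln x - Lfun p x + (p - 1) / x) has_real_derivative (1/t - Lden p t - (p - 1) / t\<^sup>2)) (at t)"
      using t that p by (auto intro!: derivative_eq_intros Lfun_deriv simp: power2_eq_square minus_divide_left)
    moreover have "1/t - Lden p t - (p - 1) / t\<^sup>2 \<le> 0" using Lden_le(2)[of p t] p t that by simp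
    ultimately show "\<exists>y. ((\<lambda>x. ln x - Lfun p x + (p - 1) / x) has_real_derivative y) (at t) \<and> y \<le> 0" by blast
  qed
  have ub: "ln y - Lfun p y \<le> ln v - Lfun p v + (p - 1) / v" if "y \<ge> 1" for y
  proof (cases "y \<le> v")
    case True
    then show ?thesis using inc[OF that True] p v by (smt (verit) divide_nonneg_pos)
  next
    case False
    then have "ln y - Lfun p y + (p - 1) / y \<le> ln v - Lfun p v + (p - 1) / v" using v by (intro dec) auto
    moreover have "0 \<le> (p - 1) / y" using p that by simp
    ultimately show ?thesis by linarith
  qed
  have bdd: "bdd_above ((\<lambda>v. ln v - Lfun p v) ` {1..})" using ub by (intro bdd_aboveI2) auto
  show "ln v - Lfun p v \<le> cst p" unfolding cst_def using v by (intro cSUP_upper bdd) auto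
  show "cst p \<le> ln v - Lfun p v + (p - 1) / v" unfolding cst_def using ub by (intro cSUP_least) auto
qed

lemma Lfun_surj:
  assumes "p \<ge> 2" "\<sigma> \<ge> 0"
  obtains v where "v \<ge> 1" "Lfun p v = \<sigma>"
proof -
  \<comment> \<open>Finiteness of \<open>cst p\<close> guarantees that the cost at this point is
    already at least \<sigma>.\<close>
  define V where "V = exp (\<sigma> + \<bar>cst p\<bar>)"
  have V: "V \<ge> 1" using assms by (simp add: V_def)
  have "ln V - Lfun p V \<le> cst p" using cst_bounds(1)[OF assms(1) V] .
  then have "\<sigma> \<le> Lfun p V" by (simp add: V_def)
  moreover have "continuous_on {1..V} (Lfun p)"
    using assms by (intro continuous_on_subset[OF Lfun_cont]) auto
  ultimately obtain v where "1 \<le> v" "v \<le> V" "Lfun p v = \<sigma>"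
    using IVT'[of "Lfun p" 1 \<sigma> V] V assms by auto
  then show ?thesis using that by blast
qed

section \<open>The Bellman inequality for the linearised exponent\<close>

lemma young_scaled:
  fixes p c \<kappa> w x :: real
  assumes "p > 1" "c > 0" "\<kappa> > 0" "w \<ge> 0" "x \<ge> 0"
  shows "c * w * x powr (p - 1) \<le> \<kappa> * x powr p + c powr p / (p * (p / (p - 1) * \<kappa>) powr (p - 1)) * w powr p"
proof (cases "x = 0")
  case False
  define a where "a = p / (p - 1) * \<kappa>"
  have a: "a > 0" using assms by (simp add: a_def)
  define A where "A = c powr p / (p * a powr (p - 1))"
  have A: "A > 0" using assms a by (simp add: A_def)
  \<comment> \<open>The value of \<open>w\<close> for which the inequality becomes an equality; the
    tangent of \<open>powr p\<close> is taken there.\<close>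
  define m where "m = a * x / c"
  have m: "m > 0" using a assms False by (simp add: m_def)
  have "A * (m powr p + p * m powr (p - 1) * (w - m)) \<le> A * w powr p"
    using A assms m by (intro mult_left_mono powr_tangent) auto
  moreover have h1: "A * (p * m powr (p - 1)) = c * x powr (p - 1)"
  proof -
    have "m powr (p - 1) = a powr (p - 1) * x powr (p - 1) / c powr (p - 1)"
      using a assms by (simp add: m_def powr_mult powr_divide)
    moreover have "c powr p = c * c powr (p - 1)" using assms by (simp add: powr_mult_base)
    ultimately show ?thesis using assms a by (simp add: A_def field_simps)
  qed
  moreover have "A * (m powr p) * (p - 1) = \<kappa> * x powr p"
  proof -
    have "m powr p = m * m powr (p - 1)" using m by (simp add: powr_mult_base)
    then have "A * (m powr p) * p = m * (A * (p * m powr (p - 1)))" by simp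
    also have "\<dots> = m * (c * x powr (p - 1))" by (simp only: h1)
    also have "\<dots> = a * x powr p"
      using assms powr_mult_base[of x "p - 1"] by (simp add: m_def)
    finally have "A * (m powr p) * p * (p - 1) = a * x powr p * (p - 1)" by simp
    also have "a * x powr p * (p - 1) = p * (\<kappa> * x powr p)" using assms by (simp add: a_def field_simps)
    finally show ?thesis using assms by simp
  qed
  moreover have "A * (m powr p + p * m powr (p - 1) * (w - m)) = A * m powr p + A * (p * m powr (p - 1)) * (w - m)"
    by (simp add: algebra_simps)
  moreover have "A * (p * m powr (p - 1)) * m = A * m powr p * p"
    using m powr_mult_base[of m "p - 1"] by (simp add: mult_ac)
  ultimately have "A * m powr p + c * x powr (p - 1) * w - A * m powr p * p \<le> A * w powr p"
    by (simp add: right_diff_distrib)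
  moreover have "A * m powr p * p - A * m powr p = \<kappa> * x powr p"
    using \<open>A * (m powr p) * (p - 1) = \<kappa> * x powr p\<close> by (simp add: algebra_simps)
  ultimately show ?thesis unfolding A_def a_def by (simp add: mult_ac)
qed (use assms in auto)

text \<open>For \<open>c = \<kappa> = 1\<close> and \<open>q = p / (p - 1)\<close>, \<open>p * q powr (p - 1) * Lfun p (I t)\<close> with the cost-to-go \<open>I t\<close> decreases at most
  at the rate \<open>w t powr p\<close>, by Young's inequality.\<close>
lemma linear_bound_continuous:
  fixes p c \<kappa> T :: real and w :: "real \<Rightarrow> real"
  assumes p: "p \<ge> 2" and c: "c > 0" "\<kappa> > 0" "T > 0" and w: "continuous_on {0..T} w" "\<And>s. s \<in> {0..T} \<Longrightarrow> w s \<ge> 0"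
  shows "\<kappa> * integral {0..T} (\<lambda>t. exp (c * integral {0..t} w - \<kappa> * t))
    \<le> exp (cst p + c powr p / (p * (p / (p - 1) * \<kappa>) powr (p - 1)) * integral {0..T} (\<lambda>t. w t powr p))"
proof -
  define A where "A = c powr p / (p * (p / (p - 1) * \<kappa>) powr (p - 1))"
  define z where "z t = integral {0..t} w" for t
  define f where "f t = \<kappa> * exp (c * z t - \<kappa> * t)" for t
  define P where "P t = integral {0..t} f" for t
  \<comment> \<open>The cost-to-go when \<open>w\<close> is continued by zero beyond
    \<open>T\<close>: the last summand is the integral of
    \<open>\<kappa> * exp (c * z T - \<kappa> * s)\<close> over \<open>s \<ge> T\<close>. It makes
    \<open>I T = 1\<close>, where \<open>Lfun\<close> vanishes.\<close>
  define I where "I t = exp (\<kappa> * t - c * z t) * (P T - P t + exp (c * z T - \<kappa> * T))" for t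
  define E where "E t = integral {0..t} (\<lambda>t. w t powr p)" for t
  have zd: "(z has_real_derivative w t) (at t within {0..T})" if "t \<in> {0..T}" for t
    unfolding z_def using w that by (intro integral_has_real_derivative) auto
  have zc: "continuous_on {0..T} z" using zd by (rule DERIV_continuous_on)
  have fc: "continuous_on {0..T} f" unfolding f_def by (intro continuous_intros zc)
  have Pd: "(P has_real_derivative f t) (at t within {0..T})" if "t \<in> {0..T}" for t
    unfolding P_def using fc that by (intro integral_has_real_derivative) auto
  have Pc: "continuous_on {0..T} P" using Pd by (rule DERIV_continuous_on)
  have wpc: "continuous_on {0..T} (\<lambda>t. w t powr p)"
    using w p by (intro continuous_on_powr' continuous_intros) auto
  have Ed: "(E has_real_derivative w t powr p) (at t within {0..T})" if "t \<in> {0..T}" for t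
    unfolding E_def using wpc that by (intro integral_has_real_derivative) auto
  have Ec: "continuous_on {0..T} E" using Ed by (rule DERIV_continuous_on)
  have Ic: "continuous_on {0..T} I" unfolding I_def by (intro continuous_intros zc Pc)
  have Id: "(I has_real_derivative ((\<kappa> - c * w t) * I t - \<kappa>)) (at t within {0..T})" if "t \<in> {0..T}" for t
  proof -
    have "exp (\<kappa> * t - c * z t) * f t = \<kappa>"
      by (simp add: f_def mult_exp_exp mult.left_commute)
    then show ?thesis unfolding I_def
      by (auto intro!: derivative_eq_intros zd[OF that] Pd[OF that] simp: algebra_simps)
  qed
  have zmono: "z s \<le> z t" if "0 \<le> s" "s \<le> t" "t \<le> T" for s t
    unfolding z_def using that w
    by (intro integral_subset_le integrable_continuous_interval continuous_on_subset[OF w(1)]) auto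
  \<comment> \<open>Freezing the nondecreasing \<open>z\<close> at its value at \<open>t\<close>
    lowers the integrand and turns the normalised tail into exactly 1.\<close>
  have I1: "I t \<ge> 1" if t: "t \<in> {0..T}" for t
  proof -
    have "f integrable_on {0..T}" using fc by (rule integrable_continuous_interval)
    then have "P T - P t = integral {t..T} f"
      unfolding P_def using t Henstock_Kurzweil_Integration.integral_combine[OF _ _ \<open>f integrable_on {0..T}\<close>, of t] by auto
    also have "\<dots> \<ge> integral {t..T} (\<lambda>s. exp (c * z t) * (\<kappa> * exp (- \<kappa> * s)))"
    proof (intro integral_le integrable_continuous_interval)
      show "continuous_on {t..T} f" using fc by (rule continuous_on_subset) (use t in auto)
      fix s assume s: "s \<in> {t..T}"
      have "c * z t + - \<kappa> * s \<le> c * z s - \<kappa> * s" using zmono[of t s] s t c by simp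
      then have "exp (c * z t) * exp (- \<kappa> * s) \<le> exp (c * z s - \<kappa> * s)"
        unfolding exp_add[symmetric] exp_le_cancel_iff .
      then have "\<kappa> * (exp (c * z t) * exp (- \<kappa> * s)) \<le> \<kappa> * exp (c * z s - \<kappa> * s)"
        using c by (intro mult_left_mono) auto
      then show "exp (c * z t) * (\<kappa> * exp (- \<kappa> * s)) \<le> f s"
        by (simp add: f_def mult.left_commute)
    qed (intro continuous_intros)
    also have "integral {t..T} (\<lambda>s. exp (c * z t) * (\<kappa> * exp (- \<kappa> * s))) = exp (c * z t) * (exp (- \<kappa> * t) - exp (- \<kappa> * T))"
    proof -
      have "((\<lambda>s. \<kappa> * exp (- \<kappa> * s)) has_integral (- exp (- \<kappa> * T) - - exp (- \<kappa> * t))) {t..T}"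
        using t by (intro fundamental_theorem_of_calculus)
          (auto intro!: derivative_eq_intros simp flip: has_real_derivative_iff_has_vector_derivative)
      from integral_unique[OF has_integral_mult_right[OF this, of "exp (c * z t)"]]
      show ?thesis by simp
    qed
    finally have "exp (c * z t) * (exp (- \<kappa> * t) - exp (- \<kappa> * T)) + exp (c * z T - \<kappa> * T) \<le> P T - P t + exp (c * z T - \<kappa> * T)" by simp
    moreover have "exp (c * z t) * exp (- \<kappa> * T) \<le> exp (c * z T - \<kappa> * T)"
      unfolding exp_add[symmetric] exp_le_cancel_iff using zmono[of t T] t c by simp
    ultimately have "exp (c * z t) * exp (- \<kappa> * t) \<le> P T - P t + exp (c * z T - \<kappa> * T)"
      by (simp add: right_diff_distrib)
    then have "exp (\<kappa> * t - c * z t) * (exp (c * z t) * exp (- \<kappa> * t)) \<le> I t"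
      unfolding I_def by (intro mult_left_mono) auto
    then show ?thesis by (simp add: mult_exp_exp)
  qed
  \<comment> \<open>The right side is zero, so monotonicity in time of this difference bounds the
    initial cost-to-go by the total energy.\<close>
  have "Lfun p (I 0) - A * (E T - E 0) \<le> Lfun p (I T) - A * (E T - E T)"
  proof (rule DERIV_nonneg_imp_increasing_open[where f="\<lambda>t. Lfun p (I t) - A * (E T - E t)"])
    fix t assume t: "0 < t" "t < T"
    then have at: "at t within {0..T} = at t" by (simp add: at_within_Icc_at)
    have tt: "t \<in> {0..T}" using t by simp
    have It: "I t \<ge> 1" using I1[OF tt] .
    \<comment> \<open>In terms of this fraction the drift of \<open>Lfun p (I t)\<close> is
      \<open>x powr (p - 1) * (\<kappa> * x - c * w t)\<close>, the shape handled by
      \<open>young_scaled\<close>.\<close>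
    define x where "x = (I t - 1) / I t"
    have x: "x \<ge> 0" using It by (simp add: x_def)
    have "((\<lambda>t. Lfun p (I t)) has_real_derivative Lden p (I t) * ((\<kappa> - c * w t) * I t - \<kappa>)) (at t)"
      using It p by (intro DERIV_chain2[OF Lfun_deriv] Id[OF tt, unfolded at]) auto
    then have D: "((\<lambda>t. Lfun p (I t) - A * (E T - E t)) has_real_derivative
       (Lden p (I t) * ((\<kappa> - c * w t) * I t - \<kappa>) + A * w t powr p)) (at t)"
      by (auto intro!: derivative_eq_intros Ed[OF tt, unfolded at])
    have "Lden p (I t) = x powr (p - 1) / I t"
    proof -
      have "x powr (p - 1) = (I t - 1) powr (p - 1) / I t powr (p - 1)"
        using It by (simp add: x_def powr_divide)
      moreover have "I t powr p = I t * I t powr (p - 1)" using powr_mult_base[of "I t" "p - 1"] It by simp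
      ultimately show ?thesis using It by (simp add: Lden_def powr_minus divide_inverse)
    qed
    then have "Lden p (I t) * ((\<kappa> - c * w t) * I t - \<kappa>) = x powr (p - 1) * (\<kappa> * x - c * w t)"
      using It by (simp add: x_def field_simps)
    also have "\<dots> = \<kappa> * x powr p - c * w t * x powr (p - 1)"
      using x powr_mult_base[of x "p - 1"] by (simp add: algebra_simps)
    finally have "0 \<le> Lden p (I t) * ((\<kappa> - c * w t) * I t - \<kappa>) + A * w t powr p"
      using young_scaled[of p c \<kappa> "w t" x] p c w(2)[OF tt] x by (simp add: A_def)
    then show "\<exists>D. ((\<lambda>t. Lfun p (I t) - A * (E T - E t)) has_real_derivative D) (at t) \<and> 0 \<le> D" using D by blast
  next
    have "continuous_on {1..} (Lfun p)"
      using p by (intro Lfun_cont) auto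
    then have "continuous_on {0..T} (\<lambda>t. Lfun p (I t))"
      by (rule continuous_on_compose2[OF _ Ic]) (use I1 in auto)
    then show "continuous_on {0..T} (\<lambda>t. Lfun p (I t) - A * (E T - E t))" by (intro continuous_intros Ec)
  qed (use c in simp)
  moreover have "I T = 1" by (simp add: I_def mult_exp_exp)
  moreover have "E 0 = 0" by (simp add: E_def)
  ultimately have "Lfun p (I 0) \<le> A * E T" by simp
  moreover have "I 0 \<ge> 1" using I1[of 0] c by simp
  then have "ln (I 0) - Lfun p (I 0) \<le> cst p" by (rule cst_bounds(1)[OF p])
  ultimately have "ln (I 0) \<le> cst p + A * E T" by linarith
  then have "I 0 \<le> exp (cst p + A * E T)" using \<open>I 0 \<ge> 1\<close> by (metis exp_le_cancel_iff exp_ln less_le_trans zero_less_one)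
  moreover have "P T \<le> I 0" by (simp add: I_def P_def z_def)
  moreover have "P T = \<kappa> * integral {0..T} (\<lambda>t. exp (c * integral {0..t} w - \<kappa> * t))"
    unfolding P_def f_def z_def by simp
  ultimately show ?thesis by (simp add: A_def E_def)
qed

section \<open>From continuous to arbitrary densities by Steklov averages\<close>

lemma LINT_continuous:
  fixes f :: "real \<Rightarrow> real"
  assumes "continuous_on {a..b} f"
  shows "set_integrable lborel {a..b} f" "(LINT x:{a..b}|lborel. f x) = integral {a..b} f"
proof -
  show i: "set_integrable lborel {a..b} f" by (rule borel_integrable_atLeastAtMost'[OF assms])
  show "(LINT x:{a..b}|lborel. f x) = integral {a..b} f"
    by (rule set_borel_integral_eq_integral(2)[OF i])
qed

text \<open>The integral of the difference quotient telescopes to the mean of \<open>f\<close> over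
  [t, t+h] minus its mean over [0,h]; monotonicity compares these means with end values.\<close>

lemma steklov_bounds:
  fixes f :: "real \<Rightarrow> real"
  assumes f: "continuous_on {0..} f" "\<And>s t. 0 \<le> s \<Longrightarrow> s \<le> t \<Longrightarrow> f s \<le> f t" and h: "h > 0" "t \<ge> 0"
  shows "f t - f h \<le> integral {0..t} (\<lambda>s. (f (s + h) - f s) / h)"
    "integral {0..t} (\<lambda>s. (f (s + h) - f s) / h) \<le> f (t + h) - f 0"
proof -
  have c: "continuous_on {a..b} f" if "a \<ge> 0" for a b
    using that by (intro continuous_on_subset[OF f(1)]) auto
  have i: "f integrable_on {a..b}" if "a \<ge> 0" for a b
    using c[OF that] by (rule integrable_continuous_interval)
  have cs: "continuous_on {0..t} (\<lambda>s. f (s + h))"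
    using h by (intro continuous_on_compose2[OF f(1)] continuous_intros) auto
  have "integral {0..t} (\<lambda>s. f (s + h)) = integral {h..t + h} f"
    using integral_shift[of 0 h t f] c[of h "t + h"] h by (simp add: o_def)
  then have "integral {0..t} (\<lambda>s. f (s + h) - f s) = integral {h..t + h} f - integral {0..t} f"
    using cs c[of 0 t] by (subst integral_diff) (auto intro!: integrable_continuous_interval)
  also have "integral {h..t + h} f = integral {0..t + h} f - integral {0..h} f"
    using Henstock_Kurzweil_Integration.integral_combine[OF _ _ i[of 0 "t + h"], of h] h by simp
  also have "integral {0..t + h} f = integral {0..t} f + integral {t..t + h} f"
    using Henstock_Kurzweil_Integration.integral_combine[OF _ _ i[of 0 "t + h"], of t] h by simp
  finally have e: "integral {0..t} (\<lambda>s. f (s + h) - f s) = integral {t..t + h} f - integral {0..h} f" by simp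
  have e2: "integral {0..t} (\<lambda>s. (f (s + h) - f s) / h) = (integral {t..t + h} f - integral {0..h} f) / h"
    unfolding e[symmetric] by (rule integral_divide)
  have k: "integral {a..a + h} (\<lambda>x. y) = h * y" for a y :: real
    using h by simp
  have lo: "h * f a \<le> integral {a..a + h} f" and up: "integral {a..a + h} f \<le> h * f (a + h)" if "a \<ge> 0" for a
  proof -
    have "integral {a..a + h} (\<lambda>x. f a) \<le> integral {a..a + h} f"
      using that by (intro integral_le i f(2)) auto
    then show "h * f a \<le> integral {a..a + h} f" unfolding k .
    have "integral {a..a + h} f \<le> integral {a..a + h} (\<lambda>x. f (a + h))"
      using that by (intro integral_le i f(2)) auto
    then show "integral {a..a + h} f \<le> h * f (a + h)" unfolding k .
  qed
  have "h * f t - h * f h \<le> integral {t..t + h} f - integral {0..h} f"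
    using lo[of t] up[of 0] h by simp
  then show "f t - f h \<le> integral {0..t} (\<lambda>s. (f (s + h) - f s) / h)"
    unfolding e2 using h by (simp add: field_simps)
  have "integral {t..t + h} f - integral {0..h} f \<le> h * f (t + h) - h * f 0"
    using up[of t] lo[of 0] h by simp
  then show "integral {0..t} (\<lambda>s. (f (s + h) - f s) / h) \<le> f (t + h) - f 0"
    unfolding e2 using h by (simp add: field_simps)
qed

lemma enrg_continuous:
  assumes "Lp p w"
  shows "continuous_on {0..} (\<lambda>t. enrg p w {0..t})"
proof -
  let ?f = "\<lambda>s. \<bar>w s\<bar> powr p"
  have i: "set_integrable lborel {0..s} ?f" for s using Lp_set_integrable[OF assms, of "{0..s}"] by simp
  have "continuous_on {0..t} (\<lambda>s. enrg p w {0..s})" for t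
  proof -
    have "continuous_on {0..t} (\<lambda>s. integral {0..s} ?f)"
      using set_borel_integral_eq_integral(1)[OF i] by (intro indefinite_integral_continuous_1)
    then show ?thesis using set_borel_integral_eq_integral(2)[OF i] by (simp add: enrg_def)
  qed
  note c = this
  show ?thesis
    unfolding continuous_on_eq_continuous_within
  proof
    fix t :: real assume t: "t \<in> {0..}"
    have "continuous (at t within {0..t+1}) (\<lambda>s. enrg p w {0..s})"
      using c[of "t + 1"] t by (simp add: continuous_on_eq_continuous_within)
    moreover have "at t within {0..t+1} = at t within {0..}"
      by (rule at_within_nhd[of _ "{..<t+1}"]) auto
    ultimately show "continuous (at t within {0..}) (\<lambda>t. enrg p w {0..t})" by simp
  qed
qed

text \<open>Replace \<open>w\<close> by the difference quotient \<open>v\<close> of its primitive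
  \<open>z\<close> with step \<open>h\<close>. It is continuous, has no more energy by Hoelder's
  inequality, and its own primitive falls short of \<open>z\<close> by at most \<open>z h\<close>;
  the resulting factor \<open>exp (c * z h)\<close> tends to 1.\<close>

lemma linear_bound:
  assumes p: "p \<ge> 2" and w: "Lp p w" "\<And>s. w s \<ge> 0" and c: "c > 0" "\<kappa> > 0"
  shows "set_integrable lborel {0..} (\<lambda>s. exp (c * prim w s - \<kappa> * s))"
    "\<kappa> * (LINT s:{0..}|lborel. exp (c * prim w s - \<kappa> * s))
      \<le> exp (cst p + c powr p / (p * (p / (p - 1) * \<kappa>) powr (p - 1)) * enrg p w {0..})"
proof -
  define A where "A = c powr p / (p * (p / (p - 1) * \<kappa>) powr (p - 1))"
  have A: "A \<ge> 0" using p c by (simp add: A_def)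
  define z where "z = prim w"
  have zc: "continuous_on {0..} z" unfolding z_def using p by (intro prim_continuous[OF w(1)]) auto
  have zm: "z s \<le> z t" if "0 \<le> s" "s \<le> t" for s t
    unfolding z_def using p that w(2) by (intro prim_mono[OF w(1)]) auto
  have ec: "continuous_on {0..T} (\<lambda>s. exp (c * z s - \<kappa> * s))" for T
    by (intro continuous_intros continuous_on_subset[OF zc]) auto
  define B where "B = exp (cst p + A * enrg p w {0..})"
  have main: "\<kappa> * integral {0..T} (\<lambda>s. exp (c * z s - \<kappa> * s)) \<le> exp (c * z h) * B" if T: "T > 0" and h: "h > 0" for T h
  proof -
    define v where "v s = (z (s + h) - z s) / h" for s
    have vc: "continuous_on {0..T} v"
      unfolding v_def using h
      by (intro continuous_intros continuous_on_compose2[OF zc] continuous_on_subset[OF zc]) auto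
    have v0: "v s \<ge> 0" if "s \<in> {0..T}" for s
      unfolding v_def using that h zm[of s "s + h"] by simp
    \<comment> \<open>Hoelder's inequality on [s, s+h] bounds \<open>v s powr p\<close> by the
      difference quotient of the accumulated energy, whose integral telescopes again.\<close>
    have vp: "integral {0..T} (\<lambda>t. v t powr p) \<le> enrg p w {0..}"
    proof -
      let ?E = "\<lambda>t. enrg p w {0..t}"
      have Em: "?E s \<le> ?E t" if "0 \<le> s" "s \<le> t" for s t
        using that w by (intro enrg_mono) auto
      have "integral {0..T} (\<lambda>t. v t powr p) \<le> integral {0..T} (\<lambda>s. (?E (s + h) - ?E s) / h)"
      proof (intro integral_le integrable_continuous_interval)
        show "continuous_on {0..T} (\<lambda>t. v t powr p)"
          using vc v0 p by (intro continuous_on_powr' continuous_intros) auto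
        show "continuous_on {0..T} (\<lambda>s. (?E (s + h) - ?E s) / h)"
          using h by (intro continuous_intros continuous_on_compose2[OF enrg_continuous[OF w(1)]] continuous_on_subset[OF enrg_continuous[OF w(1)]]) auto
        fix s assume s: "s \<in> {0..T}"
        have "?E (s + h) = ?E s + enrg p w {s..s + h}"
          unfolding enrg_def using s h w(1) by (intro set_integral_split Lp_set_integrable) auto
        then have "\<bar>z (s + h) - z s\<bar> powr p \<le> h powr (p - 1) * (?E (s + h) - ?E s)"
          unfolding z_def using prim_holder[of p w s "s + h"] s h p w(1) by simp
        then have "\<bar>z (s + h) - z s\<bar> powr p / h powr p \<le> h powr (p - 1) * (?E (s + h) - ?E s) / h powr p"
          using h by (intro divide_right_mono) auto
        moreover have "h powr p = h * h powr (p - 1)" using powr_mult_base[of h "p - 1"] h by simp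
        moreover have "v s powr p = \<bar>z (s + h) - z s\<bar> powr p / h powr p"
          unfolding v_def using zm[of s "s + h"] s h by (simp add: powr_divide)
        ultimately show "v s powr p \<le> (?E (s + h) - ?E s) / h" using h by simp
      qed
      also have "\<dots> \<le> ?E (T + h) - ?E 0"
        using T h Em enrg_continuous[OF w(1)] by (intro steklov_bounds) auto
      also have "\<dots> \<le> enrg p w {0..}"
        using enrg_mono[OF w(1), of "{0..T + h}" "{0..}"] by (simp add: enrg_def)
      finally show ?thesis .
    qed
    have "integral {0..T} (\<lambda>s. exp (c * z s - \<kappa> * s)) \<le>
      integral {0..T} (\<lambda>s. exp (c * z h) * exp (c * integral {0..s} v - \<kappa> * s))"
    proof (intro integral_le integrable_continuous_interval ec)
      have "continuous_on {0..T} (\<lambda>s. integral {0..s} v)"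
        using vc by (intro indefinite_integral_continuous_1 integrable_continuous_interval)
      then show "continuous_on {0..T} (\<lambda>s. exp (c * z h) * exp (c * integral {0..s} v - \<kappa> * s))"
        by (intro continuous_intros)
      fix s assume s: "s \<in> {0..T}"
      have "z s - z h \<le> integral {0..s} v"
        unfolding v_def using s h zc zm by (intro steklov_bounds(1)) auto
      then have "c * (z s - z h) \<le> c * integral {0..s} v" using c by (intro mult_left_mono) auto
      then have "c * z s - \<kappa> * s \<le> c * z h + (c * integral {0..s} v - \<kappa> * s)"
        by (simp add: algebra_simps)
      then show "exp (c * z s - \<kappa> * s) \<le> exp (c * z h) * exp (c * integral {0..s} v - \<kappa> * s)"
        unfolding exp_add[symmetric] exp_le_cancel_iff .
    qed
    also have "\<dots> = exp (c * z h) * integral {0..T} (\<lambda>s. exp (c * integral {0..s} v - \<kappa> * s))" by simp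
    finally have "\<kappa> * integral {0..T} (\<lambda>s. exp (c * z s - \<kappa> * s)) \<le>
      exp (c * z h) * (\<kappa> * integral {0..T} (\<lambda>s. exp (c * integral {0..s} v - \<kappa> * s)))"
      using c by (simp add: mult.left_commute mult_left_mono)
    also have "\<dots> \<le> exp (c * z h) * exp (cst p + A * integral {0..T} (\<lambda>t. v t powr p))"
      unfolding A_def using p c T vc v0 by (intro mult_left_mono linear_bound_continuous) auto
    also have "\<dots> \<le> exp (c * z h) * B"
      unfolding B_def using A vp by (intro mult_left_mono) (auto intro: mult_left_mono)
    finally show ?thesis .
  qed
  have B: "\<kappa> * integral {0..T} (\<lambda>s. exp (c * z s - \<kappa> * s)) \<le> B" if T: "T > 0" for T
  proof (rule tendsto_lowerbound)
    have "(z \<longlongrightarrow> z 0) (at 0 within {0..})" using zc by (auto simp: continuous_on_def)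
    then have "(z \<longlongrightarrow> z 0) (at_right 0)" by (rule tendsto_within_subset) auto
    then have "(z \<longlongrightarrow> 0) (at_right 0)" by (simp add: z_def)
    then have "((\<lambda>h. exp (c * z h) * B) \<longlongrightarrow> exp (c * 0) * B) (at_right 0)" by (intro tendsto_intros)
    then show "((\<lambda>h. exp (c * z h) * B) \<longlongrightarrow> B) (at_right 0)" by simp
    show "\<forall>\<^sub>F h in at_right 0. \<kappa> * integral {0..T} (\<lambda>s. exp (c * z s - \<kappa> * s)) \<le> exp (c * z h) * B"
      using main[OF T] by (auto simp: eventually_at_right_field intro: exI[of _ 1])
  qed (auto simp: )
  have lint: "(LINT s:{0..T}|lborel. exp (c * z s - \<kappa> * s)) \<le> B / \<kappa>" if "T \<ge> 0" for T
  proof (cases "T = 0")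
    case False
    then show ?thesis using B[of T] that c LINT_continuous(2)[OF ec[of T]] by (simp add: field_simps)
  next
    case True
    then show ?thesis using c by (simp add: B_def)
  qed
  have "set_integrable lborel {0..} (\<lambda>s. exp (c * z s - \<kappa> * s))"
    "(LINT s:{0..}|lborel. exp (c * z s - \<kappa> * s)) \<le> B / \<kappa>"
    using lint LINT_continuous(1)[OF ec] set_integrable_bounded_limit[of "\<lambda>s. exp (c * z s - \<kappa> * s)" "B / \<kappa>"]
    by auto
  then show "set_integrable lborel {0..} (\<lambda>s. exp (c * prim w s - \<kappa> * s))"
    "\<kappa> * (LINT s:{0..}|lborel. exp (c * prim w s - \<kappa> * s))
      \<le> exp (cst p + c powr p / (p * (p / (p - 1) * \<kappa>) powr (p - 1)) * enrg p w {0..})"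
    using c unfolding z_def B_def A_def by (auto simp: field_simps)
qed

section \<open>Shifting and concatenating densities\<close>

lemma set_integral_shift:
  fixes f :: "real \<Rightarrow> real"
  assumes "\<And>x. x + a \<in> A \<longleftrightarrow> x \<in> B"
  shows "(LINT x:A|lborel. f x) = (LINT x:B|lborel. f (x + a))"
    "set_integrable lborel A f \<longleftrightarrow> set_integrable lborel B (\<lambda>x. f (x + a))"
proof -
  have e: "(\<lambda>x. indicat_real A (a + 1 * x) *\<^sub>R f (a + 1 * x)) = (\<lambda>x. indicat_real B x *\<^sub>R f (x + a))"
    using assms by (auto simp: indicator_def add.commute fun_eq_iff)
  show "(LINT x:A|lborel. f x) = (LINT x:B|lborel. f (x + a))"
    unfolding set_lebesgue_integral_def
    using lborel_integral_real_affine[of 1 "\<lambda>x. indicat_real A x *\<^sub>R f x" a] unfolding e by simp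
  show "set_integrable lborel A f \<longleftrightarrow> set_integrable lborel B (\<lambda>x. f (x + a))"
    unfolding set_integrable_def
    using lborel_integrable_real_affine_iff[of 1 "\<lambda>x. indicat_real A x *\<^sub>R f x" a] unfolding e by simp
qed

lemma Lp_shift:
  assumes "Lp p w" "a \<ge> 0"
  shows "Lp p (\<lambda>s. w (s + a))" "enrg p (\<lambda>s. w (s + a)) {0..} = enrg p w {a..}"
    "p \<ge> 1 \<Longrightarrow> s \<ge> 0 \<Longrightarrow> prim (\<lambda>s. w (s + a)) s = prim w (s + a) - prim w a"
proof -
  have [measurable]: "w \<in> borel_measurable borel" using assms by (simp add: Lp_def)
  have "set_integrable lborel {a..} (\<lambda>s. \<bar>w s\<bar> powr p)" using assms by (intro Lp_set_integrable) auto
  then show "Lp p (\<lambda>s. w (s + a))"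
    using set_integral_shift(2)[of a "{a..}" "{0..}" "\<lambda>s. \<bar>w s\<bar> powr p"] by (simp add: Lp_def)
  show "enrg p (\<lambda>s. w (s + a)) {0..} = enrg p w {a..}"
    using set_integral_shift(1)[of a "{a..}" "{0..}" "\<lambda>s. \<bar>w s\<bar> powr p"] by (simp add: enrg_def)
  show "prim (\<lambda>s. w (s + a)) s = prim w (s + a) - prim w a" if "p \<ge> 1" "s \<ge> 0"
    using set_integral_shift(1)[of a "{a..s + a}" "{0..s}" w] prim_diff[OF assms(1) that(1) assms(2), of "s + a"] that
    by (simp add: prim_def)
qed

lemma set_integral_open_closed:
  fixes f :: "real \<Rightarrow> real"
  shows "set_integrable lborel {a<..} f \<Longrightarrow> f \<in> borel_measurable borel \<Longrightarrow> set_integrable lborel {a..} f"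
    "f \<in> borel_measurable borel \<Longrightarrow> (LINT x:{a..}|lborel. f x) = (LINT x:{a<..}|lborel. f x)"
proof -
  have ae: "AE x in lborel. indicat_real {a..} x *\<^sub>R f x = indicat_real {a<..} x *\<^sub>R f x"
    using AE_lborel_singleton[of a] by eventually_elim (auto simp: indicator_def)
  show "set_integrable lborel {a..} f" if "set_integrable lborel {a<..} f" "f \<in> borel_measurable borel"
    using that ae unfolding set_integrable_def by (subst integrable_cong_AE[of _ _ "\<lambda>x. indicat_real {a<..} x *\<^sub>R f x"]) auto
  show "(LINT x:{a..}|lborel. f x) = (LINT x:{a<..}|lborel. f x)" if "f \<in> borel_measurable borel"
    unfolding set_lebesgue_integral_def using that by (intro integral_cong_AE ae) auto
qed

definition glue :: "real \<Rightarrow> (real \<Rightarrow> real) \<Rightarrow> (real \<Rightarrow> real) \<Rightarrow> real \<Rightarrow> real" where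
  "glue T v w s = (if s \<le> T then v s else w (s - T))"

lemma glue:
  assumes v: "Lp p v" and w: "Lp p w" and p: "p \<ge> 1" and T: "T \<ge> 0"
  shows "Lp p (glue T v w)" "enrg p (glue T v w) {0..T} = enrg p v {0..T}"
    "enrg p (glue T v w) {0..} = enrg p v {0..T} + enrg p w {0..}"
    "s \<le> T \<Longrightarrow> prim (glue T v w) s = prim v s"
    "T \<le> s \<Longrightarrow> prim (glue T v w) s = prim v T + prim w (s - T)"
    "T \<le> s \<Longrightarrow> enrg p (glue T v w) {0..s} = enrg p v {0..T} + enrg p w {0..s - T}"
proof -
  have [measurable]: "v \<in> borel_measurable borel" "w \<in> borel_measurable borel" using v w by (auto simp: Lp_def)
  have [measurable]: "glue T v w \<in> borel_measurable borel" unfolding glue_def by measurable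
  let ?g = "\<lambda>s. \<bar>glue T v w s\<bar> powr p"
  have i1: "set_integrable lborel {0..T} ?g"
  proof -
    have "set_integrable lborel {0..T} (\<lambda>s. \<bar>v s\<bar> powr p)" using v by (intro Lp_set_integrable) auto
    moreover have "set_integrable lborel {0..T} ?g = set_integrable lborel {0..T} (\<lambda>s. \<bar>v s\<bar> powr p)"
      by (intro set_integrable_cong) (auto simp: glue_def)
    ultimately show ?thesis by simp
  qed
  have i2: "set_integrable lborel {T<..} ?g"
  proof -
    have "set_integrable lborel {0<..} (\<lambda>s. \<bar>w s\<bar> powr p)" using w by (intro Lp_set_integrable) auto
    moreover have "set_integrable lborel {0<..} (\<lambda>s. \<bar>w s\<bar> powr p) = set_integrable lborel {T<..} (\<lambda>s. \<bar>w (s + - T)\<bar> powr p)"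
      by (rule set_integral_shift(2)) auto
    moreover have "set_integrable lborel {T<..} ?g = set_integrable lborel {T<..} (\<lambda>s. \<bar>w (s + - T)\<bar> powr p)"
      by (intro set_integrable_cong) (auto simp: glue_def)
    ultimately show ?thesis by simp
  qed
  have "{0..} = {0..T} \<union> {T<..}" using T by auto
  then show L: "Lp p (glue T v w)" using i1 i2 set_integrable_Un[OF i1 i2] by (simp add: Lp_def)
  show e1: "enrg p (glue T v w) {0..T} = enrg p v {0..T}"
    unfolding enrg_def by (intro set_lebesgue_integral_cong) (auto simp: glue_def)
  have e2: "enrg p (glue T v w) {T..} = enrg p w {0..}"
  proof -
    have "enrg p (glue T v w) {T..} = (LINT s:{T<..}|lborel. ?g s)"
      unfolding enrg_def by (rule set_integral_open_closed(2)) measurable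
    also have "\<dots> = (LINT s:{T<..}|lborel. \<bar>w (s + - T)\<bar> powr p)"
      by (intro set_lebesgue_integral_cong) (auto simp: glue_def)
    also have "\<dots> = (LINT s:{0<..}|lborel. \<bar>w s\<bar> powr p)"
      by (rule set_integral_shift(1)[symmetric]) auto
    also have "\<dots> = enrg p w {0..}" unfolding enrg_def by (rule set_integral_open_closed(2)[symmetric]) measurable
    finally show ?thesis .
  qed
  have "enrg p (glue T v w) {0..} = enrg p (glue T v w) {0..T} + enrg p (glue T v w) {T..}"
    unfolding enrg_def using L T by (intro set_integral_split_inf) (auto simp: Lp_def)
  then show "enrg p (glue T v w) {0..} = enrg p v {0..T} + enrg p w {0..}" using e1 e2 by simp
  show p1: "prim (glue T v w) s = prim v s" if "s \<le> T" for s
    unfolding prim_def using that by (intro set_lebesgue_integral_cong) (auto simp: glue_def)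
  have ae: "AE x in lborel. x \<noteq> T" by (rule AE_lborel_singleton)
  have ivl: "(LINT x:{T..s}|lborel. f (glue T v w x)) = (LINT x:{0..s - T}|lborel. f (w x))"
    if [measurable]: "f \<in> borel_measurable borel" for f :: "real \<Rightarrow> real" and s
  proof -
    have "(LINT x:{T..s}|lborel. f (glue T v w x)) = (LINT x:{T..s}|lborel. f (w (x + - T)))"
      by (intro set_lebesgue_integral_cong_AE AE_mp[OF ae AE_I2]) (auto simp: glue_def)
    also have "\<dots> = (LINT x:{0..s - T}|lborel. f (w x))"
      by (rule set_integral_shift(1)[symmetric]) auto
    finally show ?thesis .
  qed
  show "prim (glue T v w) s = prim v T + prim w (s - T)" if "T \<le> s"
    using prim_diff[OF L p T that] ivl[of "\<lambda>x. x" s] p1[of T] by (simp add: prim_def)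
  show "enrg p (glue T v w) {0..s} = enrg p v {0..T} + enrg p w {0..s - T}" if "T \<le> s"
  proof -
    have "enrg p (glue T v w) {0..s} = enrg p (glue T v w) {0..T} + enrg p (glue T v w) {T..s}"
      unfolding enrg_def using L T that by (intro set_integral_split Lp_set_integrable) auto
    then show ?thesis using e1 ivl[of "\<lambda>x. \<bar>x\<bar> powr p" s] by (simp add: enrg_def)
  qed
qed

text \<open>The equality case of the Bellman inequality behind \<open>linear_bound\<close>.\<close>
definition ext :: "real \<Rightarrow> real \<Rightarrow> real \<Rightarrow> real" where
  "ext p k t = p / (p - 1) * (k * exp (- t / (p - 1)) / (1 + k * exp (- t / (p - 1))))"

text \<open>Along this profile the cost-to-go is \<open>1 + k * exp (- t / (p - 1))\<close>. The
  energy spent from \<open>t\<close> on is \<open>p * (p / (p - 1)) powr (p - 1)\<close> times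
  \<open>Lfun\<close> of it, and the remaining integral is \<open>exp (prim (ext p k) t - t)\<close>
  times it; this supplies explicit antiderivatives for both integrals.\<close>

lemma ext_props:
  assumes p: "p \<ge> 2" and k: "k \<ge> 0"
  shows "Lp p (ext p k)" "enrg p (ext p k) {0..} = p * (p / (p - 1)) powr (p - 1) * Lfun p (1 + k)"
    "t \<ge> 0 \<Longrightarrow> prim (ext p k) t = p * ln ((1 + k) / (1 + k * exp (- t / (p - 1))))"
    "set_integrable lborel {0..} (\<lambda>t. exp (prim (ext p k) t - t))"
    "(LINT t:{0..}|lborel. exp (prim (ext p k) t - t)) = 1 + k"
proof -
  define g where "g t = k * exp (- t / (p - 1))" for t
  have g0: "g t \<ge> 0" for t using k by (simp add: g_def)
  have g1: "1 + g t > 0" for t using g0[of t] by simp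
  have gd: "(g has_real_derivative - g t / (p - 1)) (at t)" for t
    unfolding g_def using p by (auto intro!: derivative_eq_intros)
  have glim: "(g \<longlongrightarrow> 0) at_top"
  proof -
    have "((\<lambda>t. exp (- t / (p - 1))) \<longlongrightarrow> 0) at_top" using p by real_asymp
    then show ?thesis unfolding g_def using tendsto_mult_right_zero by blast
  qed
  have ext: "ext p k t = p / (p - 1) * (g t / (1 + g t))" for t by (simp add: ext_def g_def)
  have e0: "ext p k t \<ge> 0" for t unfolding ext using g0[of t] g1[of t] p by simp
  have ec: "continuous_on A (ext p k)" for A
    unfolding ext_def using p k by (intro continuous_intros) (auto simp: add_nonneg_eq_0_iff)
  then have em [measurable]: "ext p k \<in> borel_measurable borel" by (rule borel_measurable_continuous_onI)
  define K where "K = p * (p / (p - 1)) powr (p - 1)"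
  have D1: "DERIV (\<lambda>t. - K * Lfun p (1 + g t)) t :> \<bar>ext p k t\<bar> powr p" for t
  proof -
    have "((\<lambda>t. Lfun p (1 + g t)) has_real_derivative Lden p (1 + g t) * (- g t / (p - 1))) (at t)"
      using p g0[of t] gd[of t] by (intro DERIV_chain2[OF Lfun_deriv]) (auto intro!: derivative_eq_intros)
    then have "DERIV (\<lambda>t. - K * Lfun p (1 + g t)) t :> - K * (Lden p (1 + g t) * (- g t / (p - 1)))"
      by (intro DERIV_cmult)
    moreover have "- K * (Lden p (1 + g t) * (- g t / (p - 1))) = \<bar>ext p k t\<bar> powr p"
    proof -
      have "g t powr p = g t * g t powr (p - 1)" using powr_mult_base[of "g t" "p - 1"] g0[of t] by simp
      moreover have "(p / (p - 1)) powr p = p / (p - 1) * (p / (p - 1)) powr (p - 1)"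
        using powr_mult_base[of "p / (p - 1)" "p - 1"] p by simp
      moreover have "\<bar>ext p k t\<bar> powr p = (p / (p - 1)) powr p * (g t powr p / (1 + g t) powr p)"
        using e0[of t] p g0[of t] g1[of t] unfolding ext by (simp add: powr_mult powr_divide)
      ultimately show ?thesis using g0[of t] g1[of t] p
        by (simp add: K_def Lden_def powr_minus divide_inverse mult_ac)
    qed
    ultimately show ?thesis by simp
  qed
  have L1: "((\<lambda>t. - K * Lfun p (1 + g t)) \<longlongrightarrow> - K * Lfun p (1 + 0)) at_top"
    using p by (intro tendsto_intros isCont_tendsto_compose[OF DERIV_isCont[OF Lfun_deriv]] glim) auto
  have "set_integrable lborel {0..} (\<lambda>t. \<bar>ext p k t\<bar> powr p)"
    "(LINT t:{0..}|lborel. \<bar>ext p k t\<bar> powr p) = - K * Lfun p (1 + 0) - - K * Lfun p (1 + g 0)"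
    using D1 L1 by (intro FTC_atLeast_nonneg; simp)+
  then show Lp: "Lp p (ext p k)" and "enrg p (ext p k) {0..} = p * (p / (p - 1)) powr (p - 1) * Lfun p (1 + k)"
    by (auto simp: Lp_def enrg_def K_def g_def)
  define Z where "Z t = p * ln ((1 + k) / (1 + g t))" for t
  have Z: "Z t = p * (ln (1 + k) - ln (1 + g t))" for t
    using g1[of t] k by (simp add: Z_def ln_div)
  have Zd: "(Z has_real_derivative ext p k t) (at t)" for t
  proof -
    have "((\<lambda>t. p * (ln (1 + k) - ln (1 + g t))) has_real_derivative p * (0 - (- g t / (p - 1)) / (1 + g t))) (at t)"
      using g1[of t] by (auto intro!: derivative_eq_intros gd simp: mult_ac)
    moreover have "p * (0 - (- G / (p - 1)) / (1 + G)) = p / (p - 1) * (G / (1 + G))" for G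
      unfolding divide_inverse by (simp only: diff_0 mult_minus_left mult_minus_right minus_minus mult_ac)
    ultimately show ?thesis unfolding Z ext by (simp only:)
  qed
  have prim: "prim (ext p k) t = Z t" if "t \<ge> 0" for t
  proof -
    have "(ext p k has_integral (Z t - Z 0)) {0..t}"
      using that Zd by (intro fundamental_theorem_of_calculus)
        (auto simp flip: has_real_derivative_iff_has_vector_derivative intro: has_field_derivative_at_within)
    then have "integral {0..t} (ext p k) = Z t - Z 0" by (rule integral_unique)
    moreover have "Z 0 = 0" using k by (simp add: Z_def g_def)
    ultimately show ?thesis unfolding prim_def using LINT_continuous(2)[OF ec] by simp
  qed
  then show "prim (ext p k) t = p * ln ((1 + k) / (1 + k * exp (- t / (p - 1))))" if "t \<ge> 0"
    using that by (simp add: Z_def g_def)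
  have eZ: "exp (Z t - t) = (1 + k) powr p * exp (- t) * (1 + g t) powr (- p)" for t
  proof -
    have e: "Z t - t = p * ln (1 + k) + (- t) + (- p) * ln (1 + g t)" unfolding Z by (simp add: algebra_simps)
    show ?thesis unfolding e exp_add using g1[of t] k by (simp add: powr_def)
  qed
  define F where "F t = - ((1 + k) powr p * (exp (- t) * (1 + g t) powr (1 - p)))" for t
  have D2: "DERIV F t :> exp (Z t - t)" for t
  proof -
    have dP: "((\<lambda>t. (1 + g t) powr (1 - p)) has_real_derivative (1 - p) * (1 + g t) powr (1 - p - 1) * (- g t / (p - 1))) (at t)"
      using g1[of t] by (auto intro!: derivative_eq_intros gd)
    have de: "((\<lambda>t. exp (- t)) has_real_derivative - exp (- t)) (at t)"
      by (auto intro!: derivative_eq_intros)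
    have d: "DERIV F t :> - ((1 + k) powr p * (- exp (- t) * (1 + g t) powr (1 - p) + (1 - p) * (1 + g t) powr (1 - p - 1) * (- g t / (p - 1)) * exp (- t)))"
      unfolding F_def by (intro DERIV_minus DERIV_cmult DERIV_mult dP de)
    have a: "(1 + g t) powr (1 - p) = (1 + g t) * (1 + g t) powr (- p)"
      using powr_mult_base[of "1 + g t" "- p"] g1[of t] by simp
    have b: "(1 - p) * X * (- g t / (p - 1)) = X * g t" for X
      using p by (simp add: field_simps)
    have "- ((1 + k) powr p * (- exp (- t) * (1 + g t) powr (1 - p) + (1 - p) * (1 + g t) powr (1 - p - 1) * (- g t / (p - 1)) * exp (- t))) = exp (Z t - t)"
      unfolding eZ b a by (simp add: algebra_simps)
    then show ?thesis using d by simp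
  qed
  have L2: "(F \<longlongrightarrow> 0) at_top"
  proof -
    have "((\<lambda>t::real. exp (- t)) \<longlongrightarrow> 0) at_top" by real_asymp
    then have "(F \<longlongrightarrow> - ((1 + k) powr p * (0 * (1 + 0) powr (1 - p)))) at_top"
      unfolding F_def by (intro tendsto_minus tendsto_mult tendsto_const tendsto_powr tendsto_add glim) auto
    then show ?thesis by simp
  qed
  have "(\<lambda>t. exp (Z t - t)) \<in> borel_measurable borel"
    unfolding Z_def g_def by measurable
  then have "set_integrable lborel {0..} (\<lambda>t. exp (Z t - t))" "(LINT t:{0..}|lborel. exp (Z t - t)) = 0 - F 0"
    using D2 L2 by (intro FTC_atLeast_nonneg; simp)+
  moreover have "set_integrable lborel {0..} (\<lambda>t. exp (prim (ext p k) t - t)) = set_integrable lborel {0..} (\<lambda>t. exp (Z t - t))"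
    using prim by (intro set_integrable_cong) auto
  moreover have "(LINT t:{0..}|lborel. exp (prim (ext p k) t - t)) = (LINT t:{0..}|lborel. exp (Z t - t))"
    using prim by (intro set_lebesgue_integral_cong) auto
  moreover have "F 0 = - (1 + k)"
    using k powr_mult_base[of "1 + k" "-p"] by (simp add: F_def g_def powr_add[symmetric])
  ultimately show "set_integrable lborel {0..} (\<lambda>t. exp (prim (ext p k) t - t))"
    "(LINT t:{0..}|lborel. exp (prim (ext p k) t - t)) = 1 + k" by auto
qed

section \<open>The outer problem with potential\<close>

text \<open>Cutting the density off at \<open>T\<close> freezes the primitive instead of killing it,
  so the mass before \<open>T\<close> is kept and some is added.\<close>

lemma mass_restrict:
  assumes "Lp p w" "p > 1" "T \<ge> 0"
  shows "mass p w {0..T} \<le> mass p (\<lambda>s. indicator {0..T} s * w s) {0..}"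
proof -
  define v where "v = (\<lambda>s. indicator {0..T} s * w s)"
  have v: "Lp p v" unfolding v_def using assms by (intro Lp_restrict) auto
  have "mass p w {0..T} = mass p v {0..T}"
    unfolding mass_def v_def using assms
    by (intro set_lebesgue_integral_cong) (auto simp: prim_restrict min_def)
  also have "\<dots> \<le> mass p v {0..}"
    using mass_integrable[OF v assms(2), of "{0..T}"] mass_integrable[OF v assms(2), of "{0..}"]
    unfolding mass_def set_lebesgue_integral_def set_integrable_def
    by (intro integral_mono) (auto simp: indicator_def)
  finally show ?thesis by (simp add: v_def)
qed

lemma mass_scale: 
  shows "mass p (\<lambda>s. c * w s) A = \<bar>c\<bar> powr p * mass p w A"
  by (simp add: mass_def prim_scale abs_mult powr_mult mult.assoc)

text \<open>Adding the remaining geometric series turns the nondecreasing sequence into a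
  nonincreasing one, and the two enclose the limit.\<close>

lemma geometric_increments:
  fixes x :: "nat \<Rightarrow> real"
  assumes inc: "\<And>n. x n \<le> x (Suc n)" and step: "\<And>n. x (Suc n) \<le> x n + C * r ^ n" and r: "0 \<le> r" "r < 1"
  obtains A where "\<And>n. x n \<le> A" "\<And>n. A \<le> x n + C / (1 - r) * r ^ n"
proof -
  define y where "y n = x n + C / (1 - r) * r ^ n" for n
  have "y (Suc n) \<le> y n" for n
  proof -
    have "C * r ^ n + C / (1 - r) * r ^ Suc n = C / (1 - r) * r ^ n"
      using r by (simp add: field_simps)
    then show ?thesis using step[of n] by (simp add: y_def)
  qed
  then have dec: "decseq y" by (rule decseq_SucI)
  have inc': "incseq x" using inc by (rule incseq_SucI)
  have C: "C \<ge> 0" using inc[of 0] step[of 0] by simp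
  have xy: "x m \<le> y n" for m n
  proof -
    have "x m \<le> x (max m n)" using inc' by (auto simp: incseq_def)
    also have "\<dots> \<le> y (max m n)" using C r by (simp add: y_def)
    also have "\<dots> \<le> y n" using dec by (auto simp: decseq_def)
    finally show ?thesis .
  qed
  have bdd: "bdd_above (range x)" using xy[of _ 0] by (intro bdd_aboveI2) auto
  show ?thesis
  proof
    show "x n \<le> Sup (range x)" for n using bdd by (intro cSup_upper) auto
    show "Sup (range x) \<le> x n + C / (1 - r) * r ^ n" for n
      using xy[of _ n] by (intro cSup_least) (auto simp: y_def)
  qed
qed

text \<open>\<open>coerc\<close> is the Poincare inequality after the substitution:
  \<open>\<nu>\<close> absorbs the constants of the change of variables, and \<open>\<kappa>\<close>
  is the ratio of the given parameter to the first eigenvalue, so \<open>\<kappa> < 1\<close>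
  expresses subcriticality of the potential.\<close>

locale moser =
  fixes p \<nu> \<kappa> :: real
  assumes p: "p \<ge> 2" and \<nu>: "\<nu> \<ge> 0" and \<kappa>: "0 \<le> \<kappa>" "\<kappa> < 1"
    and coerc: "\<And>w. Lp p w \<Longrightarrow> \<nu> * mass p w {0..} \<le> \<kappa> * enrg p w {0..}"
begin

lemma p1: "p > 1" "p \<ge> 1" "p > 0" using p by auto

definition outer :: "real \<Rightarrow> (real \<Rightarrow> real) \<Rightarrow> real" where
  "outer T w = enrg p w {0..T} - \<nu> * mass p w {0..T}"

text \<open>Coercivity is given only on the half line; it passes to \<open>{0..T}\<close> by testing
  with the density cut off at \<open>T\<close>.\<close>

lemma outer_ge:
  assumes "Lp p w" "T \<ge> 0"
  shows "(1 - \<kappa>) * enrg p w {0..T} \<le> outer T w" "0 \<le> outer T w"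
proof -
  have "Lp p (\<lambda>s. indicator {0..T} s * w s)" using assms p by (intro Lp_restrict) auto
  from coerc[OF this] have "\<nu> * mass p (\<lambda>s. indicator {0..T} s * w s) {0..} \<le> \<kappa> * enrg p w {0..T}"
    using p enrg_restrict[of p "{0..T}" w "{0..}"] by (simp add: Int_absorb2)
  moreover have "\<nu> * mass p w {0..T} \<le> \<nu> * mass p (\<lambda>s. indicator {0..T} s * w s) {0..}"
    using \<nu> assms p by (intro mult_left_mono mass_restrict) auto
  ultimately show "(1 - \<kappa>) * enrg p w {0..T} \<le> outer T w" by (simp add: outer_def algebra_simps)
  then show "0 \<le> outer T w" using \<kappa> by (smt (verit) enrg_nonneg mult_nonneg_nonneg)
qed

lemma outer_scale: "outer T (\<lambda>s. c * w s) = \<bar>c\<bar> powr p * outer T w"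
  by (simp add: outer_def enrg_scale mass_scale algebra_simps)

section \<open>Optimal cost and effective length of the outer piece\<close>

definition eT :: "real \<Rightarrow> real" where
  "eT T = Inf (outer T ` {w. Lp p w \<and> prim w T = 1})"

lemma eT_bdd: "T \<ge> 0 \<Longrightarrow> bdd_below (outer T ` {w. Lp p w \<and> prim w T = 1})"
  using outer_ge(2) by (intro bdd_belowI[of _ 0]) auto

lemma Lp_const_restrict: "Lp p (\<lambda>s. indicator {0..T} s * c)" "T \<ge> 0 \<Longrightarrow> 0 \<le> s \<Longrightarrow> s \<le> T \<Longrightarrow> prim (\<lambda>s. indicator {0..T} s * c) s = c * s"
  "T \<ge> 0 \<Longrightarrow> enrg p (\<lambda>s. indicator {0..T} s * c) {0..T} = \<bar>c\<bar> powr p * T"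
proof -
  have e: "(\<lambda>s. indicat_real {0..} s *\<^sub>R \<bar>indicat_real {0..T} s * c\<bar> powr p) = (\<lambda>s. indicator {0..T} s *\<^sub>R \<bar>c\<bar> powr p)"
    using p by (auto simp: indicator_def fun_eq_iff)
  have "set_integrable lborel {0..T} (\<lambda>_. \<bar>c\<bar> powr p)" by simp
  then show "Lp p (\<lambda>s. indicator {0..T} s * c)" unfolding Lp_def set_integrable_def e by simp
  show "prim (\<lambda>s. indicator {0..T} s * c) s = c * s" if "T \<ge> 0" "0 \<le> s" "s \<le> T"
  proof -
    have "prim (\<lambda>s. indicator {0..T} s * c) s = (LINT x:{0..s}|lborel. c)"
      unfolding prim_def using that by (intro set_lebesgue_integral_cong) auto
    then show ?thesis using that by (simp add: set_integral_constI)
  qed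
  show "enrg p (\<lambda>s. indicator {0..T} s * c) {0..T} = \<bar>c\<bar> powr p * T" if "T \<ge> 0"
  proof -
    have "enrg p (\<lambda>s. indicator {0..T} s * c) {0..T} = (LINT x:{0..T}|lborel. \<bar>c\<bar> powr p)"
      unfolding enrg_def by (intro set_lebesgue_integral_cong) auto
    then show ?thesis using that by (simp add: set_integral_constI)
  qed
qed

lemma eT_ne: "T > 0 \<Longrightarrow> {w. Lp p w \<and> prim w T = 1} \<noteq> {}"
  using Lp_const_restrict(1,2)[of T "1/T"] Lp_const_restrict(2)[of T T "1/T"] by auto

lemma eT_lower:
  assumes "T > 0"
  shows "(1 - \<kappa>) * T powr (1 - p) \<le> eT T"
  unfolding eT_def
proof (rule cINF_greatest[OF eT_ne[OF assms]])
  fix w assume "w \<in> {w. Lp p w \<and> prim w T = 1}"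
  then have w: "Lp p w" "prim w T = 1" by auto
  have "1 \<le> T powr (p - 1) * enrg p w {0..T}" using prim_bound[OF w(1) p1(1), of T] w assms by simp
  then have "T powr (1 - p) * 1 \<le> T powr (1 - p) * (T powr (p - 1) * enrg p w {0..T})"
    by (intro mult_left_mono) auto
  also have "\<dots> = enrg p w {0..T}" using assms by (simp add: mult.assoc[symmetric] powr_add[symmetric])
  finally have "(1 - \<kappa>) * T powr (1 - p) \<le> (1 - \<kappa>) * enrg p w {0..T}" using \<kappa> by (intro mult_left_mono) auto
  also have "\<dots> \<le> outer T w" using outer_ge(1)[OF w(1)] assms by simp
  finally show "(1 - \<kappa>) * T powr (1 - p) \<le> outer T w" .
qed

lemma eT_pos: "T > 0 \<Longrightarrow> eT T > 0"
  using eT_lower[of T] \<kappa> by (smt (verit) mult_pos_pos powr_gt_zero)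

lemma eT_le:
  assumes "T > 0" "Lp p w"
  shows "eT T * \<bar>prim w T\<bar> powr p \<le> outer T w"
proof (cases "prim w T = 0")
  case True
  then show ?thesis using outer_ge(2)[OF assms(2), of T] assms p by simp
next
  case False
  define c where "c = 1 / prim w T"
  have "eT T \<le> outer T (\<lambda>s. c * w s)"
    unfolding eT_def
  proof (rule cINF_lower[OF eT_bdd])
    have "prim (\<lambda>s. c * w s) T = 1" unfolding prim_scale using False by (simp add: c_def)
    then show "(\<lambda>s. c * w s) \<in> {w. Lp p w \<and> prim w T = 1}"
      using Lp_scale[OF assms(2), of c] p1 by simp
  qed (use assms in simp)
  then have "eT T \<le> \<bar>c\<bar> powr p * outer T w" by (simp add: outer_scale)
  then have "eT T * \<bar>prim w T\<bar> powr p \<le> \<bar>c\<bar> powr p * outer T w * \<bar>prim w T\<bar> powr p"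
    by (intro mult_right_mono) auto
  also have "\<bar>c\<bar> powr p * outer T w * \<bar>prim w T\<bar> powr p = outer T w * (\<bar>c\<bar> * \<bar>prim w T\<bar>) powr p"
    by (simp add: powr_mult)
  also have "\<bar>c\<bar> * \<bar>prim w T\<bar> = 1" using False by (simp add: c_def)
  finally show ?thesis by simp
qed

lemma eT_approx:
  assumes "T > 0" "eT T < e"
  obtains w where "Lp p w" "prim w T = 1" "outer T w < e"
  using cInf_lessD[of "outer T ` {w. Lp p w \<and> prim w T = 1}" e] eT_ne[OF assms(1)] assms(2)
  unfolding eT_def by auto

text \<open>The value \<open>y\<close> at \<open>T\<close> costs the energy \<open>y powr p * tau T powr (1 - p)\<close>, that of a
  straight line of length \<open>tau T\<close> in the problem without potential.\<close>
definition tau :: "real \<Rightarrow> real" where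
  "tau T = eT T powr (- 1 / (p - 1))"

lemma tau_pos: "T > 0 \<Longrightarrow> tau T > 0" using eT_pos[of T] by (simp add: tau_def)

lemma powr_conj:
  assumes "x > 0"
  shows "(x powr (1 - p)) powr (- 1 / (p - 1)) = x" "(x powr (- 1 / (p - 1))) powr (1 - p) = x"
proof -
  have "(1 - p) * (- 1 / (p - 1)) = 1" "(- 1 / (p - 1)) * (1 - p) = 1" using p by (simp_all add: field_simps)
  then show "(x powr (1 - p)) powr (- 1 / (p - 1)) = x" "(x powr (- 1 / (p - 1))) powr (1 - p) = x"
    using assms unfolding powr_powr by (simp_all only: powr_one)
qed

lemma tau_powr: "T > 0 \<Longrightarrow> tau T powr (1 - p) = eT T"
  using eT_pos[of T] powr_conj(2)[of "eT T"] by (simp add: tau_def)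

lemma le_tauI:
  assumes "T > 0" "x > 0" "eT T \<le> x powr (1 - p)"
  shows "x \<le> tau T"
proof -
  have "(x powr (1 - p)) powr (- 1 / (p - 1)) \<le> eT T powr (- 1 / (p - 1))"
    using assms eT_pos[of T] p by (intro powr_mono2') auto
  then show ?thesis using powr_conj(1)[OF assms(2)] by (simp add: tau_def)
qed

lemma tau_leI:
  assumes "T > 0" "x > 0" "x powr (1 - p) \<le> eT T"
  shows "tau T \<le> x"
proof -
  have "eT T powr (- 1 / (p - 1)) \<le> (x powr (1 - p)) powr (- 1 / (p - 1))"
    using assms eT_pos[of T] p by (intro powr_mono2') auto
  then show ?thesis using powr_conj(1)[OF assms(2)] by (simp add: tau_def)
qed

text \<open>Extend a near-minimiser by a line of slope \<open>1 / t\<close>, the slope of the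
  virtual line of length \<open>t\<close> that reaches 1. The extended path reaches
  \<open>1 + h / t\<close> at no more than the cost of a virtual line of length
  \<open>t + h\<close>; the potential on the extension only helps.\<close>

lemma tau_superadd:
  assumes T: "T > 0" and h: "h \<ge> 0"
  shows "tau T + h \<le> tau (T + h)"
proof -
  \<comment> \<open>The infimum \<open>eT T\<close> need not be attained, hence a length strictly
    below \<open>tau T\<close>; density of the order removes the difference at the end.\<close>
  have *: "t + h \<le> tau (T + h)" if t: "0 < t" "t < tau T" for t
  proof -
    have "eT T < t powr (1 - p)"
    proof -
      have "tau T powr (1 - p) < t powr (1 - p)" using t p by (intro powr_less_mono2_neg) auto
      then show ?thesis using tau_powr[OF T] by simp
    qed
    then obtain w where w: "Lp p w" "prim w T = 1" "outer T w < t powr (1 - p)"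
      using eT_approx[OF T] by metis
    define u where "u = (\<lambda>s. indicator {0..h} s * (1/t))"
    have u: "Lp p u" "prim u h = h / t" "enrg p u {0..h} = (1/t) powr p * h"
      using Lp_const_restrict(1)[of h "1/t"] Lp_const_restrict(2)[of h h "1/t"] Lp_const_restrict(3)[of h "1/t"] h t
      by (auto simp: u_def)
    note G = glue[OF w(1) u(1) p1(2), of T]
    define g where "g = glue T w u"
    have g: "Lp p g" "prim g (T + h) = 1 + h / t" "enrg p g {0..T + h} = enrg p w {0..T} + (1/t) powr p * h"
      using G(1) G(5,6)[of "T + h"] T h w u by (auto simp: g_def)
    have "mass p w {0..T} = mass p g {0..T}"
      unfolding mass_def using G(4) T by (intro set_lebesgue_integral_cong) (auto simp: g_def)
    also have "\<dots> \<le> mass p g {0..T + h}"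
      using mass_integrable[OF g(1) p1(1), of "{0..T}"] mass_integrable[OF g(1) p1(1), of "{0..T + h}"] h
      unfolding mass_def set_lebesgue_integral_def set_integrable_def
      by (intro integral_mono) (auto simp: indicator_def)
    finally have "\<nu> * mass p w {0..T} \<le> \<nu> * mass p g {0..T + h}" using \<nu> by (intro mult_left_mono) auto
    then have "outer (T + h) g \<le> t powr (1 - p) + (1/t) powr p * h"
      using w(3) g(3) by (simp add: outer_def)
    also have "(1/t) powr p * h = t powr (1 - p) * (h / t)"
      using t by (simp add: powr_divide powr_diff)
    finally have "outer (T + h) g \<le> t powr (1 - p) * (1 + h / t)" by (simp add: algebra_simps)
    moreover have "eT (T + h) * (1 + h / t) powr p \<le> outer (T + h) g"
      using eT_le[of "T + h" g] T h t g by simp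
    ultimately have "eT (T + h) * (1 + h / t) powr p \<le> t powr (1 - p) * (1 + h / t)" by linarith
    then have "eT (T + h) * (1 + h / t) powr p * (1 + h / t) powr (- p) \<le> t powr (1 - p) * (1 + h / t) * (1 + h / t) powr (- p)"
      by (intro mult_right_mono) auto
    moreover have "1 + h / t > 0" using h t by (simp add: add_pos_nonneg)
    ultimately have "eT (T + h) \<le> t powr (1 - p) * (1 + h / t) powr (1 - p)"
      by (simp add: mult.assoc powr_add[symmetric] powr_mult_base)
    also have "\<dots> = (t * (1 + h / t)) powr (1 - p)" using t h by (simp add: powr_mult)
    also have "t * (1 + h / t) = t + h" using t by (simp add: distrib_left)
    finally show ?thesis using T t h by (intro le_tauI) auto
  qed
  have "tau T \<le> tau (T + h) - h"
  proof (rule dense_le_bounded[of 0])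
    show "0 < tau T" using tau_pos[OF T] .
    show "t \<le> tau (T + h) - h" if "0 < t" "t < tau T" for t using *[OF that] by linarith
  qed
  then show ?thesis by linarith
qed

definition C1 :: real where "C1 = (1 - \<kappa>) powr (- 1 / (p - 1))"

lemma C1_ge: "C1 \<ge> 1"
proof -
  have "1 powr (- 1 / (p - 1)) \<le> (1 - \<kappa>) powr (- 1 / (p - 1))" using \<kappa> p by (intro powr_mono2') auto
  then show ?thesis by (simp add: C1_def)
qed

lemma tau_upper:
  assumes "T > 0"
  shows "tau T \<le> C1 * T"
proof (rule tau_leI[OF assms])
  show "0 < C1 * T" using C1_ge assms by simp
  have "C1 powr (1 - p) = 1 - \<kappa>"
    using powr_conj(2)[of "1 - \<kappa>"] \<kappa> by (simp add: C1_def)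
  then have "(C1 * T) powr (1 - p) = (1 - \<kappa>) * T powr (1 - p)"
    using C1_ge assms by (simp add: powr_mult)
  then show "(C1 * T) powr (1 - p) \<le> eT T" using eT_lower[OF assms] by simp
qed

text \<open>A line of length \<open>t\<close> followed by a unit line is at best one straight line
  of length \<open>t + 1\<close>: the tangent at its slope \<open>m = 1 / (t + 1)\<close> is used on
  both pieces.\<close>

lemma two_piece:
  assumes "t > 0" "a \<ge> 0" "b \<ge> 0" "a + b \<ge> 1"
  shows "(t + 1) powr (1 - p) \<le> t powr (1 - p) * a powr p + b powr p"
proof -
  define m where "m = 1 / (t + 1)"
  have m: "m > 0" using assms by (simp add: m_def)
  have 1: "m powr p + p * m powr (p - 1) * (a / t - m) \<le> (a / t) powr p"
    "m powr p + p * m powr (p - 1) * (b - m) \<le> b powr p"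
    using m assms p by (intro powr_tangent; simp)+
  have "t * (m powr p + p * m powr (p - 1) * (a / t - m)) \<le> t * (a / t) powr p"
    using 1(1) assms by (intro mult_left_mono) auto
  also have "t * (a / t) powr p = t powr (1 - p) * a powr p"
    using assms by (simp add: powr_divide powr_diff)
  finally have "t * (m powr p + p * m powr (p - 1) * (a / t - m)) + (m powr p + p * m powr (p - 1) * (b - m))
    \<le> t powr (1 - p) * a powr p + b powr p" using 1(2) by linarith
  moreover have "t * (m powr p + p * m powr (p - 1) * (a / t - m)) + (m powr p + p * m powr (p - 1) * (b - m))
    = (t + 1) * m powr p + p * m powr (p - 1) * (a + b - (t + 1) * m)"
    using assms by (simp add: field_simps)
  moreover have "(t + 1) * m = 1" using assms by (simp add: m_def)
  moreover have "0 \<le> p * m powr (p - 1) * (a + b - 1)" using assms p by simp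
  moreover have "(t + 1) * m powr p = (t + 1) powr (1 - p)"
    using assms by (simp add: m_def powr_divide powr_diff)
  ultimately show ?thesis by simp
qed

text \<open>Bounds the potential on [T, T+1] relative to the cost \<open>outer (T + 1)\<close>: the
  weight gives the exponential, Hoelder's inequality the power, coercivity the factor
  \<open>1 / (1 - \<kappa>)\<close>.\<close>

definition Xn :: "real \<Rightarrow> real" where "Xn T = \<nu> / (1 - \<kappa>) * (exp (- T) * (T + 1) powr (p - 1))"

lemma Xn_nonneg: "Xn T \<ge> 0" using \<nu> \<kappa> by (simp add: Xn_def)

text \<open>Cut a competitor at \<open>T\<close>: \<open>eT_le\<close> prices its first part by the
  effective length, Hoelder's inequality prices the unit piece, and \<open>two_piece\<close>
  recombines them. The potential on the unit piece is the relative error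
  \<open>Xn T\<close>.\<close>

lemma tau_step:
  assumes T: "T > 0"
  shows "tau (T + 1) \<le> (tau T + 1) * (1 + Xn T)"
proof -
  define t where "t = tau T"
  have t: "t > 0" using tau_pos[OF T] by (simp add: t_def)
  have "(t + 1) powr (1 - p) / (1 + Xn T) \<le> eT (T + 1)"
    unfolding eT_def
  proof (rule cINF_greatest[OF eT_ne])
    fix w assume "w \<in> {w. Lp p w \<and> prim w (T + 1) = 1}"
    then have w: "Lp p w" "prim w (T + 1) = 1" by auto
    define N where "N = enrg p w {0..T + 1}"
    have e: "N = enrg p w {0..T} + enrg p w {T..T + 1}"
      unfolding enrg_def N_def using T w(1) by (intro set_integral_split Lp_set_integrable) auto
    have m: "mass p w {0..T + 1} = mass p w {0..T} + mass p w {T..T + 1}"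
      unfolding mass_def using T w(1) p by (intro set_integral_split mass_integrable) auto
    have "mass p w {T..T + 1} \<le> (LINT s:{T..T + 1}|lborel. (T + 1) powr (p - 1) * N * exp (- T))"
      unfolding mass_def
    proof (intro set_integral_mono mass_integrable w(1) p1 set_integrable_bdd_interval)
      fix s assume s: "s \<in> {T..T + 1}"
      have "\<bar>prim w s\<bar> powr p \<le> s powr (p - 1) * enrg p w {0..s}" using prim_bound[OF w(1) p1(1), of s] s T by simp
      also have "\<dots> \<le> (T + 1) powr (p - 1) * N"
        unfolding N_def using s T w(1) p by (intro mult_mono powr_mono2 enrg_mono) auto
      finally show "\<bar>prim w s\<bar> powr p * exp (- s) \<le> (T + 1) powr (p - 1) * N * exp (- T)"
        using s T by (intro mult_mono) (auto simp: N_def)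
    qed (use T in auto)
    also have "\<dots> = exp (- T) * (T + 1) powr (p - 1) * N" by (simp add: set_integral_constI)
    finally have "\<nu> * mass p w {T..T + 1} \<le> \<nu> * (exp (- T) * (T + 1) powr (p - 1) * N)"
      using \<nu> by (intro mult_left_mono)
    also have "\<dots> = Xn T * ((1 - \<kappa>) * N)" using \<kappa> by (simp add: Xn_def)
    also have "\<dots> \<le> Xn T * outer (T + 1) w"
      unfolding N_def using outer_ge(1)[OF w(1), of "T + 1"] T Xn_nonneg by (intro mult_left_mono) auto
    finally have a: "\<nu> * mass p w {T..T + 1} \<le> Xn T * outer (T + 1) w" .
    have b: "t powr (1 - p) * \<bar>prim w T\<bar> powr p \<le> outer T w"
      using eT_le[OF T w(1)] tau_powr[OF T] by (simp add: t_def)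
    have c: "\<bar>1 - prim w T\<bar> powr p \<le> enrg p w {T..T + 1}"
      using prim_holder[OF w(1) p1(1), of T "T + 1"] T w(2) by simp
    have "(t + 1) powr (1 - p) \<le> t powr (1 - p) * \<bar>prim w T\<bar> powr p + \<bar>1 - prim w T\<bar> powr p"
      using t by (intro two_piece) auto
    also have "\<dots> \<le> outer T w + enrg p w {T..T + 1}" using b c by linarith
    also have "\<dots> = outer (T + 1) w + \<nu> * mass p w {T..T + 1}"
      unfolding outer_def using e m by (simp add: N_def algebra_simps)
    also have "\<dots> \<le> outer (T + 1) w * (1 + Xn T)" using a by (simp add: algebra_simps)
    finally show "(t + 1) powr (1 - p) / (1 + Xn T) \<le> outer (T + 1) w"
      using Xn_nonneg[of T] by (simp add: field_simps)
  qed (use T in simp)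
  moreover have "((t + 1) * (1 + Xn T)) powr (1 - p) \<le> (t + 1) powr (1 - p) / (1 + Xn T)"
  proof -
    have "(1 + Xn T) powr (1 - p) \<le> (1 + Xn T) powr (- 1)"
      using Xn_nonneg[of T] p by (intro powr_mono) auto
    then have "(t + 1) powr (1 - p) * (1 + Xn T) powr (1 - p) \<le> (t + 1) powr (1 - p) * (1 + Xn T) powr (- 1)"
      by (intro mult_left_mono) auto
    then show ?thesis using Xn_nonneg[of T] t by (simp add: powr_mult powr_minus_divide)
  qed
  ultimately have "((t + 1) * (1 + Xn T)) powr (1 - p) \<le> eT (T + 1)" by linarith
  moreover have "(t + 1) * (1 + Xn T) > 0" using t Xn_nonneg[of T] by (intro mult_pos_pos) auto
  ultimately show ?thesis using T unfolding t_def by (intro tau_leI) auto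
qed

text \<open>\<open>tau T - T\<close> is nondecreasing by \<open>tau_superadd\<close>, with
  exponentially small increments at integers by \<open>tau_step\<close>. The upper bound is needed
  at all times, since a crossing time cannot be prescribed; the rate is needed only where the test
  function is glued, and there an integer can be chosen.\<close>

lemma tau_asymp:
  obtains A C where "\<And>T. T > 0 \<Longrightarrow> tau T \<le> T + A" "C \<ge> 0" "\<And>n::nat. n \<ge> 1 \<Longrightarrow> A \<le> tau n - n + C * exp (- real n / 2)"
proof -
  \<comment> \<open>Shifted by one because \<open>tau_step\<close> requires a positive time.\<close>
  define x where "x n = tau (real (Suc n)) - real (Suc n)" for n
  \<comment> \<open>Collects the linear growth of \<open>tau\<close>, the factor of
    \<open>Xn\<close>, and the price of trading the polynomial for half of the exponential
    decay.\<close>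
  define D where "D = (C1 + 1) * (\<nu> / (1 - \<kappa>)) * ((p / (1/2)) powr p * exp (1/2) * exp (- 1/2))"
  have inc: "x n \<le> x (Suc n)" for n
    using tau_superadd[of "real (Suc n)" 1] by (simp add: x_def add_ac)
  have step: "x (Suc n) \<le> x n + D * exp (- 1/2) ^ n" for n
  proof -
    define T where "T = real (Suc n)"
    have T: "T \<ge> 1" by (simp add: T_def)
    have "tau (T + 1) \<le> (tau T + 1) * (1 + Xn T)" using T by (intro tau_step) auto
    then have "tau (T + 1) - (T + 1) \<le> tau T - T + (tau T + 1) * Xn T" by (simp add: algebra_simps)
    moreover have "(tau T + 1) * Xn T \<le> ((C1 + 1) * (T + 1)) * Xn T"
    proof (intro mult_right_mono Xn_nonneg)
      have "tau T \<le> C1 * T" using T by (intro tau_upper) auto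
      then show "tau T + 1 \<le> (C1 + 1) * (T + 1)" using C1_ge T by (simp add: algebra_simps)
    qed
    moreover have "((C1 + 1) * (T + 1)) * Xn T = (C1 + 1) * (\<nu> / (1 - \<kappa>)) * ((T + 1) powr p * exp (- T))"
      using T powr_mult_base[of "T + 1" "p - 1"] by (simp add: Xn_def mult_ac)
    moreover have "(T + 1) powr p * exp (- T) \<le> (p / (1/2)) powr p * exp ((1/2) * (T + 1)) * exp (- T)"
      using T p by (intro mult_right_mono powr_le_exp) auto
    moreover have "(p / (1/2)) powr p * exp ((1/2) * (T + 1)) * exp (- T) = (p / (1/2)) powr p * exp (1/2) * exp (- T / 2)"
      by (simp add: mult.assoc mult_exp_exp; simp add: field_simps)
    moreover have "exp (- T / 2) = exp (- 1/2) * exp (- 1/2) ^ n"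
      by (simp add: T_def exp_of_nat_mult[symmetric] mult_exp_exp; simp add: field_simps)
    moreover have "0 \<le> (C1 + 1) * (\<nu> / (1 - \<kappa>))" using C1_ge \<nu> \<kappa> by simp
    ultimately have "tau (T + 1) - (T + 1) \<le> tau T - T + (C1 + 1) * (\<nu> / (1 - \<kappa>)) * ((p / (1/2)) powr p * exp (1/2) * (exp (- 1/2) * exp (- 1/2) ^ n))"
      by (smt (verit) mult_left_mono)
    then show ?thesis by (simp add: x_def T_def D_def mult_ac add_ac)
  qed
  obtain A where A: "\<And>n. x n \<le> A" "\<And>n. A \<le> x n + D / (1 - exp (- 1/2)) * exp (- 1/2) ^ n"
  proof (rule geometric_increments[of x D "exp (- 1/2)"])
    show "x n \<le> x (Suc n)" for n by (rule inc)
    show "x (Suc n) \<le> x n + D * exp (- 1/2) ^ n" for n by (rule step)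
  qed auto
  have D: "D \<ge> 0" using C1_ge \<nu> \<kappa> by (simp add: D_def)
  show ?thesis
  proof
    fix T :: real assume T: "T > 0"
    obtain n :: nat where n: "T \<le> real n" using real_arch_simple by blast
    have "tau T + (real (Suc n) - T) \<le> tau (T + (real (Suc n) - T))" using T n by (intro tau_superadd) auto
    then show "tau T \<le> T + A" using A(1)[of n] by (simp add: x_def)
  next
    show "D / (1 - exp (- 1/2)) * exp (1/2) \<ge> 0" using D by simp
    fix n :: nat assume "n \<ge> 1"
    then obtain m where m: "n = Suc m" by (cases n) auto
    have "exp (1/2) * exp (- real n / 2) = exp (- 1/2) ^ m"
      by (simp add: m exp_of_nat_mult[symmetric] mult_exp_exp; simp add: field_simps)
    then show "A \<le> tau n - n + D / (1 - exp (- 1/2)) * exp (1/2) * exp (- real n / 2)"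
      using A(2)[of m] by (simp add: x_def m mult.assoc)
  qed
qed

end

section \<open>A test function\<close>

text \<open>For a single density the tail energy can be made as small as desired, and it controls
  the slope of the exponent. The constant \<open>C\<close> depends on \<open>w\<close>; uniformity
  is lost when energy escapes to infinity.\<close>

lemma prim_growth:
  assumes w: "Lp p w" and p: "p > 1" and e: "e > 0"
  obtains C where "C \<ge> 0" "\<And>s. s \<ge> 0 \<Longrightarrow> \<bar>prim w s\<bar> powr (p / (p - 1)) \<le> C + e * s"
proof -
  define q where "q = p / (p - 1)"
  have q: "q > 1" using p by (simp add: q_def field_simps)
  have q1: "(p - 1) / p = 1 / q" using p by (simp add: q_def)
  define d' where "d' = e powr (1 / q)"
  have d': "d' > 0" "d' powr q = e" using e q by (simp_all add: d'_def powr_powr)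
  define d where "d = d' / 2"
  have d: "d > 0" "d < d'" using d' by (simp_all add: d_def)
  obtain T where T: "T \<ge> 0" "enrg p w {T..} < d powr p" using enrg_tail[OF w, of "d powr p"] d by auto
  have "enrg p w {T..} powr (1/p) \<le> (d powr p) powr (1/p)" using T p by (intro powr_mono2) auto
  then have Td: "enrg p w {T..} powr (1/p) \<le> d" using p d by (simp add: powr_powr)
  define K where "K = T powr (1/q) * enrg p w {0..} powr (1/p)"
  have K: "K \<ge> 0" by (simp add: K_def)
  have early: "\<bar>prim w s\<bar> \<le> K" if "0 \<le> s" "s \<le> T" for s
  proof -
    have "\<bar>prim w s\<bar> \<le> s powr (1/q) * enrg p w {0..} powr (1/p)"
      using prim_holder'[OF w p, of 0 s] that q1 by simp
    also have "\<dots> \<le> K" unfolding K_def using that q by (intro mult_right_mono powr_mono2) auto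
    finally show ?thesis .
  qed
  have all: "\<bar>prim w s\<bar> \<le> K + d * s powr (1/q)" if s: "s \<ge> 0" for s
  proof (cases "s \<le> T")
    case True
    then show ?thesis using early[OF s True] d by (smt (verit) mult_nonneg_nonneg powr_ge_zero)
  next
    case False
    then have "\<bar>prim w s\<bar> \<le> \<bar>prim w T\<bar> + enrg p w {T..} powr (1/p) * s powr (1/q)"
      using prim_tail_bound[OF w p T(1), of s] q1 by simp
    also have "\<dots> \<le> K + d * s powr (1/q)"
      using early[of T] T Td by (intro add_mono mult_right_mono) auto
    finally show ?thesis .
  qed
  obtain C where C: "C \<ge> 0" "\<And>s. s \<ge> 0 \<Longrightarrow> (K + d * s powr (1 / q)) powr q \<le> C + d' powr q * s"
    using powr_growth[OF q, of d d' K] d K by auto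
  show ?thesis
  proof
    show "C \<ge> 0" by fact
    fix s :: real assume s: "s \<ge> 0"
    have "\<bar>prim w s\<bar> powr q \<le> (K + d * s powr (1/q)) powr q" using all[OF s] q by (intro powr_mono2) auto
    also have "\<dots> \<le> C + e * s" using C(2)[OF s] d' by simp
    finally show "\<bar>prim w s\<bar> powr (p / (p - 1)) \<le> C + e * s" by (simp add: q_def)
  qed
qed

lemma expint_integrable:
  assumes w: "Lp p w" and p: "p > 1" and A: "A \<in> sets borel" "A \<subseteq> {0..}"
  shows "set_integrable lborel A (\<lambda>s. exp (\<bar>prim w s\<bar> powr (p / (p - 1)) - s))"
proof -
  obtain C where C: "C \<ge> 0" "\<And>s. s \<ge> 0 \<Longrightarrow> \<bar>prim w s\<bar> powr (p / (p - 1)) \<le> C + (1/2) * s"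
    by (rule prim_growth[OF w p, of "1/2"]) auto
  show ?thesis
  proof (rule set_integrable_boundI[OF _ A])
    have "set_integrable lborel {0..} (\<lambda>s. exp C * exp (- (1/2) * s))"
      by (intro set_integrable_mult_right set_integrable_exp_decay) auto
    then show "set_integrable lborel A (\<lambda>s. exp C * exp (- (1/2) * s))"
      by (rule set_integrable_subset) (use A in auto)
    show "(\<lambda>s. exp (\<bar>prim w (max 0 s)\<bar> powr (p / (p - 1)) - max 0 s)) \<in> borel_measurable borel"
      using prim_meas[OF w p] by measurable
    fix s assume "s \<in> A"
    then have "s \<ge> 0" using A by auto
    then have "\<bar>prim w s\<bar> powr (p / (p - 1)) - s \<le> C + - (1/2) * s" using C(2)[of s] by simp
    then show "\<bar>exp (\<bar>prim w s\<bar> powr (p / (p - 1)) - s)\<bar> \<le> exp C * exp (- (1/2) * s)"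
      unfolding exp_add[symmetric] by simp
  qed
qed

lemma expint_split:
  assumes "Lp p w" "p > 1" "T \<ge> 0"
  shows "expint (p / (p - 1)) w {0..} = expint (p / (p - 1)) w {0..T} + expint (p / (p - 1)) w {T..}"
  unfolding expint_def using assms by (intro set_integral_split_inf expint_integrable) auto

context moser
begin

lemma tau_ge:
  assumes "T > 0"
  shows "T \<le> tau T"
proof (rule le_tauI[OF assms assms])
  define w where "w = (\<lambda>s. indicator {0..T} s * (1/T))"
  have w: "Lp p w" "prim w T = 1" "enrg p w {0..T} = (1/T) powr p * T"
    using Lp_const_restrict(1)[of T "1/T"] Lp_const_restrict(2)[of T T "1/T"] Lp_const_restrict(3)[of T "1/T"] assms
    by (auto simp: w_def)
  have "eT T \<le> outer T w" using eT_le[OF assms w(1)] w(2) by simp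
  also have "\<dots> \<le> (1/T) powr p * T" unfolding outer_def w(3) using \<nu> by simp
  also have "\<dots> = T powr (1 - p)" using assms by (simp add: powr_divide powr_diff)
  finally show "eT T \<le> T powr (1 - p)" .
qed

text \<open>Replace the path up to \<open>s0\<close> by a unit-time line to the same height. The new
  path is at least one time unit shorter, hence dearer by at least the relative amount
  \<open>1 / t\<close>, of which near-minimality covers only half; the rest must be paid by the new
  line, whose energy is the height to the power \<open>p\<close>. These heights produce the gain
  over the concentration level.\<close>

lemma near_minimizer_lower:
  assumes T: "T \<ge> 4" and w: "Lp p w" "prim w T = 1"
    and near: "outer T w \<le> tau T powr (1 - p) * (1 + 1 / (2 * tau T))" and s0: "2 \<le> s0" "s0 \<le> 3"
  shows "1 / (2 * tau T) \<le> \<bar>prim w s0\<bar>"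
proof -
  define t where "t = tau T"
  have t: "t \<ge> 4" using tau_ge[of T] T by (simp add: t_def)
  define \<eta> where "\<eta> = prim w s0"
  define c where "c = (\<lambda>s. indicator {0..1::real} s * \<eta>)"
  have c: "Lp p c" "prim c 1 = \<eta>" "enrg p c {0..1} = \<bar>\<eta>\<bar> powr p"
    using Lp_const_restrict(1)[of 1 \<eta>] Lp_const_restrict(2)[of 1 1 \<eta>] Lp_const_restrict(3)[of 1 \<eta>]
    by (auto simp: c_def)
  have s00: "s0 \<ge> 0" using s0 by simp
  note sh = Lp_shift[OF w(1) s00]
  define g where "g = glue 1 c (\<lambda>s. w (s + s0))"
  note G = glue[OF c(1) sh(1) p1(2), of 1, folded g_def]
  define S where "S = T - s0 + 1"
  have S: "S > 1" using T s0 by (simp add: S_def)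
  have pg: "prim g s = prim w (s - 1 + s0)" if "1 \<le> s" for s
    using G(5)[of s] sh(3)[of "s - 1"] that p1 c(2) by (simp add: \<eta>_def)
  have "prim g S = 1" using pg[of S] S w by (simp add: S_def)
  then have e1: "eT S \<le> outer S g" using eT_le[of S g] G(1) S by simp
  have eg: "enrg p g {0..S} = \<bar>\<eta>\<bar> powr p + enrg p w {s0..T}"
  proof -
    have "enrg p (\<lambda>s. w (s + s0)) {0..S - 1} = enrg p w {s0..T}"
      unfolding enrg_def by (rule set_integral_shift(1)[symmetric]) (auto simp: S_def)
    then show ?thesis using G(6)[of S] S c by simp
  qed
  \<comment> \<open>The path is moved to earlier times, where the weight \<open>exp (- s)\<close> is
    larger, so its mass can only grow.\<close>
  have mg: "mass p w {s0..T} \<le> mass p g {0..S}"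
  proof -
    have "mass p w {s0..T} = (LINT x:{1..S}|lborel. \<bar>prim w (x + (s0 - 1))\<bar> powr p * exp (- (x + (s0 - 1))))"
      unfolding mass_def by (rule set_integral_shift(1)) (auto simp: S_def)
    also have "\<dots> \<le> mass p g {1..S}"
      unfolding mass_def
    proof (intro set_integral_mono mass_integrable G(1) p1)
      have "set_integrable lborel {s0..T} (\<lambda>s. \<bar>prim w s\<bar> powr p * exp (- s))"
        using w p1 s0 by (intro mass_integrable) auto
      then show "set_integrable lborel {1..S} (\<lambda>x. \<bar>prim w (x + (s0 - 1))\<bar> powr p * exp (- (x + (s0 - 1))))"
        by (subst (asm) set_integral_shift(2)[of "s0 - 1" _ "{1..S}"]) (auto simp: S_def)
      fix x assume "x \<in> {1..S}"
      then show "\<bar>prim w (x + (s0 - 1))\<bar> powr p * exp (- (x + (s0 - 1))) \<le> \<bar>prim g x\<bar> powr p * exp (- x)"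
        using pg[of x] s0 by (intro mult_mono) (auto simp: algebra_simps)
    qed auto
    also have "\<dots> \<le> mass p g {0..S}"
      using mass_integrable[OF G(1) p1(1), of "{1..S}"] mass_integrable[OF G(1) p1(1), of "{0..S}"]
      unfolding mass_def set_lebesgue_integral_def set_integrable_def
      by (intro integral_mono) (auto simp: indicator_def)
    finally show ?thesis .
  qed
  have ew: "enrg p w {0..T} = enrg p w {0..s0} + enrg p w {s0..T}"
    unfolding enrg_def using T s0 w(1) by (intro set_integral_split Lp_set_integrable) auto
  have mw: "mass p w {0..T} = mass p w {0..s0} + mass p w {s0..T}"
    unfolding mass_def using T s0 w(1) p by (intro set_integral_split mass_integrable) auto
  have "outer S g \<le> \<bar>\<eta>\<bar> powr p + enrg p w {s0..T} - \<nu> * mass p w {s0..T}"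
    unfolding outer_def eg using \<nu> mg by (simp add: mult_left_mono)
  also have "\<dots> = \<bar>\<eta>\<bar> powr p + outer T w - outer s0 w"
    unfolding outer_def ew mw by (simp add: algebra_simps)
  also have "\<dots> \<le> \<bar>\<eta>\<bar> powr p + outer T w" using outer_ge(2)[OF w(1) s00] by simp
  finally have e2: "eT S \<le> \<bar>\<eta>\<bar> powr p + outer T w" using e1 by simp
  have "tau S + (s0 - 1) \<le> t" using tau_superadd[of S "s0 - 1"] S s0 by (simp add: S_def t_def)
  then have "tau S \<le> t - 1" using s0 by simp
  then have "(t - 1) powr (1 - p) \<le> tau S powr (1 - p)" using tau_pos[of S] S p by (intro powr_mono2') auto
  then have e3: "(t - 1) powr (1 - p) \<le> eT S" using tau_powr[of S] S by simp
  have "t powr (1 - p) * (1 + 1 / t) \<le> (t - 1) powr (1 - p)"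
  proof -
    define x where "x = 1 - 1 / t"
    have x: "0 < x" "x < 1" "t - 1 = t * x" using t by (simp_all add: x_def field_simps)
    have "1 + 1 / t \<le> 1 / x" using t by (simp add: x_def field_simps)
    also have "\<dots> = x powr (- 1)" using x by (simp add: powr_minus_divide)
    also have "\<dots> \<le> x powr (1 - p)" using x p by (intro powr_mono') auto
    finally have "t powr (1 - p) * (1 + 1 / t) \<le> t powr (1 - p) * x powr (1 - p)" by (intro mult_left_mono) auto
    also have "\<dots> = (t - 1) powr (1 - p)" using x t by (simp add: powr_mult)
    finally show ?thesis .
  qed
  then have "t powr (1 - p) * (1 + 1 / t) \<le> \<bar>\<eta>\<bar> powr p + t powr (1 - p) * (1 + 1 / (2 * t))"
    using e2 e3 near by (simp add: t_def)
  then have "t powr (1 - p) * (1 / (2 * t)) \<le> \<bar>\<eta>\<bar> powr p"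
    by (simp add: distrib_left)
  moreover have "(1 / (2 * t)) powr p \<le> t powr (1 - p) * (1 / (2 * t))"
  proof -
    have "(1 / (2 * t)) powr p = (1 / 2) powr p * t powr (- p)"
      using t by (simp add: powr_divide powr_mult powr_minus_divide)
    also have "\<dots> \<le> (1 / 2) powr 1 * t powr (- p)" using p by (intro mult_right_mono powr_mono') auto
    also have "\<dots> = t powr (1 - p) * (1 / (2 * t))" using t by (simp add: powr_diff powr_minus_divide)
    finally show ?thesis .
  qed
  ultimately have "(1 / (2 * t)) powr p \<le> \<bar>\<eta>\<bar> powr p" by linarith
  then have "((1 / (2 * t)) powr p) powr (1 / p) \<le> (\<bar>\<eta>\<bar> powr p) powr (1 / p)"
    using p by (intro powr_mono2[of "1 / p"]) auto
  then show ?thesis using p t by (simp add: powr_powr \<eta>_def t_def)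
qed

text \<open>The tangent of \<open>b powr q\<close> is taken at the height \<open>Y\<close> with \<open>Y powr q = p * \<sigma>\<close>, while the
  profile reaches \<open>Y / p\<close> at time \<open>T\<close>. With this choice the linearised inner problem
  loses nothing against the concentration level, except for the exponentially small
  remainder in \<open>cst_bounds\<close>.\<close>
lemma test_function_estimate:
  assumes T: "T \<ge> 4" and \<epsilon>: "0 < \<epsilon>" "\<epsilon> \<le> 1 / (2 * tau T)"
  obtains g where "Lp p g" "enrg p g {0..} - \<nu> * mass p g {0..} \<le> 1"
    "1 - exp (- T) + exp (- 3) * (p powr (- 1 / (p - 1)) * (tau T * (1 - \<epsilon>)) * (1 / (2 * tau T)) powr (p / (p - 1)))
      + exp (tau T * (1 - \<epsilon>) - T + cst p - (p - 1) * exp (p - 1 - cst p - tau T * (1 - \<epsilon>)))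
      \<le> expint (p / (p - 1)) g {0..}"
proof -
  define q where "q = p / (p - 1)"
  have q: "q > 1" "p / (p - 1) = q" "q - 1 = 1 / (p - 1)" "p * (q - 1) = q" "q * (p - 1) = p"
    using p by (simp_all add: q_def field_simps)
  define t where "t = tau T"
  have t: "t \<ge> 4" using tau_ge[of T] T by (simp add: t_def)
  \<comment> \<open>Chosen so that \<open>\<sigma> powr (1 - p)\<close> exceeds the infimum
    \<open>eT T\<close> by the factor \<open>1 + \<epsilon>\<close>, which provides a competitor;
    the length loses at most the factor \<open>1 - \<epsilon>\<close>.\<close>
  define \<sigma> where "\<sigma> = t * (1 + \<epsilon>) powr (- 1 / (p - 1))"
  have \<sigma>0: "\<sigma> > 0" using t \<epsilon> by (simp add: \<sigma>_def)
  have \<sigma>: "\<sigma> powr (1 - p) = t powr (1 - p) * (1 + \<epsilon>)"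
    using t \<epsilon> powr_conj(2)[of "1 + \<epsilon>"] by (simp add: \<sigma>_def powr_mult)
  have \<sigma>lo: "t * (1 - \<epsilon>) \<le> \<sigma>"
  proof -
    have "1 - \<epsilon> \<le> 1 / (1 + \<epsilon>)" using \<epsilon> by (simp add: field_simps)
    also have "\<dots> = (1 + \<epsilon>) powr (- 1)" using \<epsilon> by (simp add: powr_minus_divide)
    also have "\<dots> \<le> (1 + \<epsilon>) powr (- 1 / (p - 1))"
      using \<epsilon> p by (intro powr_mono) (auto simp: field_simps)
    finally show ?thesis unfolding \<sigma>_def using t by (intro mult_left_mono) auto
  qed
  have "eT T < \<sigma> powr (1 - p)"
    unfolding \<sigma> using tau_powr[of T] eT_pos[of T] T \<epsilon> by (simp add: t_def)
  then obtain w where w: "Lp p w" "prim w T = 1" "outer T w < \<sigma> powr (1 - p)"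
    using eT_approx[of T "\<sigma> powr (1 - p)"] T by auto
  have wlow: "1 / (2 * t) \<le> \<bar>prim w s\<bar>" if "2 \<le> s" "s \<le> 3" for s
    unfolding t_def
  proof (rule near_minimizer_lower[OF T w(1,2) _ that])
    have "outer T w \<le> t powr (1 - p) * (1 + \<epsilon>)" using w(3) \<sigma> by simp
    also have "\<dots> \<le> t powr (1 - p) * (1 + 1 / (2 * t))" using \<epsilon> by (intro mult_left_mono) (auto simp: t_def)
    finally show "outer T w \<le> tau T powr (1 - p) * (1 + 1 / (2 * tau T))" by (simp add: t_def)
  qed
  define Y where "Y = (p * \<sigma>) powr (1 / q)"
  have Y: "Y > 0" "Y powr q = p * \<sigma>" using \<sigma>0 p q by (simp_all add: Y_def powr_powr)
  \<comment> \<open>This height splits the unit of energy: the outer piece costs at most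
    \<open>1 / p\<close>, and \<open>(p - 1) / p\<close> remains for the inner one.\<close>
  define y where "y = Y / p"
  have y: "y > 0" using Y p by (simp add: y_def)
  have yp: "y powr p * \<sigma> powr (1 - p) = 1 / p"
  proof -
    have "Y powr p = (Y powr q) powr (p - 1)" using q by (simp add: powr_powr)
    also have "\<dots> = p powr (p - 1) * \<sigma> powr (p - 1)" using Y p \<sigma>0 by (simp add: powr_mult)
    finally have "y powr p * \<sigma> powr (1 - p) = p powr (p - 1) / p powr p * (\<sigma> powr (p - 1) * \<sigma> powr (1 - p))"
      using Y p by (simp add: y_def powr_divide)
    also have "\<sigma> powr (p - 1) * \<sigma> powr (1 - p) = 1" using \<sigma>0 by (simp add: powr_add[symmetric])
    also have "p powr (p - 1) / p powr p = 1 / p" using p by (simp add: powr_diff)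
    finally show ?thesis by simp
  qed
  have yq: "y powr q = p powr (- 1 / (p - 1)) * \<sigma>"
  proof -
    have "y powr q = p powr 1 / p powr q * \<sigma>" using Y p by (simp add: y_def powr_divide)
    also have "p powr 1 / p powr q = p powr (1 - q)" using p by (simp only: powr_diff)
    also have "1 - q = - 1 / (p - 1)" using q(3) by simp
    finally show ?thesis .
  qed
  \<comment> \<open>The extremal with cost \<sigma> uses exactly the remaining energy once divided
    by the tangent slope \<open>c\<close>, and \<open>v\<close> is about
    \<open>exp (\<sigma> + cst p)\<close>.\<close>
  obtain v where v: "v \<ge> 1" "Lfun p v = \<sigma>" using Lfun_surj[OF p, of \<sigma>] \<sigma>0 by auto
  define k where "k = v - 1"
  have k: "k \<ge> 0" "1 + k = v" using v by (simp_all add: k_def)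
  define c where "c = q * Y powr (q - 1)"
  have c: "c > 0" using q Y by (simp add: c_def)
  have cp: "c powr p = q powr p * (p * \<sigma>)"
    using q Y by (simp add: c_def powr_mult powr_powr mult.commute)
  note X = ext_props[OF p k(1)]
  define u where "u = (\<lambda>s. (1 / c) * ext p k s)"
  have u: "Lp p u" unfolding u_def using X(1) p1 by (intro Lp_scale) auto
  have ue: "enrg p u {0..} = (p - 1) / p"
  proof -
    have "enrg p u {0..} = (1 / c) powr p * (p * q powr (p - 1) * \<sigma>)"
      unfolding u_def enrg_scale using X(2) v k c by (simp add: q(2))
    also have "\<dots> = q powr (p - 1) / q powr p * (p * \<sigma> / (p * \<sigma>))" using c by (simp add: powr_divide cp)
    also have "p * \<sigma> / (p * \<sigma>) = 1" using p \<sigma>0 by simp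
    also have "q powr (p - 1) / q powr p = 1 / q" using q by (simp add: powr_diff)
    finally show ?thesis by (simp add: q_def)
  qed
  have up: "prim u s = prim (ext p k) s / c" for s
    using prim_scale[of "1 / c" "ext p k" s] unfolding u_def[symmetric] by simp
  define yw where "yw = (\<lambda>s. y * w s)"
  have yw: "Lp p yw" unfolding yw_def using w p1 by (intro Lp_scale) auto
  have ywp: "prim yw s = y * prim w s" for s by (simp add: yw_def prim_scale)
  define g where "g = glue T yw u"
  have T0: "T \<ge> 0" using T by simp
  note G = glue[OF yw u p1(2) T0, folded g_def]
  show ?thesis
  proof
    show "Lp p g" by (rule G(1))
    have "mass p yw {0..T} = mass p g {0..T}"
      unfolding mass_def using G(4) by (intro set_lebesgue_integral_cong) auto
    also have "\<dots> \<le> mass p g {0..}"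
      using mass_integrable[OF G(1) p1(1), of "{0..T}"] mass_integrable[OF G(1) p1(1), of "{0..}"]
      unfolding mass_def set_lebesgue_integral_def set_integrable_def
      by (intro integral_mono) (auto simp: indicator_def)
    finally have "\<nu> * mass p yw {0..T} \<le> \<nu> * mass p g {0..}" using \<nu> by (intro mult_left_mono)
    then have "enrg p g {0..} - \<nu> * mass p g {0..} \<le> outer T yw + (p - 1) / p"
      unfolding G(3) outer_def ue by simp
    also have "outer T yw \<le> y powr p * \<sigma> powr (1 - p)"
      unfolding yw_def outer_scale using w(3) y by simp
    also have "y powr p * \<sigma> powr (1 - p) + (p - 1) / p = 1" unfolding yp using p by (simp add: field_simps)
    finally show "enrg p g {0..} - \<nu> * mass p g {0..} \<le> 1" by simp
    have J: "expint q g {0..} = expint q g {0..T} + expint q g {T..}"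
      using expint_split[OF G(1) p1(1) T0] by (simp add: q(2))
    have int: "set_integrable lborel A (\<lambda>s. exp (\<bar>prim g s\<bar> powr q - s))" if "A \<in> sets borel" "A \<subseteq> {0..}" for A
      using expint_integrable[OF G(1) p1(1) that] by (simp add: q(2))
    have first: "1 - exp (- T) + exp (- 3) * ((y * (1 / (2 * t))) powr q) \<le> expint q g {0..T}"
    proof -
      \<comment> \<open>A minorant from \<open>1 + x \<le> exp x\<close>, keeping the first-order
        term only on [2,3], where the profile is bounded away from zero.\<close>
      define f where "f s = exp (- s) + indicator {2..3} s * (exp (- 3) * ((y * (1 / (2 * t))) powr q))" for s :: real
      have i1: "set_integrable lborel {0..T} (\<lambda>s. exp (- s))" "(LINT s:{0..T}|lborel. exp (- s)) = 1 - exp (- T)"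
      proof -
        have "continuous_on {0..T} (\<lambda>s. exp (- s))" by (intro continuous_intros)
        note * = LINT_continuous[OF this]
        have "((\<lambda>s. exp (- s)) has_integral (- exp (- T) - - exp (- 0))) {0..T}"
          using T0 by (intro fundamental_theorem_of_calculus)
            (auto intro!: derivative_eq_intros simp flip: has_real_derivative_iff_has_vector_derivative)
        then show "set_integrable lborel {0..T} (\<lambda>s. exp (- s))" "(LINT s:{0..T}|lborel. exp (- s)) = 1 - exp (- T)"
          using * by (auto simp: integral_unique)
      qed
      have e: "(\<lambda>s. indicat_real {0..T} s *\<^sub>R (indicator {2..3} s * K)) = (\<lambda>s. indicat_real {2..3} s *\<^sub>R K)" for K :: real
        using T by (auto simp: indicator_def fun_eq_iff)
      have i2: "set_integrable lborel {0..T} (\<lambda>s. indicator {2..3} s * K)" "(LINT s:{0..T}|lborel. indicator {2..3} s * K) = K" for K :: real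
        using set_integrable_bdd_interval[of 2 3 K] set_integral_constI[of 2 3 K]
        unfolding set_integrable_def set_lebesgue_integral_def e by auto
      have "(LINT s:{0..T}|lborel. f s) \<le> expint q g {0..T}"
        unfolding expint_def
      proof (rule set_integral_mono)
        show "set_integrable lborel {0..T} f" unfolding f_def using i1 i2 by (intro set_integral_add)
        show "set_integrable lborel {0..T} (\<lambda>s. exp (\<bar>prim g s\<bar> powr q - s))" by (rule int) auto
        fix s assume s: "s \<in> {0..T}"
        have "exp (- s) * (1 + \<bar>prim g s\<bar> powr q) \<le> exp (- s) * exp (\<bar>prim g s\<bar> powr q)"
          by (intro mult_left_mono exp_ge_add_one_self) auto
        then have a: "exp (- s) + exp (- s) * \<bar>prim g s\<bar> powr q \<le> exp (\<bar>prim g s\<bar> powr q - s)"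
          by (simp add: distrib_left exp_diff exp_minus divide_inverse mult.commute)
        show "f s \<le> exp (\<bar>prim g s\<bar> powr q - s)"
        proof (cases "s \<in> {2..3}")
          case True
          then have "prim g s = y * prim w s" using G(4)[of s] ywp T by simp
          moreover have "y * (1 / (2 * t)) \<le> y * \<bar>prim w s\<bar>" using True wlow[of s] y by (intro mult_left_mono) auto
          ultimately have "(y * (1 / (2 * t))) powr q \<le> \<bar>prim g s\<bar> powr q"
            using y t q by (intro powr_mono2) (auto simp: abs_mult)
          then have "exp (- 3) * ((y * (1 / (2 * t))) powr q) \<le> exp (- s) * \<bar>prim g s\<bar> powr q"
            using True by (intro mult_mono) auto
          then show ?thesis using a True by (simp add: f_def)
        next
          case False
          have "0 \<le> exp (- s) * \<bar>prim g s\<bar> powr q" by simp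
          then show ?thesis using a False by (simp add: f_def)
        qed
      qed
      moreover have "(LINT s:{0..T}|lborel. f s) = 1 - exp (- T) + exp (- 3) * ((y * (1 / (2 * t))) powr q)"
        unfolding f_def using i1 i2 by (subst set_integral_add) auto
      ultimately show ?thesis by simp
    qed
    have second: "exp (- T) * v \<le> expint q g {T..}"
    proof -
      have "expint q g {T..} = (LINT s:{0..}|lborel. exp (\<bar>prim g (s + T)\<bar> powr q - (s + T)))"
        unfolding expint_def by (rule set_integral_shift(1)) auto
      also have "\<dots> \<ge> (LINT s:{0..}|lborel. exp (- T) * exp (prim (ext p k) s - s))"
      proof (rule set_integral_mono)
        show "set_integrable lborel {0..} (\<lambda>s. exp (- T) * exp (prim (ext p k) s - s))"
          using X(4) by simp
        have "set_integrable lborel {T..} (\<lambda>s. exp (\<bar>prim g s\<bar> powr q - s))" using T0 by (intro int) auto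
        then show "set_integrable lborel {0..} (\<lambda>s. exp (\<bar>prim g (s + T)\<bar> powr q - (s + T)))"
          by (subst (asm) set_integral_shift(2)[of T _ "{0..}"]) auto
        fix s :: real assume s: "s \<in> {0..}"
        define z where "z = prim u s"
        have z0: "z \<ge> 0"
        proof -
          have "0 \<le> prim (ext p k) s" using p k by (intro prim_nonneg) (simp add: ext_def)
          then show ?thesis using c by (simp add: z_def up)
        qed
        have pg: "prim g (s + T) = y + z" using G(5)[of "s + T"] s ywp[of T] w(2) by (simp add: z_def)
        have "Y powr q + q * Y powr (q - 1) * ((y + z) - Y) \<le> (y + z) powr q"
          using q Y y z0 by (intro powr_tangent) auto
        \<comment> \<open>The constant terms cancel because \<open>q * (Y / p - Y) = - Y\<close>;
          this is the reason for the ratio \<open>p\<close> between the two heights.\<close>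
        moreover have "Y powr q + q * Y powr (q - 1) * ((y + z) - Y) = c * z"
        proof -
          have "Y powr q = Y * Y powr (q - 1)" using powr_mult_base[of Y "q - 1"] Y by simp
          moreover have "q * (Y / p - Y) = - Y" using p by (simp add: q_def field_simps)
          then have h: "q * (y - Y) = - Y" by (simp add: y_def)
          have "q * Y powr (q - 1) * (y - Y) = (q * (y - Y)) * Y powr (q - 1)" by (simp only: mult_ac)
          then have "q * Y powr (q - 1) * (y - Y) = - (Y * Y powr (q - 1))" unfolding h by simp
          ultimately show ?thesis by (simp add: c_def algebra_simps)
        qed
        moreover have "c * z = prim (ext p k) s" using c by (simp add: z_def up)
        ultimately have "- T + (prim (ext p k) s - s) \<le> \<bar>prim g (s + T)\<bar> powr q - (s + T)"
          unfolding pg using y z0 by simp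
        then show "exp (- T) * exp (prim (ext p k) s - s) \<le> exp (\<bar>prim g (s + T)\<bar> powr q - (s + T))"
          unfolding exp_add[symmetric] by simp
      qed
      also have "(LINT s:{0..}|lborel. exp (- T) * exp (prim (ext p k) s - s)) = exp (- T) * v"
        using X(5) k by simp
      finally show ?thesis .
    qed
    define \<rho> where "\<rho> = tau T * (1 - \<epsilon>)"
    have \<rho>: "\<rho> \<le> \<sigma>" using \<sigma>lo by (simp add: \<rho>_def t_def)
    \<comment> \<open>\<open>cst_bounds\<close> is used twice: crudely, to see that
      \<open>1 / v\<close> is exponentially small, and then with this value inserted in its
      remainder.\<close>
    have third: "exp (\<rho> - T + cst p - (p - 1) * exp (p - 1 - cst p - \<rho>)) \<le> exp (- T) * v"
    proof -
      have a: "cst p \<le> ln v - \<sigma> + (p - 1) / v" using cst_bounds(2)[OF p v(1)] v by simp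
      have "(p - 1) / v \<le> p - 1" using p v by (simp add: divide_le_eq mult_left_mono[of 1 v "p - 1", simplified])
      then have "\<rho> + cst p - (p - 1) \<le> ln v" using a \<rho> by linarith
      then have "exp (\<rho> + cst p - (p - 1)) \<le> v" using v by (simp add: ln_ge_iff)
      then have "1 / v \<le> exp (- (\<rho> + cst p - (p - 1)))"       proof -
        assume h: "exp (\<rho> + cst p - (p - 1)) \<le> v"
        have "inverse v \<le> inverse (exp (\<rho> + cst p - (p - 1)))" by (rule le_imp_inverse_le[OF h exp_gt_zero])
        then show ?thesis unfolding exp_minus by (simp add: divide_inverse)
      qed
      then have "(p - 1) * (1 / v) \<le> (p - 1) * exp (- (\<rho> + cst p - (p - 1)))" using p by (intro mult_left_mono) auto
      then have "\<rho> - T + cst p - (p - 1) * exp (p - 1 - cst p - \<rho>) \<le> - T + ln v"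
        using a \<rho> by (simp add: algebra_simps)
      then have "exp (\<rho> - T + cst p - (p - 1) * exp (p - 1 - cst p - \<rho>)) \<le> exp (- T + ln v)"
        by (simp only: exp_le_cancel_iff)
      moreover have "exp (- T + ln v) = exp (- T) * v" unfolding exp_add using v by simp
      ultimately show ?thesis by (simp only:)
    qed
    have "p powr (- 1 / (p - 1)) * (tau T * (1 - \<epsilon>)) * (1 / (2 * tau T)) powr q \<le> (y * (1 / (2 * t))) powr q"
    proof -
      have "(y * (1 / (2 * t))) powr q = p powr (- 1 / (p - 1)) * \<sigma> * (1 / (2 * t)) powr q"
        using y t yq by (simp only: powr_mult) 
      then show ?thesis using \<rho> by (simp add: \<rho>_def[symmetric] t_def mult_right_mono mult_left_mono)
    qed
    then have "exp (- 3) * (p powr (- 1 / (p - 1)) * (tau T * (1 - \<epsilon>)) * (1 / (2 * tau T)) powr q) \<le> exp (- 3) * ((y * (1 / (2 * t))) powr q)"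
      by (intro mult_left_mono) auto
    then show "1 - exp (- T) + exp (- 3) * (p powr (- 1 / (p - 1)) * (tau T * (1 - \<epsilon>)) * (1 / (2 * tau T)) powr (p / (p - 1)))
      + exp (tau T * (1 - \<epsilon>) - T + cst p - (p - 1) * exp (p - 1 - cst p - tau T * (1 - \<epsilon>)))
      \<le> expint (p / (p - 1)) g {0..}"
      using first second third unfolding J q(2) \<rho>_def by linarith
  qed
qed

end

section \<open>The concentration level\<close>

lemma powr_recip_bound:
  fixes r x :: real
  assumes "r \<ge> 1" "0 \<le> x" "x \<le> 1/2"
  shows "1 / (1 - x) powr r \<le> 1 + r * 2 powr r * x"
proof -
  define y where "y = 1 / (1 - x)"
  have y: "1 \<le> y" "y \<le> 2" "y - 1 \<le> 2 * x"
  proof -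
    show "1 \<le> y" "y \<le> 2" using assms by (simp_all add: y_def field_simps)
    have "x * (1 / (1 - x)) \<le> x * 2" using assms by (intro mult_left_mono) (auto simp: field_simps)
    moreover have "y - 1 = x * (1 / (1 - x))" using assms by (simp add: y_def field_simps)
    ultimately show "y - 1 \<le> 2 * x" by simp
  qed
  have "y powr r - 1 \<le> r * y powr (r - 1) * (y - 1)"
  proof (cases "r = 1")
    case False
    then have "y powr r + r * y powr (r - 1) * (1 - y) \<le> 1 powr r"
      using assms y by (intro powr_tangent) auto
    then show ?thesis by (simp add: algebra_simps)
  qed (use y in auto)
  also have "\<dots> \<le> r * 2 powr (r - 1) * (2 * x)"
    using assms y by (intro mult_mono powr_mono2) auto
  also have "\<dots> = r * 2 powr r * x" by (simp add: powr_diff)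
  finally show ?thesis using assms by (simp add: y_def powr_divide)
qed

section \<open>Energy and potential beyond a crossing time\<close>

context moser
begin

text \<open>The 4 is the energy bound 2 times the factor 2 from integrating
  \<open>exp (- s / 2)\<close>; the power is the price of absorbing \<open>s powr (p - 1)\<close>
  into half of the decay.\<close>

definition Dc :: real where "Dc = \<nu> * (4 * ((p - 1) / (1/2)) powr (p - 1))"

lemma mass_tail:
  assumes w: "Lp p w" "enrg p w {0..} \<le> 2" and a: "a \<ge> 0"
  shows "\<nu> * mass p w {a..} \<le> Dc * exp (- a / 2)"
proof -
  define K where "K = ((p - 1) / (1/2)) powr (p - 1)"
  have K: "K \<ge> 0" by (simp add: K_def)
  have "mass p w {a..} \<le> (LINT s:{a..}|lborel. 2 * K * exp (- (1/2) * s))"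
    unfolding mass_def
  proof (intro set_integral_mono mass_integrable w(1) p1)
    show "set_integrable lborel {a..} (\<lambda>s. 2 * K * exp (- (1/2) * s))"
      by (intro set_integrable_mult_right set_integrable_exp_decay) auto
    fix s assume s: "s \<in> {a..}"
    have "\<bar>prim w s\<bar> powr p \<le> s powr (p - 1) * enrg p w {0..}" using prim_bound'[OF w(1) p1(1), of s] s a by simp
    also have "\<dots> \<le> (K * exp ((1/2) * s)) * 2"
      unfolding K_def using s a p w by (intro mult_mono powr_le_exp) auto
    finally have "\<bar>prim w s\<bar> powr p * exp (- s) \<le> (K * exp ((1/2) * s)) * 2 * exp (- s)" by (intro mult_right_mono) auto
    also have "\<dots> = 2 * K * (exp ((1/2) * s) * exp (- s))" by simp
    also have "exp ((1/2) * s) * exp (- s) = exp (- (1/2) * s)" by (simp add: mult_exp_exp)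
    finally show "\<bar>prim w s\<bar> powr p * exp (- s) \<le> 2 * K * exp (- (1/2) * s)" .
  qed (use a in auto)
  also have "\<dots> = 2 * K * (LINT s:{a..}|lborel. exp (- (1/2) * s))" by (rule set_integral_mult_right)
  also have "(LINT s:{a..}|lborel. exp (- (1/2) * s)) = exp (- (1/2) * a) / (1/2)" by (rule integral_exp_decay) simp
  finally have "mass p w {a..} \<le> 4 * K * exp (- a / 2)" by simp
  then have "\<nu> * mass p w {a..} \<le> \<nu> * (4 * K * exp (- a / 2))" using \<nu> by (intro mult_left_mono)
  then show ?thesis by (simp add: Dc_def K_def)
qed

text \<open>Bounds the energy left after a crossing at time \<open>a\<close>: the first summand is
  what remains of 1 once the crossing height has been paid at effective length at most
  \<open>a + A\<close>, the second is the potential of the tail.\<close>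

definition dhat :: "real \<Rightarrow> real \<Rightarrow> real" where
  "dhat A a = (p - 1) * ((A + 2 * ln a) / (a + A)) + Dc * exp (- a / 2)"

text \<open>Bounds the exponent of the tail integral apart from \<open>cst p\<close>: the limit
  value \<open>A\<close>, the potential of the tail, and the effect of the lowered decay rate in the
  linearised problem.\<close>

definition Ghat :: "real \<Rightarrow> real \<Rightarrow> real" where
  "Ghat A a = A + a * (Dc * exp (- a / 2)) / (p - 1)
     + a * dhat A a / (p - 1) * ((p - 1) * 2 powr (p - 1) * dhat A a powr (1 / (p - 1)))"

text \<open>The crossing time \<open>a\<close> of the curve \<open>a - 2 * ln a\<close> fixes the energy left for the tail, where
  the exponent is linearised at the height \<open>prim w a\<close>.\<close>
lemma tail_after_crossing:
  assumes A: "\<And>T. T > 0 \<Longrightarrow> tau T \<le> T + A"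
    and w: "Lp p w" "\<And>s. w s \<ge> 0" "enrg p w {0..} - \<nu> * mass p w {0..} \<le> 1" "\<nu> * mass p w {0..} \<le> 1"
    and a: "a \<ge> 1" "prim w a powr (p / (p - 1)) = a - 2 * ln a" "dhat A a powr (1 / (p - 1)) \<le> 1/2"
  shows "expint (p / (p - 1)) w {a..} \<le> exp (Ghat A a + cst p) / (1 - dhat A a powr (1 / (p - 1)))"
proof -
  define q where "q = p / (p - 1)"
  have q: "q > 1" "q \<le> 2" "p / (p - 1) = q" "p * (q - 1) = q" "q * (p - 1) = p" "q / p = 1 / (p - 1)"
    using p by (simp_all add: q_def field_simps)
  have a0: "a > 0" "a \<ge> 0" using a by auto
  have A0: "A \<ge> 0" using A[of 1] tau_ge[of 1] by simp
  define L where "L = a - 2 * ln a"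
  have L: "0 < L" "L \<le> a"
  proof -
    have "ln (a / 2) \<le> a / 2 - 1" using a0 by (intro ln_le_minus_one) auto
    moreover have "ln (a / 2) = ln a - ln 2" using a0 by (simp add: ln_div)
    moreover have "ln (2::real) < 1" using ln_less_self[of 2] ln_2_less_1 by simp
    ultimately show "0 < L" by (simp add: L_def)
    show "L \<le> a" using a by (simp add: L_def)
  qed
  define y where "y = prim w a"
  have y0: "y \<ge> 0" unfolding y_def by (intro prim_nonneg w)
  have yq: "y powr q = L" using a(2) by (simp add: y_def q_def L_def)
  then have y: "y > 0" using L y0 by (cases "y = 0") auto
  define \<delta> where "\<delta> = enrg p w {a..}"
  have \<delta>0: "\<delta> \<ge> 0" by (simp add: \<delta>_def)
  \<comment> \<open>Energy balance: at most 1 is available, the outer piece takes its cost away, and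
    the potential beyond \<open>a\<close> is the only extra income.\<close>
  have \<delta>: "\<delta> \<le> dhat A a"
  proof -
    have e: "enrg p w {0..} = enrg p w {0..a} + \<delta>"
      unfolding enrg_def \<delta>_def using a0 w(1) by (intro set_integral_split_inf) (auto simp: Lp_def)
    have m: "mass p w {0..} = mass p w {0..a} + mass p w {a..}"
      unfolding mass_def using a0 w(1) p1 by (intro set_integral_split_inf mass_integrable) auto
    have mt: "\<nu> * mass p w {a..} \<le> Dc * exp (- a / 2)" using mass_tail[OF w(1) _ a0(2)] w(3,4) by simp
    have "(L / (a + A)) powr (p - 1) \<le> outer a w"
    proof -
      have "(a + A) powr (1 - p) \<le> tau a powr (1 - p)" using A[OF a0(1)] tau_pos[OF a0(1)] p by (intro powr_mono2') auto
      then have "(a + A) powr (1 - p) * y powr p \<le> eT a * y powr p"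
        using tau_powr[OF a0(1)] by (intro mult_right_mono) auto
      also have "\<dots> \<le> outer a w" using eT_le[OF a0(1) w(1)] y by (simp add: y_def)
      also have "y powr p = L powr (p - 1)" unfolding yq[symmetric] powr_powr q(5) ..
      finally show ?thesis using a0 A0 L powr_minus_divide[of "a + A" "p - 1"] by (simp add: powr_divide)
    qed
    moreover have "1 - (p - 1) * ((A + 2 * ln a) / (a + A)) \<le> (L / (a + A)) powr (p - 1)"
    proof (cases "p = 2")
      case True
      have "L / (a + A) = 1 - (A + 2 * ln a) / (a + A)" using a0 A0 by (simp add: L_def field_simps)
      then show ?thesis using True L a0 A0 by simp
    next
      case False
      have "1 powr (p - 1) + (p - 1) * 1 powr (p - 1 - 1) * (L / (a + A) - 1) \<le> (L / (a + A)) powr (p - 1)"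
        using False p L a0 A0 by (intro powr_tangent) auto
      moreover have "L / (a + A) - 1 = - ((A + 2 * ln a) / (a + A))" using a0 A0 by (simp add: L_def field_simps)
      ultimately have "1 + (p - 1) * (- ((A + 2 * ln a) / (a + A))) \<le> (L / (a + A)) powr (p - 1)"
        by (simp only: powr_one_eq_one mult_1_right)
      then show ?thesis by (simp only: mult_minus_right diff_conv_add_uminus)
    qed
    ultimately show ?thesis
      using e m mt w(3) by (simp add: outer_def dhat_def algebra_simps)
  qed
  define r where "r = 1 / (p - 1)"
  have r: "r > 0" using p by (simp add: r_def)
  \<comment> \<open>By Hoelder's inequality the nonlinear term \<open>z powr q\<close> of the
    expansion is at most \<open>\<eta> * s\<close>. It merely lowers the decay rate from 1 to
    \<open>1 - \<eta>\<close>, and the problem is linear.\<close>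
  define \<eta> where "\<eta> = \<delta> powr r"
  define \<eta>' where "\<eta>' = dhat A a powr r"
  have \<eta>: "0 \<le> \<eta>" "\<eta> \<le> \<eta>'" "\<eta>' \<le> 1/2"
    using \<delta> \<delta>0 r a(3) by (auto simp: \<eta>_def \<eta>'_def r_def intro!: powr_mono2)
  define v where "v = (\<lambda>s. w (s + a))"
  have v: "Lp p v" "enrg p v {0..} = \<delta>" "\<And>s. s \<ge> 0 \<Longrightarrow> prim v s = prim w (s + a) - y"
    using Lp_shift[OF w(1) a0(2)] p1 by (auto simp: v_def \<delta>_def y_def)
  define c where "c = q * y powr (q - 1)"
  have c: "c > 0" using q y by (simp add: c_def)
  have \<kappa>': "1 - \<eta> > 0" using \<eta> by simp
  have v0: "v s \<ge> 0" for s unfolding v_def by (rule w(2))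
  note lin = linear_bound[OF p v(1) v0 c \<kappa>']
  have "expint q w {a..} = (LINT s:{0..}|lborel. exp (\<bar>prim w (s + a)\<bar> powr q - (s + a)))"
    unfolding expint_def by (rule set_integral_shift(1)) auto
  also have "\<dots> \<le> (LINT s:{0..}|lborel. exp (L - a) * exp (c * prim v s - (1 - \<eta>) * s))"
  proof (rule set_integral_mono)
    have "set_integrable lborel {a..} (\<lambda>s. exp (\<bar>prim w s\<bar> powr q - s))"
      using expint_integrable[OF w(1) p1(1), of "{a..}"] a0 by (auto simp: q(3))
    then show "set_integrable lborel {0..} (\<lambda>s. exp (\<bar>prim w (s + a)\<bar> powr q - (s + a)))"
      by (subst (asm) set_integral_shift(2)[of a _ "{0..}"]) auto
    show "set_integrable lborel {0..} (\<lambda>s. exp (L - a) * exp (c * prim v s - (1 - \<eta>) * s))"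
      using lin(1) by simp
    fix s :: real assume s: "s \<in> {0..}"
    define z where "z = prim v s"
    have z: "z \<ge> 0" unfolding z_def by (intro prim_nonneg v0)
    have b: "prim w (s + a) = y + z" using v(3)[of s] s by (simp add: z_def)
    have "z powr q \<le> \<eta> * s"
    proof -
      have "z powr p \<le> s powr (p - 1) * \<delta>" using prim_bound'[OF v(1) p1(1), of s] s z v(2) by (simp add: z_def)
      then have "(z powr p) powr (q / p) \<le> (s powr (p - 1) * \<delta>) powr (q / p)" using q p by (intro powr_mono2) auto
      moreover have "(z powr p) powr (q / p) = z powr q" using p by (simp add: powr_powr)
      moreover have "(s powr (p - 1) * \<delta>) powr (q / p) = s * \<eta>"
        using s p by (simp add: powr_mult powr_powr q(6) \<eta>_def r_def)
      ultimately show ?thesis by (simp add: mult.commute)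
    qed
    then have "(y + z) powr q \<le> L + c * z + \<eta> * s"
      using powr_add_le[OF q(1,2) y0 z] yq by (simp add: c_def)
    then have "\<bar>prim w (s + a)\<bar> powr q - (s + a) \<le> (L - a) + (c * prim v s - (1 - \<eta>) * s)"
      unfolding b z_def[symmetric] using y0 z by (simp add: algebra_simps)
    then show "exp (\<bar>prim w (s + a)\<bar> powr q - (s + a)) \<le> exp (L - a) * exp (c * prim v s - (1 - \<eta>) * s)"
      unfolding exp_add[symmetric] exp_le_cancel_iff .
  qed
  also have "\<dots> = exp (L - a) * (LINT s:{0..}|lborel. exp (c * prim v s - (1 - \<eta>) * s))" by simp
  also have "\<dots> \<le> exp (L - a) * (exp (cst p + L * \<delta> / (p - 1) * (1 / (1 - \<eta>) powr (p - 1))) / (1 - \<eta>))"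
  proof (intro mult_left_mono)
    have "c powr p / (p * (p / (p - 1) * (1 - \<eta>)) powr (p - 1)) * \<delta> = L * \<delta> / (p - 1) * (1 / (1 - \<eta>) powr (p - 1))"
    proof -
      have "c powr p = q powr p * L" using q y by (simp add: c_def powr_mult powr_powr mult.commute yq)
      moreover have "q powr p = q * q powr (p - 1)" using powr_mult_base[of q "p - 1"] q by simp
      moreover have "(p / (p - 1) * (1 - \<eta>)) powr (p - 1) = q powr (p - 1) * (1 - \<eta>) powr (p - 1)"
        unfolding q(3) using q(1) \<kappa>' by (simp add: powr_mult)
      ultimately have "c powr p / (p * (p / (p - 1) * (1 - \<eta>)) powr (p - 1)) = (q / p) * L * (1 / (1 - \<eta>) powr (p - 1))"
        using q(1) p by simp
      then show ?thesis by (simp add: q(6))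
    qed
    then show "(LINT s:{0..}|lborel. exp (c * prim v s - (1 - \<eta>) * s)) \<le> exp (cst p + L * \<delta> / (p - 1) * (1 / (1 - \<eta>) powr (p - 1))) / (1 - \<eta>)"
      using lin(2) \<kappa>' v(2) by (simp add: field_simps)
  qed simp
  also have "\<dots> = exp (L - a + L * \<delta> / (p - 1) * (1 / (1 - \<eta>) powr (p - 1)) + cst p) / (1 - \<eta>)"
    by (simp add: exp_add exp_diff mult_ac)
  also have "\<dots> \<le> exp (Ghat A a + cst p) / (1 - \<eta>')"
  proof (intro frac_le)
    define d where "d = dhat A a"
    have d: "\<delta> \<le> d" "0 \<le> d" using \<delta> \<delta>0 by (auto simp: d_def)
    define K where "K = (p - 1) * 2 powr (p - 1)"
    have K: "K \<ge> 0" using p by (simp add: K_def)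
    have "1 / (1 - \<eta>) powr (p - 1) \<le> 1 + K * \<eta>"
      unfolding K_def using p \<eta> by (intro powr_recip_bound) auto
    also have "\<dots> \<le> 1 + K * \<eta>'" using K \<eta> by (intro add_left_mono mult_left_mono) auto
    finally have 0: "1 / (1 - \<eta>) powr (p - 1) \<le> 1 + K * \<eta>'" .
    have "L * \<delta> / (p - 1) \<le> L * d / (p - 1)"
      using L d p by (intro divide_right_mono mult_left_mono) auto
    then have "L * \<delta> / (p - 1) * (1 / (1 - \<eta>) powr (p - 1)) \<le> L * d / (p - 1) * (1 + K * \<eta>')"
      by (rule mult_mono[OF _ 0]) (use L d p in auto)
    also have "\<dots> = L * d / (p - 1) + L * d / (p - 1) * (K * \<eta>')" by (simp only: distrib_left mult_1_right)
    also have "\<dots> \<le> L * d / (p - 1) + a * d / (p - 1) * (K * \<eta>')"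
      using L d p K \<eta> by (intro add_left_mono mult_right_mono divide_right_mono) auto
    finally have 1: "L * \<delta> / (p - 1) * (1 / (1 - \<eta>) powr (p - 1)) \<le> L * d / (p - 1) + a * d / (p - 1) * (K * \<eta>')" .
    have 2: "L * d / (p - 1) = L * ((A + 2 * ln a) / (a + A)) + L * (Dc * exp (- a / 2)) / (p - 1)"
      unfolding d_def dhat_def using p by (simp add: field_simps)
    \<comment> \<open>Here the logarithm of the crossing curve is recovered: \<open>L - a\<close> is
      \<open>- 2 * ln a\<close>, and this part of the energy term contributes at most
      \<open>A + 2 * ln a\<close>.\<close>
    have 3: "L * ((A + 2 * ln a) / (a + A)) \<le> A + 2 * ln a"
    proof -
      have "L / (a + A) \<le> 1" using L a0 A0 by simp
      then have "L / (a + A) * (A + 2 * ln a) \<le> 1 * (A + 2 * ln a)" using a A0 by (intro mult_right_mono) auto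
      then show ?thesis by simp
    qed
    have 4: "L * (Dc * exp (- a / 2)) / (p - 1) \<le> a * (Dc * exp (- a / 2)) / (p - 1)"
      using L p \<nu> by (intro divide_right_mono mult_right_mono) (auto simp: Dc_def)
    have "L - a + L * \<delta> / (p - 1) * (1 / (1 - \<eta>) powr (p - 1)) \<le> Ghat A a"
      using 1 2 3 4 unfolding Ghat_def by (simp add: L_def d_def K_def \<eta>'_def r_def)
    then show "exp (L - a + L * \<delta> / (p - 1) * (1 / (1 - \<eta>) powr (p - 1)) + cst p) \<le> exp (Ghat A a + cst p)" by simp
  qed (use \<eta> in auto)
  finally show ?thesis by (simp add: q(3) \<eta>'_def r_def)
qed

text \<open>\<open>dhat A a\<close> is of order \<open>ln a / a\<close>, so the delicate term of
  \<open>Ghat\<close> is \<open>a\<close> times its power \<open>1 + 1 / (p - 1)\<close>, which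
  still tends to zero.\<close>

lemma crossing_limit:
  "((\<lambda>a. exp (Ghat A a + cst p) / (1 - dhat A a powr (1 / (p - 1)))) \<longlongrightarrow> exp (A + cst p)) at_top"
  "((\<lambda>a. dhat A a powr (1 / (p - 1))) \<longlongrightarrow> 0) at_top"
proof -
  define r where "r = 1 / (p - 1)"
  have r: "r > 0" "1 + r = p / (p - 1)" using p by (simp_all add: r_def field_simps)
  \<comment> \<open>Since \<open>s * (1 + r) = 1\<close>, the delicate term is the power
    \<open>1 + r\<close> of \<open>a powr s * dhat A a\<close>, and \<open>s < 1\<close> makes that
    base tend to zero.\<close>
  define s where "s = (p - 1) / p"
  have s: "0 < s" "s < 1" "s * (1 + r) = 1" using p by (simp_all add: s_def r)
  have l1: "((\<lambda>a. (A + 2 * ln a) / (a + A)) \<longlongrightarrow> 0) at_top" by real_asymp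
  have l2: "((\<lambda>a::real. exp (- a / 2)) \<longlongrightarrow> 0) at_top" by real_asymp
  have l3: "((\<lambda>a::real. a * exp (- a / 2)) \<longlongrightarrow> 0) at_top" by real_asymp
  have l4: "((\<lambda>a. a powr s * ((A + 2 * ln a) / (a + A))) \<longlongrightarrow> 0) at_top" using s by real_asymp
  have l5: "((\<lambda>a::real. a powr s * exp (- a / 2)) \<longlongrightarrow> 0) at_top" using s by real_asymp
  have d0: "(dhat A \<longlongrightarrow> 0) at_top"
  proof -
    have "(dhat A \<longlongrightarrow> (p - 1) * 0 + Dc * 0) at_top" unfolding dhat_def by (intro tendsto_intros l1 l2)
    then show ?thesis by simp
  qed
  have ds: "((\<lambda>a. a powr s * dhat A a) \<longlongrightarrow> 0) at_top"
  proof -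
    have "((\<lambda>a. (p - 1) * (a powr s * ((A + 2 * ln a) / (a + A))) + Dc * (a powr s * exp (- a / 2))) \<longlongrightarrow> (p - 1) * 0 + Dc * 0) at_top"
      by (intro tendsto_intros l4 l5)
    then show ?thesis by (simp add: dhat_def algebra_simps)
  qed
  have dn: "\<forall>\<^sub>F a in at_top. dhat A a \<ge> 0"
    using eventually_ge_at_top[of "max 1 (max (- A + 1) (exp (- A / 2)))"]
  proof eventually_elim
    fix a :: real assume a: "max 1 (max (- A + 1) (exp (- A / 2))) \<le> a"
    then have "- A / 2 \<le> ln a" by (simp add: ln_ge_iff)
    then show "0 \<le> dhat A a" using a p \<nu> by (auto simp: dhat_def Dc_def intro!: add_nonneg_nonneg mult_nonneg_nonneg divide_nonneg_nonneg)
  qed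
  have dr: "((\<lambda>a. dhat A a powr r) \<longlongrightarrow> 0) at_top"
    using tendsto_powr'[OF d0 tendsto_const, of r] r dn by simp
  then show "((\<lambda>a. dhat A a powr (1 / (p - 1))) \<longlongrightarrow> 0) at_top" by (simp add: r_def)
  have "((\<lambda>a. (a powr s * dhat A a) powr (1 + r)) \<longlongrightarrow> 0 powr (1 + r)) at_top"
  proof (rule tendsto_powr'[OF ds tendsto_const])
    show "(0::real) \<noteq> 0 \<or> 0 < 1 + r \<and> (\<forall>\<^sub>F a in at_top. 0 \<le> a powr s * dhat A a)"
      using r dn by (auto elim!: eventually_mono)
  qed
  moreover have "\<forall>\<^sub>F a in at_top. (a powr s * dhat A a) powr (1 + r) = a * dhat A a * dhat A a powr r"
    using dn eventually_gt_at_top[of 0]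
  proof eventually_elim
    case (elim a)
    then show ?case using s powr_mult_base[of "dhat A a" r] by (simp add: powr_mult powr_powr)
  qed
  ultimately have dd: "((\<lambda>a. a * dhat A a * dhat A a powr r) \<longlongrightarrow> 0) at_top"
    by (simp add: tendsto_cong)
  have "(Ghat A \<longlongrightarrow> A + Dc / (p - 1) * 0 + 2 powr (p - 1) * 0) at_top"
  proof (rule Lim_transform_eventually)
    show "((\<lambda>a. A + Dc / (p - 1) * (a * exp (- a / 2)) + 2 powr (p - 1) * (a * dhat A a * dhat A a powr r)) \<longlongrightarrow> A + Dc / (p - 1) * 0 + 2 powr (p - 1) * 0) at_top"
      by (intro tendsto_intros l3 dd)
    show "\<forall>\<^sub>F a in at_top. A + Dc / (p - 1) * (a * exp (- a / 2)) + 2 powr (p - 1) * (a * dhat A a * dhat A a powr r) = Ghat A a"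
      using p by (intro always_eventually) (simp add: Ghat_def r_def)
  qed
  then have "((\<lambda>a. exp (Ghat A a + cst p) / (1 - dhat A a powr r)) \<longlongrightarrow> exp ((A + Dc / (p - 1) * 0 + 2 powr (p - 1) * 0) + cst p) / (1 - 0)) at_top"
    by (intro tendsto_intros dr) auto
  then show "((\<lambda>a. exp (Ghat A a + cst p) / (1 - dhat A a powr (1 / (p - 1)))) \<longlongrightarrow> exp (A + cst p)) at_top"
    by (simp add: r_def)
qed

text \<open>The reason for the coefficient 2 in the crossing curve: below
  \<open>s - 2 * ln s\<close> the integrand is at most the inverse square, whose tail is
  small.\<close>

lemma inverse_square_tail:
  fixes a :: real
  assumes "a > 0"
  shows "set_integrable lborel {a..} (\<lambda>s. exp (- 2 * ln s))" "(LINT s:{a..}|lborel. exp (- 2 * ln s)) = 1 / a"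
proof -
  have D: "((\<lambda>s. - 1 / s) has_real_derivative exp (- 2 * ln s)) (at s)" if "a \<le> s" for s
  proof -
    have "exp (- 2 * ln s) = 1 / (s * s)"
      using assms that by (simp add: exp_minus exp_double power2_eq_square divide_inverse)
    then show ?thesis using assms that by (auto intro!: derivative_eq_intros simp: power2_eq_square)
  qed
  have "((\<lambda>s::real. - 1 / s) \<longlongrightarrow> 0) at_top" by real_asymp
  note * = FTC_atLeast_nonneg[OF _ D _ this]
  show "set_integrable lborel {a..} (\<lambda>s. exp (- 2 * ln s))" by (rule *(1)) auto
  have "(LINT s:{a..}|lborel. exp (- 2 * ln s)) = 0 - - 1 / a" by (rule *(2)) auto
  then show "(LINT s:{a..}|lborel. exp (- 2 * ln s)) = 1 / a" by simp
qed

text \<open>Up to a fixed large \<open>S\<close> the primitives tend to zero, which gives about 1.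
  From \<open>S\<close> to the first crossing of \<open>s - 2 * ln s\<close> the integrand is below
  an inverse square. Beyond it \<open>tail_after_crossing\<close> applies, uniformly because the
  crossing is not earlier than \<open>S\<close>. Without a crossing the second estimate covers the
  whole tail.\<close>

lemma concentration_level:
  fixes w :: "nat \<Rightarrow> real \<Rightarrow> real"
  assumes A: "\<And>T. T > 0 \<Longrightarrow> tau T \<le> T + A"
    and w: "\<And>n. Lp p (w n)" "\<And>n s. w n s \<ge> 0" "\<And>n. enrg p (w n) {0..} - \<nu> * mass p (w n) {0..} \<le> 1"
    and lim: "(\<lambda>n. \<nu> * mass p (w n) {0..}) \<longlonglongrightarrow> 0" "\<And>s. s \<ge> 0 \<Longrightarrow> (\<lambda>n. prim (w n) s) \<longlonglongrightarrow> 0" and e: "e > 0"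
  shows "\<forall>\<^sub>F n in sequentially. expint (p / (p - 1)) (w n) {0..} \<le> 1 + exp (A + cst p) + e"
proof -
  define q where "q = p / (p - 1)"
  have q: "q > 1" "p / (p - 1) = q" using p by (simp_all add: q_def field_simps)
  have "\<forall>\<^sub>F a in at_top. exp (Ghat A a + cst p) / (1 - dhat A a powr (1 / (p - 1))) < exp (A + cst p) + e / 3"
    using crossing_limit(1) e by (intro order_tendstoD) auto
  moreover have "\<forall>\<^sub>F a in at_top. dhat A a powr (1 / (p - 1)) < 1/2"
    using crossing_limit(2) by (intro order_tendstoD) auto
  moreover have "\<forall>\<^sub>F a in at_top. 1 / a < e / 3" using e by real_asymp
  ultimately have "\<forall>\<^sub>F a in at_top. exp (Ghat A a + cst p) / (1 - dhat A a powr (1 / (p - 1))) < exp (A + cst p) + e / 3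
      \<and> dhat A a powr (1 / (p - 1)) < 1/2 \<and> 1 / a < e / 3"
    by eventually_elim auto
  then obtain S0 where S0: "\<And>a. a \<ge> S0 \<Longrightarrow> exp (Ghat A a + cst p) / (1 - dhat A a powr (1 / (p - 1))) < exp (A + cst p) + e / 3
      \<and> dhat A a powr (1 / (p - 1)) < 1/2 \<and> 1 / a < e / 3"
    by (auto simp: eventually_at_top_linorder)
  define S where "S = max 2 S0"
  have S: "S \<ge> 2" "S \<ge> S0" by (auto simp: S_def)
  have SL: "S - 2 * ln S > 0"
  proof -
    have "ln (S / 2) \<le> S / 2 - 1" using S by (intro ln_le_minus_one) auto
    moreover have "ln (S / 2) = ln S - ln 2" using S by (simp add: ln_div)
    ultimately show ?thesis using ln_2_less_1 by simp
  qed
  have pS: "(\<lambda>n. prim (w n) S powr q) \<longlonglongrightarrow> 0"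
  proof -
    have "(\<lambda>n. prim (w n) S powr q) \<longlonglongrightarrow> 0 powr q"
    proof (rule tendsto_powr'[OF lim(2) tendsto_const])
      show "(0::real) \<noteq> 0 \<or> 0 < q \<and> (\<forall>\<^sub>F n in sequentially. 0 \<le> prim (w n) S)"
        using q w(2) prim_nonneg by (auto intro!: always_eventually)
    qed (use S in simp)
    then show ?thesis using q by simp
  qed
  then have "(\<lambda>n. exp (prim (w n) S powr q)) \<longlonglongrightarrow> exp 0" by (intro tendsto_intros)
  then have ev1: "\<forall>\<^sub>F n in sequentially. exp (prim (w n) S powr q) < 1 + e / 3"
    using e by (intro order_tendstoD) auto
  have ev2: "\<forall>\<^sub>F n in sequentially. prim (w n) S powr q < S - 2 * ln S"
    using pS SL by (intro order_tendstoD)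
  have ev3: "\<forall>\<^sub>F n in sequentially. \<nu> * mass p (w n) {0..} < 1"
    using lim(1) by (intro order_tendstoD) auto
  show ?thesis using ev1 ev2 ev3
  proof eventually_elim
    fix n
    assume 1: "exp (prim (w n) S powr q) < 1 + e / 3" and 2: "prim (w n) S powr q < S - 2 * ln S"
      and 3: "\<nu> * mass p (w n) {0..} < 1"
    define b where "b = prim (w n)"
    have bc: "continuous_on {0..} b" unfolding b_def using w(1) p1 by (intro prim_continuous) auto
    have b0: "b s \<ge> 0" for s unfolding b_def by (intro prim_nonneg w)
    have bm: "b s \<le> b t" if "0 \<le> s" "s \<le> t" for s t
      unfolding b_def using that w p1 by (intro prim_mono[where p = p]) auto
    have int: "set_integrable lborel X (\<lambda>s. exp (\<bar>prim (w n) s\<bar> powr q - s))" if "X \<in> sets borel" "X \<subseteq> {0..}" for X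
      using expint_integrable[OF w(1) p1(1) that] by (simp add: q(2))
    have J0: "expint q (w n) {0..} = expint q (w n) {0..S} + expint q (w n) {S..}"
      using expint_split[OF w(1) p1(1), of S] S by (simp add: q(2))
    have first: "expint q (w n) {0..S} \<le> 1 + e / 3"
    proof -
      have i: "set_integrable lborel {0..} (\<lambda>s::real. exp (- 1 * s))" by (rule set_integrable_exp_decay) simp
      then have i': "set_integrable lborel {0..S} (\<lambda>s. exp (- s))" using set_integrable_subset[OF i, of "{0..S}"] by simp
      have "expint q (w n) {0..S} \<le> (LINT s:{0..S}|lborel. exp (b S powr q) * exp (- s))"
        unfolding expint_def
      proof (rule set_integral_mono)
        show "set_integrable lborel {0..S} (\<lambda>s. exp (b S powr q) * exp (- s))" using i' by simp
        fix s assume s: "s \<in> {0..S}"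
        have "b s powr q \<le> b S powr q" using s b0 bm q by (intro powr_mono2) auto
        then show "exp (\<bar>prim (w n) s\<bar> powr q - s) \<le> exp (b S powr q) * exp (- s)"
          unfolding exp_add[symmetric] b_def[symmetric] using b0[of s] by simp
      qed (rule int, auto)
      also have "\<dots> = exp (b S powr q) * (LINT s:{0..S}|lborel. exp (- s))" by simp
      also have "(LINT s:{0..S}|lborel. exp (- s)) \<le> 1"
      proof -
        have "(LINT s:{0::real..}|lborel. exp (- 1 * s)) = (LINT s:{0..S}|lborel. exp (- 1 * s)) + (LINT s:{S..}|lborel. exp (- 1 * s))"
          using i S by (intro set_integral_split_inf) auto
        moreover have "(LINT s:{0::real..}|lborel. exp (- 1 * s)) = exp (- 1 * 0) / 1" by (rule integral_exp_decay) simp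
        moreover have "0 \<le> (LINT s:{S..}|lborel. exp (- 1 * s))"
          unfolding set_lebesgue_integral_def by (intro integral_nonneg_AE) auto
        ultimately show ?thesis by simp
      qed
      finally show ?thesis using 1 by (simp add: b_def mult_left_mono)
    qed
    have middle: "(LINT s:X|lborel. exp (\<bar>prim (w n) s\<bar> powr q - s)) \<le> e / 3"
      if X: "X \<in> sets borel" "X \<subseteq> {S..}" "\<And>s. s \<in> X \<Longrightarrow> b s powr q \<le> s - 2 * ln s" for X
    proof -
      have "(LINT s:X|lborel. exp (\<bar>prim (w n) s\<bar> powr q - s)) \<le> (LINT s:{S..}|lborel. exp (- 2 * ln s))"
        unfolding set_lebesgue_integral_def
      proof (rule integral_mono)
        show "integrable lborel (\<lambda>s. indicat_real X s *\<^sub>R exp (\<bar>prim (w n) s\<bar> powr q - s))"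
        proof -
          have "X \<subseteq> {0..}" using X(2) S by force
          from int[OF X(1) this] show ?thesis by (simp add: set_integrable_def)
        qed
        show "integrable lborel (\<lambda>s. indicat_real {S..} s *\<^sub>R exp (- 2 * ln s))"
          using inverse_square_tail(1)[of S] S by (auto simp: set_integrable_def)
        show "indicat_real X s *\<^sub>R exp (\<bar>prim (w n) s\<bar> powr q - s) \<le> indicat_real {S..} s *\<^sub>R exp (- 2 * ln s)" for s
          using X(2) X(3)[of s] b0[of s] by (auto simp: indicator_def b_def)
      qed
      also have "\<dots> = 1 / S" using S by (intro inverse_square_tail) auto
      also have "\<dots> \<le> e / 3" using S0[OF S(2)] by simp
      finally show ?thesis .
    qed
    have "expint q (w n) {S..} \<le> exp (A + cst p) + 2 * e / 3"
    proof (cases "\<exists>s\<ge>S. b s powr q \<ge> s - 2 * ln s")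
      case False
      then have "\<And>s. S \<le> s \<Longrightarrow> b s powr q \<le> s - 2 * ln s" by (meson linear)
      then have "expint q (w n) {S..} \<le> e / 3" unfolding expint_def by (intro middle) (auto simp: not_le less_eq_real_def)
      moreover have "0 \<le> exp (A + cst p) + e / 3" using e by (simp add: add_nonneg_nonneg)
      ultimately show ?thesis by simp
    next
      case True
      then obtain s1 where s1: "s1 \<ge> S" "b s1 powr q \<ge> s1 - 2 * ln s1" by blast
      define f where "f s = b s powr q - (s - 2 * ln s)" for s
      have fc: "continuous_on {S..s1} f"
        unfolding f_def using S q b0
        by (intro continuous_intros continuous_on_powr' continuous_on_subset[OF bc]) auto
      \<comment> \<open>The primitive starts below the curve at \<open>S\<close>, so compactness of
        the zero set yields a first crossing and the intermediate value theorem keeps everything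
        before it below the curve.\<close>
      define Z where "Z = {s \<in> {S..s1}. f s = 0}"
      have Zc: "compact Z"
      proof -
        have "closed Z" unfolding Z_def by (rule continuous_closed_preimage_constant[OF fc]) simp
        then show ?thesis unfolding compact_eq_bounded_closed Z_def
          by (auto intro: bounded_subset[of "{S..s1}"])
      qed
      have fS: "f S < 0" using 2 by (simp add: f_def b_def)
      have ivt: "\<exists>s\<in>Z. s \<le> t" if "t \<in> {S..s1}" "f t \<ge> 0" for t
      proof -
        have "\<exists>s\<ge>S. s \<le> t \<and> f s = 0"
          using that fS by (intro IVT' continuous_on_subset[OF fc]) auto
        then show ?thesis using that by (auto simp: Z_def)
      qed
      have "Z \<noteq> {}" using ivt[of s1] s1 by (auto simp: f_def)
      then obtain a where a: "a \<in> Z" "\<And>s. s \<in> Z \<Longrightarrow> a \<le> s" using compact_attains_inf[OF Zc] by blast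
      have aS: "a \<ge> S" "b a powr q = a - 2 * ln a" using a(1) by (auto simp: Z_def f_def)
      have before: "b s powr q \<le> s - 2 * ln s" if "s \<in> {S..a}" for s
      proof (rule ccontr)
        assume "\<not> ?thesis"
        then have fs: "f s > 0" by (simp add: f_def)
        moreover have "s \<in> {S..s1}" using that a(1) by (auto simp: Z_def)
        ultimately obtain s' where s': "s' \<in> Z" "s' \<le> s" using ivt[of s] by auto
        then have "a \<le> s'" using a(2) by blast
        then have "s = a" using s' that by auto
        then show False using fs aS by (simp add: f_def)
      qed
      have "expint q (w n) {S..a} \<le> e / 3" unfolding expint_def using before by (intro middle) auto
      moreover have "expint q (w n) {S..} = expint q (w n) {S..a} + expint q (w n) {a..}"
        unfolding expint_def using aS S by (intro set_integral_split_inf int) auto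
      moreover have "expint q (w n) {a..} \<le> exp (A + cst p) + e / 3"
      proof -
        have "expint (p / (p - 1)) (w n) {a..} \<le> exp (Ghat A a + cst p) / (1 - dhat A a powr (1 / (p - 1)))"
        proof (rule tail_after_crossing[OF A w(1) w(2) w(3)])
          show "prim (w n) a powr (p / (p - 1)) = a - 2 * ln a" using aS by (simp add: b_def q(2))
        qed (use 3 aS S S0[of a] in auto)
        then show ?thesis using S0[of a] aS S by (simp add: q(2))
      qed
      ultimately show ?thesis by simp
    qed
    then show "expint (p / (p - 1)) (w n) {0..} \<le> 1 + exp (A + cst p) + e"
      using J0 first by (simp add: q(2))
  qed
qed

text \<open>The gain is at least of order 1/x because \<open>q \<le> 2\<close>, while all losses are
  exponentially small; one large integer time therefore suffices.\<close>

lemma exceeds_level: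
  assumes A: "\<And>T. T > 0 \<Longrightarrow> tau T \<le> T + A" "C \<ge> 0" "\<And>n::nat. n \<ge> 1 \<Longrightarrow> A \<le> tau n - n + C * exp (- real n / 2)"
  obtains g where "Lp p g" "enrg p g {0..} - \<nu> * mass p g {0..} \<le> 1" "1 + exp (A + cst p) < expint (p / (p - 1)) g {0..}"
proof -
  have A0: "A \<ge> 0" using A(1)[of 1] tau_ge[of 1] by simp
  define q where "q = p / (p - 1)"
  have q: "q > 1" "q \<le> 2" "p / (p - 1) = q" using p by (simp_all add: q_def field_simps)
  define c where "c = exp (- 3) * p powr (- 1 / (p - 1))"
  have c: "c > 0" using p by (simp add: c_def)
  define D where "D = (p - 1) * exp (p - 1 - cst p)"
  have D: "D \<ge> 0" using p by (simp add: D_def)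
  define B where "B = exp (A + cst p)"
  have B: "B > 0" by (simp add: B_def)
  \<comment> \<open>All losses: the missing part of the outer integral and, relative to
    \<open>B\<close>, the rate of \<open>tau\<close>, the near-optimality parameter, and the
    remainder of \<open>cst_bounds\<close>.\<close>
  define lo where "lo x = exp (- x) + B * (C * exp (- x / 2) + (x + A) * exp (- x) + D * exp (- x / 2))" for x :: real
  \<comment> \<open>The gain with the length bounded below by \<open>x / 2\<close>,
    \<open>tau\<close> above by \<open>x + A\<close>, and \<open>q\<close> replaced by 2.\<close>
  define hi where "hi x = c * (x / 2) * (1 / (2 * (x + A)))\<^sup>2" for x :: real
  have "((\<lambda>x. x * exp (- x) + B * (C * (x * exp (- x / 2)) + (x\<^sup>2 * exp (- x) + A * (x * exp (- x))) + D * (x * exp (- x / 2)))) \<longlongrightarrow>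
     0 + B * (C * 0 + (0 + A * 0) + D * 0)) at_top"
    by (intro tendsto_intros) real_asymp+
  then have "((\<lambda>x. x * lo x) \<longlongrightarrow> 0) at_top"
    by (simp add: lo_def algebra_simps power2_eq_square)
  moreover have "((\<lambda>x. x * hi x) \<longlongrightarrow> c / 8) at_top"
  proof -
    have "((\<lambda>x. x / (x + A)) \<longlongrightarrow> 1) at_top" by real_asymp
    then have "((\<lambda>x. c / 8 * (x / (x + A))\<^sup>2) \<longlongrightarrow> c / 8 * 1\<^sup>2) at_top" by (intro tendsto_intros)
    moreover have "c / 8 * (x / y)\<^sup>2 = x * (c * (x / 2) * (1 / (2 * y))\<^sup>2)" for x y
      by (simp add: power2_eq_square)
    then have "(\<lambda>x. c / 8 * (x / (x + A))\<^sup>2) = (\<lambda>x. x * hi x)"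
      by (simp only: hi_def)
    ultimately show ?thesis by simp
  qed
  ultimately have "((\<lambda>x. x * hi x - x * lo x) \<longlongrightarrow> c / 8 - 0) at_top" by (intro tendsto_diff)
  then have "\<forall>\<^sub>F x in at_top. 0 < x * hi x - x * lo x" by (rule order_tendstoD(1)) (use c in simp)
  moreover have "\<forall>\<^sub>F x in at_top. 2 * ((x + A) * exp (- x)) < 1" by real_asymp
  ultimately have "\<forall>\<^sub>F x in at_top. 0 < x * hi x - x * lo x \<and> 2 * ((x + A) * exp (- x)) < 1 \<and> x \<ge> 4"
    using eventually_ge_at_top[of 4] by eventually_elim auto
  then have "\<forall>\<^sub>F n in sequentially. 0 < real n * hi (real n) - real n * lo (real n) \<and> 2 * ((real n + A) * exp (- real n)) < 1 \<and> real n \<ge> 4"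
    by (rule eventually_compose_filterlim[OF _ filterlim_real_sequentially])
  then obtain n :: nat where n0: "0 < real n * hi (real n) - real n * lo (real n)" "2 * ((real n + A) * exp (- real n)) < 1" "real n \<ge> 4"
    by (auto simp: eventually_sequentially)
  define x where "x = real n"
  have x: "x \<ge> 4" "lo x < hi x" using n0 by (auto simp: x_def simp flip: right_diff_distrib simp: zero_less_mult_iff)
  \<comment> \<open>Its cost is invisible against the gain, and it is small enough for
    \<open>near_minimizer_lower\<close> since \<open>tau\<close> grows only linearly.\<close>
  define \<epsilon> where "\<epsilon> = exp (- x)"
  define t where "t = tau x"
  have t: "x \<le> t" "t \<le> x + A" using tau_ge[of x] A(1)[of x] x by (auto simp: t_def)
  have small: "(x + A) * \<epsilon> < 1 / 2" using n0(2) by (simp add: x_def \<epsilon>_def)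
  have te: "t * \<epsilon> \<le> (x + A) * \<epsilon>" using t by (intro mult_right_mono) (auto simp: \<epsilon>_def)
  have \<epsilon>: "0 < \<epsilon>" "\<epsilon> \<le> 1 / (2 * tau x)"
  proof -
    show "0 < \<epsilon>" by (simp add: \<epsilon>_def)
    have "t * \<epsilon> < 1 / 2" using te small by (rule le_less_trans)
    moreover have "\<epsilon> * (2 * t) = 2 * (t * \<epsilon>)" by (simp only: mult_ac)
    ultimately have "\<epsilon> * (2 * t) \<le> 1" by linarith
    then show "\<epsilon> \<le> 1 / (2 * tau x)" using t x by (simp add: t_def field_simps)
  qed
  define \<rho> where "\<rho> = t * (1 - \<epsilon>)"
  have \<rho>1: "t - (x + A) * \<epsilon> \<le> \<rho>" using te by (simp add: \<rho>_def algebra_simps)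
  have \<rho>2: "x / 2 \<le> \<rho>" using \<rho>1 small t x by simp
  obtain g where g: "Lp p g" "enrg p g {0..} - \<nu> * mass p g {0..} \<le> 1"
    "1 - exp (- x) + exp (- 3) * (p powr (- 1 / (p - 1)) * \<rho> * (1 / (2 * t)) powr q)
      + exp (\<rho> - x + cst p - (p - 1) * exp (p - 1 - cst p - \<rho>)) \<le> expint q g {0..}"
    using test_function_estimate[OF x(1) \<epsilon>] unfolding q(3) \<rho>_def t_def by blast
  have gain: "hi x \<le> exp (- 3) * (p powr (- 1 / (p - 1)) * \<rho> * (1 / (2 * t)) powr q)"
  proof -
    have "(1 / (2 * (x + A)))\<^sup>2 \<le> (1 / (2 * t))\<^sup>2"
      using t x by (intro power_mono) (auto intro!: divide_left_mono)
    also have "\<dots> = (1 / (2 * t)) powr 2" using t x by simp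
    also have "\<dots> \<le> (1 / (2 * t)) powr q" using t x q by (intro powr_mono') auto
    finally have "c * (x / 2) * (1 / (2 * (x + A)))\<^sup>2 \<le> c * \<rho> * (1 / (2 * t)) powr q"
      using c \<rho>2 x by (intro mult_mono) auto
    then show ?thesis by (simp add: hi_def c_def mult_ac)
  qed
  have main: "B * (1 - (C * exp (- x / 2) + (x + A) * exp (- x) + D * exp (- x / 2))) \<le> exp (\<rho> - x + cst p - (p - 1) * exp (p - 1 - cst p - \<rho>))"
  proof -
    define z where "z = C * exp (- x / 2) + (x + A) * exp (- x) + D * exp (- x / 2)"
    have 1: "(p - 1) * exp (p - 1 - cst p - \<rho>) \<le> D * exp (- x / 2)"
    proof -
      have "exp (p - 1 - cst p - \<rho>) \<le> exp (p - 1 - cst p + - x / 2)" using \<rho>2 by simp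
      also have "\<dots> = exp (p - 1 - cst p) * exp (- x / 2)" by (rule exp_add)
      finally show ?thesis unfolding D_def mult.assoc using p by (intro mult_left_mono) auto
    qed
    have 2: "A \<le> t - x + C * exp (- x / 2)" using A(3)[of n] x by (simp add: x_def t_def)
    have "A + cst p + - (C * exp (- x / 2) + (x + A) * exp (- x) + D * exp (- x / 2)) \<le> \<rho> - x + cst p - (p - 1) * exp (p - 1 - cst p - \<rho>)"
      using 1 2 \<rho>1 by (simp add: \<epsilon>_def)
    then have "exp (A + cst p) * exp (- (C * exp (- x / 2) + (x + A) * exp (- x) + D * exp (- x / 2))) \<le> exp (\<rho> - x + cst p - (p - 1) * exp (p - 1 - cst p - \<rho>))"
      unfolding exp_add[symmetric] exp_le_cancel_iff .
    then have "B * exp (- z) \<le> exp (\<rho> - x + cst p - (p - 1) * exp (p - 1 - cst p - \<rho>))"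
      unfolding B_def z_def .
    moreover have "B * (1 + - z) \<le> B * exp (- z)"
      using B by (intro mult_left_mono exp_ge_add_one_self) auto
    ultimately have "B * (1 - z) \<le> exp (\<rho> - x + cst p - (p - 1) * exp (p - 1 - cst p - \<rho>))" by simp
    then show ?thesis unfolding z_def .
  qed
  have "1 + B < expint q g {0..}"
    using g(3) gain main x(2) by (simp add: lo_def algebra_simps)
  then show ?thesis using that g by (simp add: B_def q(3))
qed

end

section \<open>Existence of a maximiser\<close>

context moser
begin

definition adm :: "(real \<Rightarrow> real) \<Rightarrow> bool" where
  "adm w \<longleftrightarrow> Lp p w \<and> enrg p w {0..} - \<nu> * mass p w {0..} \<le> 1"

lemma adm_enrg:
  assumes "adm w"
  shows "enrg p w {0..} \<le> 1 / (1 - \<kappa>)"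
proof -
  have "(1 - \<kappa>) * enrg p w {0..} \<le> enrg p w {0..} - \<nu> * mass p w {0..}"
    using coerc[of w] assms by (simp add: adm_def algebra_simps)
  also have "\<dots> \<le> 1" using assms by (simp add: adm_def)
  finally show ?thesis using \<kappa> by (simp add: field_simps)
qed

lemma mass_mono_prim:
  assumes "Lp p v" "Lp p w" "\<And>s. s \<ge> 0 \<Longrightarrow> \<bar>prim v s\<bar> \<le> \<bar>prim w s\<bar>"
  shows "mass p v {0..} \<le> mass p w {0..}"
  unfolding mass_def using assms p1
  by (intro set_integral_mono mass_integrable mult_right_mono powr_mono2) auto

lemma expint_mono_prim:
  assumes "Lp p v" "Lp p w" "\<And>s. s \<ge> 0 \<Longrightarrow> \<bar>prim v s\<bar> \<le> \<bar>prim w s\<bar>"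
  shows "expint (p / (p - 1)) v {0..} \<le> expint (p / (p - 1)) w {0..}"
  unfolding expint_def
proof (rule set_integral_mono)
  fix s :: real assume "s \<in> {0..}"
  then have "\<bar>prim v s\<bar> powr (p / (p - 1)) \<le> \<bar>prim w s\<bar> powr (p / (p - 1))"
    using assms(3) p by (intro powr_mono2) auto
  then show "exp (\<bar>prim v s\<bar> powr (p / (p - 1)) - s) \<le> exp (\<bar>prim w s\<bar> powr (p / (p - 1)) - s)" by simp
qed (use assms(1,2) p1 in \<open>auto intro!: expint_integrable\<close>)

text \<open>Moduli keep the energy and enlarge the primitive; as the mass enters the constraint with
  a negative sign, both constraint and functional improve.\<close>

lemma adm_abs:
  assumes "adm w"
  shows "adm (\<lambda>s. \<bar>w s\<bar>)" "expint (p / (p - 1)) w {0..} \<le> expint (p / (p - 1)) (\<lambda>s. \<bar>w s\<bar>) {0..}"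
proof -
  have w: "Lp p w" "Lp p (\<lambda>s. \<bar>w s\<bar>)" using assms Lp_abs by (auto simp: adm_def)
  have le: "\<bar>prim w s\<bar> \<le> \<bar>prim (\<lambda>s. \<bar>w s\<bar>) s\<bar>" for s using prim_abs_le[of w s] by linarith
  have "\<nu> * mass p w {0..} \<le> \<nu> * mass p (\<lambda>s. \<bar>w s\<bar>) {0..}"
    using le \<nu> by (intro mult_left_mono mass_mono_prim w) auto
  then show "adm (\<lambda>s. \<bar>w s\<bar>)" using assms w by (simp add: adm_def)
  show "expint (p / (p - 1)) w {0..} \<le> expint (p / (p - 1)) (\<lambda>s. \<bar>w s\<bar>) {0..}"
    using le by (intro expint_mono_prim w) auto
qed

lemma equi_bound:
  assumes "Lp p w" "enrg p w {0..} \<le> E" "0 \<le> s" "s \<le> t"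
  shows "\<bar>prim w t - prim w s\<bar> \<le> (t - s) powr ((p - 1) / p) * E powr (1 / p)"
  using assms p by (intro order.trans[OF prim_holder'[OF assms(1) p1(1) assms(3,4)]] mult_left_mono powr_mono2) auto

text \<open>Arzela-Ascoli on the half line: a diagonal subsequence converges at rational times, and
  Hoelder's inequality supplies the equicontinuity that spreads convergence to all times.\<close>

lemma pointwise_subsequence:
  fixes w :: "nat \<Rightarrow> real \<Rightarrow> real"
  assumes w: "\<And>n. Lp p (w n)" "\<And>n. enrg p (w n) {0..} \<le> E"
  obtains k b where "strict_mono (k :: nat \<Rightarrow> nat)" "\<And>s. s \<ge> 0 \<Longrightarrow> (\<lambda>n. prim (w (k n)) s) \<longlonglongrightarrow> b s"
    "continuous_on {0..} b"
proof -
  define q where "q = (p - 1) / p"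
  have q: "0 < q" "q < 1" using p by (simp_all add: q_def)
  define H where "H = E powr (1 / p)"
  have H: "H \<ge> 0" by (simp add: H_def)
  have eq: "\<bar>prim (w n) t - prim (w n) s\<bar> \<le> (t - s) powr q * H" if "0 \<le> s" "s \<le> t" for n s t
    unfolding q_def H_def using w that by (intro equi_bound) auto
  \<comment> \<open>The diagonal argument asks for one bound at all times; dividing by
    \<open>1 + x\<close> removes the growth of the primitives.\<close>
  have bd: "norm (prim (w n) x / (1 + x)) \<le> H" if "x \<in> \<rat> \<inter> {0..}" for n x
  proof -
    have x: "x \<ge> 0" using that by simp
    have "\<bar>prim (w n) x\<bar> \<le> x powr q * H" using eq[of 0 x n] x by simp
    also have "\<dots> \<le> (1 + x) * H"
    proof (intro mult_right_mono H)
      have "x powr q \<le> (1 + x) powr q" using x q by (intro powr_mono2) auto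
      also have "\<dots> \<le> (1 + x) powr 1" using x q by (intro powr_mono) auto
      finally show "x powr q \<le> 1 + x" using x by simp
    qed
    finally show ?thesis using x by (simp add: field_simps)
  qed
  have cou: "countable (\<rat> \<inter> {0::real..})" using countable_rat by (rule countable_Int1)
  obtain k :: "nat \<Rightarrow> nat" where k: "strict_mono k" "\<And>x. x \<in> \<rat> \<inter> {0::real..} \<Longrightarrow> \<exists>l. (\<lambda>n. prim (w (k n)) x / (1 + x)) \<longlonglongrightarrow> l"
    by (rule function_convergent_subsequence[OF cou, of "\<lambda>n x. prim (w n) x / (1 + x)" H]) (use bd in blast)+
  have rat: "Cauchy (\<lambda>n. prim (w (k n)) x)" if x: "x \<in> \<rat>" "x \<ge> 0" for x
  proof -
    obtain l where "(\<lambda>n. prim (w (k n)) x / (1 + x)) \<longlonglongrightarrow> l" using k(2)[of x] x by auto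
    then have "(\<lambda>n. prim (w (k n)) x / (1 + x) * (1 + x)) \<longlonglongrightarrow> l * (1 + x)" by (intro tendsto_intros)
    then have "(\<lambda>n. prim (w (k n)) x) \<longlonglongrightarrow> l * (1 + x)" using x by simp
    then show ?thesis by (rule LIMSEQ_imp_Cauchy)
  qed
  have "\<exists>l. (\<lambda>n. prim (w (k n)) s) \<longlonglongrightarrow> l" if s: "s \<ge> 0" for s
  proof -
    have "Cauchy (\<lambda>n. prim (w (k n)) s)"
    proof (rule metric_CauchyI)
      fix e :: real assume e: "e > 0"
      have "((\<lambda>x. (x - s) powr q * H) \<longlongrightarrow> 0 powr q * H) (at_right s)"
        using q by (intro tendsto_intros tendsto_powr') (auto intro!: tendsto_eq_intros eventually_at_right_less[THEN eventually_mono])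
      then have "\<forall>\<^sub>F x in at_right s. (x - s) powr q * H < e / 3"
        using e q by (intro order_tendstoD) auto
      then obtain d where d: "d > s" "\<And>x. s < x \<Longrightarrow> x < d \<Longrightarrow> (x - s) powr q * H < e / 3"
        by (auto simp: eventually_at_right_field)
      obtain x where x: "x \<in> \<rat>" "s < x" "x < d" using Rats_dense_in_real[OF d(1)] by auto
      have sm: "\<bar>prim (w n) x - prim (w n) s\<bar> < e / 3" for n
        using eq[of s x n] d(2)[of x] x s by simp
      obtain N where N: "\<And>m n. m \<ge> N \<Longrightarrow> n \<ge> N \<Longrightarrow> dist (prim (w (k m)) x) (prim (w (k n)) x) < e / 3"
        using metric_CauchyD[OF rat[of x], of "e / 3"] x s e by auto
      have "dist (prim (w (k m)) s) (prim (w (k n)) s) < e" if "m \<ge> N" "n \<ge> N" for m n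
        using sm[of "k m"] sm[of "k n"] N[OF that] unfolding dist_real_def by linarith
      then show "\<exists>M. \<forall>m\<ge>M. \<forall>n\<ge>M. dist (prim (w (k m)) s) (prim (w (k n)) s) < e" by blast
    qed
    then show ?thesis using Cauchy_convergent convergent_def by blast
  qed
  then obtain b where b: "\<And>s. s \<ge> 0 \<Longrightarrow> (\<lambda>n. prim (w (k n)) s) \<longlonglongrightarrow> b s" by metis
  have hb: "\<bar>b t - b s\<bar> \<le> \<bar>t - s\<bar> powr q * H" if "0 \<le> s" "0 \<le> t" for s t
  proof -
    have "(\<lambda>n. \<bar>prim (w (k n)) t - prim (w (k n)) s\<bar>) \<longlonglongrightarrow> \<bar>b t - b s\<bar>" using b that by (intro tendsto_intros) auto
    moreover have "\<bar>prim (w (k n)) t - prim (w (k n)) s\<bar> \<le> \<bar>t - s\<bar> powr q * H" for n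
      using eq[of s t "k n"] eq[of t s "k n"] that by (cases "s \<le> t") (auto simp: abs_minus_commute)
    ultimately show ?thesis by (intro LIMSEQ_le_const2) auto
  qed
  have "continuous_on {0..} b"
    unfolding continuous_on_def
  proof
    fix s :: real assume s: "s \<in> {0..}"
    have "((\<lambda>t. \<bar>t - s\<bar> powr q * H) \<longlongrightarrow> 0 powr q * H) (at s within {0..})"
      using q by (intro tendsto_intros tendsto_powr') (auto intro!: tendsto_eq_intros)
    then have "((\<lambda>t. \<bar>t - s\<bar> powr q * H) \<longlongrightarrow> 0) (at s within {0..})" using q by simp
    then have "((\<lambda>t. b t - b s) \<longlongrightarrow> 0) (at s within {0..})"
    proof (rule Lim_null_comparison[rotated])
      show "\<forall>\<^sub>F t in at s within {0..}. norm (b t - b s) \<le> \<bar>t - s\<bar> powr q * H"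
        using hb s by (auto simp: eventually_at intro!: exI[of _ 1])
    qed
    then show "(b \<longlongrightarrow> b s) (at s within {0..})" by (rule LIM_zero_cancel)
  qed
  then show ?thesis using that k(1) b by blast
qed

text \<open>The weight \<open>exp (- s)\<close> beats the Hoelder growth
  \<open>s powr (p - 1)\<close>, so the potential passes to the limit even when energy
  escapes.\<close>

lemma mass_limit:
  fixes w :: "nat \<Rightarrow> real \<Rightarrow> real"
  assumes w: "\<And>n. Lp p (w n)" "\<And>n. enrg p (w n) {0..} \<le> E" and b: "\<And>s. s \<ge> 0 \<Longrightarrow> (\<lambda>n. prim (w n) s) \<longlonglongrightarrow> prim u s"
    and u: "Lp p u"
  shows "(\<lambda>n. mass p (w n) {0..}) \<longlonglongrightarrow> mass p u {0..}"
  unfolding mass_def set_lebesgue_integral_def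
proof (rule integral_dominated_convergence)
  show "(\<lambda>s. indicat_real {0..} s *\<^sub>R (\<bar>prim u s\<bar> powr p * exp (- s))) \<in> borel_measurable lborel"
    using mass_integrable[OF u p1(1), of "{0..}"] by (auto simp: set_integrable_def)
  show "(\<lambda>s. indicat_real {0..} s *\<^sub>R (\<bar>prim (w n) s\<bar> powr p * exp (- s))) \<in> borel_measurable lborel" for n
    using mass_integrable[OF w(1) p1(1), of "{0..}"] by (auto simp: set_integrable_def)
  show "integrable lborel (\<lambda>s. indicat_real {0..} s *\<^sub>R (E * (s powr (p - 1) * exp (- s))))"
    using set_integrable_mult_right[OF set_integrable_powr_exp[of "p - 1"], of E] p
    unfolding set_integrable_def by simp
  show "AE s in lborel. (\<lambda>n. indicat_real {0..} s *\<^sub>R (\<bar>prim (w n) s\<bar> powr p * exp (- s)))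
      \<longlonglongrightarrow> indicat_real {0..} s *\<^sub>R (\<bar>prim u s\<bar> powr p * exp (- s))"
  proof (rule AE_I2)
    fix s :: real
    show "(\<lambda>n. indicat_real {0..} s *\<^sub>R (\<bar>prim (w n) s\<bar> powr p * exp (- s)))
      \<longlonglongrightarrow> indicat_real {0..} s *\<^sub>R (\<bar>prim u s\<bar> powr p * exp (- s))"
    proof (cases "s \<ge> 0")
      case True
      have "(\<lambda>n. \<bar>prim (w n) s\<bar> powr p) \<longlonglongrightarrow> \<bar>prim u s\<bar> powr p"
        using b[OF True] p by (intro tendsto_powr' tendsto_rabs tendsto_const) auto
      then show ?thesis by (intro tendsto_scaleR tendsto_mult tendsto_const)
    qed simp
  qed
  show "AE s in lborel. norm (indicat_real {0..} s *\<^sub>R (\<bar>prim (w n) s\<bar> powr p * exp (- s)))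
      \<le> indicat_real {0..} s *\<^sub>R (E * (s powr (p - 1) * exp (- s)))" for n
  proof (rule AE_I2)
    fix s :: real
    show "norm (indicat_real {0..} s *\<^sub>R (\<bar>prim (w n) s\<bar> powr p * exp (- s))) \<le> indicat_real {0..} s *\<^sub>R (E * (s powr (p - 1) * exp (- s)))"
    proof (cases "s \<ge> 0")
      case True
      have "\<bar>prim (w n) s\<bar> powr p \<le> s powr (p - 1) * enrg p (w n) {0..}" by (rule prim_bound'[OF w(1) p1(1) True])
      also have "\<dots> \<le> s powr (p - 1) * E" using w(2) by (intro mult_left_mono) auto
      finally have "\<bar>prim (w n) s\<bar> powr p * exp (- s) \<le> s powr (p - 1) * E * exp (- s)" by (intro mult_right_mono) auto
      then show ?thesis using True by (simp add: mult_ac)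
    qed simp
  qed
qed

text \<open>Tail energies bounded away from 1 make the exponent uniformly subcritical: one slope
  \<open>d' powr q < 1\<close> serves the whole sequence and yields a common majorant.\<close>

lemma expint_limit:
  fixes w :: "nat \<Rightarrow> real \<Rightarrow> real"
  assumes w: "\<And>n. Lp p (w n)" "\<And>n. enrg p (w n) {0..} \<le> E" and b: "\<And>s. s \<ge> 0 \<Longrightarrow> (\<lambda>n. prim (w n) s) \<longlonglongrightarrow> prim u s"
    and u: "Lp p u" and tail: "T \<ge> 0" "\<delta> < 1" "\<And>n. enrg p (w n) {T..} \<le> \<delta>"
  shows "(\<lambda>n. expint (p / (p - 1)) (w n) {0..}) \<longlonglongrightarrow> expint (p / (p - 1)) u {0..}"
proof -
  define q where "q = p / (p - 1)"
  have q: "q > 1" "p / (p - 1) = q" "(p - 1) / p = 1 / q" using p by (simp_all add: q_def field_simps)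
  have \<delta>0: "\<delta> \<ge> 0" using tail(3)[of 0] enrg_nonneg order.trans by blast
  define d where "d = \<delta> powr (1 / p)"
  have "\<delta> powr (1 / p) < 1 powr (1 / p)" using \<delta>0 tail(2) p by (intro powr_less_mono2) auto
  then have d: "0 \<le> d" "d < 1" by (auto simp: d_def)
  define d' where "d' = (1 + d) / 2"
  have d': "d < d'" "0 < d'" "d' < 1" using d by (simp_all add: d'_def)
  define K where "K = T powr (1 / q) * E powr (1 / p)"
  have K: "K \<ge> 0" by (simp add: K_def)
  have all: "\<bar>prim (w n) s\<bar> \<le> K + d * s powr (1 / q)" if s: "s \<ge> 0" for n s
  proof (cases "s \<le> T")
    case True
    have "\<bar>prim (w n) s\<bar> \<le> s powr (1 / q) * E powr (1 / p)" using equi_bound[OF w(1,2), of 0 s n] s by (simp add: q(3))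
    also have "\<dots> \<le> K" unfolding K_def using s True q by (intro mult_right_mono powr_mono2) auto
    also have "\<dots> \<le> K + d * s powr (1 / q)" using d by simp
    finally show ?thesis .
  next
    case False
    have "\<bar>prim (w n) T\<bar> \<le> K" using equi_bound[OF w(1,2), of 0 T n] tail(1) by (simp add: q(3) K_def)
    moreover have "enrg p (w n) {T..} powr (1/p) \<le> d" unfolding d_def using tail(3)[of n] p by (intro powr_mono2) auto
    then have "enrg p (w n) {T..} powr (1/p) * s powr (1 / q) \<le> d * s powr (1 / q)" by (intro mult_right_mono) auto
    ultimately show ?thesis using prim_tail_bound[OF w(1) p1(1) tail(1), of s n] False by (simp add: q(3))
  qed
  obtain C where C: "C \<ge> 0" "\<And>s. s \<ge> 0 \<Longrightarrow> (K + d * s powr (1 / q)) powr q \<le> C + d' powr q * s"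
    using powr_growth[OF q(1) d(1) d'(1) K] by auto
  have dq: "d' powr q < 1" using d' q powr_less_mono2[of q d' 1] by simp
  show ?thesis unfolding expint_def set_lebesgue_integral_def
  proof (rule integral_dominated_convergence)
    show "(\<lambda>s. indicat_real {0..} s *\<^sub>R exp (\<bar>prim u s\<bar> powr (p / (p - 1)) - s)) \<in> borel_measurable lborel"
      using expint_integrable[OF u p1(1), of "{0..}"] by (auto simp: set_integrable_def)
    show "(\<lambda>s. indicat_real {0..} s *\<^sub>R exp (\<bar>prim (w n) s\<bar> powr (p / (p - 1)) - s)) \<in> borel_measurable lborel" for n
      using expint_integrable[OF w(1) p1(1), of "{0..}"] by (auto simp: set_integrable_def)
    show "integrable lborel (\<lambda>s. indicat_real {0..} s *\<^sub>R (exp C * exp (- (1 - d' powr q) * s)))"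
      using set_integrable_exp_decay[of "1 - d' powr q" 0] dq
        set_integrable_mult_right[of "exp C" lborel "{0..}" "\<lambda>s. exp (- (1 - d' powr q) * s)"]
      unfolding set_integrable_def by simp
    show "AE s in lborel. (\<lambda>n. indicat_real {0..} s *\<^sub>R exp (\<bar>prim (w n) s\<bar> powr (p / (p - 1)) - s))
      \<longlonglongrightarrow> indicat_real {0..} s *\<^sub>R exp (\<bar>prim u s\<bar> powr (p / (p - 1)) - s)"
    proof (rule AE_I2)
      fix s :: real
      show "(\<lambda>n. indicat_real {0..} s *\<^sub>R exp (\<bar>prim (w n) s\<bar> powr (p / (p - 1)) - s))
        \<longlonglongrightarrow> indicat_real {0..} s *\<^sub>R exp (\<bar>prim u s\<bar> powr (p / (p - 1)) - s)"
      proof (cases "s \<ge> 0")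
        case True
        have "(\<lambda>n. \<bar>prim (w n) s\<bar> powr (p / (p - 1))) \<longlonglongrightarrow> \<bar>prim u s\<bar> powr (p / (p - 1))"
          using b[OF True] q by (intro tendsto_powr' tendsto_rabs tendsto_const) auto
        then show ?thesis by (intro tendsto_scaleR tendsto_exp tendsto_diff tendsto_const)
      qed simp
    qed
    show "AE s in lborel. norm (indicat_real {0..} s *\<^sub>R exp (\<bar>prim (w n) s\<bar> powr (p / (p - 1)) - s))
      \<le> indicat_real {0..} s *\<^sub>R (exp C * exp (- (1 - d' powr q) * s))" for n
    proof (rule AE_I2)
      fix s :: real
      show "norm (indicat_real {0..} s *\<^sub>R exp (\<bar>prim (w n) s\<bar> powr (p / (p - 1)) - s))
        \<le> indicat_real {0..} s *\<^sub>R (exp C * exp (- (1 - d' powr q) * s))"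
      proof (cases "s \<ge> 0")
        case True
        have "\<bar>prim (w n) s\<bar> powr q \<le> (K + d * s powr (1 / q)) powr q"
          using all[OF True, of n] q by (intro powr_mono2) auto
        also have "\<dots> \<le> C + d' powr q * s" by (rule C(2)[OF True])
        finally have "\<bar>prim (w n) s\<bar> powr q - s \<le> C + - (1 - d' powr q) * s" by (simp add: algebra_simps)
        then have "exp (\<bar>prim (w n) s\<bar> powr q - s) \<le> exp C * exp (- (1 - d' powr q) * s)"
          unfolding exp_add[symmetric] exp_le_cancel_iff .
        then show ?thesis using True by (simp add: q(2))
      qed simp
    qed
  qed
qed

text \<open>Along a maximising sequence either some energy stays at a bounded distance, and the
  functional converges, or all of it escapes to infinity; then the limit vanishes by
  coercivity and the level is at most the concentration level, which is exceeded.\<close>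
lemma exists_maximizer:
  obtains w where "adm w" "\<And>s. w s \<ge> 0" "\<And>v. adm v \<Longrightarrow> expint (p / (p - 1)) v {0..} \<le> expint (p / (p - 1)) w {0..}"
    "1 < expint (p / (p - 1)) w {0..}"
proof -
  define J where "J w = expint (p / (p - 1)) w {0..}" for w
  define E where "E = 1 / (1 - \<kappa>)"
  obtain A C where A: "\<And>T. T > 0 \<Longrightarrow> tau T \<le> T + A" "C \<ge> 0" "\<And>n::nat. n \<ge> 1 \<Longrightarrow> A \<le> tau n - n + C * exp (- real n / 2)"
    by (rule tau_asymp, rule that)
  obtain g where g: "adm g" "1 + exp (A + cst p) < J g"
    by (rule exceeds_level[OF A], assumption, assumption, rule that) (auto simp: adm_def J_def)
  \<comment> \<open>Taken in the extended reals, since finiteness is obtained only when the value is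
    attained.\<close>
  define S where "S = Sup ((\<lambda>w. ereal (J w)) ` {w. adm w})"
  have JS: "ereal (J w) \<le> S" if "adm w" for w
    unfolding S_def using that by (intro Sup_upper) auto
  have "(\<lambda>w. ereal (J w)) ` {w. adm w} \<noteq> {}" using g by auto
  then obtain f :: "nat \<Rightarrow> ereal" where f: "incseq f" "range f \<subseteq> (\<lambda>w. ereal (J w)) ` {w. adm w}" "S = (SUP i. f i)"
    unfolding S_def using Sup_countable_SUP by metis
  have fS: "f \<longlonglongrightarrow> S" unfolding f(3) using f(1) by (rule LIMSEQ_SUP)
  have "\<forall>n. \<exists>w. adm w \<and> f n = ereal (J w)" using f(2) by auto
  then obtain w' where w': "\<And>n. adm (w' n)" "\<And>n. f n = ereal (J (w' n))" by metis
  define w where "w n = (\<lambda>s. \<bar>w' n s\<bar>)" for n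
  have w: "adm (w n)" "Lp p (w n)" "enrg p (w n) {0..} \<le> E" for n
    using adm_abs(1)[OF w'(1)[of n]] adm_enrg[of "w n"] by (auto simp: w_def adm_def E_def)
  have w0: "w n s \<ge> 0" for n s by (simp add: w_def)
  have wS: "(\<lambda>n. ereal (J (w n))) \<longlonglongrightarrow> S"
  proof (rule tendsto_sandwich[OF _ _ fS tendsto_const])
    show "\<forall>\<^sub>F n in sequentially. f n \<le> ereal (J (w n))"
      using adm_abs(2)[OF w'(1)] by (simp add: w'(2) w_def J_def)
    show "\<forall>\<^sub>F n in sequentially. ereal (J (w n)) \<le> S" using JS w by simp
  qed
  obtain k b where k: "strict_mono (k :: nat \<Rightarrow> nat)" "\<And>s. s \<ge> 0 \<Longrightarrow> (\<lambda>n. prim (w (k n)) s) \<longlonglongrightarrow> b s" "continuous_on {0..} b"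
    by (rule pointwise_subsequence[OF w(2,3)], rule that)
  define v where "v n = w (k n)" for n
  have v: "adm (v n)" "Lp p (v n)" "enrg p (v n) {0..} \<le> E" "v n s \<ge> 0" for n s
    using w w0 by (auto simp: v_def)
  have vb: "\<And>s. s \<ge> 0 \<Longrightarrow> (\<lambda>n. prim (v n) s) \<longlonglongrightarrow> b s" using k(2) by (simp add: v_def)
  have vS: "(\<lambda>n. ereal (J (v n))) \<longlonglongrightarrow> S"
    using LIMSEQ_subseq_LIMSEQ[OF wS k(1)] by (simp add: v_def o_def)
  \<comment> \<open>A preliminary limit whose purpose is to write the limit of the masses as a mass;
    its energy bound would be too weak for admissibility.\<close>
  obtain u0 where u0: "Lp p u0" "\<And>s. s \<ge> 0 \<Longrightarrow> prim u0 s = b s"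
    by (rule Lp_weak_limit[OF p v(2) v(3) tendsto_const vb k(3)], assumption, rule that)
  have mlim: "(\<lambda>n. mass p (v n) {0..}) \<longlonglongrightarrow> mass p u0 {0..}"
    using vb u0 by (intro mass_limit[OF v(2,3)]) auto
  have muq: "mass p u {0..} = mass p u0 {0..}" if "\<And>s. s \<ge> 0 \<Longrightarrow> prim u s = b s" for u
    unfolding mass_def using that u0(2) by (intro set_lebesgue_integral_cong) auto
  have vF: "enrg p (v n) {0..} \<le> 1 + \<nu> * mass p (v n) {0..}" for n using v(1)[of n] by (simp add: adm_def)
  have clim: "(\<lambda>n. 1 + \<nu> * mass p (v n) {0..}) \<longlonglongrightarrow> 1 + \<nu> * mass p u0 {0..}" by (intro tendsto_intros mlim)
  have "\<exists>T\<ge>0. \<exists>\<delta><1. \<exists>r. strict_mono (r :: nat \<Rightarrow> nat) \<and> (\<forall>n. enrg p (v (r n)) {T..} \<le> \<delta>)"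
  proof (rule ccontr)
    assume neg: "\<not> ?thesis"
    \<comment> \<open>Otherwise all tails beyond \<open>j\<close>, from index \<open>j\<close> on,
      would have energy bounded below 1, and shifting the index would give the subsequence that is
      denied.\<close>
    have "\<exists>n\<ge>j. 1 - 1 / real (Suc j) < enrg p (v n) {real j..}" for j
    proof (rule ccontr)
      assume "\<not> ?thesis"
      then have "\<forall>n\<ge>j. enrg p (v n) {real j..} \<le> 1 - 1 / real (Suc j)" by (auto simp: not_less)
      then have "\<forall>n. enrg p (v (n + j)) {real j..} \<le> 1 - 1 / real (Suc j)" by simp
      moreover have "strict_mono (\<lambda>n. n + j)" by (simp add: strict_mono_def)
      moreover have "1 - 1 / real (Suc j) < 1" by simp
      ultimately show False using neg of_nat_0_le_iff by blast
    qed
    then obtain m where m: "\<And>j. m j \<ge> j" "\<And>j. 1 - 1 / real (Suc j) < enrg p (v (m j)) {real j..}" by metis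
    have mlim': "filterlim m at_top sequentially"
      using m(1) by (intro filterlim_at_top_mono[OF filterlim_ident]) auto
    \<comment> \<open>What remains after cutting off the escaping part: its energy is at most the
      potential plus \<open>1 / Suc j\<close>, and its primitives have the same limit.\<close>
    define x where "x j = (\<lambda>s. indicator {0..real j} s * v (m j) s)" for j
    have x: "Lp p (x j)" for j unfolding x_def using v(2) p1 by (intro Lp_restrict) auto
    have xe: "enrg p (x j) {0..} \<le> \<nu> * mass p (v (m j)) {0..} + 1 / real (Suc j)" for j
    proof -
      have "enrg p (x j) {0..} = enrg p (v (m j)) {0..real j}"
        unfolding x_def enrg_restrict[OF p1(3)] by (simp add: Int_absorb2)
      moreover have "enrg p (v (m j)) {0..} = enrg p (v (m j)) {0..real j} + enrg p (v (m j)) {real j..}"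
        unfolding enrg_def using v(2) by (intro set_integral_split_inf) (auto simp: Lp_def)
      ultimately show ?thesis using vF[of "m j"] m(2)[of j] by linarith
    qed
    have "(\<lambda>j. \<nu> * mass p (v (m j)) {0..} + 1 / real (Suc j)) \<longlonglongrightarrow> \<nu> * mass p u0 {0..} + 0"
      by (intro tendsto_add tendsto_mult tendsto_const filterlim_compose[OF mlim mlim'] LIMSEQ_Suc[OF lim_1_over_n])
    then have xl: "(\<lambda>j. \<nu> * mass p (v (m j)) {0..} + 1 / real (Suc j)) \<longlonglongrightarrow> \<nu> * mass p u0 {0..}" by simp
    have xb: "(\<lambda>j. prim (x j) s) \<longlonglongrightarrow> b s" if s: "s \<ge> 0" for s
    proof (rule Lim_transform_eventually)
      show "(\<lambda>j. prim (v (m j)) s) \<longlonglongrightarrow> b s" by (rule filterlim_compose[OF vb[OF s] mlim'])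
      obtain j0 :: nat where "s \<le> real j0" using real_arch_simple by blast
      then show "\<forall>\<^sub>F j in sequentially. prim (v (m j)) s = prim (x j) s"
        using s by (intro eventually_sequentiallyI[of j0]) (auto simp: x_def prim_restrict min_def)
    qed
    obtain u where u: "Lp p u" "\<And>s. s \<ge> 0 \<Longrightarrow> prim u s = b s" "enrg p u {0..} \<le> \<nu> * mass p u0 {0..}"
      by (rule Lp_weak_limit[OF p x xe xl xb k(3)], assumption, rule that)
    \<comment> \<open>The energy of the limit is bounded by its own potential, which coercivity
      allows only for zero.\<close>
    have "enrg p u {0..} \<le> \<kappa> * enrg p u {0..}" using u(3) coerc[OF u(1)] muq[OF u(2)] by simp
    then have "(1 - \<kappa>) * enrg p u {0..} \<le> 0" by (simp add: algebra_simps)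
    then have ue: "enrg p u {0..} = 0" using \<kappa> enrg_nonneg[of p u "{0..}"] by (smt (verit) mult_pos_pos)
    have b0: "b s = 0" if s: "s \<ge> 0" for s
    proof -
      have "\<bar>prim u s\<bar> powr p \<le> 0" using prim_bound'[OF u(1) p1(1) s] ue by simp
      then have "prim u s = 0" using p by (metis abs_eq_0 order_antisym powr_eq_0_iff powr_ge_zero)
      then show ?thesis using u(2)[OF s] by simp
    qed
    have "mass p u0 {0..} = (LINT s:{0::real..}|lborel. 0)"
      unfolding mass_def using u0(2) b0 p by (intro set_lebesgue_integral_cong) auto
    then have m0: "mass p u0 {0..} = 0" by simp
    have l1: "(\<lambda>n. \<nu> * mass p (v n) {0..}) \<longlonglongrightarrow> 0"
      using tendsto_mult_left[OF mlim, of \<nu>] m0 by simp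
    have l2: "(\<lambda>n. prim (v n) s) \<longlonglongrightarrow> 0" if "s \<ge> 0" for s using vb[OF that] b0[OF that] by simp
    have vF': "enrg p (v n) {0..} - \<nu> * mass p (v n) {0..} \<le> 1" for n using v(1) by (simp add: adm_def)
    define e where "e = (J g - (1 + exp (A + cst p))) / 2"
    have e: "e > 0" using g(2) by (simp add: e_def)
    have "\<forall>\<^sub>F n in sequentially. J (v n) \<le> 1 + exp (A + cst p) + e"
      using concentration_level[OF A(1) v(2) v(4) vF' l1 l2 e] by (simp add: J_def)
    then have "S \<le> ereal (1 + exp (A + cst p) + e)"
      by (intro tendsto_upperbound[OF vS]) (auto elim!: eventually_mono)
    then have "J g \<le> 1 + exp (A + cst p) + e" using JS[OF g(1)] by (metis ereal_less_eq(3) order.trans)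
    then show False using g(2) by (simp add: e_def field_simps)
  qed
  then obtain T \<delta> r where T: "T \<ge> 0" "\<delta> < 1" "strict_mono (r :: nat \<Rightarrow> nat)" "\<And>n. enrg p (v (r n)) {T..} \<le> \<delta>" by blast
  \<comment> \<open>The same limit of primitives, now with the sharp energy bounds
    \<open>1 + \<nu> * mass p (v n) {0..}\<close>, so that the constraint itself passes to the
    limit.\<close>
  obtain u where u: "Lp p u" "\<And>s. s \<ge> 0 \<Longrightarrow> prim u s = b s" "enrg p u {0..} \<le> 1 + \<nu> * mass p u0 {0..}"
    by (rule Lp_weak_limit[OF p v(2) vF clim vb k(3)], assumption, rule that)
  have ua: "adm u" using u muq[OF u(2)] by (simp add: adm_def)
  have "(\<lambda>n. J (v (r n))) \<longlonglongrightarrow> J u"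
    unfolding J_def
  proof (rule expint_limit[OF v(2) v(3) _ u(1) T(1,2,4)])
    fix s :: real assume s: "s \<ge> 0"
    show "(\<lambda>n. prim (v (r n)) s) \<longlonglongrightarrow> prim u s"
      using LIMSEQ_subseq_LIMSEQ[OF vb[OF s] T(3)] u(2)[OF s] by (simp add: o_def)
  qed
  then have "(\<lambda>n. ereal (J (v (r n)))) \<longlonglongrightarrow> ereal (J u)" by simp
  moreover have "(\<lambda>n. ereal (J (v (r n)))) \<longlonglongrightarrow> S"
    using LIMSEQ_subseq_LIMSEQ[OF vS T(3)] by (simp add: o_def)
  ultimately have Su: "S = ereal (J u)" using LIMSEQ_unique by blast
  define z where "z = (\<lambda>s. \<bar>u s\<bar>)"
  have z: "adm z" "J u \<le> J z" using adm_abs[OF ua] by (auto simp: z_def J_def)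
  have zmax: "J x \<le> J z" if "adm x" for x
    using JS[OF that] z(2) Su by simp
  have "1 < J z" using zmax[OF g(1)] g(2) exp_gt_zero[of "A + cst p"] by linarith
  then show ?thesis using that[of z] z zmax by (auto simp: J_def z_def)
qed

end

section \<open>Regularity of maximisers\<close>

lemma set_integral_ge_unit:
  fixes f :: "real \<Rightarrow> real"
  assumes "set_integrable lborel A f" "{m..m + 1} \<subseteq> A" "\<And>s. s \<in> A \<Longrightarrow> 0 \<le> f s" "\<And>s. s \<in> {m..m + 1} \<Longrightarrow> c \<le> f s"
  shows "c \<le> (LINT s:A|lborel. f s)"
proof -
  have "(LINT s:{m..m + 1}|lborel. c) \<le> (LINT s:A|lborel. f s)"
    unfolding set_lebesgue_integral_def
  proof (rule integral_mono)
    show "integrable lborel (\<lambda>s. indicat_real {m..m + 1} s *\<^sub>R c)"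
      using set_integrable_bdd_interval[of m "m + 1" c] by (simp add: set_integrable_def)
    show "integrable lborel (\<lambda>s. indicat_real A s *\<^sub>R f s)" using assms(1) by (simp add: set_integrable_def)
    show "indicat_real {m..m + 1} s *\<^sub>R c \<le> indicat_real A s *\<^sub>R f s" for s
      using assms(2-4) by (auto simp: indicator_def)
  qed
  then show ?thesis by (simp add: set_integral_constI)
qed

lemma Lp_exp_decay:
  assumes "f \<in> borel_measurable borel" "\<And>s. 0 \<le> s \<Longrightarrow> \<bar>f s\<bar> \<le> D * exp (- a * s)" "a > 0" "p > 0"
  shows "Lp p f"
  unfolding Lp_def
proof (intro conjI assms(1))
  have D: "D \<ge> 0" using assms(2)[of 0] by simp
  show "set_integrable lborel {0..} (\<lambda>s. \<bar>f s\<bar> powr p)"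
  proof (rule set_integrable_bound_fin)
    show "set_integrable lborel {0..} (\<lambda>s. D powr p * exp (- (a * p) * s))"
      using assms by (intro set_integrable_mult_right set_integrable_exp_decay) auto
    fix s :: real assume s: "s \<in> {0..}"
    have "\<bar>f s\<bar> powr p \<le> (D * exp (- a * s)) powr p" using assms s by (intro powr_mono2) auto
    also have "\<dots> = D powr p * exp (- (a * p) * s)" using D by (simp add: powr_mult exp_powr_real mult_ac)
    finally show "\<bar>\<bar>f s\<bar> powr p\<bar> \<le> D powr p * exp (- (a * p) * s)" by simp
  qed (use assms(1) in measurable)
qed

text \<open>Tonelli's theorem on the triangle \<open>0 \<le> t \<le> s\<close> moves the weight from
  the primitive to the density. First variations of the exponential integral and of the mass thus
  become integrals of \<open>v\<close> against a continuous function with exponential decay.\<close>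

lemma decaying_density:
  fixes f :: "real \<Rightarrow> real"
  assumes f12: "f \<in> borel_measurable borel" "\<And>s. 0 \<le> f s" and f3: "\<forall>s\<ge>0. f s \<le> D * exp (- a * s)" and a: "a > 0"
  defines "P \<equiv> \<lambda>s. (LINT t:{s..}|lborel. f t)"
  shows "set_integrable lborel {0..} f" "\<And>s. 0 \<le> P s" "\<And>s. 0 \<le> s \<Longrightarrow> P s \<le> D / a * exp (- a * s)"
    "continuous_on {0..} P"
    "\<And>v p. Lp p v \<Longrightarrow> p > 1 \<Longrightarrow> set_integrable lborel {0..} (\<lambda>s. f s * prim v s)"
    "\<And>v p. Lp p v \<Longrightarrow> p > 1 \<Longrightarrow> (\<And>s. 0 \<le> v s) \<Longrightarrow> set_integrable lborel {0..} (\<lambda>s. v s * P s)"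
    "\<And>v p. Lp p v \<Longrightarrow> p > 1 \<Longrightarrow> (\<And>s. 0 \<le> v s) \<Longrightarrow> (LINT s:{0..}|lborel. f s * prim v s) = (LINT s:{0..}|lborel. v s * P s)"
proof -
  have f: "f \<in> borel_measurable borel" "\<And>s. 0 \<le> f s" "\<And>s. 0 \<le> s \<Longrightarrow> f s \<le> D * exp (- a * s)"
    using f12 f3 by auto
  have D: "D \<ge> 0" using f(2)[of 0] f(3)[of 0] by simp
  have L: "Lp 2 f" using f by (intro Lp_exp_decay[OF _ _ a]) auto
  have "set_integrable lborel {0..} (\<lambda>s. D * exp (- a * s))"
    using a by (intro set_integrable_mult_right set_integrable_exp_decay)
  then show i: "set_integrable lborel {0..} f"
    by (rule set_integrable_bound_fin) (use f in \<open>auto simp: abs_of_nonneg\<close>)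
  have i': "set_integrable lborel {s..} f" if "s \<ge> 0" for s
    using that by (intro set_integrable_subset[OF i]) auto
  show P0: "0 \<le> P s" for s
    unfolding P_def set_lebesgue_integral_def using f(2) by (intro integral_nonneg_AE) auto
  show "P s \<le> D / a * exp (- a * s)" if s: "0 \<le> s" for s
  proof -
    have "P s \<le> (LINT t:{s..}|lborel. D * exp (- a * t))"
      unfolding P_def using i'[OF s] a s f(3)
      by (intro set_integral_mono set_integrable_mult_right set_integrable_exp_decay) auto
    also have "\<dots> = D * (exp (- a * s) / a)" using integral_exp_decay[OF a, of s] by simp
    finally show ?thesis by simp
  qed
  have Pp: "P s = P 0 - prim f s" if "s \<ge> 0" for s
    unfolding P_def prim_def using set_integral_split_inf[OF i that] by simp
  have "continuous_on {0..} (\<lambda>s. P 0 - prim f s)" by (intro continuous_intros prim_continuous[OF L]) auto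
  then show Pc: "continuous_on {0..} P" by (rule continuous_on_eq) (rule Pp[symmetric], simp)
  show fi: "set_integrable lborel {0..} (\<lambda>s. f s * prim v s)" if v: "Lp p v" "p > 1" for v p
  proof -
    define q where "q = p / (p - 1)"
    have q: "q > 1" using v by (simp add: q_def field_simps)
    obtain C where C: "C \<ge> 0" "\<And>s. s \<ge> 0 \<Longrightarrow> \<bar>prim v s\<bar> powr (p / (p - 1)) \<le> C + 1 * s"
      by (rule prim_growth[OF v, of 1]) auto
    show ?thesis
    proof (rule set_integrable_boundI)
      show "set_integrable lborel {0..} (\<lambda>s. D * (1 + C + 2 / a) * exp (- (a / 2) * s))"
        using a by (intro set_integrable_mult_right set_integrable_exp_decay) auto
      show "(\<lambda>s. f (max 0 s) * prim v (max 0 s)) \<in> borel_measurable borel"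
        using prim_meas[OF v] f(1) by measurable
      fix s :: real assume s: "s \<in> {0..}"
      have "\<bar>prim v s\<bar> \<le> 1 + \<bar>prim v s\<bar> powr q"
      proof (cases "\<bar>prim v s\<bar> \<le> 1")
        case False
        then have "\<bar>prim v s\<bar> powr 1 \<le> \<bar>prim v s\<bar> powr q" using q(1) by (intro powr_mono) auto
        then show ?thesis by simp
      qed (simp add: add_increasing2)
      also have "\<dots> \<le> 1 + C + s" using C(2)[of s] s by (simp add: q_def)
      also have "\<dots> \<le> (1 + C) * exp (a / 2 * s) + 2 / a * exp (a / 2 * s)"
      proof (rule add_mono)
        have "1 \<le> exp (a / 2 * s)" using a s by simp
        then show "1 + C \<le> (1 + C) * exp (a / 2 * s)" using C(1) mult_left_mono[of 1 "exp (a / 2 * s)" "1 + C"] by simp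
        have "a / 2 * s \<le> exp (a / 2 * s)" using exp_ge_add_one_self[of "a / 2 * s"] by linarith
        then have "2 / a * (a / 2 * s) \<le> 2 / a * exp (a / 2 * s)" using a by (intro mult_left_mono) auto
        then show "s \<le> 2 / a * exp (a / 2 * s)" using a by simp
      qed
      finally have pv: "\<bar>prim v s\<bar> \<le> (1 + C + 2 / a) * exp (a / 2 * s)" by (simp add: distrib_right)
      have "f s * \<bar>prim v s\<bar> \<le> (D * exp (- a * s)) * ((1 + C + 2 / a) * exp (a / 2 * s))"
        using f(2)[of s] f(3)[of s] pv s D by (intro mult_mono) auto
      also have "\<dots> = D * (1 + C + 2 / a) * (exp (- a * s) * exp (a / 2 * s))" by simp
      also have "exp (- a * s) * exp (a / 2 * s) = exp (- (a / 2) * s)"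
        unfolding exp_add[symmetric] by (simp add: field_simps)
      finally show "\<bar>f s * prim v s\<bar> \<le> D * (1 + C + 2 / a) * exp (- (a / 2) * s)"
        using f(2)[of s] by (simp add: abs_mult)
    qed auto
  qed
  have nn: "(\<integral>\<^sup>+s. ennreal (indicator {0..} s * (f s * prim v s)) \<partial>lborel) = (\<integral>\<^sup>+s. ennreal (indicator {0..} s * (v s * P s)) \<partial>lborel)"
    if v: "Lp p v" "p > 1" "\<And>s. 0 \<le> v s" for v p
  proof -
    have [measurable]: "v \<in> borel_measurable borel" "f \<in> borel_measurable borel" using v f by (auto simp: Lp_def)
    have iv: "set_integrable lborel {0..s} v" for s using Lp_int_integrable[OF v(1), of 0 s] v by simp
    have e1: "ennreal (prim v s) = (\<integral>\<^sup>+t. ennreal (indicator {0..s} t * v t) \<partial>lborel)" for s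
      unfolding prim_def set_lebesgue_integral_def using iv[of s] v(3)
      by (subst nn_integral_eq_integral) (auto simp: set_integrable_def)
    have e2: "ennreal (P t) = (\<integral>\<^sup>+s. ennreal (indicator {t..} s * f s) \<partial>lborel)" if "t \<ge> 0" for t
      unfolding P_def set_lebesgue_integral_def using i'[OF that] f(2)
      by (subst nn_integral_eq_integral) (auto simp: set_integrable_def)
    have "(\<integral>\<^sup>+s. ennreal (indicator {0..} s * (f s * prim v s)) \<partial>lborel) =
      (\<integral>\<^sup>+s. (\<integral>\<^sup>+t. ennreal (if 0 \<le> t \<and> t \<le> s then f s * v t else 0) \<partial>lborel) \<partial>lborel)"
    proof (intro nn_integral_cong)
      fix s :: real
      show "ennreal (indicator {0..} s * (f s * prim v s)) = (\<integral>\<^sup>+t. ennreal (if 0 \<le> t \<and> t \<le> s then f s * v t else 0) \<partial>lborel)"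
      proof (cases "s \<ge> 0")
        case True
        have "ennreal (indicator {0..} s * (f s * prim v s)) = ennreal (f s) * (\<integral>\<^sup>+t. ennreal (indicator {0..s} t * v t) \<partial>lborel)"
          using True f(2)[of s] by (simp add: ennreal_mult' e1)
        also have "\<dots> = (\<integral>\<^sup>+t. ennreal (f s) * ennreal (indicator {0..s} t * v t) \<partial>lborel)"
          by (subst nn_integral_cmult) auto
        also have "\<dots> = (\<integral>\<^sup>+t. ennreal (if 0 \<le> t \<and> t \<le> s then f s * v t else 0) \<partial>lborel)"
          using f(2)[of s] by (intro nn_integral_cong) (auto simp: ennreal_mult'[symmetric] indicator_def)
        finally show ?thesis .
      next
        case False
        then have "(\<lambda>t. ennreal (if 0 \<le> t \<and> t \<le> s then f s * v t else 0)) = (\<lambda>t. 0)" by auto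
        then show ?thesis using False by simp
      qed
    qed
    also have "\<dots> = (\<integral>\<^sup>+t. (\<integral>\<^sup>+s. ennreal (if 0 \<le> t \<and> t \<le> s then f s * v t else 0) \<partial>lborel) \<partial>lborel)"
      by (rule lborel_pair.Fubini') measurable
    also have "\<dots> = (\<integral>\<^sup>+t. ennreal (indicator {0..} t * (v t * P t)) \<partial>lborel)"
    proof (intro nn_integral_cong)
      fix t :: real
      show "(\<integral>\<^sup>+s. ennreal (if 0 \<le> t \<and> t \<le> s then f s * v t else 0) \<partial>lborel) = ennreal (indicator {0..} t * (v t * P t))"
      proof (cases "t \<ge> 0")
        case True
        have "ennreal (indicator {0..} t * (v t * P t)) = ennreal (v t) * (\<integral>\<^sup>+s. ennreal (indicator {t..} s * f s) \<partial>lborel)"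
          using True v(3)[of t] by (simp add: ennreal_mult' e2)
        also have "\<dots> = (\<integral>\<^sup>+s. ennreal (v t) * ennreal (indicator {t..} s * f s) \<partial>lborel)"
          by (subst nn_integral_cmult) auto
        also have "\<dots> = (\<integral>\<^sup>+s. ennreal (if 0 \<le> t \<and> t \<le> s then f s * v t else 0) \<partial>lborel)"
          using v(3)[of t] True by (intro nn_integral_cong) (auto simp: ennreal_mult'[symmetric] indicator_def mult.commute)
        finally show ?thesis by simp
      qed simp
    qed
    finally show ?thesis .
  qed
  have mP: "(\<lambda>s. P (max 0 s)) \<in> borel_measurable borel"
    by (intro borel_measurable_continuous_onI continuous_on_compose2[OF Pc] continuous_intros) auto
  have m2: "(\<lambda>s. indicat_real {0..} s * (v s * P s)) \<in> borel_measurable borel" if "v \<in> borel_measurable borel" for v :: "real \<Rightarrow> real"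
  proof -
    have "(\<lambda>s. indicat_real {0..} s * (v s * P (max 0 s))) \<in> borel_measurable borel" using that mP by measurable
    moreover have "(\<lambda>s. indicat_real {0..} s * (v s * P (max 0 s))) = (\<lambda>s. indicat_real {0..} s * (v s * P s))"
      by (auto simp: indicator_def max_def fun_eq_iff)
    ultimately show ?thesis by simp
  qed
  show "set_integrable lborel {0..} (\<lambda>s. v s * P s)" if v: "Lp p v" "p > 1" "\<And>s. 0 \<le> v s" for v p
  proof -
    have "integrable lborel (\<lambda>s. indicator {0..} s * (f s * prim v s))" using fi[OF v(1,2)] by (simp add: set_integrable_def)
    then have "(\<integral>\<^sup>+s. ennreal (indicator {0..} s * (f s * prim v s)) \<partial>lborel) < \<infinity>"
      using f(2) prim_nonneg[OF v(3)] by (subst nn_integral_eq_integral) auto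
    then show ?thesis
      unfolding set_integrable_def real_scaleR_def using nn[OF v] m2[of v] v P0
      by (intro integrableI_nonneg) (auto simp: Lp_def)
  qed
  show "(LINT s:{0..}|lborel. f s * prim v s) = (LINT s:{0..}|lborel. v s * P s)" if v: "Lp p v" "p > 1" "\<And>s. 0 \<le> v s" for v p
  proof -
    have "(LINT s:{0..}|lborel. f s * prim v s) = enn2real (\<integral>\<^sup>+s. ennreal (indicator {0..} s * (f s * prim v s)) \<partial>lborel)"
      unfolding set_lebesgue_integral_def real_scaleR_def using f(2) prim_nonneg[OF v(3)] fi[OF v(1,2)]
      by (intro integral_eq_nn_integral) (auto simp: set_integrable_def)
    moreover have "(LINT s:{0..}|lborel. v s * P s) = enn2real (\<integral>\<^sup>+s. ennreal (indicator {0..} s * (v s * P s)) \<partial>lborel)"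
      unfolding set_lebesgue_integral_def real_scaleR_def using P0 v m2[of v]
      by (intro integral_eq_nn_integral) (auto simp: Lp_def)
    ultimately show ?thesis using nn[OF v] by simp
  qed
qed

context moser
begin

text \<open>Since \<open>t \<mapsto> exp (t powr q)\<close> and \<open>t powr p\<close> are convex, a maximiser \<open>w0\<close> also maximises the
  linear functional \<open>v \<mapsto> \<integral>v P\<close> under the convex constraint
  \<open>\<integral>v powr p - \<nu> p \<integral>v Q \<le> const\<close>, and the maximiser of that problem is
  \<open>(c P + \<nu> Q) powr (1 / (p - 1))\<close> by strict convexity.\<close>
lemma regular_maximizer:
  obtains w C \<beta> where "adm w" "continuous_on {0..} w" "\<beta> > 1 / p" "\<And>s. 0 \<le> s \<Longrightarrow> \<bar>w s\<bar> \<le> C * exp (- \<beta> * s)"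
    "enrg p w {0..} - \<nu> * mass p w {0..} = 1"
    "\<And>v. adm v \<Longrightarrow> expint (p / (p - 1)) v {0..} \<le> expint (p / (p - 1)) w {0..}"
proof -
  define q where "q = p / (p - 1)"
  have q: "q > 1" "p / (p - 1) = q" "q - 1 = 1 / (p - 1)" using p by (simp_all add: q_def field_simps)
  define J where "J w = expint q w {0..}" for w
  obtain w0 where w0x: "adm w0" "\<And>s. w0 s \<ge> 0"
    "\<And>v. adm v \<Longrightarrow> expint (p / (p - 1)) v {0..} \<le> expint (p / (p - 1)) w0 {0..}" "1 < expint (p / (p - 1)) w0 {0..}"
    by (rule exists_maximizer, rule that)
  then have w0a: "adm w0" "\<And>s. w0 s \<ge> 0" "\<And>v. adm v \<Longrightarrow> J v \<le> J w0" "1 < J w0"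
    unfolding J_def q(2)[symmetric] by blast+
  have w0: "Lp p w0" using w0a by (simp add: adm_def)
  define b where "b s = prim w0 (max 0 s)" for s
  have bp: "b s = prim w0 s" if "s \<ge> 0" for s using that by (simp add: b_def)
  have bm [measurable]: "b \<in> borel_measurable borel" unfolding b_def by (rule prim_meas[OF w0 p1(1)])
  have b0: "b s \<ge> 0" for s unfolding b_def by (rule prim_nonneg) (rule w0a)
  have bmono: "b s \<le> b t" if "s \<le> t" for s t
    unfolding b_def using that w0 w0a(2) p1 by (intro prim_mono[where p = p]) auto
  \<comment> \<open>Any rate strictly between \<open>1 - 1 / p\<close> and 1 would do: the maximiser
    will decay at the rate \<open>a / (p - 1)\<close>, and regularity at the origin requires this to
    exceed \<open>1 / p\<close>.\<close>
  define a where "a = 1 - 1 / (2 * p)"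
  have a: "a > 0" "a < 1" using p by (simp_all add: a_def field_simps)
  \<comment> \<open>First variations at \<open>w0\<close>: this is the derivative of
    \<open>exp (t powr q - s)\<close> at \<open>t = b s\<close>, and \<open>p * \<sigma> s\<close>
    is that of \<open>t powr p * exp (- s)\<close>.\<close>
  define \<rho> where "\<rho> s = q * b s powr (q - 1) * exp (b s powr q - s)" for s
  define \<sigma> where "\<sigma> s = b s powr (p - 1) * exp (- s)" for s
  have [measurable]: "\<rho> \<in> borel_measurable borel" "\<sigma> \<in> borel_measurable borel"
    unfolding \<rho>_def \<sigma>_def by measurable
  have \<rho>0: "\<rho> s \<ge> 0" and \<sigma>0: "\<sigma> s \<ge> 0" for s using q(1) by (simp_all add: \<rho>_def \<sigma>_def)
  \<comment> \<open>In the bound for \<rho> the growth of \<open>b s powr q\<close> enters twice,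
    from the exponential and from the prefactor; hence the half.\<close>
  define e where "e = (1 - a) / 2"
  have a2: "e > 0" using a by (simp add: e_def)
  have "2 * e = 1 - a" by (simp add: e_def)
  then have es: "2 * (e * s) = s - a * s" for s by (metis left_diff_distrib mult.assoc mult_1)
  obtain C where Cx: "C \<ge> 0" "\<And>s. s \<ge> 0 \<Longrightarrow> \<bar>prim w0 s\<bar> powr (p / (p - 1)) \<le> C + e * s"
    by (rule prim_growth[OF w0 p1(1) a2], rule that)
  have C: "b s powr q \<le> C + e * s" if "s \<ge> 0" for s
    using Cx(2)[OF that] b0[of s] bp[OF that] by (simp_all add: q(2))
  define k where "k = (p - 1) / q"
  have k: "k > 0" using p q(1) by (simp add: k_def)
  define D where "D = q * exp (2 * C) + k powr k * exp C"
  have \<rho>D: "\<rho> s \<le> D * exp (- a * s)" and \<sigma>D: "\<sigma> s \<le> D * exp (- a * s)" if s: "s \<ge> 0" for s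
  proof -
    have "b s powr (q - 1) \<le> exp (b s powr q)"
    proof (cases "b s \<le> 1")
      case True
      then have "b s powr (q - 1) \<le> 1 powr (q - 1)" using b0[of s] q(1) by (intro powr_mono2) auto
      also have "\<dots> \<le> exp (b s powr q)" by simp
      finally show ?thesis .
    next
      case False
      then have "b s powr (q - 1) \<le> b s powr q" by (intro powr_mono) auto
      also have "\<dots> \<le> exp (b s powr q)" using exp_ge_add_one_self[of "b s powr q"] by linarith
      finally show ?thesis .
    qed
    then have "\<rho> s \<le> q * exp (b s powr q) * exp (b s powr q - s)"
      unfolding \<rho>_def using q(1) by (intro mult_right_mono mult_left_mono) auto
    also have "\<dots> = q * exp (b s powr q + (b s powr q - s))" by (simp only: exp_add mult.assoc)
    also have "\<dots> \<le> q * exp (2 * C + - a * s)"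
    proof -
      have "b s powr q + (b s powr q - s) \<le> 2 * C + - a * s" using C[OF s] es[of s] by simp
      then show ?thesis using q(1) by simp
    qed
    also have "\<dots> = q * exp (2 * C) * exp (- a * s)" by (simp only: exp_add mult.assoc)
    also have "\<dots> \<le> D * exp (- a * s)" unfolding D_def by (intro mult_right_mono) auto
    finally show "\<rho> s \<le> D * exp (- a * s)" .
    have "b s powr (p - 1) = (b s powr q) powr k" using q(1) by (simp add: powr_powr k_def)
    also have "\<dots> \<le> (k / 1) powr k * exp (1 * (b s powr q))" using k by (intro powr_le_exp) auto
    finally have "\<sigma> s \<le> k powr k * exp (b s powr q) * exp (- s)"
      unfolding \<sigma>_def by (intro mult_right_mono) auto
    also have "\<dots> = k powr k * exp (b s powr q + - s)" by (simp only: exp_add mult.assoc)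
    also have "\<dots> \<le> k powr k * exp (C + - a * s)"
    proof -
      have "0 \<le> e * s" using a2 s by simp
      then have "b s powr q + - s \<le> C + - a * s" using C[OF s] es[of s] by simp
      then show ?thesis by (intro mult_left_mono) auto
    qed
    also have "\<dots> = k powr k * exp C * exp (- a * s)" by (simp only: exp_add mult.assoc)
    also have "\<dots> \<le> D * exp (- a * s)" unfolding D_def using q(1) by (intro mult_right_mono) auto
    finally show "\<sigma> s \<le> D * exp (- a * s)" .
  qed
  define P where "P s = (LINT t:{s..}|lborel. \<rho> t)" for s
  define Q where "Q s = (LINT t:{s..}|lborel. \<sigma> t)" for s
  have \<rho>D': "\<forall>s\<ge>0. \<rho> s \<le> D * exp (- a * s)" and \<sigma>D': "\<forall>s\<ge>0. \<sigma> s \<le> D * exp (- a * s)"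
    using \<rho>D \<sigma>D by auto
  have \<rho>m: "\<rho> \<in> borel_measurable borel" and \<sigma>m: "\<sigma> \<in> borel_measurable borel" by measurable
  note PP = decaying_density[OF \<rho>m \<rho>0 \<rho>D' a(1), folded P_def]
  note QQ = decaying_density[OF \<sigma>m \<sigma>0 \<sigma>D' a(1), folded Q_def]
  define ell where "ell v = (LINT s:{0..}|lborel. v s * P s)" for v
  define m where "m v = (LINT s:{0..}|lborel. v s * Q s)" for v
  \<comment> \<open>Convexity in two layers: the tangent of the power inside, then
    \<open>1 + x \<le> exp x\<close> outside.\<close>
  have Jconv: "J w0 + ell v - ell w0 \<le> J v" if v: "Lp p v" "\<And>s. 0 \<le> v s" for v
  proof -
    have i0: "set_integrable lborel {0..} (\<lambda>s. exp (\<bar>prim w0 s\<bar> powr q - s))" and iv: "set_integrable lborel {0..} (\<lambda>s. exp (\<bar>prim v s\<bar> powr q - s))"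
      using expint_integrable[OF w0 p1(1), of "{0..}"] expint_integrable[OF v(1) p1(1), of "{0..}"] by (simp_all add: q(2))
    note r0 = PP(5)[OF w0 p1(1)] and rv = PP(5)[OF v(1) p1(1)]
    have "(LINT s:{0..}|lborel. exp (\<bar>prim w0 s\<bar> powr q - s) + \<rho> s * prim v s - \<rho> s * prim w0 s) \<le> J v"
      unfolding J_def expint_def
    proof (intro set_integral_mono set_integral_add set_integral_diff i0 iv r0 rv)
      fix s :: real assume s: "s \<in> {0..}"
      then have bs: "prim w0 s = b s" using bp by simp
      have pv: "prim v s \<ge> 0" by (intro prim_nonneg v(2))
      have "b s powr q + q * b s powr (q - 1) * (prim v s - b s) \<le> prim v s powr q"
        using q(1) pv b0[of s] by (intro powr_tangent) auto
      then have "exp (b s powr q - s) * exp (q * b s powr (q - 1) * (prim v s - b s)) \<le> exp (prim v s powr q - s)"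
        unfolding exp_add[symmetric] by simp
      moreover have "exp (b s powr q - s) * (1 + q * b s powr (q - 1) * (prim v s - b s)) \<le> exp (b s powr q - s) * exp (q * b s powr (q - 1) * (prim v s - b s))"
        by (intro mult_left_mono exp_ge_add_one_self) auto
      ultimately have "exp (b s powr q - s) * (1 + q * b s powr (q - 1) * (prim v s - b s)) \<le> exp (prim v s powr q - s)" by linarith
      then show "exp (\<bar>prim w0 s\<bar> powr q - s) + \<rho> s * prim v s - \<rho> s * prim w0 s \<le> exp (\<bar>prim v s\<bar> powr q - s)"
        unfolding bs using b0[of s] pv by (simp add: \<rho>_def algebra_simps)
    qed
    moreover have "(LINT s:{0..}|lborel. exp (\<bar>prim w0 s\<bar> powr q - s) + \<rho> s * prim v s - \<rho> s * prim w0 s) = J w0 + ell v - ell w0"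
    proof -
      have "(LINT s:{0..}|lborel. exp (\<bar>prim w0 s\<bar> powr q - s) + \<rho> s * prim v s - \<rho> s * prim w0 s) =
        (LINT s:{0..}|lborel. exp (\<bar>prim w0 s\<bar> powr q - s)) + (LINT s:{0..}|lborel. \<rho> s * prim v s) - (LINT s:{0..}|lborel. \<rho> s * prim w0 s)"
        using i0 r0 rv by (simp add: set_integral_add set_integral_diff)
      then show ?thesis
        unfolding J_def expint_def ell_def using PP(7)[OF v(1) p1(1) v(2)] PP(7)[OF w0 p1(1) w0a(2)] by simp
    qed
    ultimately show ?thesis by simp
  qed
  have Mconv: "mass p w0 {0..} + p * (m v - m w0) \<le> mass p v {0..}" if v: "Lp p v" "\<And>s. 0 \<le> v s" for v
  proof -
    note i0 = mass_integrable[OF w0 p1(1), of "{0..}", simplified] and iv = mass_integrable[OF v(1) p1(1), of "{0..}", simplified]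
    note r0 = QQ(5)[OF w0 p1(1)] and rv = QQ(5)[OF v(1) p1(1)]
    have "(LINT s:{0..}|lborel. \<bar>prim w0 s\<bar> powr p * exp (- s) + p * (\<sigma> s * prim v s - \<sigma> s * prim w0 s)) \<le> mass p v {0..}"
      unfolding mass_def
    proof (intro set_integral_mono set_integral_add set_integrable_mult_right set_integral_diff i0 iv r0 rv)
      fix s :: real assume s: "s \<in> {0..}"
      then have bs: "prim w0 s = b s" using bp by simp
      have pv: "prim v s \<ge> 0" by (intro prim_nonneg v(2))
      have "(b s powr p + p * b s powr (p - 1) * (prim v s - b s)) * exp (- s) \<le> prim v s powr p * exp (- s)"
        using p1 pv b0[of s] by (intro mult_right_mono powr_tangent) auto
      then show "\<bar>prim w0 s\<bar> powr p * exp (- s) + p * (\<sigma> s * prim v s - \<sigma> s * prim w0 s) \<le> \<bar>prim v s\<bar> powr p * exp (- s)"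
        unfolding bs using b0[of s] pv by (simp add: \<sigma>_def algebra_simps)
    qed
    moreover have "(LINT s:{0..}|lborel. \<bar>prim w0 s\<bar> powr p * exp (- s) + p * (\<sigma> s * prim v s - \<sigma> s * prim w0 s)) = mass p w0 {0..} + p * (m v - m w0)"
    proof -
      have "(LINT s:{0..}|lborel. \<bar>prim w0 s\<bar> powr p * exp (- s) + p * (\<sigma> s * prim v s - \<sigma> s * prim w0 s)) =
        (LINT s:{0..}|lborel. \<bar>prim w0 s\<bar> powr p * exp (- s)) + p * ((LINT s:{0..}|lborel. \<sigma> s * prim v s) - (LINT s:{0..}|lborel. \<sigma> s * prim w0 s))"
        using i0 r0 rv by (subst set_integral_add(2)) (auto simp: set_integral_diff)
      then show ?thesis
        unfolding mass_def m_def using QQ(7)[OF v(1) p1(1) v(2)] QQ(7)[OF w0 p1(1) w0a(2)] by simp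
    qed
    ultimately show ?thesis by simp
  qed
  define \<Phi> where "\<Phi> v = enrg p v {0..} - \<nu> * p * m v" for v
  \<comment> \<open>Linearising the convex mass shrinks the constraint set, so a competitor of the
    linear problem is admissible for the original one, and \<open>Jconv\<close> transfers its
    optimality.\<close>
  have opt: "ell v \<le> ell w0" if v: "Lp p v" "\<And>s. 0 \<le> v s" "\<Phi> v \<le> \<Phi> w0" for v
  proof -
    have "\<nu> * (mass p w0 {0..} + p * (m v - m w0)) \<le> \<nu> * mass p v {0..}"
      using \<nu> Mconv[OF v(1,2)] by (intro mult_left_mono)
    then have "enrg p v {0..} - \<nu> * mass p v {0..} \<le> enrg p w0 {0..} - \<nu> * mass p w0 {0..}"
      using v(3) by (simp add: \<Phi>_def algebra_simps)
    then have "adm v" using v w0a(1) by (simp add: adm_def)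
    then show ?thesis using w0a(3)[of v] Jconv[OF v(1,2)] by simp
  qed
  \<comment> \<open>A vanishing primitive has value exactly 1, which the maximiser exceeds.\<close>
  have "\<exists>s1\<ge>0. b s1 > 0"
  proof (rule ccontr)
    assume neg: "\<not> ?thesis"
    have "prim w0 s = 0" if s: "s \<ge> 0" for s
    proof -
      have "\<not> b s > 0" using neg s by blast
      then show ?thesis using b0[of s] bp[OF s] by simp
    qed
    then have "J w0 = (LINT s:{0..}|lborel. exp (- 1 * s))"
      unfolding J_def expint_def using q(1) by (intro set_lebesgue_integral_cong) auto
    then have "J w0 = 1" using integral_exp_decay[of 1 0] by simp
    then show False using w0a(4) by simp
  qed
  then obtain s1 where s1: "s1 \<ge> 0" "b s1 > 0" by blast
  have \<rho>low: "q * b s1 powr (q - 1) * exp (- (t + 1)) \<le> \<rho> s" if "s1 \<le> t" "s \<in> {t..t + 1}" for s t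
  proof -
    have "b s1 powr (q - 1) \<le> b s powr (q - 1)" using bmono[of s1 s] that s1 q(1) by (intro powr_mono2) auto
    moreover have "exp (- (t + 1)) \<le> exp (b s powr q - s)" using that powr_ge_zero[of "b s" q] by (simp del: powr_ge_zero)
    ultimately show ?thesis unfolding \<rho>_def using q(1) by (intro mult_mono mult_left_mono) auto
  qed
  have ll_pos: "ell w0 > 0"
  proof -
    have "q * b s1 powr (q - 1) * exp (- (s1 + 1)) * b s1 \<le> (LINT s:{0..}|lborel. \<rho> s * prim w0 s)"
    proof (rule set_integral_ge_unit[OF PP(5)[OF w0 p1(1)], of s1])
      show "0 \<le> \<rho> s * prim w0 s" for s using \<rho>0 prim_nonneg[OF w0a(2)] by simp
      fix s assume s: "s \<in> {s1..s1 + 1}"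
      then have "b s1 \<le> prim w0 s" using bmono[of s1 s] bp[of s] s1 by simp
      then show "q * b s1 powr (q - 1) * exp (- (s1 + 1)) * b s1 \<le> \<rho> s * prim w0 s"
        using \<rho>low[of s1 s] s s1 \<rho>0[of s] by (intro mult_mono) auto
    qed (use s1 in auto)
    moreover have "0 < q * b s1 powr (q - 1) * exp (- (s1 + 1)) * b s1" using q s1 by simp
    ultimately show ?thesis unfolding ell_def PP(7)[OF w0 p1(1) w0a(2)] by simp
  qed
  define P1 where "P1 = q * b s1 powr (q - 1) * exp (- (max 1 s1 + 1))"
  have P1: "P1 > 0" using q s1 by (simp add: P1_def)
  have Plow: "P1 \<le> P s" if s: "0 \<le> s" "s \<le> 1" for s
    unfolding P_def P1_def
  proof (rule set_integral_ge_unit[of _ _ "max 1 s1"])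
    show "set_integrable lborel {s..} \<rho>" using s by (intro set_integrable_subset[OF PP(1)]) auto
  qed (use s \<rho>0 \<rho>low[of "max 1 s1"] in auto)
  \<comment> \<open>A slack constraint would permit scaling by some \<open>l > 1\<close>, which
    raises the positive linear functional.\<close>
  have F1: "enrg p w0 {0..} - \<nu> * mass p w0 {0..} = 1"
  proof (rule ccontr)
    define F where "F = enrg p w0 {0..} - \<nu> * mass p w0 {0..}"
    assume "\<not> ?thesis"
    then have F: "F < 1" using w0a(1) by (simp add: adm_def F_def)
    obtain l where l: "l > 1" "l powr p * F \<le> 1"
    proof (cases "F \<le> 0")
      case True
      then have "2 powr p * F \<le> 1" by (smt (verit) mult_nonneg_nonpos powr_ge_zero)
      then show ?thesis using that[of 2] by simp
    next
      case False
      have "1 powr (- 1 / p) < F powr (- 1 / p)" using False F p by (intro powr_less_mono2_neg) auto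
      moreover have "(F powr (- 1 / p)) powr p * F = 1"
      proof -
        have "- 1 / p * p = - 1" using p by simp
        then have "(F powr (- 1 / p)) powr p = F powr (- 1)" unfolding powr_powr by (simp only:)
        then show ?thesis using False by (simp add: powr_minus_divide)
      qed
      ultimately show ?thesis using that[of "F powr (- 1 / p)"] by simp
    qed
    define v where "v = (\<lambda>s. l * w0 s)"
    have v: "Lp p v" "\<And>s. 0 \<le> v s" unfolding v_def using w0 w0a(2) l p1 by (auto intro: Lp_scale)
    have "enrg p v {0..} - \<nu> * mass p v {0..} = l powr p * F"
      unfolding v_def enrg_scale mass_scale F_def using l by (simp add: algebra_simps)
    then have "adm v" using v l by (simp add: adm_def)
    then have "J v \<le> J w0" by (rule w0a(3))
    moreover have "ell v = l * ell w0" unfolding ell_def v_def by (simp add: mult.assoc)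
    ultimately have "(l - 1) * ell w0 \<le> 0" using Jconv[OF v] by (simp add: algebra_simps)
    then show False using l ll_pos by (simp add: mult_le_0_iff)
  qed
  define P' where "P' s = P (max 0 s)" for s
  define Q' where "Q' s = Q (max 0 s)" for s
  have P'c: "continuous_on UNIV P'" and Q'c: "continuous_on UNIV Q'"
    unfolding P'_def Q'_def
    by (intro continuous_on_compose2[OF PP(4)] continuous_on_compose2[OF QQ(4)] continuous_intros; auto)+
  have P'0: "P' s \<ge> 0" and Q'0: "Q' s \<ge> 0" for s using PP(2) QQ(2) by (auto simp: P'_def Q'_def)
  \<comment> \<open>The right side of the Euler-Lagrange equation of the linear problem, with
    multiplier \<open>c\<close> up to normalisation; \<open>W c\<close> is the density solving
    it.\<close>
  define h where "h c s = c * P' s + \<nu> * Q' s" for c s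
  have h0: "h c s \<ge> 0" if "c \<ge> 0" for c s using that P'0 Q'0 \<nu> by (simp add: h_def)
  have hc: "continuous_on UNIV (h c)" for c unfolding h_def by (intro continuous_intros P'c Q'c)
  define W where "W c s = h c s powr (1 / (p - 1))" for c s
  have W0: "W c s \<ge> 0" for c s by (simp add: W_def)
  have Wc: "continuous_on UNIV (W c)" if "c \<ge> 0" for c
    unfolding W_def using hc h0[OF that] p by (intro continuous_on_powr' continuous_intros) auto
  have Wm: "W c \<in> borel_measurable borel" if "c \<ge> 0" for c using Wc[OF that] by (rule borel_measurable_continuous_onI)
  have Wpow: "W c s powr (p - 1) = h c s" if "c \<ge> 0" for c s
    using h0[OF that, of s] p by (simp add: W_def powr_powr)
  define \<beta> where "\<beta> = a / (p - 1)"
  have \<beta>: "\<beta> > 1 / p" "\<beta> > 0"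
  proof -
    have "(p - 1) < a * p" using p by (simp add: a_def field_simps)
    then show "\<beta> > 1 / p" using p by (simp add: \<beta>_def field_simps)
    then show "\<beta> > 0" using p by (smt (verit) divide_pos_pos)
  qed
  have Wd: "\<bar>W c s\<bar> \<le> ((c + \<nu>) * (D / a)) powr (1 / (p - 1)) * exp (- \<beta> * s)" if c: "c \<ge> 0" and s: "s \<ge> 0" for c s
  proof -
    have "h c s \<le> c * (D / a * exp (- a * s)) + \<nu> * (D / a * exp (- a * s))"
      unfolding h_def P'_def Q'_def using c \<nu> s PP(3)[OF s] QQ(3)[OF s] by (intro add_mono mult_left_mono) auto
    also have "\<dots> = ((c + \<nu>) * (D / a)) * exp (- a * s)" by (simp only: distrib_right mult.assoc)
    finally have "W c s \<le> (((c + \<nu>) * (D / a)) * exp (- a * s)) powr (1 / (p - 1))"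
      unfolding W_def using h0[OF c] p by (intro powr_mono2) auto
    also have "\<dots> = ((c + \<nu>) * (D / a)) powr (1 / (p - 1)) * exp (- \<beta> * s)"
    proof -
      have "D \<ge> 0" using \<rho>D[of 0] \<rho>0[of 0] by simp
      then have K: "(c + \<nu>) * (D / a) \<ge> 0" using c \<nu> a by simp
      have "- a * s * (1 / (p - 1)) = - \<beta> * s" by (simp add: \<beta>_def)
      then have "exp (- a * s) powr (1 / (p - 1)) = exp (- \<beta> * s)" by (simp only: exp_powr_real)
      moreover have "(K * x) powr r = K powr r * x powr r" if "K \<ge> 0" "x \<ge> 0" for K x r :: real
        by (rule powr_mult)
      ultimately show ?thesis using K by (simp only: exp_ge_zero)
    qed
    finally show ?thesis using W0[of c s] by simp
  qed
  have WLp: "Lp p (W c)" if "c \<ge> 0" for c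
    using Wm[OF that] Wd[OF that] \<beta> p1 by (intro Lp_exp_decay[where a = \<beta>]) auto
  \<comment> \<open>The integrand is the gap between \<open>powr p\<close> and its tangent at
    \<open>W c s\<close>. Its slope there is \<open>p * h c s\<close>, which is why only the two
    functionals of the linear problem survive integration.\<close>
  have gap: "(LINT s:{0..}|lborel. w0 s powr p - (W c s powr p + p * h c s * (w0 s - W c s))) = \<Phi> w0 - \<Phi> (W c) - p * c * (ell w0 - ell (W c))"
    "set_integrable lborel {0..} (\<lambda>s. w0 s powr p - (W c s powr p + p * h c s * (w0 s - W c s)))" if c: "c \<ge> 0" for c
  proof -
    note iP = PP(6)[OF w0 p1(1) w0a(2)] PP(6)[OF WLp[OF c] p1(1) W0]
    note iQ = QQ(6)[OF w0 p1(1) w0a(2)] QQ(6)[OF WLp[OF c] p1(1) W0]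
    have iw: "set_integrable lborel {0..} (\<lambda>s. w0 s powr p)" using w0 w0a(2) by (simp add: Lp_def)
    have iW: "set_integrable lborel {0..} (\<lambda>s. W c s powr p)" using WLp[OF c] W0 by (simp add: Lp_def)
    define g where "g s = (w0 s powr p - W c s powr p) - (p * c * (w0 s * P s - W c s * P s) + \<nu> * p * (w0 s * Q s - W c s * Q s))" for s
    have gi: "set_integrable lborel {0..} g"
      unfolding g_def by (intro set_integral_diff set_integral_add set_integrable_mult_right iw iW iP iQ)
    have e: "w0 s powr p - (W c s powr p + p * h c s * (w0 s - W c s)) = g s" if "s \<in> {0..}" for s
      using that by (simp add: g_def h_def P'_def Q'_def algebra_simps)
    have "set_integrable lborel {0..} (\<lambda>s. w0 s powr p - (W c s powr p + p * h c s * (w0 s - W c s))) = set_integrable lborel {0..} g"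
      using e by (intro set_integrable_cong) auto
    then show "set_integrable lborel {0..} (\<lambda>s. w0 s powr p - (W c s powr p + p * h c s * (w0 s - W c s)))" using gi by simp
    have "(LINT s:{0..}|lborel. w0 s powr p - (W c s powr p + p * h c s * (w0 s - W c s))) = (LINT s:{0..}|lborel. g s)"
      using e by (intro set_lebesgue_integral_cong) auto
    also have "\<dots> = ((LINT s:{0..}|lborel. w0 s powr p) - (LINT s:{0..}|lborel. W c s powr p))
       - (p * c * (ell w0 - ell (W c)) + \<nu> * p * (m w0 - m (W c)))"
      unfolding g_def ell_def m_def using iw iW iP iQ
      by (simp add: set_integral_diff set_integral_add)
    also have "(LINT s:{0..}|lborel. w0 s powr p) = enrg p w0 {0..}" unfolding enrg_def using w0a(2) by simp
    also have "(LINT s:{0..}|lborel. W c s powr p) = enrg p (W c) {0..}" unfolding enrg_def using W0 by simp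
    finally show "(LINT s:{0..}|lborel. w0 s powr p - (W c s powr p + p * h c s * (w0 s - W c s))) = \<Phi> w0 - \<Phi> (W c) - p * c * (ell w0 - ell (W c))"
      by (simp add: \<Phi>_def algebra_simps)
  qed
  have gapnn: "0 \<le> w0 s powr p - (W c s powr p + p * h c s * (w0 s - W c s))" if "c \<ge> 0" for c s
    using powr_tangent[OF p1(1) w0a(2)[of s] W0[of c s]] Wpow[OF that] by simp
  have gapI: "0 \<le> \<Phi> w0 - \<Phi> (W c) - p * c * (ell w0 - ell (W c))" if "c \<ge> 0" for c
    unfolding gap(1)[OF that, symmetric] set_lebesgue_integral_def
    using gapnn[OF that] by (intro integral_nonneg_AE) auto
  have "\<exists>c1\<ge>0. \<Phi> w0 < \<Phi> (W c1)"
  proof (rule ccontr)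
    assume "\<not> ?thesis"
    then have le: "\<Phi> (W c) \<le> \<Phi> w0" if "c \<ge> 0" for c using that by (auto simp: not_less)
    \<comment> \<open>Makes \<open>W c\<close> at least \<open>(ell w0 + 1) / P1\<close> on [0,1],
      where \<open>P\<close> is at least \<open>P1\<close>, so that \<open>ell (W c)\<close> would
      beat the optimum.\<close>
    define c where "c = ((ell w0 + 1) / P1) powr (p - 1) / P1"
    have c: "c \<ge> 0" using P1 by (simp add: c_def)
    have "(ell w0 + 1) / P1 * P1 \<le> ell (W c)"
      unfolding ell_def[of "W c"]
    proof (rule set_integral_ge_unit[OF PP(6)[OF WLp[OF c] p1(1) W0], of 0])
      show "0 \<le> W c s * P s" for s using W0 PP(2) by simp
      fix s :: real assume s: "s \<in> {0..0 + 1}"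
      have Ps: "P1 \<le> P s" using Plow s by simp
      have "c * P1 \<le> h c s" unfolding h_def P'_def using s Ps c \<nu> Q'0[of s] by (intro add_increasing2 mult_left_mono) auto
      then have "(c * P1) powr (1 / (p - 1)) \<le> W c s" unfolding W_def using c P1 p by (intro powr_mono2) auto
      moreover have "(c * P1) powr (1 / (p - 1)) = (ell w0 + 1) / P1"
        using P1 p ll_pos by (simp add: c_def powr_powr)
      ultimately show "(ell w0 + 1) / P1 * P1 \<le> W c s * P s"
        using Ps P1 ll_pos W0 by (intro mult_mono) auto
    qed auto
    then have "ell w0 + 1 \<le> ell (W c)" using P1 by simp
    then show False using opt[OF WLp[OF c] W0 le[OF c]] by simp
  qed
  then obtain c1 where c1: "c1 \<ge> 0" "\<Phi> w0 < \<Phi> (W c1)" by blast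
  \<comment> \<open>Dominated convergence: \<open>W\<close> increases with \<open>c\<close>, and
    \<open>\<nu> * Q\<close> is at most \<open>W c1 powr (p - 1)\<close>, so a multiple of
    \<open>W c1 powr p\<close> is a majorant.\<close>
  have \<Phi>c: "continuous_on {0..c1} (\<lambda>c. \<Phi> (W c))"
  proof -
    define G where "G c s = W c s powr p - \<nu> * p * (W c s * Q s)" for c s
    have GI: "set_integrable lborel {0..} (G c)" "\<Phi> (W c) = (LINT s:{0..}|lborel. G c s)" if c: "c \<ge> 0" for c
    proof -
      have iW: "set_integrable lborel {0..} (\<lambda>s. W c s powr p)" using WLp[OF c] W0 by (simp add: Lp_def)
      note iQ = QQ(6)[OF WLp[OF c] p1(1) W0]
      show "set_integrable lborel {0..} (G c)" unfolding G_def by (intro set_integral_diff set_integrable_mult_right iW iQ)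
      show "\<Phi> (W c) = (LINT s:{0..}|lborel. G c s)"
        unfolding \<Phi>_def enrg_def m_def G_def using iW iQ W0 by (simp add: set_integral_diff)
    qed
    have "continuous_on {0..c1} (\<lambda>c. LINT s|lborel. indicat_real {0..} s *\<^sub>R G c s)"
      unfolding continuous_on_sequentially
    proof (intro ballI allI impI)
      fix c and x :: "nat \<Rightarrow> real"
      assume c: "c \<in> {0..c1}" and "(\<forall>n. x n \<in> {0..c1}) \<and> x \<longlonglongrightarrow> c"
      then have x: "\<And>n. x n \<in> {0..c1}" "x \<longlonglongrightarrow> c" by auto
      show "((\<lambda>c. LINT s|lborel. indicat_real {0..} s *\<^sub>R G c s) \<circ> x) \<longlonglongrightarrow> (LINT s|lborel. indicat_real {0..} s *\<^sub>R G c s)"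
        unfolding o_def
      proof (rule integral_dominated_convergence)
        show "(\<lambda>s. indicat_real {0..} s *\<^sub>R G c s) \<in> borel_measurable lborel"
          using GI(1)[of c] c by (auto simp: set_integrable_def)
        show "(\<lambda>s. indicat_real {0..} s *\<^sub>R G (x n) s) \<in> borel_measurable lborel" for n
          using GI(1)[of "x n"] x(1)[of n] by (auto simp: set_integrable_def)
        show "integrable lborel (\<lambda>s. indicat_real {0..} s *\<^sub>R ((1 + p) * W c1 s powr p))"
        proof -
          have "set_integrable lborel {0..} (\<lambda>s. W c1 s powr p)" using WLp[OF c1(1)] W0 by (simp add: Lp_def)
          then have "set_integrable lborel {0..} (\<lambda>s. (1 + p) * W c1 s powr p)" by (rule set_integrable_mult_right)
          then show ?thesis by (simp add: set_integrable_def)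
        qed
        show "AE s in lborel. (\<lambda>n. indicat_real {0..} s *\<^sub>R G (x n) s) \<longlonglongrightarrow> indicat_real {0..} s *\<^sub>R G c s"
        proof (rule AE_I2)
          fix s :: real
          have "(\<lambda>n. h (x n) s) \<longlonglongrightarrow> h c s" unfolding h_def by (intro tendsto_intros x)
          then have "(\<lambda>n. W (x n) s) \<longlonglongrightarrow> W c s"
            unfolding W_def using p x(1) h0 by (intro tendsto_powr' tendsto_const) auto
          moreover from this have "(\<lambda>n. W (x n) s powr p) \<longlonglongrightarrow> W c s powr p"
            using p W0 by (intro tendsto_powr' tendsto_const) auto
          ultimately show "(\<lambda>n. indicat_real {0..} s *\<^sub>R G (x n) s) \<longlonglongrightarrow> indicat_real {0..} s *\<^sub>R G c s"
            unfolding G_def by (intro tendsto_scaleR tendsto_diff tendsto_mult tendsto_const)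
        qed
        show "AE s in lborel. norm (indicat_real {0..} s *\<^sub>R G (x n) s) \<le> indicat_real {0..} s *\<^sub>R ((1 + p) * W c1 s powr p)" for n
        proof (rule AE_I2)
          fix s :: real
          show "norm (indicat_real {0..} s *\<^sub>R G (x n) s) \<le> indicat_real {0..} s *\<^sub>R ((1 + p) * W c1 s powr p)"
          proof (cases "s \<ge> 0")
            case True
            have xn: "0 \<le> x n" "x n \<le> c1" using x(1)[of n] by auto
            have "h (x n) s \<le> h c1 s" unfolding h_def using xn P'0[of s] by (intro add_right_mono mult_right_mono)
            then have WW: "W (x n) s \<le> W c1 s" unfolding W_def using h0[OF xn(1)] p by (intro powr_mono2) auto
            have "\<nu> * Q s \<le> h c1 s" unfolding h_def Q'_def using True c1(1) P'0[of s] by (simp add: add_increasing)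
            then have "W (x n) s * (\<nu> * Q s) \<le> W c1 s * W c1 s powr (p - 1)"
              unfolding Wpow[OF c1(1)] using WW W0 \<nu> QQ(2) by (intro mult_mono) auto
            also have "\<dots> = W c1 s powr p" using powr_mult_base[of "W c1 s" "p - 1"] W0 by simp
            finally have "p * (W (x n) s * (\<nu> * Q s)) \<le> p * W c1 s powr p" using p by (intro mult_left_mono) auto
            moreover have "W (x n) s powr p \<le> W c1 s powr p" using WW W0 p by (intro powr_mono2) auto
            moreover have "0 \<le> p * (W (x n) s * (\<nu> * Q s))" using p W0 \<nu> QQ(2) by simp
            ultimately have "\<bar>W (x n) s powr p - p * (W (x n) s * (\<nu> * Q s))\<bar> \<le> W c1 s powr p + p * W c1 s powr p"
              using powr_ge_zero[of "W (x n) s" p] powr_ge_zero[of "W c1 s" p] by (simp add: abs_le_iff del: powr_ge_zero)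
            moreover have "G (x n) s = W (x n) s powr p - p * (W (x n) s * (\<nu> * Q s))" by (simp add: G_def)
            ultimately show ?thesis using True by (simp add: distrib_right)
          qed simp
        qed
      qed
    qed
    then show ?thesis
      by (rule continuous_on_eq) (use GI(2) in \<open>auto simp: set_lebesgue_integral_def\<close>)
  qed
  \<comment> \<open>At \<open>c = 0\<close> the multiplier term drops out of the gap; together with
    \<open>c1\<close> this brackets the level of \<open>w0\<close>.\<close>
  have "\<Phi> (W 0) \<le> \<Phi> w0" using gapI[of 0] by simp
  then obtain c where c: "0 \<le> c" "c \<le> c1" "\<Phi> (W c) = \<Phi> w0"
    using IVT'[of "\<lambda>c. \<Phi> (W c)" 0 "\<Phi> w0" c1] \<Phi>c c1 by auto
  have "ell (W c) \<le> ell w0" using c by (intro opt WLp W0) auto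
  then have "0 \<le> p * c * (ell w0 - ell (W c))" using p c by simp
  then have zero: "(LINT s:{0..}|lborel. w0 s powr p - (W c s powr p + p * h c s * (w0 s - W c s))) = 0"
    using gap(1)[OF c(1)] gapI[OF c(1)] c(3) by simp
  \<comment> \<open>A nonnegative gap with zero integral vanishes almost everywhere, and strict
    convexity forces the two densities to agree there.\<close>
  have ae: "AE s in lborel. s \<in> {0..} \<longrightarrow> w0 s = W c s"
  proof -
    have "AE s in lborel. indicat_real {0..} s *\<^sub>R (w0 s powr p - (W c s powr p + p * h c s * (w0 s - W c s))) = 0"
      using zero gap(2)[OF c(1)] gapnn[OF c(1)] unfolding set_lebesgue_integral_def set_integrable_def
      by (subst integral_nonneg_eq_0_iff_AE[symmetric]) auto
    then show ?thesis
    proof eventually_elim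
      fix s assume "indicat_real {0..} s *\<^sub>R (w0 s powr p - (W c s powr p + p * h c s * (w0 s - W c s))) = 0"
      then have "w0 s powr p = W c s powr p + p * h c s * (w0 s - W c s)" if "s \<in> {0..}" using that by simp
      then show "s \<in> {0..} \<longrightarrow> w0 s = W c s"
        using powr_tangent_strict[OF p1(1) w0a(2)[of s] W0[of c s]] Wpow[OF c(1), of s] by fastforce
    qed
  qed
  have pe: "prim (W c) s = prim w0 s" for s
    unfolding prim_def
    by (rule set_lebesgue_integral_cong_AE) (use Wm[OF c(1)] w0 in \<open>auto simp: Lp_def intro: AE_mp[OF ae AE_I2]\<close>)
  have ee: "enrg p (W c) {0..} = enrg p w0 {0..}"
    unfolding enrg_def
    by (rule set_lebesgue_integral_cong_AE) (use Wm[OF c(1)] w0 in \<open>auto simp: Lp_def intro: AE_mp[OF ae AE_I2]\<close>)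
  have me: "mass p (W c) {0..} = mass p w0 {0..}" and je: "J (W c) = J w0"
    by (simp_all add: mass_def J_def expint_def pe)
  show ?thesis
  proof (rule that[of "W c" \<beta> "((c + \<nu>) * (D / a)) powr (1 / (p - 1))"])
    show "adm (W c)" using WLp[OF c(1)] ee me F1 by (simp add: adm_def)
    show "continuous_on {0..} (W c)" by (rule continuous_on_subset[OF Wc[OF c(1)]]) auto
    show "enrg p (W c) {0..} - \<nu> * mass p (W c) {0..} = 1" using ee me F1 by simp
    show "expint (p / (p - 1)) v {0..} \<le> expint (p / (p - 1)) (W c) {0..}" if "adm v" for v
      using w0a(3)[OF that] je by (simp add: J_def q(2))
  qed (use \<beta> Wd[OF c(1)] in auto)
qed

end

section \<open>Transfer to the interval\<close>

text \<open>The substitution rule is applied to an increasing exponential on the intervals [-n,0];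
  monotone convergence exhausts the half line, and a reflection gives the stated
  orientation.\<close>

lemma exp_substitution_nn:
  fixes h :: "real \<Rightarrow> real"
  assumes [measurable]: "h \<in> borel_measurable borel" and h: "\<And>x. 0 \<le> h x" and RT: "R > 0" "T > 0"
  shows "(\<integral>\<^sup>+x. indicator {0<..<R} x * ennreal (h x) \<partial>lborel) =
    (\<integral>\<^sup>+s. ennreal (indicator {0..} s * (h (R * exp (- s / T)) * (R * exp (- s / T) / T))) \<partial>lborel)"
proof -
  define g where "g x = R * exp (x / T)" for x
  define g' where "g' x = R * exp (x / T) / T" for x
  have gR: "g 0 = R" by (simp add: g_def)
  have gpos: "g x > 0" for x using RT by (simp add: g_def)
  have g'0: "g' x \<ge> 0" for x using RT by (simp add: g'_def)
  have [measurable]: "g \<in> borel_measurable borel" "g' \<in> borel_measurable borel" unfolding g_def g'_def by measurable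
  have gle: "g x \<le> y \<longleftrightarrow> x \<le> T * ln (y / R)" if "y > 0" for x y
  proof -
    have "g x \<le> y \<longleftrightarrow> exp (x / T) \<le> y / R" using RT by (simp add: g_def field_simps)
    also have "\<dots> \<longleftrightarrow> x / T \<le> ln (y / R)" using that RT by (simp add: ln_ge_iff)
    also have "\<dots> \<longleftrightarrow> x \<le> T * ln (y / R)" using RT by (simp add: field_simps)
    finally show ?thesis .
  qed
  have gmono: "g x \<le> g y" if "x \<le> y" for x y using RT that by (simp add: g_def divide_right_mono)
  have step: "(\<integral>\<^sup>+x. ennreal (h x * indicator {g (- real n)..g 0} x) \<partial>lborel) =
      (\<integral>\<^sup>+x. ennreal (h (g x) * g' x * indicator {- real n..0} x) \<partial>lborel)" for n
  proof (rule nn_integral_substitution)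
    show "set_borel_measurable borel {g (- real n)..g 0} h" unfolding set_borel_measurable_def by measurable
    show "(g has_real_derivative g' x) (at x)" for x
      unfolding g_def g'_def using RT by (auto intro!: derivative_eq_intros)
    show "continuous_on {- real n..0} g'" unfolding g'_def using RT by (intro continuous_intros) auto
  qed (use g'0 in auto)
  have L: "(\<lambda>n. \<integral>\<^sup>+x. ennreal (h x * indicator {g (- real n)..g 0} x) \<partial>lborel) \<longlonglongrightarrow> (\<integral>\<^sup>+x. ennreal (h x * indicator {0<..R} x) \<partial>lborel)"
  proof (rule nn_integral_LIMSEQ)
    show "incseq (\<lambda>n x. ennreal (h x * indicator {g (- real n)..g 0} x))"
    proof (intro incseq_SucI le_funI ennreal_leI mult_left_mono h)
      fix n x
      have "g (- real (Suc n)) \<le> g (- real n)" by (rule gmono) simp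
      then show "indicat_real {g (- real n)..g 0} x \<le> indicator {g (- real (Suc n))..g 0} x"
        by (auto simp: indicator_def)
    qed
    fix x :: real
    show "(\<lambda>n. ennreal (h x * indicator {g (- real n)..g 0} x)) \<longlonglongrightarrow> ennreal (h x * indicator {0<..R} x)"
    proof (rule tendsto_eventually)
      show "\<forall>\<^sub>F n in sequentially. ennreal (h x * indicator {g (- real n)..g 0} x) = ennreal (h x * indicator {0<..R} x)"
      proof (cases "x > 0")
        case True
        obtain m :: nat where m: "- (T * ln (x / R)) \<le> real m" using real_arch_simple by blast
        show ?thesis
        proof (rule eventually_sequentiallyI[of m])
          fix n assume "m \<le> n"
          then have "g (- real n) \<le> x" using gle[OF True] m by (metis le_trans minus_le_iff of_nat_le_iff order_trans)
          then show "ennreal (h x * indicator {g (- real n)..g 0} x) = ennreal (h x * indicator {0<..R} x)"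
            using True gR by (simp add: indicator_def)
        qed
      next
        case False
        then have "x \<notin> {g (- real n)..g 0}" for n using gpos[of "- real n"] by auto
        then show ?thesis using False by simp
      qed
    qed
  qed measurable
  have Rr: "(\<lambda>n. \<integral>\<^sup>+x. ennreal (h (g x) * g' x * indicator {- real n..0} x) \<partial>lborel) \<longlonglongrightarrow> (\<integral>\<^sup>+x. ennreal (h (g x) * g' x * indicator {..0} x) \<partial>lborel)"
  proof (rule nn_integral_LIMSEQ)
    show "incseq (\<lambda>n x. ennreal (h (g x) * g' x * indicator {- real n..0} x))"
      using h g'0 by (intro incseq_SucI le_funI ennreal_leI mult_left_mono) (auto simp: indicator_def)
    fix x :: real
    show "(\<lambda>n. ennreal (h (g x) * g' x * indicator {- real n..0} x)) \<longlonglongrightarrow> ennreal (h (g x) * g' x * indicator {..0} x)"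
    proof (rule tendsto_eventually)
      obtain m :: nat where m: "- x \<le> real m" using real_arch_simple by blast
      show "\<forall>\<^sub>F n in sequentially. ennreal (h (g x) * g' x * indicator {- real n..0} x) = ennreal (h (g x) * g' x * indicator {..0} x)"
        using m by (intro eventually_sequentiallyI[of m]) (auto simp: indicator_def)
    qed
  qed measurable
  have "(\<integral>\<^sup>+x. indicator {0<..<R} x * ennreal (h x) \<partial>lborel) = (\<integral>\<^sup>+x. ennreal (h x * indicator {0<..R} x) \<partial>lborel)"
  proof (intro nn_integral_cong_AE)
    show "AE x in lborel. indicator {0<..<R} x * ennreal (h x) = ennreal (h x * indicator {0<..R} x)"
      using AE_lborel_singleton[of R] by eventually_elim (auto simp: indicator_def)
  qed
  also have "\<dots> = (\<integral>\<^sup>+x. ennreal (h (g x) * g' x * indicator {..0} x) \<partial>lborel)"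
    using L Rr unfolding step by (rule LIMSEQ_unique)
  also have "\<dots> = ennreal \<bar>- 1\<bar> * (\<integral>\<^sup>+s. ennreal (h (g (0 + (- 1) * s)) * g' (0 + (- 1) * s) * indicator {..0} (0 + (- 1) * s)) \<partial>lborel)"
    by (rule nn_integral_real_affine) auto
  also have "\<dots> = (\<integral>\<^sup>+s. ennreal (indicator {0..} s * (h (R * exp (- s / T)) * (R * exp (- s / T) / T))) \<partial>lborel)"
    by (simp, intro nn_integral_cong) (auto simp: indicator_def g_def g'_def)
  finally show ?thesis .
qed

lemma exp_substitution:
  fixes f :: "real \<Rightarrow> real"
  assumes f: "f \<in> borel_measurable borel" and RT: "R > 0" "T > 0" and A: "A \<in> sets borel" "A \<subseteq> {0<..<R}" "B \<in> sets borel"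
    "\<And>s. s \<in> B \<longleftrightarrow> 0 \<le> s \<and> R * exp (- s / T) \<in> A"
  shows "set_integrable lborel A f \<longleftrightarrow> set_integrable lborel B (\<lambda>s. f (R * exp (- s / T)) * (R * exp (- s / T) / T))"
    "(LINT x:A|lborel. f x) = (LINT s:B|lborel. f (R * exp (- s / T)) * (R * exp (- s / T) / T))"
proof -
  define F where "F x = indicator A x * f x" for x
  define G where "G s = indicator B s * (f (R * exp (- s / T)) * (R * exp (- s / T) / T))" for s
  have Fm [measurable]: "F \<in> borel_measurable borel" unfolding F_def using f A by measurable
  have Gm [measurable]: "G \<in> borel_measurable borel" unfolding G_def using f A by measurable
  \<comment> \<open>Here \<open>k\<close> will be the positive or the negative part; positive
    homogeneity lets it commute with the Jacobian factor.\<close>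
  have *: "(\<integral>\<^sup>+x. ennreal (k (F x)) \<partial>lborel) = (\<integral>\<^sup>+s. ennreal (k (G s)) \<partial>lborel)"
    if k: "k \<in> borel_measurable borel" "\<And>x. k x \<ge> 0" "k 0 = 0" "\<And>x c. c \<ge> 0 \<Longrightarrow> k (x * c) = k x * c" for k :: "real \<Rightarrow> real"
  proof -
    have m: "(\<lambda>x. k (F x)) \<in> borel_measurable borel" using k(1) by measurable
    have "(\<integral>\<^sup>+x. ennreal (k (F x)) \<partial>lborel) = (\<integral>\<^sup>+x. indicator {0<..<R} x * ennreal (k (F x)) \<partial>lborel)"
      using A(2) k(3) by (intro nn_integral_cong) (auto simp: F_def indicator_def)
    also have "\<dots> = (\<integral>\<^sup>+s. ennreal (indicator {0..} s * (k (F (R * exp (- s / T))) * (R * exp (- s / T) / T))) \<partial>lborel)"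
      by (rule exp_substitution_nn[OF m k(2) RT])
    also have "\<dots> = (\<integral>\<^sup>+s. ennreal (k (G s)) \<partial>lborel)"
    proof (intro nn_integral_cong arg_cong[where f = ennreal])
      fix s :: real
      have c: "R * exp (- s / T) / T \<ge> 0" using RT by simp
      show "indicator {0..} s * (k (F (R * exp (- s / T))) * (R * exp (- s / T) / T)) = k (G s)"
        using A(4)[of s] k(3) k(4)[OF c, of "f (R * exp (- s / T))"] by (auto simp: F_def G_def indicator_def)
    qed
    finally show ?thesis .
  qed
  have me: "ennreal (max 0 x) = ennreal x" for x by (simp add: max_def ennreal_neg)
  have pos: "(\<integral>\<^sup>+x. ennreal (F x) \<partial>lborel) = (\<integral>\<^sup>+s. ennreal (G s) \<partial>lborel)"
  proof -
    have "max 0 (x * c) = max 0 x * c" if "c \<ge> 0" for x c :: real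
      using that max_mult_distrib_right[of 0 x c] by simp
    from *[of "\<lambda>x. max 0 x", OF _ _ _ this] show ?thesis by (simp only: me) simp
  qed
  have neg: "(\<integral>\<^sup>+x. ennreal (- F x) \<partial>lborel) = (\<integral>\<^sup>+s. ennreal (- G s) \<partial>lborel)"
  proof -
    have "max 0 (- (x * c)) = max 0 (- x) * c" if "c \<ge> 0" for x c :: real
      using that max_mult_distrib_right[of 0 "- x" c] by simp
    from *[of "\<lambda>x. max 0 (- x)", OF _ _ _ this] show ?thesis by (simp only: me) simp
  qed
  have i: "integrable lborel F \<longleftrightarrow> integrable lborel G"
    unfolding real_integrable_def using pos neg by simp
  then show "set_integrable lborel A f \<longleftrightarrow> set_integrable lborel B (\<lambda>s. f (R * exp (- s / T)) * (R * exp (- s / T) / T))"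
    by (simp add: set_integrable_def F_def[abs_def] G_def[abs_def])
  have "integral\<^sup>L lborel F = integral\<^sup>L lborel G"
  proof (cases "integrable lborel F")
    case True
    then show ?thesis using i pos neg by (simp add: real_lebesgue_integral_def)
  next
    case False
    then show ?thesis using i by (simp add: not_integrable_integral_eq)
  qed
  then show "(LINT x:A|lborel. f x) = (LINT s:B|lborel. f (R * exp (- s / T)) * (R * exp (- s / T) / T))"
    by (simp add: set_lebesgue_integral_def F_def[abs_def] G_def[abs_def])
qed

section \<open>Constants and norms under the logarithmic change of variables\<close>

locale radial =
  fixes p R th :: real
  assumes p: "p \<ge> 2" and R: "R > 0" and th: "th \<ge> p - 1"
begin

definition T :: real where "T = th + 1"
text \<open>The amplitude factor for the function. It makes the gradient norm to the power
  \<open>p\<close> equal to \<open>enrg\<close> without a constant and simultaneously satisfies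
  \<open>K powr (p / (p - 1)) = mu (p - 1) th\<close>, which normalises the critical exponent to
  1.\<close>

definition K :: real where "K = T powr ((p - 1) / p) * omega (p - 1) powr (1 / p)"
definition rr :: "real \<Rightarrow> real" where "rr s = R * exp (- s / T)"
definition ss :: "real \<Rightarrow> real" where "ss r = T * ln (R / r)"
text \<open>In the variable \<open>s\<close> the measure with weight \<open>th\<close> becomes
  \<open>cJ * exp (- s)\<close>; \<open>cM\<close> also undoes the amplitude factor in the
  mass.\<close>

definition cJ :: real where "cJ = omega th * R powr T / T"
definition cM :: real where "cM = cJ / K powr p"

lemma p1: "p > 1" "p \<ge> 1" "p > 0" using p by auto

lemma T: "T \<ge> p" "T > 0" using p th by (auto simp: T_def)

lemma omega_pos: "s > 0 \<Longrightarrow> omega s > 0"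
  unfolding omega_def using Gamma_real_pos[of "s / 2"] by simp

lemma om: "omega (p - 1) > 0" "omega th > 0"
  using p th by (auto intro!: omega_pos)

lemma K: "K > 0" using om T by (simp add: K_def)

lemma cpos: "cJ > 0" "cM > 0" using om T R K by (simp_all add: cJ_def cM_def)

lemma Kp: "K powr p = T powr (p - 1) * omega (p - 1)"
  using om T p by (simp add: K_def powr_mult powr_powr)

lemma Kq: "K powr (p / (p - 1)) = mu (p - 1) th"
proof -
  have "(p - 1) / p * (p / (p - 1)) = 1" "1 / p * (p / (p - 1)) = 1 / (p - 1)" using p by simp_all
  then show ?thesis using om T unfolding K_def mu_def powr_mult powr_powr by (simp add: T_def)
qed

lemma rr: "rr s > 0" "0 < s \<Longrightarrow> rr s < R" "0 \<le> s \<Longrightarrow> rr s \<le> R"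
  using R T by (auto simp: rr_def)

lemma rr_ss: "0 < r \<Longrightarrow> rr (ss r) = r" and ss_rr: "ss (rr s) = s"
  using R T by (simp_all add: rr_def ss_def ln_div exp_diff ln_mult)

lemma ss_pos: "0 < r \<Longrightarrow> r < R \<Longrightarrow> 0 < ss r" "0 < r \<Longrightarrow> r \<le> R \<Longrightarrow> 0 \<le> ss r"
  using R T by (auto simp: ss_def)

lemma ss_antimono: "0 < x \<Longrightarrow> x \<le> y \<Longrightarrow> ss y \<le> ss x"
  using R T by (auto simp: ss_def intro!: mult_left_mono divide_left_mono)

lemma rr_le_iff: "0 < y \<Longrightarrow> rr s \<le> y \<longleftrightarrow> ss y \<le> s" and le_rr_iff: "0 < y \<Longrightarrow> y \<le> rr s \<longleftrightarrow> s \<le> ss y"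
proof -
  have sm: "rr s \<le> rr t \<longleftrightarrow> t \<le> s" for s t using R T by (simp add: rr_def divide_le_cancel)
  show "0 < y \<Longrightarrow> rr s \<le> y \<longleftrightarrow> ss y \<le> s" using sm[of s "ss y"] by (simp add: rr_ss)
  show "0 < y \<Longrightarrow> y \<le> rr s \<longleftrightarrow> s \<le> ss y" using sm[of "ss y" s] by (simp add: rr_ss)
qed

lemma rr_measurable [measurable]: "rr \<in> borel_measurable borel"
  unfolding rr_def by measurable

lemma ss_measurable [measurable]: "ss \<in> borel_measurable borel"
  unfolding ss_def by measurable

lemma sub_nn:
  assumes "h \<in> borel_measurable borel" "\<And>x. 0 \<le> h x"
  shows "(\<integral>\<^sup>+x. indicator {0<..<R} x * ennreal (h x) \<partial>lborel) = (\<integral>\<^sup>+s. ennreal (indicator {0..} s * (h (rr s) * (rr s / T))) \<partial>lborel)"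
  unfolding rr_def by (rule exp_substitution_nn[OF assms R T(2)])

lemma sub_interval:
  assumes "f \<in> borel_measurable borel" "0 < x" "x \<le> y" "y < R"
  shows "set_integrable lborel {x..y} f \<longleftrightarrow> set_integrable lborel {ss y..ss x} (\<lambda>s. f (rr s) * (rr s / T))"
    "(LINT r:{x..y}|lborel. f r) = (LINT s:{ss y..ss x}|lborel. f (rr s) * (rr s / T))"
proof -
  have B: "s \<in> {ss y..ss x} \<longleftrightarrow> 0 \<le> s \<and> R * exp (- s / T) \<in> {x..y}" for s
    using rr_le_iff[of y s] le_rr_iff[of x s] ss_pos[of y] assms unfolding rr_def by auto
  have A: "{x..y} \<subseteq> {0<..<R}" using assms by auto
  show "set_integrable lborel {x..y} f \<longleftrightarrow> set_integrable lborel {ss y..ss x} (\<lambda>s. f (rr s) * (rr s / T))"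
    "(LINT r:{x..y}|lborel. f r) = (LINT s:{ss y..ss x}|lborel. f (rr s) * (rr s / T))"
    unfolding rr_def by (intro exp_substitution[OF assms(1) R T(2) _ A _ B]; simp)+
qed

lemma rr_powr: "rr s powr a * rr s = R powr (a + 1) * exp (- s / T * (a + 1))"
proof -
  have "rr s powr a * rr s = rr s powr (a + 1)" using rr(1)[of s] by (simp add: powr_add)
  also have "\<dots> = R powr (a + 1) * exp (- s / T) powr (a + 1)" using R unfolding rr_def by (simp add: powr_mult)
  also have "exp (- s / T) powr (a + 1) = exp (- s / T * (a + 1))" by (rule exp_powr_real)
  finally show ?thesis .
qed

lemma weight: "omega th * rr s powr th * (rr s / T) = cJ * exp (- s)"
proof -
  have "omega th * rr s powr th * (rr s / T) = omega th * (rr s powr th * rr s) / T" by simp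
  also have "\<dots> = omega th * (R powr (th + 1) * exp (- s / T * (th + 1))) / T" by (simp only: rr_powr)
  also have "- s / T * (th + 1) = - s" using T by (simp add: T_def[symmetric])
  finally show ?thesis by (simp add: cJ_def T_def)
qed

text \<open>Members of the space are measurable only on the interval; \<open>f\<close> stands for a
  measurable extension to the whole line.\<close>

lemma lpn_u:
  assumes [measurable]: "f \<in> borel_measurable borel" and e: "\<And>x. 0 < x \<Longrightarrow> x < R \<Longrightarrow> f x = u x"
  shows "lpn R th p u = ennreal cM * (\<integral>\<^sup>+s. ennreal (indicator {0..} s * (\<bar>K * f (rr s)\<bar> powr p * exp (- s))) \<partial>lborel)"
proof -
  have "lpn R th p u = (\<integral>\<^sup>+ x. indicator {0<..<R} x * ennreal (omega th * x powr th * \<bar>f x\<bar> powr p) \<partial>lborel)"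
    unfolding lpn_def using e by (intro nn_integral_cong) (auto simp: indicator_def)
  also have "\<dots> = (\<integral>\<^sup>+s. ennreal (indicator {0..} s * (omega th * rr s powr th * \<bar>f (rr s)\<bar> powr p * (rr s / T))) \<partial>lborel)"
    using om by (intro sub_nn) auto
  also have "\<dots> = (\<integral>\<^sup>+s. ennreal cM * ennreal (indicator {0..} s * (\<bar>K * f (rr s)\<bar> powr p * exp (- s))) \<partial>lborel)"
  proof (intro nn_integral_cong)
    fix s :: real
    have "omega th * rr s powr th * \<bar>f (rr s)\<bar> powr p * (rr s / T) = (omega th * rr s powr th * (rr s / T)) * \<bar>f (rr s)\<bar> powr p" by simp
    also have "\<dots> = cM * (\<bar>K * f (rr s)\<bar> powr p * exp (- s))"
      unfolding weight cM_def using K by (simp add: abs_mult powr_mult)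
    finally have "omega th * rr s powr th * \<bar>f (rr s)\<bar> powr p * (rr s / T) = cM * (\<bar>K * f (rr s)\<bar> powr p * exp (- s))" .
    then show "ennreal (indicator {0..} s * (omega th * rr s powr th * \<bar>f (rr s)\<bar> powr p * (rr s / T))) =
      ennreal cM * ennreal (indicator {0..} s * (\<bar>K * f (rr s)\<bar> powr p * exp (- s)))"
      using cpos by (simp add: ennreal_mult'[symmetric] mult.left_commute)
  qed
  also have "\<dots> = ennreal cM * (\<integral>\<^sup>+s. ennreal (indicator {0..} s * (\<bar>K * f (rr s)\<bar> powr p * exp (- s))) \<partial>lborel)"
    by (rule nn_integral_cmult) measurable
  finally show ?thesis .
qed

text \<open>The chain rule for \<open>K * u (rr s)\<close>: \<open>rr\<close> decreases, hence the
  sign, and \<open>rr s / T\<close> is the modulus of its derivative.\<close>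

definition bet :: "(real \<Rightarrow> real) \<Rightarrow> real \<Rightarrow> real" where
  "bet w s = - (K * w (rr s) * (rr s / T))"

lemma bet_measurable [measurable]:
  assumes [measurable]: "w \<in> borel_measurable borel"
  shows "bet w \<in> borel_measurable borel"
  unfolding bet_def by measurable

lemma lpn_w:
  assumes [measurable]: "f \<in> borel_measurable borel" and e: "\<And>x. 0 < x \<Longrightarrow> x < R \<Longrightarrow> f x = w x"
  shows "lpn R (p - 1) p w = (\<integral>\<^sup>+s. ennreal (indicator {0..} s * \<bar>bet f s\<bar> powr p) \<partial>lborel)"
proof -
  have "lpn R (p - 1) p w = (\<integral>\<^sup>+ x. indicator {0<..<R} x * ennreal (omega (p - 1) * x powr (p - 1) * \<bar>f x\<bar> powr p) \<partial>lborel)"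
    unfolding lpn_def using e by (intro nn_integral_cong) (auto simp: indicator_def)
  also have "\<dots> = (\<integral>\<^sup>+s. ennreal (indicator {0..} s * (omega (p - 1) * rr s powr (p - 1) * \<bar>f (rr s)\<bar> powr p * (rr s / T))) \<partial>lborel)"
    using om by (intro sub_nn) auto
  also have "\<dots> = (\<integral>\<^sup>+s. ennreal (indicator {0..} s * \<bar>bet f s\<bar> powr p) \<partial>lborel)"
  proof (intro nn_integral_cong arg_cong[where f = ennreal] arg_cong2[where f = "times"] refl)
    fix s :: real
    have "\<bar>bet f s\<bar> = K * (\<bar>f (rr s)\<bar> * (rr s / T))"
      using K rr(1)[of s] T by (simp add: bet_def abs_mult)
    then have "\<bar>bet f s\<bar> powr p = K powr p * (\<bar>f (rr s)\<bar> powr p * (rr s powr p / T powr p))"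
      using rr(1)[of s] T by (simp add: powr_mult powr_divide)
    also have "\<dots> = omega (p - 1) * (T powr (p - 1) / T powr p) * (\<bar>f (rr s)\<bar> powr p * rr s powr p)"
      unfolding Kp by simp
    also have "T powr (p - 1) / T powr p = 1 / T" using T by (simp add: powr_diff)
    also have "rr s powr p = rr s powr (p - 1) * rr s" using powr_mult_base[of "rr s" "p - 1"] rr(1)[of s] by (simp add: mult.commute)
    finally show "omega (p - 1) * rr s powr (p - 1) * \<bar>f (rr s)\<bar> powr p * (rr s / T) = \<bar>bet f s\<bar> powr p"
      by (simp add: mult_ac)
  qed
  finally show ?thesis .
qed

lemma MT_eq:
  assumes b: "Lp p b" and e: "\<And>s. 0 < s \<Longrightarrow> K * u (rr s) = prim b s"
  shows "MT R p (p - 1) th u = ennreal (cJ * expint (p / (p - 1)) b {0..})"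
proof -
  define f where "f x = prim b (max 0 (ss x)) / K" for x
  have [measurable]: "f \<in> borel_measurable borel"
    unfolding f_def using measurable_compose[OF ss_measurable prim_meas[OF b p1(1)]] by measurable
  have fu: "f x = u x" if "0 < x" "x < R" for x
    using e[of "ss x"] ss_pos(1)[OF that] that K by (simp add: f_def rr_ss field_simps)
  have "MT R p (p - 1) th u = (\<integral>\<^sup>+ x. indicator {0<..<R} x * ennreal (omega th * x powr th * exp (mu (p - 1) th * \<bar>f x\<bar> powr (p / (p - 1)))) \<partial>lborel)"
    unfolding MT_def using fu by (intro nn_integral_cong) (auto simp: indicator_def)
  also have "\<dots> = (\<integral>\<^sup>+s. ennreal (indicator {0..} s * (omega th * rr s powr th * exp (mu (p - 1) th * \<bar>f (rr s)\<bar> powr (p / (p - 1))) * (rr s / T))) \<partial>lborel)"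
    using om by (intro sub_nn) auto
  also have "\<dots> = (\<integral>\<^sup>+s. ennreal (cJ * (indicator {0..} s * exp (\<bar>prim b s\<bar> powr (p / (p - 1)) - s))) \<partial>lborel)"
  proof (intro nn_integral_cong arg_cong[where f = ennreal])
    fix s :: real
    have "omega th * rr s powr th * exp (mu (p - 1) th * \<bar>f (rr s)\<bar> powr (p / (p - 1))) * (rr s / T) = cJ * exp (\<bar>prim b s\<bar> powr (p / (p - 1)) - s)" if "s \<ge> 0"
    proof -
      have "mu (p - 1) th * \<bar>f (rr s)\<bar> powr (p / (p - 1)) = \<bar>prim b s\<bar> powr (p / (p - 1))"
        unfolding Kq[symmetric] f_def ss_rr using K that by (simp add: abs_divide powr_divide)
      then have "omega th * rr s powr th * exp (mu (p - 1) th * \<bar>f (rr s)\<bar> powr (p / (p - 1))) * (rr s / T) = (omega th * rr s powr th * (rr s / T)) * exp (\<bar>prim b s\<bar> powr (p / (p - 1)))" by simp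
      also have "\<dots> = cJ * (exp (- s) * exp (\<bar>prim b s\<bar> powr (p / (p - 1))))" unfolding weight by simp
      also have "exp (- s) * exp (\<bar>prim b s\<bar> powr (p / (p - 1))) = exp (\<bar>prim b s\<bar> powr (p / (p - 1)) - s)"
        unfolding exp_add[symmetric] by simp
      finally show ?thesis .
    qed
    then show "indicator {0..} s * (omega th * rr s powr th * exp (mu (p - 1) th * \<bar>f (rr s)\<bar> powr (p / (p - 1))) * (rr s / T)) = cJ * (indicator {0..} s * exp (\<bar>prim b s\<bar> powr (p / (p - 1)) - s))"
      by (simp add: indicator_def)
  qed
  also have "\<dots> = ennreal (LINT s|lborel. cJ * (indicator {0..} s * exp (\<bar>prim b s\<bar> powr (p / (p - 1)) - s)))"
    using expint_integrable[OF b p1(1), of "{0..}"] cpos by (intro nn_integral_eq_integral) (auto simp: set_integrable_def)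
  also have "(LINT s|lborel. cJ * (indicator {0..} s * exp (\<bar>prim b s\<bar> powr (p / (p - 1)) - s))) = cJ * expint (p / (p - 1)) b {0..}"
    by (simp add: expint_def set_lebesgue_integral_def)
  finally show ?thesis .
qed

text \<open>A function on \<open>(0, R)\<close> with derivative \<open>w\<close> corresponds to the primitive of \<open>bet w\<close>
  in the variable \<open>s = T ln (R / r)\<close>.\<close>
definition rep :: "(real \<Rightarrow> real) \<Rightarrow> (real \<Rightarrow> real) \<Rightarrow> (real \<Rightarrow> real) \<Rightarrow> bool" where
  "rep u w b \<longleftrightarrow> Lp p b \<and> (\<forall>s>0. K * u (rr s) = prim b s) \<and> lpp R (p - 1) p w = enrg p b {0..}
     \<and> lpp R th p u = cM * mass p b {0..} \<and> MT R p (p - 1) th u = ennreal (cJ * expint (p / (p - 1)) b {0..})"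

lemma lpn_u_mass:
  assumes b: "Lp p b" and e: "\<And>s. 0 < s \<Longrightarrow> K * u (rr s) = prim b s"
  shows "lpn R th p u = ennreal (cM * mass p b {0..})"
proof -
  define f where "f x = prim b (max 0 (ss x)) / K" for x
  have fm: "f \<in> borel_measurable borel"
    unfolding f_def using measurable_compose[OF ss_measurable prim_meas[OF b p1(1)]] by measurable
  have fu: "f x = u x" if "0 < x" "x < R" for x
    using e[of "ss x"] ss_pos(1)[OF that] that K by (simp add: f_def rr_ss field_simps)
  have "lpn R th p u = ennreal cM * (\<integral>\<^sup>+s. ennreal (indicator {0..} s * (\<bar>K * f (rr s)\<bar> powr p * exp (- s))) \<partial>lborel)"
    by (rule lpn_u[OF fm fu])
  also have "(\<integral>\<^sup>+s. ennreal (indicator {0..} s * (\<bar>K * f (rr s)\<bar> powr p * exp (- s))) \<partial>lborel) =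
      (\<integral>\<^sup>+s. ennreal (indicator {0..} s * (\<bar>prim b s\<bar> powr p * exp (- s))) \<partial>lborel)"
    using K by (intro nn_integral_cong) (auto simp: indicator_def f_def ss_rr)
  also have "\<dots> = ennreal (mass p b {0..})"
    unfolding mass_def set_lebesgue_integral_def real_scaleR_def
    using mass_integrable[OF b p1(1), of "{0..}"] by (intro nn_integral_eq_integral) (auto simp: set_integrable_def)
  finally show ?thesis using cpos by (simp add: ennreal_mult)
qed

lemma repI:
  assumes b: "Lp p b" and e: "\<And>s. 0 < s \<Longrightarrow> K * u (rr s) = prim b s"
    and w: "f \<in> borel_measurable borel" "\<And>x. 0 < x \<Longrightarrow> x < R \<Longrightarrow> f x = w x" "\<And>s. 0 < s \<Longrightarrow> bet f s = b s"
  shows "rep u w b" "lpn R (p - 1) p w < \<infinity>" "lpn R th p u < \<infinity>"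
proof -
  have "lpn R (p - 1) p w = (\<integral>\<^sup>+s. ennreal (indicator {0..} s * \<bar>bet f s\<bar> powr p) \<partial>lborel)"
    by (rule lpn_w[OF w(1,2)])
  also have "\<dots> = (\<integral>\<^sup>+s. ennreal (indicator {0..} s * \<bar>b s\<bar> powr p) \<partial>lborel)"
  proof (intro nn_integral_cong_AE)
    show "AE s in lborel. ennreal (indicator {0..} s * \<bar>bet f s\<bar> powr p) = ennreal (indicator {0..} s * \<bar>b s\<bar> powr p)"
      using AE_lborel_singleton[of 0] by eventually_elim (use w(3) in \<open>auto simp: indicator_def\<close>)
  qed
  also have "\<dots> = ennreal (enrg p b {0..})" by (rule enrg_nn[OF b])
  finally have lw: "lpn R (p - 1) p w = ennreal (enrg p b {0..})" .
  have lu: "lpn R th p u = ennreal (cM * mass p b {0..})" by (rule lpn_u_mass[OF b e])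
  show "lpn R (p - 1) p w < \<infinity>" "lpn R th p u < \<infinity>" by (simp_all add: lw lu)
  show "rep u w b" unfolding rep_def lpp_def lw lu using b e MT_eq[OF b e] cpos by simp
qed

lemma AC_bet:
  assumes ac: "AC_loc_pair R u w" and f: "f \<in> borel_measurable borel" "\<And>x. 0 < x \<Longrightarrow> x < R \<Longrightarrow> f x = w x" and s: "0 < s" "s \<le> t"
  shows "(LINT x:{s..t}|lborel. bet f x) = K * u (rr t) - K * u (rr s)"
proof -
  have r: "0 < rr t" "rr t \<le> rr s" "rr s < R" using rr[of t] rr[of s] s R T by (auto simp: rr_def divide_right_mono)
  have "u (rr s) - u (rr t) = (LINT x:{rr t..rr s}|lborel. w x)" using ac r unfolding AC_loc_pair_def by blast
  also have "\<dots> = (LINT x:{rr t..rr s}|lborel. f x)" using f(2) r by (intro set_lebesgue_integral_cong) auto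
  also have "\<dots> = (LINT x:{s..t}|lborel. f (rr x) * (rr x / T))" using sub_interval(2)[OF f(1) r] by (simp add: ss_rr)
  finally have "K * (u (rr s) - u (rr t)) = (LINT x:{s..t}|lborel. K * (f (rr x) * (rr x / T)))"
    by (simp only: set_integral_mult_right)
  moreover have "(LINT x:{s..t}|lborel. bet f x) = - (LINT x:{s..t}|lborel. K * (f (rr x) * (rr x / T)))"
    unfolding bet_def set_lebesgue_integral_def by (simp add: mult.assoc)
  ultimately show ?thesis by (simp add: algebra_simps)
qed

lemma bet_Lp:
  assumes "f \<in> borel_measurable borel" "\<And>x. 0 < x \<Longrightarrow> x < R \<Longrightarrow> f x = w x" "lpn R (p - 1) p w < \<infinity>"
  shows "Lp p (bet f)" "ennreal (enrg p (bet f) {0..}) = lpn R (p - 1) p w"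
proof -
  have e: "lpn R (p - 1) p w = (\<integral>\<^sup>+s. ennreal (indicator {0..} s * \<bar>bet f s\<bar> powr p) \<partial>lborel)"
    by (rule lpn_w[OF assms(1,2)])
  obtain c where c: "c \<ge> 0" "lpn R (p - 1) p w = ennreal c" using assms(3) by (cases "lpn R (p - 1) p w") auto
  show L: "Lp p (bet f)" by (rule enrg_of_nn(1)[OF bet_measurable[OF assms(1)] c(1)]) (use e c in simp)
  show "ennreal (enrg p (bet f) {0..}) = lpn R (p - 1) p w" using enrg_nn[OF L] e by simp
qed

lemma zero_extension:
  fixes w :: "real \<Rightarrow> real"
  assumes "set_borel_measurable lborel {0<..<R} w"
  shows "(\<lambda>x. indicator {0<..<R} x * w x) \<in> borel_measurable borel"
  using assms by (simp add: set_borel_measurable_def)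

text \<open>Absolute continuity determines \<open>K * u (rr t)\<close> up to a constant, and the
  boundary condition at \<open>R\<close>, which is \<open>s = 0\<close>, makes that constant
  vanish.\<close>

lemma nice_prim:
  assumes n: "nice R p (p - 1) th u w" and f: "f \<in> borel_measurable borel" "\<And>x. 0 < x \<Longrightarrow> x < R \<Longrightarrow> f x = w x" and t: "t > 0"
  shows "K * u (rr t) = prim (bet f) t"
proof -
  have ac: "AC_loc_pair R u w" and lim: "(u \<longlongrightarrow> 0) (at_left R)" and fin: "lpn R (p - 1) p w < \<infinity>"
    using n by (auto simp: nice_def)
  have b: "Lp p (bet f)" by (rule bet_Lp(1)[OF f fin])
  have eq: "prim (bet f) s = prim (bet f) t - K * u (rr t) + K * u (rr s)" if s: "0 < s" "s \<le> t" for s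
    using prim_diff[OF b p1(2), of s t] AC_bet[OF ac f s] s by simp
  have "((\<lambda>s. prim (bet f) s) \<longlongrightarrow> prim (bet f) 0) (at 0 within {0..})"
    using bspec[OF iffD1[OF continuous_on_def prim_continuous[OF b p1(1)]], of 0] by simp
  then have "(prim (bet f) \<longlongrightarrow> prim (bet f) 0) (at_right 0)" by (rule tendsto_within_subset) auto
  then have l1: "(prim (bet f) \<longlongrightarrow> 0) (at_right 0)" by simp
  have "filterlim rr (at_left R) (at_right 0)"
    unfolding filterlim_at
  proof
    have "(rr \<longlongrightarrow> R * exp (- 0 / T)) (at_right 0)" unfolding rr_def using T by (intro tendsto_intros) auto
    then show "(rr \<longlongrightarrow> R) (at_right 0)" by simp
    show "\<forall>\<^sub>F s in at_right 0. rr s \<in> {..<R} \<and> rr s \<noteq> R"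
      using eventually_at_right_less[of "0::real"] by eventually_elim (use rr(2) in force)
  qed
  then have "((\<lambda>s. u (rr s)) \<longlongrightarrow> 0) (at_right 0)" by (rule filterlim_compose[OF lim])
  then have "((\<lambda>s. prim (bet f) t - K * u (rr t) + K * u (rr s)) \<longlongrightarrow> prim (bet f) t - K * u (rr t) + K * 0) (at_right 0)"
    by (intro tendsto_intros)
  moreover have "\<forall>\<^sub>F s in at_right 0. prim (bet f) t - K * u (rr t) + K * u (rr s) = prim (bet f) s"
    unfolding eventually_at_right_field using t by (intro exI[of _ t] conjI allI impI eq[symmetric]) simp_all
  ultimately have "(prim (bet f) \<longlongrightarrow> prim (bet f) t - K * u (rr t) + K * 0) (at_right 0)"
    by (rule Lim_transform_eventually)
  from tendsto_unique[OF _ this l1] show ?thesis by simp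
qed

text \<open>A member of the completion carries no explicit boundary condition. The primitives of its
  approximants converge at every \<open>s\<close> because the derivatives converge; if
  \<open>u\<close> differed from its primitive by a constant \<open>c\<close>, that constant would
  survive in the pointwise limit of the differences, and Fatou's lemma against their convergence to
  zero in the weighted norm excludes it.\<close>

lemma Xsp_rep:
  assumes X: "Xsp R p (p - 1) th u w"
  obtains b where "rep u w b"
proof -
  have ac: "AC_loc_pair R u w" and mw: "set_borel_measurable lborel {0<..<R} w" and mu: "set_borel_measurable lborel {0<..<R} u"
    and fin: "lpn R (p - 1) p w < \<infinity>" using X by (auto simp: Xsp_def)
  obtain U W where UW: "\<And>n. nice R p (p - 1) th (U n) (W n)"
    "(\<lambda>n. lpn R th p (\<lambda>x. U n x - u x)) \<longlonglongrightarrow> 0" "(\<lambda>n. lpn R (p - 1) p (\<lambda>x. W n x - w x)) \<longlonglongrightarrow> 0"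
    using X unfolding Xsp_def by blast
  define f where "f x = indicator {0<..<R} x * w x" for x
  define fn where "fn n x = indicator {0<..<R} x * W n x" for n x
  define gu where "gu x = indicator {0<..<R} x * u x" for x
  define gn where "gn n x = indicator {0<..<R} x * U n x" for n x
  have fm: "f \<in> borel_measurable borel" unfolding f_def by (rule zero_extension[OF mw])
  have gum: "gu \<in> borel_measurable borel" unfolding gu_def by (rule zero_extension[OF mu])
  have fnm: "fn n \<in> borel_measurable borel" and gnm: "gn n \<in> borel_measurable borel" for n
    unfolding fn_def gn_def using UW(1)[of n] by (auto simp: nice_def intro: zero_extension)
  have fe: "f x = w x" and fne: "fn n x = W n x" and gue: "gu x = u x" and gne: "gn n x = U n x" if "0 < x" "x < R" for x n
    using that by (simp_all add: f_def fn_def gu_def gn_def)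
  define b where "b = bet f"
  have b: "Lp p b" unfolding b_def by (rule bet_Lp(1)[OF fm fe fin])
  have bn: "Lp p (bet (fn n))" for n
    using UW(1)[of n] by (intro bet_Lp(1)[OF fnm fne]) (auto simp: nice_def)
  define c where "c = K * u (rr 1) - prim b 1"
  have const: "K * u (rr t) = prim b t + c" if t: "t > 0" for t
  proof (cases "t \<le> 1")
    case True
    then show ?thesis using prim_diff[OF b p1(2), of t 1] AC_bet[OF ac fm fe, of t 1] t by (simp add: c_def b_def)
  next
    case False
    then show ?thesis using prim_diff[OF b p1(2), of 1 t] AC_bet[OF ac fm fe, of 1 t] by (simp add: c_def b_def)
  qed
  have "(\<lambda>n. enrg p (\<lambda>s. bet (fn n) s - b s) {0..}) \<longlonglongrightarrow> 0"
  proof -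
    have le: "ennreal (enrg p (\<lambda>s. bet (fn n) s - b s) {0..}) = lpn R (p - 1) p (\<lambda>x. W n x - w x)" for n
    proof -
      have be: "bet (\<lambda>x. fn n x - f x) = (\<lambda>s. bet (fn n) s - b s)" by (auto simp: bet_def b_def algebra_simps diff_divide_distrib)
      have m: "(\<lambda>x. fn n x - f x) \<in> borel_measurable borel" using fm fnm[of n] by measurable
      have "lpn R (p - 1) p (\<lambda>x. W n x - w x) = (\<integral>\<^sup>+s. ennreal (indicator {0..} s * \<bar>bet (\<lambda>x. fn n x - f x) s\<bar> powr p) \<partial>lborel)"
        using fe fne by (intro lpn_w m) auto
      also have "\<dots> = ennreal (enrg p (\<lambda>s. bet (fn n) s - b s) {0..})"
        unfolding be by (rule enrg_nn[OF Lp_diff[OF bn b p1(2)]])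
      finally show ?thesis by simp
    qed
    show ?thesis using UW(3) unfolding le[symmetric] by (subst (asm) ennreal_0[symmetric]) (simp del: ennreal_0)
  qed
  then have pl: "(\<lambda>n. prim (bet (fn n)) t) \<longlonglongrightarrow> prim b t" if t: "t > 0" for t
  proof -
    assume e0: "(\<lambda>n. enrg p (\<lambda>s. bet (fn n) s - b s) {0..}) \<longlonglongrightarrow> 0"
    show ?thesis
    proof (rule LIM_zero_cancel, rule Lim_null_comparison)
      show "\<forall>\<^sub>F n in sequentially. norm (prim (bet (fn n)) t - prim b t) \<le> t powr ((p - 1) / p) * enrg p (\<lambda>s. bet (fn n) s - b s) {0..} powr (1 / p)"
        using prim_holder'[OF Lp_diff[OF bn b p1(2)] p1(1), of 0 t] prim_diff_fun[OF bn b p1(2)] t by simp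
      have "(\<lambda>n. enrg p (\<lambda>s. bet (fn n) s - b s) {0..} powr (1 / p)) \<longlonglongrightarrow> 0 powr (1 / p)"
        using p by (intro tendsto_powr'[OF e0 tendsto_const]) auto
      then have "(\<lambda>n. t powr ((p - 1) / p) * enrg p (\<lambda>s. bet (fn n) s - b s) {0..} powr (1 / p)) \<longlonglongrightarrow> t powr ((p - 1) / p) * 0 powr (1 / p)"
        by (intro tendsto_mult tendsto_const)
      then show "(\<lambda>n. t powr ((p - 1) / p) * enrg p (\<lambda>s. bet (fn n) s - b s) {0..} powr (1 / p)) \<longlonglongrightarrow> 0" by simp
    qed
  qed
  define I where "I n = (\<integral>\<^sup>+s. ennreal (indicator {0..} s * (\<bar>K * (gn n (rr s) - gu (rr s))\<bar> powr p * exp (- s))) \<partial>lborel)" for n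
  have I: "lpn R th p (\<lambda>x. U n x - u x) = ennreal cM * I n" for n
    unfolding I_def using gum gnm gue gne by (intro lpn_u[where f = "\<lambda>x. gn n x - gu x"]) auto
  have "(\<lambda>n. ennreal (1 / cM) * (ennreal cM * I n)) \<longlonglongrightarrow> ennreal (1 / cM) * 0"
    using UW(2) unfolding I by (intro ennreal_tendsto_cmult) auto
  moreover have "ennreal (1 / cM) * (ennreal cM * I n) = I n" for n
    using cpos by (simp add: mult.assoc[symmetric] ennreal_mult'[symmetric])
  ultimately have I0: "I \<longlonglongrightarrow> 0" by simp
  have "(\<integral>\<^sup>+s. ennreal (indicator {0..} s * (\<bar>c\<bar> powr p * exp (- s))) \<partial>lborel) =
     (\<integral>\<^sup>+s. liminf (\<lambda>n. ennreal (indicator {0..} s * (\<bar>K * (gn n (rr s) - gu (rr s))\<bar> powr p * exp (- s)))) \<partial>lborel)"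
  proof (intro nn_integral_cong_AE)
    show "AE s in lborel. ennreal (indicator {0..} s * (\<bar>c\<bar> powr p * exp (- s))) =
       liminf (\<lambda>n. ennreal (indicator {0..} s * (\<bar>K * (gn n (rr s) - gu (rr s))\<bar> powr p * exp (- s))))"
      using AE_lborel_singleton[of 0]
    proof eventually_elim
      fix s :: real assume s0: "s \<noteq> 0"
      have "(\<lambda>n. ennreal (indicator {0..} s * (\<bar>K * (gn n (rr s) - gu (rr s))\<bar> powr p * exp (- s)))) \<longlonglongrightarrow> ennreal (indicator {0..} s * (\<bar>c\<bar> powr p * exp (- s)))"
      proof (cases "s > 0")
        case True
        have "K * (gn n (rr s) - gu (rr s)) = prim (bet (fn n)) s - prim b s - c" for n
          using nice_prim[OF UW(1) fnm fne True, of n] const[OF True] gue[OF rr(1) rr(2)[OF True]] gne[OF rr(1) rr(2)[OF True], of n]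
          by (simp add: right_diff_distrib)
        moreover have "(\<lambda>n. \<bar>prim (bet (fn n)) s - prim b s - c\<bar>) \<longlonglongrightarrow> \<bar>prim b s - prim b s - c\<bar>"
          by (intro tendsto_intros pl True)
        ultimately have "(\<lambda>n. \<bar>K * (gn n (rr s) - gu (rr s))\<bar>) \<longlonglongrightarrow> \<bar>c\<bar>" by simp
        then have "(\<lambda>n. \<bar>K * (gn n (rr s) - gu (rr s))\<bar> powr p) \<longlonglongrightarrow> \<bar>c\<bar> powr p"
          using p by (intro tendsto_powr' tendsto_const) auto
        then show ?thesis by (intro tendsto_ennrealI tendsto_mult tendsto_const)
      qed (use s0 in simp)
      then show "ennreal (indicator {0..} s * (\<bar>c\<bar> powr p * exp (- s))) =
         liminf (\<lambda>n. ennreal (indicator {0..} s * (\<bar>K * (gn n (rr s) - gu (rr s))\<bar> powr p * exp (- s))))"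
        by (intro lim_imp_Liminf[symmetric]) auto
    qed
  qed
  also have "\<dots> \<le> liminf I"
  proof -
    note [measurable] = gum gnm
    have "(\<lambda>s. ennreal (indicator {0..} s * (\<bar>K * (gn n (rr s) - gu (rr s))\<bar> powr p * exp (- s)))) \<in> borel_measurable borel" for n
      by measurable
    then show ?thesis unfolding I_def by (intro nn_integral_liminf) simp
  qed
  also have "liminf I = 0" using I0 by (intro lim_imp_Liminf) auto
  finally have "(\<integral>\<^sup>+s. ennreal (\<bar>c\<bar> powr p) * ennreal (indicator {0..} s * exp (- s)) \<partial>lborel) = 0"
    by (simp add: ennreal_mult'[symmetric] mult.left_commute)
  then have "ennreal (\<bar>c\<bar> powr p) * (\<integral>\<^sup>+s. ennreal (indicator {0..} s * exp (- s)) \<partial>lborel) = 0"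
    by (subst (asm) nn_integral_cmult) auto
  moreover have "(\<integral>\<^sup>+s. ennreal (indicator {0..} s * exp (- s)) \<partial>lborel) = ennreal 1"
  proof -
    have "(\<integral>\<^sup>+s. ennreal (indicator {0..} s * exp (- s)) \<partial>lborel) = ennreal (LINT s|lborel. indicator {0..} s * exp (- s))"
      using set_integrable_exp_decay[of 1 0] by (intro nn_integral_eq_integral) (auto simp: set_integrable_def)
    also have "(LINT s|lborel. indicator {0..} s * exp (- s)) = (1::real)"
      using integral_exp_decay[of 1 0] by (simp add: set_lebesgue_integral_def)
    finally show ?thesis .
  qed
  ultimately have "c = 0" using p by simp
  then have e: "K * u (rr s) = prim b s" if "s > 0" for s using const[OF that] by simp
  have "rep u w b" by (rule repI(1)[OF b e fm fe]) (auto simp: b_def)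
  then show ?thesis using that by blast
qed

text \<open>The function built from \<open>b\<close> satisfies the boundary condition itself, so a
  constant sequence witnesses membership in the completion. This direction transfers coercivity to
  the half line and brings the maximiser back.\<close>

lemma rep_Xsp:
  assumes b: "Lp p b"
  defines "u \<equiv> \<lambda>r. prim b (ss r) / K" and "w \<equiv> \<lambda>r. - (T / (K * r)) * b (ss r)"
  shows "Xsp R p (p - 1) th u w" "rep u w b"
proof -
  have bm [measurable]: "b \<in> borel_measurable borel" using b by (simp add: Lp_def)
  have wm: "w \<in> borel_measurable borel" unfolding w_def by measurable
  have bw: "bet w s = b s" for s
    using rr(1)[of s] K T by (simp add: bet_def w_def ss_rr)
  have e: "K * u (rr s) = prim b s" for s using K by (simp add: u_def ss_rr)
  note rI = repI[of b u w w, OF b e wm refl bw]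
  show "rep u w b" by (rule rI)
  have ac: "AC_loc_pair R u w"
    unfolding AC_loc_pair_def
  proof (intro allI impI)
    fix x y assume xy: "0 < x \<and> x \<le> y \<and> y < R"
    then have xy': "0 < x" "x \<le> y" "y < R" by auto
    have s: "0 \<le> ss y" "ss y \<le> ss x" using ss_pos(1)[of y] ss_antimono[of x y] xy' by auto
    have e1: "w (rr s) * (rr s / T) = - (1 / K) * b s" for s
      using bw[of s] K by (simp add: bet_def field_simps)
    have "set_integrable lborel {ss y..ss x} b" using Lp_int_integrable[OF b p1(2) s(1)] .
    then have "set_integrable lborel {ss y..ss x} (\<lambda>s. w (rr s) * (rr s / T))" unfolding e1 by (rule set_integrable_mult_right)
    then have i: "set_integrable lborel {x..y} w" using sub_interval(1)[OF wm xy'] by simp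
    have "(LINT t:{x..y}|lborel. w t) = (LINT s:{ss y..ss x}|lborel. - (1 / K) * b s)"
      using sub_interval(2)[OF wm xy'] unfolding e1 .
    also have "\<dots> = - (1 / K) * (prim b (ss x) - prim b (ss y))"
      unfolding prim_diff[OF b p1(2) s] by (rule set_integral_mult_right)
    also have "\<dots> = u y - u x" using K by (simp add: u_def diff_divide_distrib)
    finally show "set_integrable lborel {x..y} w \<and> u y - u x = (LINT t:{x..y}|lborel. w t)" using i by simp
  qed
  have mu: "set_borel_measurable lborel {0<..<R} u"
  proof -
    have "(\<lambda>r. indicator {0<..<R} r * (prim b (max 0 (ss r)) / K)) \<in> borel_measurable borel"
      using measurable_compose[OF ss_measurable prim_meas[OF b p1(1)]] by measurable
    moreover have "(\<lambda>r. indicator {0<..<R} r * (prim b (max 0 (ss r)) / K)) = (\<lambda>r. indicator {0<..<R} r *\<^sub>R u r)"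
      using ss_pos(1) by (auto simp: indicator_def u_def fun_eq_iff max_def less_imp_le)
    ultimately show ?thesis by (simp add: set_borel_measurable_def)
  qed
  have mw: "set_borel_measurable lborel {0<..<R} w" unfolding set_borel_measurable_def using wm by measurable
  have lim: "(u \<longlongrightarrow> 0) (at_left R)"
  proof -
    have "(ss \<longlongrightarrow> T * ln (R / R)) (at_left R)" unfolding ss_def using R by (intro tendsto_intros) auto
    then have "(ss \<longlongrightarrow> 0) (at_left R)" using R by simp
    moreover have "\<forall>\<^sub>F r in at_left R. ss r \<in> {0..}"
      unfolding eventually_at_left_field using R by (intro exI[of _ 0] conjI allI impI) (simp_all add: ss_pos(1) less_imp_le)
    ultimately have "((\<lambda>r. prim b (ss r)) \<longlongrightarrow> prim b 0) (at_left R)"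
      by (intro continuous_on_tendsto_compose[OF prim_continuous[OF b p1(1)]]) auto
    then have "((\<lambda>r. prim b (ss r) / K) \<longlongrightarrow> prim b 0 / K) (at_left R)" using K by (intro tendsto_intros) auto
    then show ?thesis by (simp add: u_def)
  qed
  have n: "nice R p (p - 1) th u w"
    unfolding nice_def using ac lim mu mw rI(2,3) by simp
  have z: "lpn R a p (\<lambda>x. 0) = 0" for a using p by (simp add: lpn_def)
  show "Xsp R p (p - 1) th u w"
    unfolding Xsp_def using ac mu mw rI(2,3) n z by (intro conjI exI[of _ "\<lambda>n. u"] exI[of _ "\<lambda>n. w"]) auto
qed

text \<open>The derivative is bounded by a constant times \<open>x powr (\<beta> * T - 1)\<close>.
  As \<open>T \<ge> p\<close> and \<open>\<beta> > 1 / p\<close>, the exponent is positive, so the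
  derivative extends continuously by 0 to the origin.\<close>

lemma C1_extension:
  assumes w: "Lp p w" "continuous_on {0..} w" and \<beta>: "\<beta> > 1 / p" "\<And>s. 0 \<le> s \<Longrightarrow> \<bar>w s\<bar> \<le> C * exp (- \<beta> * s)"
  shows "\<exists>g g'. (\<forall>x\<in>{0..R}. (g has_real_derivative g' x) (at x within {0..R})) \<and> continuous_on {0..R} g'
     \<and> (\<forall>x\<in>{0<..<R}. prim w (ss x) / K = g x)"
proof -
  define g' where "g' x = (if x = 0 then 0 else - (T / (K * x)) * w (ss x))" for x
  \<comment> \<open>Integrating from \<open>R\<close>, where the primitive vanishes, gives the
    one-sided derivatives at both end points at once.\<close>
  define g where "g x = - integral {x..R} g'" for x
  have "0 < 1 / p" using p by simp
  then have \<beta>0: "\<beta> > 0" using \<beta>(1) by linarith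
  have \<beta>T: "\<beta> * T > 1"
  proof -
    have "1 < \<beta> * p" using \<beta>(1) p by (simp add: field_simps)
    also have "\<dots> \<le> \<beta> * T" using T \<beta>0 by (intro mult_left_mono) auto
    finally show ?thesis .
  qed
  have ssc: "continuous_on {0<..R} ss" unfolding ss_def using R by (intro continuous_intros) auto
  have c1: "continuous_on {0<..R} g'"
  proof (rule continuous_on_eq)
    show "continuous_on {0<..R} (\<lambda>x. - (T / (K * x)) * w (ss x))"
      using K ss_pos(2) by (intro continuous_intros continuous_on_compose2[OF w(2) ssc]) auto
  qed (auto simp: g'_def)
  have C0: "C \<ge> 0" using \<beta>(2)[of 0] by simp
  have bd: "\<bar>g' x\<bar> \<le> T / K * C * R powr (- (\<beta> * T)) * x powr (\<beta> * T - 1)" if x: "0 < x" "x \<le> R" for x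
  proof -
    have "\<bar>w (ss x)\<bar> \<le> C * exp (- \<beta> * ss x)" by (rule \<beta>(2)[OF ss_pos(2)[OF x]])
    also have "exp (- \<beta> * ss x) = (x / R) powr (\<beta> * T)"
      using x R by (simp add: ss_def powr_def ln_div algebra_simps)
    also have "\<dots> = R powr (- (\<beta> * T)) * x powr (\<beta> * T)" using x R by (simp add: powr_divide powr_minus_divide)
    finally have "T / (K * x) * \<bar>w (ss x)\<bar> \<le> T / (K * x) * (C * (R powr (- (\<beta> * T)) * x powr (\<beta> * T)))"
      using T K x by (intro mult_left_mono) auto
    also have "\<dots> = T / K * C * R powr (- (\<beta> * T)) * (x powr (\<beta> * T) / x)" by simp
    also have "x powr (\<beta> * T) / x = x powr (\<beta> * T - 1)" using x by (simp add: powr_diff)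
    finally show ?thesis using x T K by (simp add: g'_def abs_mult)
  qed
  have c: "continuous_on {0..R} g'"
    unfolding continuous_on_def
  proof
    fix x assume x: "x \<in> {0..R}"
    show "(g' \<longlongrightarrow> g' x) (at x within {0..R})"
    proof (cases "x = 0")
      case False
      then have "(g' \<longlongrightarrow> g' x) (at x within {0<..R})" using c1 x by (auto simp: continuous_on_def)
      moreover have "at x within {0<..R} = at x within {0..R}"
        using False x by (intro at_within_nhd[of _ "{0<..}"]) auto
      ultimately show ?thesis by simp
    next
      case True
      have l: "((\<lambda>x. T / K * C * R powr (- (\<beta> * T)) * x powr (\<beta> * T - 1)) \<longlongrightarrow> T / K * C * R powr (- (\<beta> * T)) * 0 powr (\<beta> * T - 1)) (at 0 within {0..R})"
        using \<beta>T by (intro tendsto_mult tendsto_const tendsto_powr' tendsto_ident_at) (auto simp: eventually_at intro!: exI[of _ 1])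
      have "(g' \<longlongrightarrow> 0) (at 0 within {0..R})"
      proof (rule Lim_null_comparison)
        show "\<forall>\<^sub>F x in at 0 within {0..R}. norm (g' x) \<le> T / K * C * R powr (- (\<beta> * T)) * x powr (\<beta> * T - 1)"
          using bd by (auto simp: eventually_at intro!: exI[of _ 1])
        show "((\<lambda>x. T / K * C * R powr (- (\<beta> * T)) * x powr (\<beta> * T - 1)) \<longlongrightarrow> 0) (at 0 within {0..R})"
          using l \<beta>T by simp
      qed
      then show ?thesis using True by (simp add: g'_def)
    qed
  qed
  have gd: "(g has_real_derivative g' x) (at x within {0..R})" if "x \<in> {0..R}" for x
    unfolding g_def using DERIV_minus[OF integral_has_real_derivative'[OF c that]] by simp
  have pd: "(prim w has_real_derivative w s) (at s)" if s: "s > 0" for s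
  proof -
    have wc: "continuous_on {0..s + 1} w" by (rule continuous_on_subset[OF w(2)]) auto
    have "((\<lambda>t. integral {0..t} w) has_real_derivative w s) (at s within {0..s + 1})"
      using s by (intro integral_has_real_derivative[OF wc]) auto
    then have "((\<lambda>t. integral {0..t} w) has_real_derivative w s) (at s)" using s by (simp add: at_within_Icc_at)
    moreover have "integral {0..t} w = prim w t" for t
      unfolding prim_def using LINT_continuous(2)[OF continuous_on_subset[OF w(2)], of 0 t] by auto
    ultimately show ?thesis by simp
  qed
  have eq: "prim w (ss x) / K = g x" if x: "0 < x" "x < R" for x
  proof -
    have "(g' has_integral (prim w (ss R) / K - prim w (ss x) / K)) {x..R}"
    proof (rule fundamental_theorem_of_calculus_interior)
      show "continuous_on {x..R} (\<lambda>r. prim w (ss r) / K)"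
        using x K ss_pos(2) by (intro continuous_intros continuous_on_compose2[OF prim_continuous[OF w(1) p1(1)] continuous_on_subset[OF ssc]]) auto
      fix r assume r: "r \<in> {x<..<R}"
      have "(ss has_real_derivative - (T / r)) (at r)"
        unfolding ss_def using r x R by (auto intro!: derivative_eq_intros simp: field_simps)
      then have "((\<lambda>r. prim w (ss r)) has_real_derivative w (ss r) * - (T / r)) (at r)"
        using r x ss_pos(1)[of r] by (intro DERIV_chain2[OF pd]) auto
      then have "((\<lambda>r. prim w (ss r) / K) has_real_derivative w (ss r) * - (T / r) / K) (at r)" by (rule DERIV_cdivide)
      moreover have "w (ss r) * - (T / r) / K = g' r" using r x by (simp add: g'_def mult_ac)
      ultimately show "((\<lambda>r. prim w (ss r) / K) has_vector_derivative g' r) (at r)"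
        by (simp add: has_real_derivative_iff_has_vector_derivative)
    qed (use x in simp)
    moreover have "ss R = 0" using R by (simp add: ss_def)
    ultimately show ?thesis unfolding g_def by (simp add: integral_unique)
  qed
  show ?thesis
    by (intro exI[of _ g] exI[of _ g'] conjI ballI gd c) (use eq in auto)
qed

end

theorem theorem1p2:
  fixes p R th nu :: real
  assumes "p \<ge> 2" and "0 < R" and "th \<ge> p - 1"
    and "0 \<le> nu" and "nu < lam R p (p - 1) th"
  shows "\<exists>u0 w0. Xsp R p (p - 1) th u0 w0
     \<and> (\<exists>g g'. (\<forall>x\<in>{0..R}. (g has_real_derivative g' x) (at x within {0..R}))
              \<and> continuous_on {0..R} g' \<and> (\<forall>x\<in>{0<..<R}. u0 x = g x))
     \<and> H R p (p - 1) th nu u0 w0 = 1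
     \<and> MT R p (p - 1) th u0 =
         (SUP uw \<in> {(u, w). Xsp R p (p - 1) th u w \<and> H R p (p - 1) th nu u w \<le> 1}.
            MT R p (p - 1) th (fst uw))"
proof -
  interpret radial p R th using assms by unfold_locales auto
  define l0 where "l0 = lam R p (p - 1) th"
  have l0: "0 < l0" "nu < l0" using assms by (simp_all add: l0_def)
  have lam_le: "l0 * lpp R th p u \<le> lpp R (p - 1) p w" if X: "Xsp R p (p - 1) th u w" for u w
  proof (cases "lpp R th p u = 0")
    case True
    then show ?thesis by (simp add: lpp_def)
  next
    case False
    then have pos: "lpp R th p u > 0" by (simp add: lpp_def less_le)
    have nz: "(lpp R th p u + lpp R (p - 1) p w) powr (1 / p) \<noteq> 0"
      using pos by (simp add: lpp_def add_pos_nonneg less_imp_neq[symmetric])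
    have "l0 \<le> lpp R (p - 1) p (snd (u, w)) / lpp R th p (fst (u, w))"
      unfolding l0_def lam_def
    proof (rule cINF_lower)
      show "bdd_below ((\<lambda>uw. lpp R (p - 1) p (snd uw) / lpp R th p (fst uw)) ` {(u, w). Xsp R p (p - 1) th u w \<and> (lpp R th p u + lpp R (p - 1) p w) powr (1 / p) \<noteq> 0})"
        by (rule bdd_belowI[of _ 0]) (auto simp: lpp_def)
    qed (use X nz in simp)
    then show ?thesis using pos by (simp add: field_simps)
  qed
  \<comment> \<open>The assumption that \<open>nu\<close> lies below the eigenvalue is exactly
    \<open>\<kappa> < 1\<close>; \<open>cM\<close> passes into the potential of the half-line
    problem.\<close>
  define \<kappa> where "\<kappa> = nu / l0"
  interpret m: moser p "nu * cM" \<kappa>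
  proof
    show "p \<ge> 2" by fact
    show "0 \<le> nu * cM" using assms cpos by simp
    show "0 \<le> \<kappa>" "\<kappa> < 1" using assms l0 by (simp_all add: \<kappa>_def)
    fix b assume b: "Lp p b"
    have "l0 * (cM * mass p b {0..}) \<le> enrg p b {0..}"
      using lam_le[OF rep_Xsp(1)[OF b]] rep_Xsp(2)[OF b] by (simp add: rep_def)
    then have "\<kappa> * (l0 * (cM * mass p b {0..})) \<le> \<kappa> * enrg p b {0..}"
      using assms l0 by (intro mult_left_mono) (auto simp: \<kappa>_def)
    then show "nu * cM * mass p b {0..} \<le> \<kappa> * enrg p b {0..}" using l0 by (simp add: \<kappa>_def mult.assoc)
  qed
  have Hrep: "H R p (p - 1) th nu u w = (enrg p b {0..} - nu * cM * mass p b {0..}) powr (1 / p)" if "rep u w b" for u w b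
    using that by (simp add: H_def rep_def mult.assoc)
  obtain w C \<beta> where w: "m.adm w" "continuous_on {0..} w" "\<beta> > 1 / p" "\<And>s. 0 \<le> s \<Longrightarrow> \<bar>w s\<bar> \<le> C * exp (- \<beta> * s)"
    "enrg p w {0..} - nu * cM * mass p w {0..} = 1"
    "\<And>v. m.adm v \<Longrightarrow> expint (p / (p - 1)) v {0..} \<le> expint (p / (p - 1)) w {0..}"
    by (rule m.regular_maximizer, rule that)
  have wL: "Lp p w" using w(1) by (simp add: m.adm_def)
  define u0 where "u0 r = prim w (ss r) / K" for r
  define w0 where "w0 r = - (T / (K * r)) * w (ss r)" for r
  have X0: "Xsp R p (p - 1) th u0 w0" and rep0: "rep u0 w0 w"
    using rep_Xsp[OF wL] by (simp_all add: u0_def[abs_def] w0_def[abs_def])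
  have H0: "H R p (p - 1) th nu u0 w0 = 1" unfolding Hrep[OF rep0] w(5) by simp
  have reg: "\<exists>g g'. (\<forall>x\<in>{0..R}. (g has_real_derivative g' x) (at x within {0..R})) \<and> continuous_on {0..R} g' \<and> (\<forall>x\<in>{0<..<R}. u0 x = g x)"
    using C1_extension[OF wL w(2-4)] by (simp add: u0_def)
  \<comment> \<open>Each competitor is replaced by its representing density, so the comparison takes
    place on the half line, where \<open>w\<close> is optimal.\<close>
  have max: "MT R p (p - 1) th u \<le> MT R p (p - 1) th u0" if X: "Xsp R p (p - 1) th u v" and H1: "H R p (p - 1) th nu u v \<le> 1" for u v
  proof -
    obtain b where b: "rep u v b" by (rule Xsp_rep[OF X])
    have "enrg p b {0..} - nu * cM * mass p b {0..} \<le> 1"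
    proof (rule ccontr)
      assume "\<not> ?thesis"
      then have "1 powr (1 / p) < (enrg p b {0..} - nu * cM * mass p b {0..}) powr (1 / p)"
        using p by (intro powr_less_mono2) auto
      then show False using H1 unfolding Hrep[OF b] by simp
    qed
    then have "m.adm b" using b by (simp add: m.adm_def rep_def)
    then have "expint (p / (p - 1)) b {0..} \<le> expint (p / (p - 1)) w {0..}" by (rule w(6))
    then show ?thesis using b rep0 cpos by (simp add: rep_def ennreal_leI)
  qed
  have "MT R p (p - 1) th u0 = (SUP uw \<in> {(u, w). Xsp R p (p - 1) th u w \<and> H R p (p - 1) th nu u w \<le> 1}. MT R p (p - 1) th (fst uw))"
  proof (rule antisym)
    have "(u0, w0) \<in> {(u, w). Xsp R p (p - 1) th u w \<and> H R p (p - 1) th nu u w \<le> 1}" using X0 H0 by simp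
    from SUP_upper[OF this, of "\<lambda>uw. MT R p (p - 1) th (fst uw)"]
    show "MT R p (p - 1) th u0 \<le> (SUP uw \<in> {(u, w). Xsp R p (p - 1) th u w \<and> H R p (p - 1) th nu u w \<le> 1}. MT R p (p - 1) th (fst uw))" by simp
    show "(SUP uw \<in> {(u, w). Xsp R p (p - 1) th u w \<and> H R p (p - 1) th nu u w \<le> 1}. MT R p (p - 1) th (fst uw)) \<le> MT R p (p - 1) th u0"
      by (rule SUP_least) (use max in auto)
  qed
  then show ?thesis using X0 reg H0 by blast
qed

end
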